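(* Let $(p_n)_{n\geq 1}$ be a sequence of positive integers with $p=p_n\to\infty$ and $\lim_{n\to\infty} n/p_n = y\in(0,\infty)$. Let $(c_j)_{j\geq 0}$ be a sequence of real numbers and let $(Z_{i,t})_{i\in\mathbb{N},\,t\in\mathbb{Z}}$ be an array of real random variables. For each $i=1,\ldots,p$, let $X_{i,t}=\sum_{j=0}^\infty c_j Z_{i,t-j}$, $t\in\mathbb{Z}$, be a linear stochastic process with continuously differentiable spectral density $f:[0,2\pi]\to\mathbb{R}$, $f(\omega)=\sum_{h\in\mathbb{Z}}\gamma(h)\mathrm{e}^{-\mathrm{i}h\omega}$, where $\gamma(h)=\sum_{j=0}^\infty c_jc_{j+|h|}$. Let $\mathbf{X}=\mathbf{X}_n=(X_{i,t})_{i=1,\ldots,p;\ t=1,\ldots,n}\in\mathbb{R}^{p\times n}$. Assume that: (i) the random variables $Z_{i,t}$ are independent, $\mathbb{E}Z_{i,t}=0$, $\mathbb{E}Z_{i,t}^2=1$, $\sigma_4:=\sup_{i,t}\mathbb{E}Z_{i,t}^4<\infty$, and for each $\epsilon>0$, $\frac{1}{pn}\sum_{i=1}^p\sum_{t=1}^n\mathbb{E}\bigl(Z_{i,t}^2\mathbf{1}_{\{Z_{i,t}^2\geq\epsilon n\}}\bigr)\to 0$ as $n\to\infty$; (ii) there exist positive constants $C$ and $\delta$ such that $|c_j|\leq C(j+1)^{-1-\delta}$ for all $j\geq 0$; (iii) for almost all $\lambda\in\mathbb{R}$, $f(\omega)=\lambda$ for at most finitely many $\omega\in[0,2\pi]$;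 (iv) $f'(\omega)\neq 0$ for almost every $\omega$. Then the empirical spectral distribution $F^{p^{-1}\mathbf{X}\mathbf{X}^T}$ of $p^{-1}\mathbf{X}\mathbf{X}^T$ converges, as $n\to\infty$, almost surely to a non-random probability distribution $\hat F$ with bounded support. Moreover, there exist positive numbers $\lambda_-,\lambda_+$ such that the Stieltjes transform $z\mapsto m_{\hat F}(z)$ of $\hat F$ is the unique mapping $\mathbb{C}^+\to\mathbb{C}^+$ satisfying $$\frac{1}{m_{\hat F}(z)}=-z+\frac{y}{2\pi}\int_{\lambda_-}^{\lambda_+}\frac{\lambda}{1+\lambda m_{\hat F}(z)}\sum_{\omega\in[0,2\pi]:\,f(\omega)=\lambda}\frac{1}{|f'(\omega)|}\,\mathrm{d}\lambda .$$
   Context: For a real symmetric $N\times N$ matrix $A$ with eigenvalues $\lambda_1,\ldots,\lambda_N$ (with multiplicity), its spectral distribution is $F^A=\frac1N\sum_{i=1}^N\delta_{\lambda_i}$, where $\delta_x$ is the Dirac measure at $x$. Convergence of the empirical spectral distribution almost surely means almost sure convergence as a random element of the space of probability measures on $\mathbb{R}$ equipped with the weak topology. $\mathbb{C}^+=\{z\in\mathbb{C}:\operatorname{Im}z>0\}$. The Stieltjes transform of a probability distribution $\hat F$ on $\mathbb{R}$ is $m_{\hat F}(z)=\int\frac{1}{\lambda-z}\,\mathrm{d}\hat F(\lambda)$, $z\in\mathbb{C}^+$. "Almost all" and "almost every" refer to Lebesgue measure.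
   Formalization: λ₋ is only claimed nonnegative when f has a zero on [0,2π] (strictly positive when f > 0 throughout), since a positive λ₋ is impossible if f vanishes somewhere, e.g. f(ω) = 2 − 2cos ω. *)

theory Defs
  imports "HOL-Probability.Probability" "Jordan_Normal_Form.Char_Poly"
begin

text \<open>
  The empirical spectral distribution \<open>(1/N) \<Sum>\<^sub>i \<delta>\<^bsub>\<lambda>\<^sub>i\<^esub>\<close> of a real symmetric \<open>N \<times> N\<close> matrix, as a
  Borel measure on the real line. The eigenvalues with multiplicity are the real roots of the
  characteristic polynomial; there are exactly \<open>N\<close> of them when the matrix is symmetric.
\<close>

definition spectral_distribution :: "real mat \<Rightarrow> real measure" where
  "spectral_distribution A =
     measure_of UNIV (sets borel)
       (\<lambda>B. (\<Sum>l\<in>#proots (char_poly A). emeasure (return borel l) B) / of_nat (dim_row A))"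

lemma sets_spectral_distribution [simp, measurable_cong]:
  "sets (spectral_distribution A) = sets borel"
  unfolding spectral_distribution_def
  by (metis sets.sigma_sets_eq sets_measure_of space_borel subset_Pow_Union Pow_UNIV top_greatest)

lemma space_spectral_distribution [simp]: "space (spectral_distribution A) = UNIV"
  by (simp add: spectral_distribution_def)

lemma emeasure_spectral_distribution:
  assumes B: "B \<in> sets borel"
  shows "emeasure (spectral_distribution A) B =
    (\<Sum>l\<in>#proots (char_poly A). emeasure (return borel l) B) / of_nat (dim_row A)"
proof -
  have suminf: "(\<Sum>i. \<Sum>l\<in>#R. emeasure (return borel l) (C i)) =
      (\<Sum>l\<in>#R. emeasure (return borel l) (\<Union>i. C i))"
    if C: "range C \<subseteq> sets borel" "disjoint_family C" for C :: "nat \<Rightarrow> real set" and R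
    by (induction R) (use C in \<open>auto simp: suminf_add[symmetric] suminf_emeasure simp del: emeasure_return\<close>)
  show ?thesis
  proof (rule emeasure_measure_of[OF spectral_distribution_def])
    show "countably_additive (sets (spectral_distribution A))
      (\<lambda>B. (\<Sum>l\<in>#proots (char_poly A). emeasure (return borel l) B) / of_nat (dim_row A))"
      unfolding countably_additive_def
      by (auto simp: divide_ennreal_def suminf simp del: emeasure_return)
    have "(\<Sum>l\<in>#R. emeasure (return borel l) {}) = 0" for R :: "real multiset"
      by (induction R) auto
    then show "positive (sets (spectral_distribution A))
      (\<lambda>B. (\<Sum>l\<in>#proots (char_poly A). emeasure (return borel l) B) / of_nat (dim_row A))"
      by (simp add: positive_def)
  qed (use B in auto)
qed

definition measure_support :: "real measure \<Rightarrow> real set" where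
  "measure_support F = {x. \<forall>U. open U \<and> x \<in> U \<longrightarrow> emeasure F U > 0}"

definition upper_half_plane :: "complex set" where
  "upper_half_plane = {z. Im z > 0}"

definition stieltjes :: "real measure \<Rightarrow> complex \<Rightarrow> complex" where
  "stieltjes F z = (\<integral>l. 1 / (complex_of_real l - z) \<partial>F)"

definition linear_process ::
    "(nat \<Rightarrow> real) \<Rightarrow> (nat \<Rightarrow> int \<Rightarrow> 'a \<Rightarrow> real) \<Rightarrow> nat \<Rightarrow> int \<Rightarrow> 'a \<Rightarrow> real" where
  "linear_process c Z i t w = (\<Sum>j. c j * Z i (t - int j) w)"

definition autocov :: "(nat \<Rightarrow> real) \<Rightarrow> int \<Rightarrow> real" where
  "autocov c h = (\<Sum>j. c j * c (j + nat \<bar>h\<bar>))"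

text \<open>
  The matrix type counts rows and columns from \<open>0\<close>, so the entry at position \<open>(i, t)\<close> of the
  \<open>p \<times> n\<close> data matrix is \<open>X\<^bsub>i+1,t+1\<^esub>\<close>.
\<close>

definition data_matrix :: "nat \<Rightarrow> nat \<Rightarrow> (nat \<Rightarrow> int \<Rightarrow> 'a \<Rightarrow> real) \<Rightarrow> 'a \<Rightarrow> real mat" where
  "data_matrix p n X w = Matrix.mat p n (\<lambda>(i, t). X (i + 1) (int (t + 1)) w)"

text \<open>
  The density \<open>\<lambda> \<mapsto> \<Sum>\<^bsub>\<omega> : f(\<omega>) = \<lambda>\<^esub> 1/|f'(\<omega>)|\<close> depends on HOL's conventions (a sum over an infinite
  set is \<open>0\<close>, and so is \<open>1/0\<close>) only at those \<open>\<lambda>\<close> which have infinitely many preimages or are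
  critical values of \<open>f\<close>.
\<close>

definition level_density :: "(real \<Rightarrow> real) \<Rightarrow> (real \<Rightarrow> real) \<Rightarrow> real \<Rightarrow> real" where
  "level_density f f' l = (\<Sum>\<omega> | \<omega> \<in> {0..2*pi} \<and> f \<omega> = l. 1 / \<bar>f' \<omega>\<bar>)"

definition solves_stieltjes_equation ::
    "real \<Rightarrow> (real \<Rightarrow> real) \<Rightarrow> (real \<Rightarrow> real) \<Rightarrow> real \<Rightarrow> real \<Rightarrow> (complex \<Rightarrow> complex) \<Rightarrow> bool" where
  "solves_stieltjes_equation y f f' l\<^sub>1 l\<^sub>2 m \<longleftrightarrow>
     m \<in> upper_half_plane \<rightarrow> upper_half_plane \<and>
     (\<forall>z\<in>upper_half_plane.
        1 / m z = - z + complex_of_real (y / (2*pi)) *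
          (LINT l=l\<^sub>1..l\<^sub>2|lebesgue.
             (complex_of_real l / (1 + complex_of_real l * m z) *
              complex_of_real (level_density f f' l))))"

end

theory Submission
  imports Defs "Jordan_Normal_Form.Schur_Decomposition" "HOL-Probability.Hoeffding"
begin

text \<open>
  The proof uses Stieltjes transforms. The \<open>n \<times> n\<close> companion matrix \<open>p\<^sup>-\<^sup>1 X\<^sup>T X\<close> has the same nonzero
  eigenvalues as \<open>p\<^sup>-\<^sup>1 X X\<^sup>T\<close> and is a sum of \<open>p\<close> independent rank one matrices, one for each row of \<open>X\<close>;
  every row has the covariance matrix \<open>\<Gamma>\<close>, the Toeplitz matrix of the autocovariances. Changing one row
  moves the trace of the resolvent by \<open>O(1)\<close>, so the fourth central moment of the Stieltjes transform is
  \<open>O(p\<^sup>-\<^sup>2)\<close>, and by Borel-Cantelli only its expectation matters. Removing one row with the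
  Sherman-Morrison formula, and using that a quadratic form of a row is close to the trace against \<open>\<Gamma>\<close>
  (fourth moments suffice), one finds that the resolvent behaves like \<open>(b \<Gamma> - z)\<^sup>-\<^sup>1\<close> for a scalar \<open>b\<close>
  with \<open>Im b \<le> 0\<close>. Fourier vectors are approximate eigenvectors of \<open>\<Gamma>\<close> (Szego), so normalised traces turn
  into averages over the symbol \<open>f\<close>, and every limit point \<open>m\<close> of the expected transforms satisfies
  \<open>1/m = - z + y \<cdot> E[f/(1 + f m)]\<close> with \<open>f\<close> evaluated at a uniform frequency. Comparing imaginary parts
  and Cauchy-Schwarz show that this has at most one solution in the upper half-plane. The change of variables
  \<open>\<lambda> = f(\<omega>)\<close> gives the form of the equation in the theorem.
\<close>

section \<open>Finitely supported complex matrices\<close>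

text \<open>The rows of X are independent, but inside a row the entries are dependent and have few
  moments. So every estimate treats a row as a whole, and the algebraic ones must not depend on its
  size. This is possible because the leave-one-out form q of a row satisfies Im q >= 0 and Im (z q)
  >= 0: the second sign gives |1 / (1 + q)| <= |z| / Im z, the first bounds the change of a trace by
  a multiple of 1 / Im z, whatever the row is. Both signs survive expectation, so the averaged form
  g obeys the same bound, and b = 1 / (1 + g) has Im b <= 0, which keeps b \<Gamma> - z invertible
  with the bound 1 / Im z. Existence of a solution of the limit equation needs no separate argument:
  the expected transforms are bounded, every limit point solves the equation, and uniqueness makes
  the limit points coincide. Matrices of all sizes live in one type, as finitely supported arrays.
  Rows, columns and square matrices then share one ring and one inner product, and side conditions
  on dimensions become equations with idempotents.\<close>

typedef cmat = "{A :: nat \<Rightarrow> nat \<Rightarrow> complex. \<exists>N. \<forall>i j. N \<le> i \<or> N \<le> j \<longrightarrow> A i j = 0}"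
  morphisms ent Cmat
  by (rule exI[of _ "\<lambda>i j. 0"]) auto

lemma cmat_eqI: "(\<And>i j. ent A i j = ent B i j) \<Longrightarrow> A = B"
  by (metis ent_inject ext)

definition csize :: "cmat \<Rightarrow> nat" where
  "csize A = (LEAST N. \<forall>i j. N \<le> i \<or> N \<le> j \<longrightarrow> ent A i j = 0)"

lemma ent_beyond: "csize A \<le> i \<or> csize A \<le> j \<Longrightarrow> ent A i j = 0"
proof -
  have "\<exists>N. \<forall>i j. N \<le> i \<or> N \<le> j \<longrightarrow> ent A i j = 0"
    using ent[of A] by auto
  from LeastI_ex[OF this] show "csize A \<le> i \<or> csize A \<le> j \<Longrightarrow> ent A i j = 0"
    unfolding csize_def by blast
qed

lemma ent_Cmat: "(\<And>i j. N \<le> i \<or> N \<le> j \<Longrightarrow> f i j = 0) \<Longrightarrow> ent (Cmat f) = f"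
  by (rule Cmat_inverse) auto

definition cm :: "nat \<Rightarrow> nat \<Rightarrow> (nat \<Rightarrow> nat \<Rightarrow> complex) \<Rightarrow> cmat" where
  "cm n m f = Cmat (\<lambda>i j. if i < n \<and> j < m then f i j else 0)"

lemma ent_cm [simp]: "ent (cm n m f) i j = (if i < n \<and> j < m then f i j else 0)"
  unfolding cm_def by (subst ent_Cmat[of "max n m"]) auto

definition csc :: "complex \<Rightarrow> cmat \<Rightarrow> cmat" where
  "csc c A = Cmat (\<lambda>i j. c * ent A i j)"

lemma ent_csc [simp]: "ent (csc c A) i j = c * ent A i j"
  unfolding csc_def by (subst ent_Cmat[of "csize A"]) (auto simp: ent_beyond)

definition cadj :: "cmat \<Rightarrow> cmat" where
  "cadj A = Cmat (\<lambda>i j. cnj (ent A j i))"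

lemma ent_cadj [simp]: "ent (cadj A) i j = cnj (ent A j i)"
  unfolding cadj_def by (subst ent_Cmat[of "csize A"]) (auto simp: ent_beyond)

definition ctr :: "cmat \<Rightarrow> complex" where
  "ctr A = (\<Sum>i<csize A. ent A i i)"

lemma sum_lessThan_mono_neutral:
  fixes f :: "nat \<Rightarrow> 'a :: comm_monoid_add"
  assumes "\<And>k. M \<le> k \<Longrightarrow> f k = 0" "\<And>k. N \<le> k \<Longrightarrow> f k = 0"
  shows "sum f {..<M} = sum f {..<N}"
proof -
  have "sum f {..<M} = sum f {..<max M N}"
    by (rule sum.mono_neutral_left) (use assms in auto)
  also have "\<dots> = sum f {..<N}"
    by (rule sum.mono_neutral_right) (use assms in auto)
  finally show ?thesis .
qed

lemma ctr_eq: "(\<And>i. N \<le> i \<Longrightarrow> ent A i i = 0) \<Longrightarrow> ctr A = (\<Sum>i<N. ent A i i)"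
  unfolding ctr_def by (rule sum_lessThan_mono_neutral) (auto simp: ent_beyond)

text \<open>Only a ring without unit, since the infinite identity is not finitely supported; the
  idempotents \<open>cunit n\<close> take its place. The sum in \<open>A * B\<close> may stop at
  \<open>csize A\<close> because the later columns of \<open>A\<close> vanish.\<close>

instantiation cmat :: ring
begin
definition "0 = Cmat (\<lambda>i j. 0)"
definition "A + B = Cmat (\<lambda>i j. ent A i j + ent B i j)"
definition "A - B = Cmat (\<lambda>i j. ent A i j - ent B i j)"
definition "- A = Cmat (\<lambda>i j. - ent A i j)"
definition "A * B = Cmat (\<lambda>i j. \<Sum>k<csize A. ent A i k * ent B k j)"

lemma ent_zero [simp]: "ent 0 i j = 0"
  unfolding zero_cmat_def by (subst ent_Cmat[of 0]) auto
lemma ent_add [simp]: "ent (A + B) i j = ent A i j + ent B i j"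
  unfolding plus_cmat_def by (subst ent_Cmat[of "max (csize A) (csize B)"]) (auto simp: ent_beyond)
lemma ent_diff [simp]: "ent (A - B) i j = ent A i j - ent B i j"
  unfolding minus_cmat_def by (subst ent_Cmat[of "max (csize A) (csize B)"]) (auto simp: ent_beyond)
lemma ent_uminus [simp]: "ent (- A) i j = - ent A i j"
  unfolding uminus_cmat_def by (subst ent_Cmat[of "csize A"]) (auto simp: ent_beyond)
lemma ent_mult0: "ent (A * B) i j = (\<Sum>k<csize A. ent A i k * ent B k j)"
  unfolding times_cmat_def
  by (subst ent_Cmat[of "max (csize A) (csize B)"]) (auto simp: ent_beyond)

lemma ent_mult:
  assumes "\<And>k. N \<le> k \<Longrightarrow> ent A i k * ent B k j = 0"
  shows "ent (A * B) i j = (\<Sum>k<N. ent A i k * ent B k j)"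
  unfolding ent_mult0 by (rule sum_lessThan_mono_neutral) (auto simp: ent_beyond assms)

instance
proof
  fix A B C :: cmat
  show "A + B + C = A + (B + C)" "A + B = B + A" "0 + A = A" "- A + A = 0" "A - B = A + - B"
    by (auto intro!: cmat_eqI)
  define N where "N = max (csize A) (max (csize B) (csize C))"
  have e: "ent (X * Y) i j = (\<Sum>k<N. ent X i k * ent Y k j)"
    if "X \<in> {A, B, C} \<or> Y \<in> {A, B, C}" for X Y i j
    by (rule ent_mult) (use that in \<open>auto simp: N_def ent_beyond\<close>)
  show "(A + B) * C = A * C + B * C"
    by (rule cmat_eqI) (simp add: e sum.distrib algebra_simps)
  show "A * (B + C) = A * B + A * C"
    by (rule cmat_eqI) (simp add: e sum.distrib algebra_simps)
  show "A * B * C = A * (B * C)"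
  proof (rule cmat_eqI)
    fix i j
    have "ent (A * B * C) i j = (\<Sum>k<N. \<Sum>l<N. ent A i l * ent B l k * ent C k j)"
      by (simp add: e sum_distrib_right)
    also have "\<dots> = (\<Sum>l<N. \<Sum>k<N. ent A i l * ent B l k * ent C k j)"
      by (rule sum.swap)
    also have "\<dots> = ent (A * (B * C)) i j"
      by (simp add: e sum_distrib_left mult.assoc)
    finally show "ent (A * B * C) i j = ent (A * (B * C)) i j" .
  qed
qed
end

lemma ent_sum [simp]: "ent (sum F S) i j = (\<Sum>x\<in>S. ent (F x) i j)"
  by (induction S rule: infinite_finite_induct) auto

lemma csc_mult_left [simp]: "csc c A * B = csc c (A * B)"
  by (rule cmat_eqI)
    (simp add: ent_mult[of "csize A"] ent_beyond sum_distrib_left mult.assoc)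

lemma csc_mult_right [simp]: "A * csc c B = csc c (A * B)"
  by (rule cmat_eqI)
    (simp add: ent_mult[of "csize A"] ent_beyond sum_distrib_left mult_ac)

lemma csc_add: "csc c (A + B) = csc c A + csc c B"
  and csc_diff: "csc c (A - B) = csc c A - csc c B"
  and csc_add_left: "csc (c + d) A = csc c A + csc d A"
  and csc_diff_left: "csc (c - d) A = csc c A - csc d A"
  and csc_csc [simp]: "csc c (csc d A) = csc (c * d) A"
  and csc_one [simp]: "csc 1 A = A"
  and csc_zero [simp]: "csc 0 A = 0" "csc c 0 = 0"
  and csc_sum: "csc c (sum F S) = (\<Sum>x\<in>S. csc c (F x))"
  by (auto intro!: cmat_eqI simp: algebra_simps sum_distrib_left)

lemma cadj_mult [simp]: "cadj (A * B) = cadj B * cadj A"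
proof (rule cmat_eqI)
  fix i j
  have "ent (cadj B * cadj A) i j = (\<Sum>k<csize A. cnj (ent B k i) * cnj (ent A j k))"
    by (subst ent_mult[of "csize A"]) (auto simp: ent_beyond)
  then show "ent (cadj (A * B)) i j = ent (cadj B * cadj A) i j"
    by (simp add: ent_mult[of "csize A"] ent_beyond mult.commute)
qed

lemma cadj_cadj [simp]: "cadj (cadj A) = A"
  and cadj_add [simp]: "cadj (A + B) = cadj A + cadj B"
  and cadj_diff [simp]: "cadj (A - B) = cadj A - cadj B"
  and cadj_csc [simp]: "cadj (csc c A) = csc (cnj c) (cadj A)"
  and cadj_zero [simp]: "cadj 0 = 0"
  and cadj_sum [simp]: "cadj (sum F S) = (\<Sum>x\<in>S. cadj (F x))"
  by (auto intro!: cmat_eqI)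

lemma ctr_add [simp]: "ctr (A + B) = ctr A + ctr B"
proof -
  define N where "N = max (csize A) (csize B)"
  have "ctr X = (\<Sum>i<N. ent X i i)" if "X \<in> {A, B, A + B}" for X
    by (rule ctr_eq) (use that in \<open>auto simp: N_def ent_beyond\<close>)
  then show ?thesis by (simp add: sum.distrib)
qed

lemma ctr_csc [simp]: "ctr (csc c A) = c * ctr A"
  by (simp add: ctr_eq[of "csize A"] ent_beyond sum_distrib_left)

lemma ctr_zero [simp]: "ctr 0 = 0"
  by (simp add: ctr_eq[of 0])

lemma ctr_diff [simp]: "ctr (A - B) = ctr A - ctr B"
  by (metis add_diff_cancel ctr_add diff_add_cancel)

lemma ctr_uminus [simp]: "ctr (- A) = - ctr A"
  by (metis ctr_diff ctr_zero diff_0)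

lemma ctr_sum [simp]: "ctr (sum F S) = (\<Sum>x\<in>S. ctr (F x))"
  by (induction S rule: infinite_finite_induct) auto

lemma ctr_cadj [simp]: "ctr (cadj A) = cnj (ctr A)"
  by (simp add: ctr_eq[of "csize A"] ent_beyond)

lemma ctr_mult:
  assumes "\<And>i k. N \<le> i \<Longrightarrow> ent A i k = 0 \<or> ent B k i = 0" "\<And>i k. K \<le> k \<Longrightarrow> ent A i k = 0 \<or> ent B k i = 0"
  shows "ctr (A * B) = (\<Sum>i<N. \<Sum>k<K. ent A i k * ent B k i)"
proof -
  have "ent (A * B) i i = (\<Sum>k<K. ent A i k * ent B k i)" for i
    by (rule ent_mult) (use assms(2) in auto)
  moreover have "ent (A * B) i i = 0" if "N \<le> i" for i
  proof -
    have "ent A i k * ent B k i = 0" for k using assms(1)[OF that, of k] by auto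
    then show ?thesis by (simp add: ent_mult0)
  qed
  ultimately show ?thesis
    by (simp add: ctr_eq[of N])
qed

lemma ctr_comm: "ctr (A * B) = ctr (B * A)"
proof -
  have "ctr (A * B) = (\<Sum>i<csize A. \<Sum>k<csize A. ent A i k * ent B k i)"
    by (rule ctr_mult) (auto simp: ent_beyond)
  also have "\<dots> = (\<Sum>k<csize A. \<Sum>i<csize A. ent B k i * ent A i k)"
    by (subst sum.swap) (simp add: mult.commute)
  also have "\<dots> = ctr (B * A)"
    by (rule ctr_mult[symmetric]) (auto simp: ent_beyond)
  finally show ?thesis .
qed

lemma ctr_cadj_mult:
  assumes "csize A \<le> N"
  shows "ctr (cadj A * B) = (\<Sum>i<N. \<Sum>k<N. cnj (ent A k i) * ent B k i)"
  by (subst ctr_mult[of N _ _ N]) (use assms in \<open>auto simp: ent_beyond\<close>)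

text \<open>The real part of the Hilbert-Schmidt product, so that \<open>norm\<close> is the
  Frobenius norm and Cauchy-Schwarz comes with the class. Vectors are matrices with a single row or
  column, for which the norm is Euclidean.\<close>

instantiation cmat :: real_inner
begin
definition "scaleR r A = csc (of_real r) A"
definition "inner A B = Re (ctr (cadj A * B))"
definition norm_cmat :: "cmat \<Rightarrow> real" where "norm_cmat A = sqrt (inner A A)"
definition dist_cmat :: "cmat \<Rightarrow> cmat \<Rightarrow> real" where "dist_cmat A B = norm (A - B)"
definition sgn_cmat :: "cmat \<Rightarrow> cmat" where "sgn_cmat A = scaleR (inverse (norm A)) A"
definition uniformity_cmat :: "(cmat \<times> cmat) filter" where
  "uniformity_cmat = (INF e\<in>{0<..}. principal {(x, y). dist x y < e})"
definition open_cmat :: "cmat set \<Rightarrow> bool" where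
  "open_cmat U = (\<forall>x\<in>U. eventually (\<lambda>(x', y). x' = x \<longrightarrow> y \<in> U) uniformity)"

lemma inner_cmat_self:
  assumes "csize A \<le> N"
  shows "inner A A = (\<Sum>i<N. \<Sum>k<N. (cmod (ent A k i))\<^sup>2)"
  unfolding inner_cmat_def ctr_cadj_mult[OF assms]
  by (simp add: cmod_power2 sum.distrib flip: power2_eq_square)

instance
proof
  fix A B C :: cmat and r s :: real
  show "r *\<^sub>R (A + B) = r *\<^sub>R A + r *\<^sub>R B" "(r + s) *\<^sub>R A = r *\<^sub>R A + s *\<^sub>R A"
    "r *\<^sub>R s *\<^sub>R A = (r * s) *\<^sub>R A" "1 *\<^sub>R A = A"
    by (auto simp: scaleR_cmat_def csc_add csc_add_left)
  show "dist A B = norm (A - B)" by (rule dist_cmat_def)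
  show "sgn A = scaleR (inverse (norm A)) A" by (rule sgn_cmat_def)
  show "uniformity = (INF e\<in>{0<..}. principal {(x, y). dist (x::cmat) y < e})"
    by (rule uniformity_cmat_def)
  show "open U = (\<forall>x\<in>U. \<forall>\<^sub>F (x', y) in uniformity. x' = x \<longrightarrow> y \<in> U)" for U :: "cmat set"
    by (rule open_cmat_def)
  have "ctr (cadj A * B) = cnj (ctr (cadj B * A))"
    by (metis cadj_cadj cadj_mult ctr_cadj)
  then show "inner A B = inner B A" by (simp add: inner_cmat_def)
  show "inner (A + B) C = inner A C + inner B C"
    by (simp add: inner_cmat_def distrib_right)
  show "inner (r *\<^sub>R A) B = r * inner A B"
    by (simp add: inner_cmat_def scaleR_cmat_def)
  show "0 \<le> inner A A"
    by (simp add: inner_cmat_self[of A "csize A"] sum_nonneg)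
  show "inner A A = 0 \<longleftrightarrow> A = 0"
  proof
    assume "inner A A = 0"
    then have z: "ent A k i = 0" if "i < csize A" "k < csize A" for i k
      using that by (simp add: inner_cmat_self[of A "csize A"] sum_nonneg_eq_0_iff sum_nonneg)
    show "A = 0"
    proof (rule cmat_eqI)
      fix i j show "ent A i j = ent 0 i j"
        using z[of j i] ent_beyond[of A i j] by (cases "i < csize A \<and> j < csize A") auto
    qed
  qed (simp add: inner_cmat_def)
  show "norm A = sqrt (inner A A)" by (rule norm_cmat_def)
qed
end

lemma norm_csc [simp]: "norm (csc c A) = cmod c * norm A"
proof -
  have "cnj c * (c * ctr (cadj A * A)) = of_real ((cmod c)\<^sup>2) * ctr (cadj A * A)"
    by (simp only: complex_norm_square mult_ac)
  then have "Re (cnj c * (c * ctr (cadj A * A))) = (cmod c)\<^sup>2 * inner A A"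
    by (simp only: Re_complex_of_real inner_cmat_def times_complex.sel Im_complex_of_real)
  then have "inner (csc c A) (csc c A) = (cmod c)\<^sup>2 * inner A A"
    by (simp only: inner_cmat_def cadj_csc csc_mult_left csc_mult_right csc_csc ctr_csc mult.assoc)
      (simp add: mult_ac)
  then show ?thesis
    by (simp add: norm_eq_sqrt_inner real_sqrt_mult)
qed

lemma ctr_cadj_self: "ctr (cadj A * A) = of_real ((norm A)\<^sup>2)"
proof -
  have "cnj (ctr (cadj A * A)) = ctr (cadj A * A)"
    by (metis cadj_cadj cadj_mult ctr_cadj)
  then have "Im (ctr (cadj A * A)) = 0"
    by (metis Reals_cnj_iff complex_is_Real_iff)
  then show ?thesis
    by (simp add: complex_eq_iff inner_cmat_def power2_norm_eq_inner)
qed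

lemma norm_cadj [simp]: "norm (cadj A) = norm A"
  by (simp add: norm_eq_sqrt_inner inner_cmat_def ctr_comm[of A])

text \<open>Cauchy-Schwarz of the real inner product controls only real parts; rotating the trace
  onto the positive axis by a unit scalar \<open>u\<close> gives the modulus.\<close>

lemma cmod_ctr_mult_le: "cmod (ctr (A * B)) \<le> norm A * norm B"
proof -
  define w where "w = ctr (A * B)"
  define u where "u = (if w = 0 then 1 else cnj w / cmod w)"
  have u: "cmod u = 1" by (auto simp: u_def norm_divide)
  have "u * w = of_real (cmod w)"
  proof (cases "w = 0")
    case False
    then have "cnj w * w = of_real (cmod w) * of_real (cmod w)"
      using complex_norm_square[of w] by (simp add: mult.commute power2_eq_square)
    then show ?thesis using False by (simp add: u_def field_simps)
  qed (simp add: u_def)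
  then have "cmod w = Re (u * w)" by simp
  also have "\<dots> = inner (cadj A) (csc u B)"
    by (simp add: inner_cmat_def w_def)
  also have "\<dots> \<le> norm (cadj A) * norm (csc u B)"
    by (rule norm_cauchy_schwarz)
  finally show ?thesis by (simp add: u w_def)
qed

lemma norm_cmat_square:
  assumes "csize A \<le> N"
  shows "(norm A)\<^sup>2 = (\<Sum>i<N. \<Sum>k<N. (cmod (ent A i k))\<^sup>2)"
  using inner_cmat_self[OF assms] by (subst sum.swap) (simp add: power2_norm_eq_inner)

section \<open>Identity blocks and the corner of size n\<close>

definition cunit :: "nat \<Rightarrow> cmat" where "cunit n = cm n n (\<lambda>i j. if i = j then 1 else 0)"

lemma ent_cunit [simp]: "ent (cunit n) i j = (if i = j \<and> i < n then 1 else 0)"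
  by (auto simp: cunit_def)

lemma ent_cunit_mult [simp]: "ent (cunit n * A) i j = (if i < n then ent A i j else 0)"
  by (subst ent_mult[of "n + i + 1"]) (auto simp: if_distrib[of "\<lambda>x. x * _"] cong: if_cong)

lemma cadj_cunit [simp]: "cadj (cunit n) = cunit n"
  by (rule cmat_eqI) auto

lemma ent_mult_cunit [simp]: "ent (A * cunit n) i j = (if j < n then ent A i j else 0)"
proof -
  have "ent (A * cunit n) i j = cnj (ent (cadj (A * cunit n)) j i)" by (simp only: ent_cadj complex_cnj_cnj)
  also have "\<dots> = (if j < n then ent A i j else 0)" by (simp only: cadj_mult cadj_cunit ent_cunit_mult) simp
  finally show ?thesis .
qed

lemma ctr_cunit [simp]: "ctr (cunit n) = of_nat n"
  by (simp add: ctr_eq[of n])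

lemma cunit_idem [simp]: "cunit n * cunit n = cunit n"
  by (rule cmat_eqI) auto

lemma norm_cunit: "norm (cunit n) = sqrt n"
proof -
  have "of_real ((norm (cunit n))\<^sup>2) = (of_nat n :: complex)"
    by (simp only: ctr_cadj_self[symmetric] cadj_cunit cunit_idem ctr_cunit)
  then have "(norm (cunit n))\<^sup>2 = real n"
    by (metis of_real_eq_iff of_real_of_nat_eq)
  then show ?thesis by (metis norm_ge_zero real_sqrt_unique)
qed

text \<open>Membership in the upper left block is stated with the idempotent, so that closure under
  the ring operations follows from associativity and distributivity alone.\<close>

definition corner :: "nat \<Rightarrow> cmat \<Rightarrow> bool" where
  "corner n A \<longleftrightarrow> cunit n * A = A \<and> A * cunit n = A"

lemma corner_iff: "corner n A \<longleftrightarrow> (\<forall>i j. n \<le> i \<or> n \<le> j \<longrightarrow> ent A i j = 0)"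
proof
  assume c: "corner n A"
  show "\<forall>i j. n \<le> i \<or> n \<le> j \<longrightarrow> ent A i j = 0"
  proof (intro allI impI)
    fix i j assume "n \<le> i \<or> n \<le> j"
    then show "ent A i j = 0"
      using c ent_cunit_mult[of n A i j] ent_mult_cunit[of A n i j]
      unfolding corner_def by (auto split: if_splits)
  qed
next
  assume "\<forall>i j. n \<le> i \<or> n \<le> j \<longrightarrow> ent A i j = 0"
  then show "corner n A"
    unfolding corner_def by (auto intro!: cmat_eqI)
qed

lemma corner_csize: "corner n A \<Longrightarrow> csize A \<le> n"
  unfolding csize_def corner_iff by (rule Least_le) auto

lemma corner_cunit [simp]: "corner n (cunit n)" by (simp add: corner_def)
lemma corner_zero [simp]: "corner n 0" by (simp add: corner_def)
lemma corner_diff: "corner n A \<Longrightarrow> corner n B \<Longrightarrow> corner n (A - B)"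
  and corner_add: "corner n A \<Longrightarrow> corner n B \<Longrightarrow> corner n (A + B)"
  by (simp_all add: corner_def algebra_simps)
lemma corner_csc: "corner n A \<Longrightarrow> corner n (csc c A)"
  by (simp add: corner_def)
lemma corner_mult: "corner n A \<Longrightarrow> corner n B \<Longrightarrow> corner n (A * B)"
  by (metis corner_def mult.assoc)
lemma corner_sum: "(\<And>x. x \<in> S \<Longrightarrow> corner n (F x)) \<Longrightarrow> corner n (sum F S)"
  by (induction S rule: infinite_finite_induct) (auto intro: corner_add)
lemma corner_cadj: "corner n A \<Longrightarrow> corner n (cadj A)"
  by (simp add: corner_iff)
lemma corner_cm: "corner n (cm n n f)"
  by (simp add: corner_iff)

section \<open>Inverses inside a corner, through determinants\<close>

definition to_mat :: "nat \<Rightarrow> cmat \<Rightarrow> complex mat" where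
  "to_mat n A = Matrix.mat n n (\<lambda>(i, j). ent A i j)"

definition of_cmat :: "nat \<Rightarrow> complex mat \<Rightarrow> cmat" where
  "of_cmat n A = cm n n (\<lambda>i j. A $$ (i, j))"

lemma to_mat_carrier [simp]: "to_mat n A \<in> carrier_mat n n"
  by (simp add: to_mat_def)

lemma of_cmat_to_mat: "corner n A \<Longrightarrow> of_cmat n (to_mat n A) = A"
  by (rule cmat_eqI) (auto simp: of_cmat_def to_mat_def corner_iff)

lemma corner_of_cmat [simp]: "corner n (of_cmat n A)"
  by (simp add: of_cmat_def corner_cm)

lemma of_cmat_mult:
  assumes "A \<in> carrier_mat n n" "B \<in> carrier_mat n n"
  shows "of_cmat n (A * B) = of_cmat n A * of_cmat n B"
proof (rule cmat_eqI)
  fix i j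
  have "ent (of_cmat n A * of_cmat n B) i j = (\<Sum>k<n. ent (of_cmat n A) i k * ent (of_cmat n B) k j)"
    by (rule ent_mult) (simp add: of_cmat_def)
  then show "ent (of_cmat n (A * B)) i j = ent (of_cmat n A * of_cmat n B) i j"
    using assms by (auto simp: of_cmat_def scalar_prod_def atLeast0LessThan)
qed

lemma of_cmat_one: "of_cmat n (1\<^sub>m n) = cunit n"
  by (rule cmat_eqI) (auto simp: of_cmat_def)

lemma of_cmat_smult: "A \<in> carrier_mat n n \<Longrightarrow> of_cmat n (c \<cdot>\<^sub>m A) = csc c (of_cmat n A)"
  by (rule cmat_eqI) (auto simp: of_cmat_def)

text \<open>The adjugate formula makes each entry a quotient of polynomials in the entries of
  \<open>B\<close>, from which measurability in \<open>B\<close> is immediate. For a singular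
  \<open>B\<close> the value is 0, by the convention for division.\<close>

definition cinv :: "nat \<Rightarrow> cmat \<Rightarrow> cmat" where
  "cinv n B = csc (1 / det (to_mat n B)) (of_cmat n (adj_mat (to_mat n B)))"

lemma corner_cinv [simp]: "corner n (cinv n B)"
  by (simp add: cinv_def corner_csc)

lemma cinv_det:
  assumes "corner n B" "det (to_mat n B) \<noteq> 0"
  shows "cinv n B * B = cunit n" "B * cinv n B = cunit n"
proof -
  note a = adj_mat[OF to_mat_carrier[of n B]]
  have l: "csc (det (to_mat n B)) (cunit n) = of_cmat n (adj_mat (to_mat n B)) * B"
    using arg_cong[OF a(3), of "of_cmat n"] assms(1) a(1)
    by (simp add: of_cmat_mult of_cmat_to_mat of_cmat_smult of_cmat_one)
  then show "cinv n B * B = cunit n"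
    using assms(2) by (simp add: cinv_def flip: l)
  have r: "csc (det (to_mat n B)) (cunit n) = B * of_cmat n (adj_mat (to_mat n B))"
    using arg_cong[OF a(2), of "of_cmat n"] assms(1) a(1)
    by (simp add: of_cmat_mult of_cmat_to_mat of_cmat_smult of_cmat_one)
  then show "B * cinv n B = cunit n"
    using assms(2) by (simp add: cinv_def flip: r)
qed

lemma det_zero_kernel:
  assumes "corner n B" "det (to_mat n B) = 0"
  obtains U where "U \<noteq> 0" "cunit n * U = U" "B * U = 0"
proof -
  obtain v where v: "v \<in> carrier_vec n" "v \<noteq> 0\<^sub>v n" "to_mat n B *\<^sub>v v = 0\<^sub>v n"
    using det_0_iff_vec_prod_zero[OF to_mat_carrier[of n B]] assms(2) by auto
  define U where "U = cm n 1 (\<lambda>i j. v $ i)"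
  have "U \<noteq> 0"
  proof
    assume U: "U = 0"
    have "v = 0\<^sub>v n"
    proof (rule eq_vecI)
      fix i assume "i < dim_vec (0\<^sub>v n)"
      then show "v $ i = 0\<^sub>v n $ i"
        using arg_cong[OF U, of "\<lambda>U. ent U i 0"] by (simp add: U_def)
    qed (use v in auto)
    then show False using v by simp
  qed
  moreover have "cunit n * U = U"
    by (rule cmat_eqI) (auto simp: U_def)
  moreover have "B * U = 0"
  proof (rule cmat_eqI)
    fix i j
    have *: "ent (B * U) i j = (\<Sum>k<n. ent B i k * ent U k j)"
      by (rule ent_mult) (simp add: U_def)
    show "ent (B * U) i j = ent 0 i j"
    proof (cases "i < n \<and> j < 1")
      case True
      then have "ent (B * U) i j = (to_mat n B *\<^sub>v v) $ i"
        using v(1) unfolding * by (simp add: U_def to_mat_def scalar_prod_def atLeast0LessThan)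
      then show ?thesis using v True by simp
    next
      case False
      then show ?thesis using assms(1) unfolding * by (auto simp: U_def corner_iff)
    qed
  qed
  ultimately show ?thesis using that by blast
qed

text \<open>A left inverse excludes a kernel and hence a zero determinant; associativity then
  identifies it with \<open>cinv\<close>. This is how a guessed formula for an inverse is
  confirmed.\<close>

lemma cinv_unique:
  assumes "corner n B" "corner n R" "R * B = cunit n"
  shows "det (to_mat n B) \<noteq> 0" "cinv n B = R"
proof -
  show d: "det (to_mat n B) \<noteq> 0"
  proof
    assume "det (to_mat n B) = 0"
    then obtain U where U: "U \<noteq> 0" "cunit n * U = U" "B * U = 0"
      using det_zero_kernel assms(1) by blast
    then have "U = R * (B * U)" by (metis assms(3) mult.assoc)
    then show False using U by simp
  qed
  have "R = R * (B * cinv n B)"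
    using assms cinv_det(2)[OF assms(1) d] by (simp add: corner_def)
  also have "\<dots> = cinv n B"
    using assms(3) corner_cinv[of n B] by (simp add: corner_def flip: mult.assoc)
  finally show "cinv n B = R" by simp
qed

text \<open>An upper bound for the operator norm, tested on all matrices in the Frobenius norm,
  which includes single columns and rows. Having both sides in the definition saves passing to
  adjoints in trace estimates.\<close>

definition op_bound :: "real \<Rightarrow> cmat \<Rightarrow> bool" where
  "op_bound L A \<longleftrightarrow> (\<forall>U. norm (A * U) \<le> L * norm U) \<and> (\<forall>U. norm (U * A) \<le> L * norm U)"

lemma op_bound_mult:
  assumes "op_bound L A" "op_bound K B" "0 \<le> L" "0 \<le> K"
  shows "op_bound (L * K) (A * B)"
  unfolding op_bound_def
proof (intro conjI allI)
  fix U
  have "norm (A * (B * U)) \<le> L * (K * norm U)"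
    using assms by (meson mult_left_mono op_bound_def order_trans)
  then show "norm (A * B * U) \<le> L * K * norm U" by (simp add: mult.assoc)
  have "norm (U * A * B) \<le> K * (L * norm U)"
    using assms by (meson mult_left_mono op_bound_def order_trans)
  then show "norm (U * (A * B)) \<le> L * K * norm U" by (simp add: mult_ac)
qed

lemma op_boundI:
  assumes "\<And>U. norm (A * U) \<le> L * norm U" "\<And>U. norm (cadj A * U) \<le> L * norm U"
  shows "op_bound L A"
  unfolding op_bound_def
proof (intro conjI allI)
  fix U
  have "norm (U * A) = norm (cadj A * cadj U)" by (metis cadj_mult norm_cadj)
  also have "\<dots> \<le> L * norm U" using assms(2)[of "cadj U"] by simp
  finally show "norm (U * A) \<le> L * norm U" .
qed (use assms in auto)

lemma op_bound_cadj: "op_bound L A \<Longrightarrow> op_bound L (cadj A)"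
  unfolding op_bound_def by (metis cadj_cadj cadj_mult norm_cadj)

lemma op_bound_cunit: "op_bound 1 (cunit n)"
proof (rule op_boundI)
  fix U :: cmat
  define N where "N = csize U"
  have N: "csize (cunit n * U) \<le> N" "csize U \<le> N"
    unfolding csize_def[of "cunit n * U"] by (rule Least_le) (auto simp: N_def ent_beyond)
  have "(norm (cunit n * U))\<^sup>2 \<le> (norm U)\<^sup>2"
    unfolding norm_cmat_square[OF N(1)] norm_cmat_square[OF N(2)] by (intro sum_mono) auto
  then have "norm (cunit n * U) \<le> norm U"
    by (rule power2_le_imp_le) simp
  then show "norm (cunit n * U) \<le> 1 * norm U" "norm (cadj (cunit n) * U) \<le> 1 * norm U"
    by simp_all
qed

text \<open>Inserting the identity block on both sides splits the trace into two Hilbert-Schmidt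
  factors; each block has norm \<open>sqrt n\<close>.\<close>

lemma cmod_ctr_le_op_bound:
  assumes "corner n A" "op_bound L A"
  shows "cmod (ctr A) \<le> L * n"
proof -
  have "cmod (ctr A) = cmod (ctr (cunit n * (A * cunit n)))"
    using assms(1) by (simp add: corner_def)
  also have "\<dots> \<le> norm (cunit n) * norm (A * cunit n)"
    by (rule cmod_ctr_mult_le)
  also have "\<dots> \<le> norm (cunit n) * (L * norm (cunit n))"
    using assms(2) by (intro mult_left_mono) (auto simp: op_bound_def)
  also have "\<dots> = L * n" by (simp add: norm_cunit)
  finally show ?thesis .
qed

lemma coercive_lower_bound:
  assumes "\<And>U. cunit n * U = U \<Longrightarrow> \<eta> * (norm U)\<^sup>2 \<le> cmod (ctr (cadj U * (B * U)))"
    and "cunit n * U = U"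
  shows "\<eta> * norm U \<le> norm (B * U)"
proof (cases "U = 0")
  case False
  have "\<eta> * norm U * norm U \<le> norm U * norm (B * U)"
    using assms(1)[OF assms(2)] cmod_ctr_mult_le[of "cadj U" "B * U"]
    by (simp add: power2_eq_square mult.assoc)
  then show ?thesis using False by simp
qed auto

text \<open>A matrix whose numerical range stays at distance \<eta> from 0 is injective on the
  corner, hence invertible there because the dimension is finite, and the lower bound for
  \<open>B\<close> is the upper bound for its inverse.\<close>

lemma coercive_cinv:
  assumes B: "corner n B" and \<eta>: "\<eta> > 0"
    and co: "\<And>U. cunit n * U = U \<Longrightarrow> \<eta> * (norm U)\<^sup>2 \<le> cmod (ctr (cadj U * (B * U)))"
  shows "cinv n B * B = cunit n" "B * cinv n B = cunit n" "op_bound (1 / \<eta>) (cinv n B)"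
proof -
  have d: "det (to_mat n B) \<noteq> 0"
  proof
    assume "det (to_mat n B) = 0"
    then obtain U where U: "U \<noteq> 0" "cunit n * U = U" "B * U = 0"
      using det_zero_kernel B by blast
    then have "\<eta> * norm U \<le> 0"
      using coercive_lower_bound[OF co U(2)] by simp
    then show False using U \<eta> by (simp add: mult_le_0_iff)
  qed
  show i: "cinv n B * B = cunit n" "B * cinv n B = cunit n"
    using cinv_det[OF B d] by auto
  define R where "R = cinv n B"
  have R: "corner n R" "R * B = cunit n" "B * R = cunit n"
    using i by (auto simp: R_def)
  \<comment> \<open>The form of the adjoint is the complex conjugate, so it is coercive with the
    same constant; it supplies the bound for the adjoint of the inverse.\<close>
  have co': "\<eta> * (norm U)\<^sup>2 \<le> cmod (ctr (cadj U * (cadj B * U)))" if "cunit n * U = U" for U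
  proof -
    have "ctr (cadj U * (cadj B * U)) = cnj (ctr (cadj U * (B * U)))"
      by (subst ctr_cadj[symmetric]) (simp add: mult.assoc)
    then show ?thesis using co[OF that] by simp
  qed
  have le: "norm (A * U) \<le> 1 / \<eta> * norm U"
    if "\<And>U. cunit n * U = U \<Longrightarrow> \<eta> * (norm U)\<^sup>2 \<le> cmod (ctr (cadj U * (C * U)))"
      "C * A = cunit n" "cunit n * A = A" for A C U
  proof -
    have "\<eta> * norm (A * U) \<le> norm (C * (A * U))"
    proof (rule coercive_lower_bound)
      show "cunit n * (A * U) = A * U" by (simp add: that(3) flip: mult.assoc)
    qed (rule that(1))
    also have "\<dots> = norm (cunit n * U)" by (simp add: that(2) flip: mult.assoc)
    also have "\<dots> \<le> norm U" using op_bound_cunit[of n] by (simp add: op_bound_def)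
    finally show ?thesis using \<eta> by (simp add: field_simps)
  qed
  show "op_bound (1 / \<eta>) (cinv n B)"
    unfolding R_def[symmetric]
  proof (rule op_boundI)
    fix U
    show "norm (R * U) \<le> 1 / \<eta> * norm U"
      by (rule le[OF co R(3)]) (use R(1) in \<open>auto simp: corner_def\<close>)
    show "norm (cadj R * U) \<le> 1 / \<eta> * norm U"
    proof (rule le[OF co'])
      show "cadj B * cadj R = cunit n" "cunit n * cadj R = cadj R"
        using R corner_cadj[OF R(1)] by (auto simp: corner_def simp flip: cadj_mult)
    qed
  qed
qed

lemma measurable_det:
  fixes A :: "'b \<Rightarrow> complex mat"
  assumes "\<And>w. A w \<in> carrier_mat n n"
    and "\<And>i j. i < n \<Longrightarrow> j < n \<Longrightarrow> (\<lambda>w. A w $$ (i, j)) \<in> borel_measurable M"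
  shows "(\<lambda>w. det (A w)) \<in> borel_measurable M"
proof -
  have "(\<lambda>w. \<Sum>q | q permutes {0..<n}. signof q * (\<Prod>i = 0..<n. A w $$ (i, q i))) \<in> borel_measurable M"
    using assms(2) by (intro borel_measurable_sum borel_measurable_times borel_measurable_prod borel_measurable_const)
      (auto simp: permutes_in_image)
  then show ?thesis by (simp add: det_def'[OF assms(1)])
qed

lemma measurable_ent_cinv:
  assumes "\<And>i j. (\<lambda>w. ent (B w) i j) \<in> borel_measurable M"
  shows "(\<lambda>w. ent (cinv n (B w)) i j) \<in> borel_measurable M"
proof -
  have d: "(\<lambda>w. det (to_mat n (B w))) \<in> borel_measurable M"
    by (rule measurable_det[of _ n]) (auto simp: to_mat_def assms)
  have m: "(\<lambda>w. det (mat_delete (to_mat n (B w)) j i)) \<in> borel_measurable M" if "i < n" "j < n"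
  proof (rule measurable_det[of _ "n - 1"])
    fix k l assume "k < n - 1" "l < n - 1"
    then have "mat_delete (to_mat n (B w)) j i $$ (k, l) =
        ent (B w) (if k < j then k else Suc k) (if l < i then l else Suc l)" for w
      by (auto simp: to_mat_def mat_delete_def)
    then show "(\<lambda>w. mat_delete (to_mat n (B w)) j i $$ (k, l)) \<in> borel_measurable M"
      using assms by simp
  qed (simp add: mat_delete_def to_mat_def)
  have "(\<lambda>w. if i < n \<and> j < n then 1 / det (to_mat n (B w)) *
      ((-1) ^ (j + i) * det (mat_delete (to_mat n (B w)) j i)) else 0) \<in> borel_measurable M"
  proof (cases "i < n \<and> j < n")
    case True
    note [measurable] = d m[OF conjunct1[OF True] conjunct2[OF True]]
    show ?thesis using True by simp
  qed auto
  also have "(\<lambda>w. if i < n \<and> j < n then 1 / det (to_mat n (B w)) *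
      ((-1) ^ (j + i) * det (mat_delete (to_mat n (B w)) j i)) else 0) = (\<lambda>w. ent (cinv n (B w)) i j)"
    by (auto simp: cinv_def of_cmat_def adj_mat_def cofactor_def to_mat_def)
  finally show ?thesis .
qed

section \<open>Moments under bounded differences\<close>

text \<open>The quadratic and quartic terms of the exponential series at |u| lie below exp |u|. This
  converts exponential moments into second and fourth moments.\<close>

lemma exp_quarter_bounds:
  fixes u :: real
  shows "u\<^sup>2 \<le> 2 * (exp u + exp (- u))" "u ^ 4 \<le> 24 * (exp u + exp (- u))"
proof -
  have *: "(\<Sum>n<5. v ^ n / fact n) \<le> exp v" if "v \<ge> 0" for v :: real
    using sum_le_suminf[OF summable_exp_generic[of v], of "{..<5}"] that
    by (simp add: exp_def scaleR_conv_of_real field_simps)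
  have a: "v ^ 4 / 24 + v\<^sup>2 / 2 \<le> exp v" if "v \<ge> 0" for v :: real
  proof -
    have "v ^ 4 / 24 + v\<^sup>2 / 2 \<le> (\<Sum>n<5. v ^ n / fact n)"
      using that by (simp add: eval_nat_numeral fact_numeral)
    then show ?thesis using *[OF that] by linarith
  qed
  have lin: "r \<le> 2 * t \<and> q \<le> 24 * t"
    if "e + e' = t" "0 \<le> e'" "q / 24 + r / 2 \<le> e" "0 \<le> q" "0 \<le> r" for e e' t q r :: real
    using that by auto
  have "u\<^sup>2 \<le> 2 * (exp u + exp (- u)) \<and> u ^ 4 \<le> 24 * (exp u + exp (- u))"
  proof (rule lin)
    show "exp \<bar>u\<bar> + exp (- \<bar>u\<bar>) = exp u + exp (- u)" by (auto simp: abs_if)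
    show "u ^ 4 / 24 + u\<^sup>2 / 2 \<le> exp \<bar>u\<bar>" using a[of "\<bar>u\<bar>"] by simp
  qed auto
  then show "u\<^sup>2 \<le> 2 * (exp u + exp (- u))" "u ^ 4 \<le> 24 * (exp u + exp (- u))" by auto
qed

text \<open>A function of oscillation at most \<open>c\<close> takes its values in an interval of
  length \<open>c\<close> that starts at its infimum, which is the setting of Hoeffding's
  lemma.\<close>

lemma (in prob_space) Hoeffdings_lemma_oscillation:
  fixes g :: "'a \<Rightarrow> real"
  assumes g: "g \<in> borel_measurable M" and l: "l > 0"
    and osc: "\<And>a b. a \<in> space M \<Longrightarrow> b \<in> space M \<Longrightarrow> \<bar>g a - g b\<bar> \<le> c"
  shows "integrable M (\<lambda>y. exp (l * (g y - expectation g)))"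
    and "expectation (\<lambda>y. exp (l * (g y - expectation g))) \<le> exp (l\<^sup>2 * c\<^sup>2 / 8)"
proof -
  obtain x0 where x0: "x0 \<in> space M" using not_empty by blast
  define a where "a = (INF y\<in>space M. g y)"
  have bdd: "bdd_below (g ` space M)"
    by (rule bdd_belowI[of _ "g x0 - c"]) (use osc x0 in \<open>fastforce simp: abs_le_iff\<close>)
  have lo: "a \<le> g y" if "y \<in> space M" for y
    unfolding a_def by (rule cINF_lower[OF bdd that])
  have up: "g y \<le> a + c" if "y \<in> space M" for y
  proof -
    have "g y - c \<le> a"
      unfolding a_def by (rule cINF_greatest) (use osc[OF that] x0 in \<open>fastforce simp: abs_le_iff\<close>)+
    then show ?thesis by simp
  qed
  interpret I: interval_bounded_random_variable M g a "a + c"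
    by unfold_locales (use lo up g in auto)
  have [measurable]: "g \<in> borel_measurable M" by fact
  show int: "integrable M (\<lambda>y. exp (l * (g y - expectation g)))"
    by (rule integrable_const_bound[of _ "exp (l * (a + c - expectation g))"])
      (use up l in \<open>auto intro!: AE_I2\<close>)
  have "ennreal (expectation (\<lambda>y. exp (l * (g y - expectation g)))) =
      (\<integral>\<^sup>+y. ennreal (exp (l * (g y - expectation g))) \<partial>M)"
    by (rule nn_integral_eq_integral[symmetric]) (use int in auto)
  also have "\<dots> \<le> ennreal (exp (l\<^sup>2 * c\<^sup>2 / 8))"
    using I.Hoeffdings_lemma_nn_integral[OF l] by simp
  finally show "expectation (\<lambda>y. exp (l * (g y - expectation g))) \<le> exp (l\<^sup>2 * c\<^sup>2 / 8)"
    by simp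
qed

text \<open>Induction over the coordinates. Integrating out the new coordinate gives a function
  \<open>h\<close> of the others that inherits the bounded differences. With the others fixed, the
  deviation from \<open>h\<close> is handled by Hoeffding's lemma at the cost of one factor exp (l^2
  c^2 / 8), and the induction hypothesis treats \<open>h\<close>.\<close>

lemma mcdiarmid_exp:
  fixes N :: "'i \<Rightarrow> 'b measure" and g :: "('i \<Rightarrow> 'b) \<Rightarrow> real"
  assumes N: "\<And>i. prob_space (N i)" and I: "finite I" and l: "l > 0"
    and g: "g \<in> borel_measurable (PiM I N)" and B: "\<And>X. X \<in> space (PiM I N) \<Longrightarrow> \<bar>g X\<bar> \<le> B"
    and osc: "\<And>X i a b. X \<in> space (PiM I N) \<Longrightarrow> i \<in> I \<Longrightarrow> a \<in> space (N i) \<Longrightarrow> b \<in> space (N i) \<Longrightarrow>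
      \<bar>g (X(i := a)) - g (X(i := b))\<bar> \<le> c"
  shows "(\<integral>X. exp (l * (g X - (\<integral>X. g X \<partial>PiM I N))) \<partial>PiM I N) \<le> exp (l\<^sup>2 * c\<^sup>2 * card I / 8)"
  using I g B osc
proof (induction I arbitrary: g rule: finite_induct)
  case empty
  interpret prob_space "PiM {} N" by (rule prob_space_PiM) (rule N)
  have "(\<integral>X. g X \<partial>PiM {} N) = g (\<lambda>_. undefined)"
    by (simp add: lebesgue_integral_count_space_finite PiM_empty)
  then show ?case
    by (simp add: PiM_empty lebesgue_integral_count_space_finite)
next
  case (insert i I)
  interpret product_sigma_finite N
    by (simp add: product_sigma_finite_def N prob_space_imp_sigma_finite)
  let ?P = "PiM (insert i I) N"
  interpret P: prob_space ?P by (rule prob_space_PiM) (rule N)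
  interpret Q: prob_space "PiM I N" by (rule prob_space_PiM) (rule N)
  interpret Ni: prob_space "N i" by (rule N)
  note g [measurable] = insert.prems(1)
  define h where "h = (\<lambda>x. \<integral>y. g (x(i := y)) \<partial>N i)"
  have upd: "x(i := y) \<in> space ?P" if "x \<in> space (PiM I N)" "y \<in> space (N i)" for x y
    using that by (auto simp: space_PiM PiE_iff extensional_def)
  have [measurable]: "(\<lambda>(x, y). g (x(i := y))) \<in> borel_measurable (PiM I N \<Otimes>\<^sub>M N i)"
    using measurable_comp[OF measurable_add_dim[of i I N] g] by (simp add: comp_def case_prod_unfold)
  have hm [measurable]: "h \<in> borel_measurable (PiM I N)"
    unfolding h_def by measurable
  have gm: "(\<lambda>y. g (x(i := y))) \<in> borel_measurable (N i)" if "x \<in> space (PiM I N)" for x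
    using measurable_comp[OF measurable_component_update[OF that insert.hyps(2)] g]
    by (simp add: comp_def)
  have gi: "integrable (N i) (\<lambda>y. g (x(i := y)))" if "x \<in> space (PiM I N)" for x
    by (rule Ni.integrable_const_bound[of _ B]) (use gm that upd insert.prems(2) in auto)
  have hB: "\<bar>h x\<bar> \<le> B" if "x \<in> space (PiM I N)" for x
  proof -
    have "\<bar>h x\<bar> \<le> (\<integral>y. \<bar>g (x(i := y))\<bar> \<partial>N i)" unfolding h_def by (rule integral_abs_bound)
    also have "\<dots> \<le> (\<integral>y. B \<partial>N i)"
      by (rule integral_mono) (use gi[OF that] that upd insert.prems(2) in auto)
    finally show ?thesis by (simp add: Ni.prob_space)
  qed
  have hosc: "\<bar>h (X(k := a)) - h (X(k := b))\<bar> \<le> c"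
    if X: "X \<in> space (PiM I N)" and k: "k \<in> I" and ab: "a \<in> space (N k)" "b \<in> space (N k)" for X k a b
  proof -
    have sp: "X(k := a) \<in> space (PiM I N)" "X(k := b) \<in> space (PiM I N)"
      using X k ab by (auto simp: space_PiM PiE_iff extensional_def)
    have ki: "k \<noteq> i" using k insert.hyps by auto
    have d: "\<bar>g (X(k := a, i := y)) - g (X(k := b, i := y))\<bar> \<le> c" if "y \<in> space (N i)" for y
      using insert.prems(3)[OF upd[OF X that] insertI2[OF k] ab]
      unfolding fun_upd_twist[OF ki] .
    have "\<bar>h (X(k := a)) - h (X(k := b))\<bar> = \<bar>\<integral>y. g (X(k := a, i := y)) - g (X(k := b, i := y)) \<partial>N i\<bar>"
      unfolding h_def using gi[OF sp(1)] gi[OF sp(2)] by simp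
    also have "\<dots> \<le> (\<integral>y. \<bar>g (X(k := a, i := y)) - g (X(k := b, i := y))\<bar> \<partial>N i)"
      by (rule integral_abs_bound)
    also have "\<dots> \<le> (\<integral>y. c \<partial>N i)"
      by (rule integral_mono) (use gi[OF sp(1)] gi[OF sp(2)] d in auto)
    finally show ?thesis by (simp add: Ni.prob_space)
  qed
  have gP: "integrable ?P g"
    by (rule P.integrable_const_bound[of _ B]) (use insert.prems(2) in auto)
  have mean: "(\<integral>X. g X \<partial>?P) = (\<integral>x. h x \<partial>PiM I N)"
    unfolding h_def by (rule product_integral_insert[OF insert.hyps gP])
  define \<mu> where "\<mu> = (\<integral>X. g X \<partial>?P)"
  have eP: "integrable ?P (\<lambda>X. exp (l * (g X - \<mu>)))"
    by (rule P.integrable_const_bound[of _ "exp (l * (B - \<mu>))"])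
      (use insert.prems(2) l in \<open>auto intro!: AE_I2 simp: abs_le_iff\<close>)
  have eQ: "integrable (PiM I N) (\<lambda>x. exp (l * (h x - \<mu>)))"
    by (rule Q.integrable_const_bound[of _ "exp (l * (B - \<mu>))"])
      (use hB l in \<open>auto intro!: AE_I2 simp: abs_le_iff\<close>)
  have inner: "(\<integral>y. exp (l * (g (x(i := y)) - \<mu>)) \<partial>N i) \<le> exp (l * (h x - \<mu>)) * exp (l\<^sup>2 * c\<^sup>2 / 8)"
    if x: "x \<in> space (PiM I N)" for x
  proof -
    have "(\<integral>y. exp (l * (g (x(i := y)) - \<mu>)) \<partial>N i) =
        (\<integral>y. exp (l * (h x - \<mu>)) * exp (l * (g (x(i := y)) - h x)) \<partial>N i)"
      by (simp add: algebra_simps flip: exp_add)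
    also have "\<dots> = exp (l * (h x - \<mu>)) * (\<integral>y. exp (l * (g (x(i := y)) - h x)) \<partial>N i)"
      by simp
    also have "\<dots> \<le> exp (l * (h x - \<mu>)) * exp (l\<^sup>2 * c\<^sup>2 / 8)"
    proof (rule mult_left_mono)
      have "\<bar>g (x(i := a)) - g (x(i := b))\<bar> \<le> c" if "a \<in> space (N i)" "b \<in> space (N i)" for a b
        using insert.prems(3)[OF upd[OF x that(1)] insertI1 that] by (simp only: fun_upd_upd)
      then show "(\<integral>y. exp (l * (g (x(i := y)) - h x)) \<partial>N i) \<le> exp (l\<^sup>2 * c\<^sup>2 / 8)"
        using Ni.Hoeffdings_lemma_oscillation(2)[OF gm[OF x] l] unfolding h_def by blast
    qed simp
    finally show ?thesis .
  qed
  have "(\<integral>X. exp (l * (g X - \<mu>)) \<partial>?P) = (\<integral>x. (\<integral>y. exp (l * (g (x(i := y)) - \<mu>)) \<partial>N i) \<partial>PiM I N)"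
    by (rule product_integral_insert[OF insert.hyps eP])
  also have "\<dots> \<le> (\<integral>x. exp (l * (h x - \<mu>)) * exp (l\<^sup>2 * c\<^sup>2 / 8) \<partial>PiM I N)"
  proof (rule integral_mono')
    show "integrable (PiM I N) (\<lambda>x. exp (l * (h x - \<mu>)) * exp (l\<^sup>2 * c\<^sup>2 / 8))" using eQ by simp
  qed (use inner in auto)
  also have "\<dots> = (\<integral>x. exp (l * (h x - \<mu>)) \<partial>PiM I N) * exp (l\<^sup>2 * c\<^sup>2 / 8)" by simp
  also have "\<dots> \<le> exp (l\<^sup>2 * c\<^sup>2 * card I / 8) * exp (l\<^sup>2 * c\<^sup>2 / 8)"
    unfolding \<mu>_def mean
    by (rule mult_right_mono) (use insert.IH[OF hm hB hosc] in auto)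
  also have "\<dots> = exp (l\<^sup>2 * c\<^sup>2 * card (insert i I) / 8)"
    using insert.hyps by (simp add: field_simps flip: exp_add)
  finally show ?case unfolding \<mu>_def .
qed

text \<open>The exponential bound is used for g and for - g at the single scale
  \<open>l = 1 / (c * sqrt k)\<close>, where the exponent is exactly 1/8. Since exp (1/8) <= 8/7,
  the constants are 2 * 16/7 < 5 and 24 * 16/7 < 55.\<close>

lemma mcdiarmid_moments:
  fixes N :: "'i \<Rightarrow> 'b measure" and g :: "('i \<Rightarrow> 'b) \<Rightarrow> real"
  assumes N: "\<And>i. prob_space (N i)" and I: "finite I" "I \<noteq> {}" and c: "c > 0"
    and g: "g \<in> borel_measurable (PiM I N)" and B: "\<And>X. X \<in> space (PiM I N) \<Longrightarrow> \<bar>g X\<bar> \<le> B"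
    and osc: "\<And>X i a b. X \<in> space (PiM I N) \<Longrightarrow> i \<in> I \<Longrightarrow> a \<in> space (N i) \<Longrightarrow> b \<in> space (N i) \<Longrightarrow>
      \<bar>g (X(i := a)) - g (X(i := b))\<bar> \<le> c"
  shows "(\<integral>X. (g X - (\<integral>X. g X \<partial>PiM I N))\<^sup>2 \<partial>PiM I N) \<le> 5 * c\<^sup>2 * card I"
    and "(\<integral>X. (g X - (\<integral>X. g X \<partial>PiM I N)) ^ 4 \<partial>PiM I N) \<le> 55 * c ^ 4 * (card I)\<^sup>2"
proof -
  interpret P: prob_space "PiM I N" by (rule prob_space_PiM) (rule N)
  note [measurable] = g
  define Y where "Y X = g X - (\<integral>X. g X \<partial>PiM I N)" for X
  have [measurable]: "Y \<in> borel_measurable (PiM I N)" unfolding Y_def by measurable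
  have YB: "\<bar>Y X\<bar> \<le> B + \<bar>\<integral>X. g X \<partial>PiM I N\<bar>" if "X \<in> space (PiM I N)" for X
    using B[OF that] unfolding Y_def by linarith
  define C where "C = B + \<bar>\<integral>X. g X \<partial>PiM I N\<bar>"
  define k where "k = real (card I)"
  have k: "k > 0" using I by (auto simp: k_def card_gt_0_iff)
  define l where "l = 1 / (c * sqrt k)"
  have l: "l > 0" using c k by (simp add: l_def)
  have lk: "l\<^sup>2 * c\<^sup>2 * k / 8 = 1 / 8"
    using c k by (simp add: l_def power_divide power_mult_distrib)
  have e: "exp (1 / 8 :: real) \<le> 8 / 7"
  proof -
    have "1 + - (1 / 8) \<le> exp (- (1 / 8 :: real))" by (rule exp_ge_add_one_self)
    then have "7 / 8 * exp (1 / 8 :: real) \<le> exp (- (1 / 8)) * exp (1 / 8)"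
      by (intro mult_right_mono) auto
    then show ?thesis by (simp flip: exp_add)
  qed
  have lY: "l * Y X \<le> l * C" "- (l * Y X) \<le> l * C" if "X \<in> space (PiM I N)" for X
    using mult_left_mono[of "Y X" C l] mult_left_mono[of "- Y X" C l] YB[OF that] l
    by (simp_all add: C_def abs_le_iff)
  have i1: "integrable (PiM I N) (\<lambda>X. exp (l * Y X))"
    by (rule P.integrable_const_bound[of _ "exp (l * C)"]) (use lY in auto)
  have i2: "integrable (PiM I N) (\<lambda>X. exp (- (l * Y X)))"
    by (rule P.integrable_const_bound[of _ "exp (l * C)"]) (use lY in auto)
  have e1: "(\<integral>X. exp (l * Y X) \<partial>PiM I N) \<le> 8 / 7"
    using mcdiarmid_exp[OF N I(1) l g B osc] lk e unfolding Y_def k_def by simp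
  have "(\<integral>X. exp (l * (- g X - (\<integral>X. - g X \<partial>PiM I N))) \<partial>PiM I N) \<le> exp (l\<^sup>2 * c\<^sup>2 * card I / 8)"
    by (rule mcdiarmid_exp[OF N I(1) l]) (use B osc in \<open>auto simp: abs_minus_commute\<close>)
  then have e2: "(\<integral>X. exp (- (l * Y X)) \<partial>PiM I N) \<le> 8 / 7"
    using lk e unfolding Y_def k_def by (simp add: algebra_simps)
  have "(\<integral>X. (l * Y X)\<^sup>2 \<partial>PiM I N) \<le> (\<integral>X. 2 * (exp (l * Y X) + exp (- (l * Y X))) \<partial>PiM I N)"
    by (rule integral_mono') (use i1 i2 exp_quarter_bounds in auto)
  also have "\<dots> = 2 * ((\<integral>X. exp (l * Y X) \<partial>PiM I N) + (\<integral>X. exp (- (l * Y X)) \<partial>PiM I N))"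
    using i1 i2 by simp
  also have "\<dots> \<le> 5" using e1 e2 by simp
  finally have "l\<^sup>2 * (\<integral>X. (Y X)\<^sup>2 \<partial>PiM I N) \<le> 5" by (simp add: power_mult_distrib)
  moreover have "l\<^sup>2 = 1 / (c\<^sup>2 * k)" using k by (simp add: l_def power_divide power_mult_distrib)
  ultimately show "(\<integral>X. (g X - (\<integral>X. g X \<partial>PiM I N))\<^sup>2 \<partial>PiM I N) \<le> 5 * c\<^sup>2 * card I"
    using c k unfolding Y_def by (simp add: k_def field_simps)
  have "(\<integral>X. (l * Y X) ^ 4 \<partial>PiM I N) \<le> (\<integral>X. 24 * (exp (l * Y X) + exp (- (l * Y X))) \<partial>PiM I N)"
    by (rule integral_mono') (use i1 i2 exp_quarter_bounds in auto)
  also have "\<dots> = 24 * ((\<integral>X. exp (l * Y X) \<partial>PiM I N) + (\<integral>X. exp (- (l * Y X)) \<partial>PiM I N))"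
    using i1 i2 by simp
  also have "\<dots> \<le> 55" using e1 e2 by simp
  finally have "l ^ 4 * (\<integral>X. (Y X) ^ 4 \<partial>PiM I N) \<le> 55" by (simp add: power_mult_distrib)
  moreover have "l ^ 4 = 1 / (c ^ 4 * k\<^sup>2)"
  proof -
    have "sqrt k ^ 4 = (sqrt k ^ 2) ^ 2" using power_mult[of "sqrt k" 2 2] by simp
    then have "sqrt k ^ 4 = k\<^sup>2" using k by simp
    then show ?thesis by (simp add: l_def power_divide power_mult_distrib)
  qed
  moreover define D where "D = c ^ 4 * k\<^sup>2"
  moreover have D: "D > 0" using c k by (simp add: D_def)
  ultimately have le: "l ^ 4 * (\<integral>X. (Y X) ^ 4 \<partial>PiM I N) \<le> 55" and one: "l ^ 4 * D = 1"
    using c k by simp_all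
  have "(\<integral>X. (Y X) ^ 4 \<partial>PiM I N) = (l ^ 4 * D) * (\<integral>X. (Y X) ^ 4 \<partial>PiM I N)"
    unfolding one by simp
  also have "\<dots> = (l ^ 4 * (\<integral>X. (Y X) ^ 4 \<partial>PiM I N)) * D"
    by (simp only: mult_ac)
  also have "\<dots> \<le> 55 * D"
    using le D by (intro mult_right_mono) auto
  finally have "(\<integral>X. (Y X) ^ 4 \<partial>PiM I N) \<le> 55 * (c ^ 4 * k\<^sup>2)"
    unfolding D_def .
  then show "(\<integral>X. (g X - (\<integral>X. g X \<partial>PiM I N)) ^ 4 \<partial>PiM I N) \<le> 55 * c ^ 4 * (card I)\<^sup>2"
    unfolding Y_def by (simp add: k_def mult.assoc)
qed

section \<open>Quadratic forms in independent variables\<close>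

lemma (in prob_space) indep_var_integrable_prod:
  fixes X Y :: "'a \<Rightarrow> real"
  assumes "indep_var borel X borel Y" "integrable M X" "integrable M Y"
  shows "integrable M (\<lambda>w. X w * Y w)" "expectation (\<lambda>w. X w * Y w) = expectation X * expectation Y"
  using indep_var_integrable[OF assms] indep_var_lebesgue_integral[OF assms] by simp_all

lemma (in prob_space) square_integrable_imp_integrable_prod:
  fixes X Y :: "'a \<Rightarrow> real"
  assumes [measurable]: "X \<in> borel_measurable M" "Y \<in> borel_measurable M"
    and "integrable M (\<lambda>w. (X w)\<^sup>2)" "integrable M (\<lambda>w. (Y w)\<^sup>2)"
  shows "integrable M (\<lambda>w. X w * Y w)"
proof (rule Bochner_Integration.integrable_bound)
  show "integrable M (\<lambda>w. (X w)\<^sup>2 + (Y w)\<^sup>2)" using assms by simp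
  have "\<bar>a * b\<bar> \<le> a\<^sup>2 + b\<^sup>2" for a b :: real
  proof -
    have "0 \<le> (\<bar>a\<bar> - \<bar>b\<bar>)\<^sup>2" by simp
    then have "2 * \<bar>a * b\<bar> \<le> a\<^sup>2 + b\<^sup>2" by (simp add: power2_eq_square algebra_simps abs_mult)
    moreover have "0 \<le> a\<^sup>2 + b\<^sup>2" by simp
    ultimately show ?thesis by linarith
  qed
  then show "AE w in M. norm (X w * Y w) \<le> norm ((X w)\<^sup>2 + (Y w)\<^sup>2)" by simp
qed simp

lemma (in prob_space) square_integrable_imp_integrable_real:
  fixes X :: "'a \<Rightarrow> real"
  assumes "X \<in> borel_measurable M" "integrable M (\<lambda>w. (X w)\<^sup>2)"
  shows "integrable M X"
  using square_integrable_imp_integrable_prod[of X "\<lambda>_. 1"] assms by simp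

locale indep_standardized = prob_space M for M :: "'a measure" +
  fixes z :: "'i \<Rightarrow> 'a \<Rightarrow> real" and S :: "'i set" and \<sigma> :: real
  assumes indep: "indep_vars (\<lambda>_. borel) z S"
    and i4: "\<And>u. u \<in> S \<Longrightarrow> integrable M (\<lambda>w. (z u w) ^ 4)"
    and m1: "\<And>u. u \<in> S \<Longrightarrow> expectation (z u) = 0"
    and m2: "\<And>u. u \<in> S \<Longrightarrow> expectation (\<lambda>w. (z u w)\<^sup>2) = 1"
    and m4: "\<And>u. u \<in> S \<Longrightarrow> expectation (\<lambda>w. (z u w) ^ 4) \<le> \<sigma>"
begin

lemma meas [measurable]: "u \<in> S \<Longrightarrow> z u \<in> borel_measurable M"
  using indep by (auto simp: indep_vars_def)

lemma i2: "u \<in> S \<Longrightarrow> integrable M (\<lambda>w. (z u w)\<^sup>2)"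
proof (rule square_integrable_imp_integrable_real)
  assume [measurable]: "u \<in> S"
  show "integrable M (\<lambda>w. ((z u w)\<^sup>2)\<^sup>2)" using i4[OF \<open>u \<in> S\<close>] by (simp flip: power_mult)
  show "(\<lambda>w. (z u w)\<^sup>2) \<in> borel_measurable M" by measurable
qed

lemma i1: "u \<in> S \<Longrightarrow> integrable M (z u)"
  by (rule square_integrable_imp_integrable_real) (auto intro: i2)

definition lin :: "('i \<Rightarrow> real) \<Rightarrow> 'i set \<Rightarrow> 'a \<Rightarrow> real" where
  "lin b T w = (\<Sum>v\<in>T. b v * z v w)"

text \<open>The quadratic form with its trace subtracted. The trace is its mean, because the
  variables are uncorrelated with unit variance. \<open>B\<close> need not be symmetric.\<close>

definition quad :: "('i \<Rightarrow> 'i \<Rightarrow> real) \<Rightarrow> 'i set \<Rightarrow> 'a \<Rightarrow> real" where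
  "quad B T w = (\<Sum>u\<in>T. \<Sum>v\<in>T. B u v * (z u w * z v w - (if u = v then 1 else 0)))"

lemma lin_meas: "T \<subseteq> S \<Longrightarrow> lin b T \<in> borel_measurable M"
  unfolding lin_def[abs_def] by (intro borel_measurable_sum borel_measurable_times) auto

lemma quad_meas: "T \<subseteq> S \<Longrightarrow> quad B T \<in> borel_measurable M"
  unfolding quad_def[abs_def]
  by (intro borel_measurable_sum borel_measurable_times borel_measurable_diff borel_measurable_const)
    auto

lemma indep_one_rest:
  assumes "T \<subseteq> S" "u \<in> S" "u \<notin> T" "h \<in> borel_measurable borel"
    and "k \<in> borel_measurable (PiM T (\<lambda>_. borel :: real measure))"
  shows "indep_var borel (\<lambda>w. h (z u w)) borel (\<lambda>w. k (\<lambda>i\<in>T. z i w))"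
proof -
  have h: "(\<lambda>f. h (f u)) \<in> borel_measurable (PiM {u} (\<lambda>_. borel :: real measure))"
    by (rule measurable_compose[OF measurable_component_singleton[of u "{u}" "\<lambda>_. borel"] assms(4)]) simp
  have "indep_var borel ((\<lambda>f. h (f u)) \<circ> (\<lambda>w. \<lambda>i\<in>{u}. z i w)) borel (k \<circ> (\<lambda>w. \<lambda>i\<in>T. z i w))"
    by (rule indep_var_compose[OF indep_var_restrict[OF indep] h assms(5)]) (use assms in auto)
  then show ?thesis by (simp add: comp_def)
qed

lemma lin_restrict: "lin b T w = (\<lambda>f. \<Sum>v\<in>T. b v * f v) (\<lambda>i\<in>T. z i w)"
  by (simp add: lin_def)

lemma quad_restrict:
  "quad B T w = (\<lambda>f. \<Sum>u\<in>T. \<Sum>v\<in>T. B u v * (f u * f v - (if u = v then 1 else 0))) (\<lambda>i\<in>T. z i w)"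
  by (simp add: quad_def)

lemma indep_lin_pow:
  assumes "T \<subseteq> S" "u \<in> S" "u \<notin> T" "h \<in> borel_measurable borel"
  shows "indep_var borel (\<lambda>w. h (z u w)) borel (\<lambda>w. (lin b T w) ^ k * (quad B T w) ^ l)"
  unfolding lin_restrict quad_restrict
  by (rule indep_one_rest[OF assms,
        of "\<lambda>f. (\<Sum>v\<in>T. b v * f v) ^ k * (\<Sum>u\<in>T. \<Sum>v\<in>T. B u v * (f u * f v - (if u = v then 1 else 0))) ^ l"])
    measurable

lemma sum_insert_square:
  fixes F :: "'i \<Rightarrow> 'i \<Rightarrow> real"
  assumes "finite T" "u \<notin> T"
  shows "(\<Sum>s\<in>insert u T. \<Sum>v\<in>insert u T. F s v) =
    (\<Sum>s\<in>T. \<Sum>v\<in>T. F s v) + (F u u + (\<Sum>v\<in>T. F u v) + (\<Sum>v\<in>T. F v u))"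
  using assms by (simp add: sum.distrib algebra_simps)

lemma lin_moments:
  assumes "finite T" "T \<subseteq> S"
  shows "integrable M (\<lambda>w. (lin b T w)\<^sup>2) \<and> expectation (lin b T) = 0 \<and>
    expectation (\<lambda>w. (lin b T w)\<^sup>2) = (\<Sum>v\<in>T. (b v)\<^sup>2)"
  using assms
proof (induction T rule: finite_induct)
  case empty
  then show ?case by (simp add: lin_def)
next
  case (insert u T)
  then have T: "T \<subseteq> S" "u \<in> S" by auto
  note IH = insert.IH[OF T(1)]
  have int: "integrable M (lin b T)"
    by (rule square_integrable_imp_integrable_real) (use IH lin_meas T in auto)
  have ind: "indep_var borel (\<lambda>w. z u w) borel (\<lambda>w. lin b T w)"
    using indep_lin_pow[OF T insert.hyps(2), of "\<lambda>x. x" b 1 "\<lambda>_ _. 0" 0] by simp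
  note c = indep_var_integrable_prod[OF ind i1[OF T(2)] int]
  have e: "lin b (insert u T) = (\<lambda>w. b u * z u w + lin b T w)"
    using insert.hyps by (simp add: lin_def fun_eq_iff)
  have sq: "(lin b (insert u T) w)\<^sup>2 = (b u)\<^sup>2 * (z u w)\<^sup>2 + 2 * b u * (z u w * lin b T w) + (lin b T w)\<^sup>2" for w
    by (simp add: e power2_eq_square algebra_simps)
  show ?case
    unfolding sq unfolding e
    using int IH c i1[OF T(2)] i2[OF T(2)] insert.hyps m1[OF T(2)] m2[OF T(2)] by simp
qed

text \<open>A new index u adds B_uu (z_u^2 - 1) and z_u times a linear form with coefficients B_uv +
  B_vu. All cross terms have mean zero by independence, so the variances add. The square term costs
  at most \<sigma>, the linear form at most twice the squares of its coefficients, and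
  \<open>\<sigma> + 2\<close> dominates both.\<close>

lemma quad_moments:
  assumes "finite T" "T \<subseteq> S"
  shows "integrable M (\<lambda>w. (quad B T w)\<^sup>2) \<and> expectation (quad B T) = 0 \<and>
    expectation (\<lambda>w. (quad B T w)\<^sup>2) \<le> (\<sigma> + 2) * (\<Sum>u\<in>T. \<Sum>v\<in>T. (B u v)\<^sup>2)"
  using assms
proof (induction T rule: finite_induct)
  case empty
  then show ?case by (simp add: quad_def)
next
  case (insert u T)
  then have T: "T \<subseteq> S" "u \<in> S" by auto
  note IH = insert.IH[OF T(1)]
  define b where "b v = B u v + B v u" for v
  define d where "d w = (z u w)\<^sup>2 - 1" for w
  define l where "l = lin b T"
  define q where "q = quad B T"
  note lm = lin_moments[OF insert.hyps(1) T(1), of b, folded l_def]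
  have zm [measurable]: "z u \<in> borel_measurable M" using T meas by blast
  have [measurable]: "l \<in> borel_measurable M" "q \<in> borel_measurable M"
    using T lin_meas quad_meas by (auto simp: l_def q_def)
  have deq: "d = (\<lambda>w. (z u w)\<^sup>2 - 1)" by (simp add: d_def fun_eq_iff)
  have [measurable]: "d \<in> borel_measurable M" unfolding deq by measurable
  have li: "integrable M l"
    by (rule square_integrable_imp_integrable_real) (use lm in auto)
  have qi: "integrable M q" "integrable M (\<lambda>w. (q w)\<^sup>2)"
    using IH by (auto simp: q_def[symmetric] intro: square_integrable_imp_integrable_real)
  have qli: "integrable M (\<lambda>w. l w * q w)"
    by (rule square_integrable_imp_integrable_prod) (use lm qi in auto)
  have di: "integrable M d" "expectation d = 0"
    unfolding deq using i2[OF T(2)] m2[OF T(2)] by (simp_all add: prob_space)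
  have sq: "(\<lambda>w. (d w)\<^sup>2) = (\<lambda>w. (z u w) ^ 4 - 2 * (z u w)\<^sup>2 + 1)"
    by (simp add: d_def power2_eq_square power4_eq_xxxx algebra_simps fun_eq_iff)
  have d2: "integrable M (\<lambda>w. (d w)\<^sup>2)" "expectation (\<lambda>w. (d w)\<^sup>2) \<le> \<sigma>"
    unfolding sq using i4[OF T(2)] i2[OF T(2)] m4[OF T(2)] m2[OF T(2)] by (simp_all add: prob_space)
  have z2: "integrable M (\<lambda>w. (z u w)\<^sup>2)" "expectation (\<lambda>w. (z u w)\<^sup>2) = 1" using i2 m2 T by auto
  have zd: "integrable M (\<lambda>w. z u w * d w)"
    by (rule square_integrable_imp_integrable_prod) (use z2 d2 in auto)
  have P: "integrable M (\<lambda>w. h (z u w) * (l w ^ k * q w ^ j)) \<and>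
      expectation (\<lambda>w. h (z u w) * (l w ^ k * q w ^ j)) =
      expectation (\<lambda>w. h (z u w)) * expectation (\<lambda>w. l w ^ k * q w ^ j)"
    if "h \<in> borel_measurable borel" "integrable M (\<lambda>w. h (z u w))" "integrable M (\<lambda>w. l w ^ k * q w ^ j)"
    for h k j
    using indep_var_integrable_prod[OF _ that(2,3)]
      indep_lin_pow[OF T insert.hyps(2) that(1), of b k B j] unfolding l_def q_def by blast

  have p1: "integrable M (\<lambda>w. (z u w)\<^sup>2 * (l w)\<^sup>2)" "expectation (\<lambda>w. (z u w)\<^sup>2 * (l w)\<^sup>2) = expectation (\<lambda>w. (l w)\<^sup>2)"
    using P[of "\<lambda>x. x\<^sup>2" 2 0] z2 lm by simp_all
  have p2: "integrable M (\<lambda>w. z u w * (l w * q w))" "expectation (\<lambda>w. z u w * (l w * q w)) = 0"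
    using P[of "\<lambda>x. x" 1 1] i1[OF T(2)] qli m1[OF T(2)] by simp_all
  have p3: "integrable M (\<lambda>w. d w * q w)" "expectation (\<lambda>w. d w * q w) = 0"
    using P[of "\<lambda>x. x\<^sup>2 - 1" 0 1] di qi unfolding deq by simp_all
  \<comment> \<open>Here the linear form provides the zero mean; the third moment of
    \<open>z u\<close>, which is hidden in the other factor, is arbitrary.\<close>
  have p4: "integrable M (\<lambda>w. (z u w * d w) * l w)" "expectation (\<lambda>w. (z u w * d w) * l w) = 0"
    using P[of "\<lambda>x. x * (x\<^sup>2 - 1)" 1 0] zd li lm by (simp_all add: d_def)
  have p5: "integrable M (\<lambda>w. z u w * l w)" "expectation (\<lambda>w. z u w * l w) = 0"
    using P[of "\<lambda>x. x" 1 0] i1[OF T(2)] li m1[OF T(2)] by simp_all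
  have e: "quad B (insert u T) w = q w + (B u u * d w + z u w * l w)" for w
  proof -
    have "(\<Sum>v\<in>T. B u v * (z u w * z v w - (if u = v then 1 else 0))) = (\<Sum>v\<in>T. B u v * (z u w * z v w))"
      "(\<Sum>v\<in>T. B v u * (z v w * z u w - (if v = u then 1 else 0))) = (\<Sum>v\<in>T. B v u * (z v w * z u w))"
      using insert.hyps by (auto intro!: sum.cong)
    moreover have "z u w * l w = (\<Sum>v\<in>T. B u v * (z u w * z v w)) + (\<Sum>v\<in>T. B v u * (z v w * z u w))"
      unfolding l_def lin_def b_def sum_distrib_left sum.distrib[symmetric]
      by (intro sum.cong refl) (simp add: algebra_simps)
    ultimately show ?thesis
      unfolding quad_def sum_insert_square[OF insert.hyps] q_def
      by (simp add: d_def power2_eq_square)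
  qed
  have s: "(quad B (insert u T) w)\<^sup>2 = (q w)\<^sup>2 + ((B u u)\<^sup>2 * (d w)\<^sup>2 + ((z u w)\<^sup>2 * (l w)\<^sup>2 +
      (2 * B u u * (d w * q w) + (2 * (z u w * (l w * q w)) + 2 * B u u * (z u w * d w * l w)))))" for w
    unfolding e by (simp add: power2_eq_square algebra_simps)
  have I: "integrable M (\<lambda>w. (quad B (insert u T) w)\<^sup>2)"
    unfolding s using qi d2 p1 p2 p3 p4 by (intro Bochner_Integration.integrable_add integrable_mult_right) auto
  have E0: "expectation (quad B (insert u T)) = 0"
    using qi di p5 IH unfolding e[abs_def] q_def[symmetric] by simp
  have "expectation (\<lambda>w. (quad B (insert u T) w)\<^sup>2) =
      expectation (\<lambda>w. (q w)\<^sup>2) + ((B u u)\<^sup>2 * expectation (\<lambda>w. (d w)\<^sup>2) + expectation (\<lambda>w. (l w)\<^sup>2))"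
    unfolding s using qi d2 p1 p2 p3 p4 by simp
  also have "\<dots> \<le> (\<sigma> + 2) * (\<Sum>u\<in>T. \<Sum>v\<in>T. (B u v)\<^sup>2) + ((B u u)\<^sup>2 * \<sigma> + (\<Sum>v\<in>T. 2 * (B u v)\<^sup>2 + 2 * (B v u)\<^sup>2))"
  proof (intro add_mono mult_left_mono)
    have sq_le: "(x + y)\<^sup>2 \<le> 2 * x\<^sup>2 + 2 * y\<^sup>2" for x y :: real
      using zero_le_power2[of "x - y"] by (simp add: power2_eq_square algebra_simps)
    have "expectation (\<lambda>w. (l w)\<^sup>2) = (\<Sum>v\<in>T. (B u v + B v u)\<^sup>2)" using lm by (simp add: b_def)
    also have "\<dots> \<le> (\<Sum>v\<in>T. 2 * (B u v)\<^sup>2 + 2 * (B v u)\<^sup>2)" by (intro sum_mono sq_le)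
    finally show "expectation (\<lambda>w. (l w)\<^sup>2) \<le> (\<Sum>v\<in>T. 2 * (B u v)\<^sup>2 + 2 * (B v u)\<^sup>2)" .
  qed (use IH d2 in \<open>auto simp: q_def\<close>)
  also have "\<dots> \<le> (\<sigma> + 2) * (\<Sum>u\<in>T. \<Sum>v\<in>T. (B u v)\<^sup>2) + ((B u u)\<^sup>2 * (\<sigma> + 2) +
      (\<Sum>v\<in>T. (\<sigma> + 2) * (B u v)\<^sup>2 + (\<sigma> + 2) * (B v u)\<^sup>2))"
  proof -
    have "0 \<le> expectation (\<lambda>w. (d w)\<^sup>2)" by simp
    then have \<sigma>: "0 \<le> \<sigma>" using d2(2) by linarith
    have le: "2 * x\<^sup>2 \<le> (\<sigma> + 2) * x\<^sup>2" for x :: real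
      using \<sigma> by (intro mult_right_mono) auto
    show ?thesis
    proof (rule add_left_mono, rule add_mono)
      show "(B u u)\<^sup>2 * \<sigma> \<le> (B u u)\<^sup>2 * (\<sigma> + 2)" by (rule mult_left_mono) auto
    qed (rule sum_mono, rule add_mono; rule le)
  qed
  also have "\<dots> = (\<sigma> + 2) * (\<Sum>s\<in>insert u T. \<Sum>v\<in>insert u T. (B s v)\<^sup>2)"
    unfolding sum_insert_square[OF insert.hyps] sum.distrib sum_distrib_left[symmetric]
    by (simp only: distrib_left mult_ac add_ac)
  finally show ?case using I E0 by blast
qed

end

section \<open>Stieltjes transforms\<close>

lemma cmod_real_minus_ge:
  assumes "Im z > 0"
  shows "Im z \<le> cmod (complex_of_real l - z)" "complex_of_real l - z \<noteq> 0"
proof -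
  show *: "Im z \<le> cmod (complex_of_real l - z)"
    using abs_Im_le_cmod[of "complex_of_real l - z"] assms by simp
  show "complex_of_real l - z \<noteq> 0" using assms * by auto
qed

lemma cmod_resolvent_kernel_le: "Im z > 0 \<Longrightarrow> cmod (1 / (complex_of_real l - z)) \<le> 1 / Im z"
  using cmod_real_minus_ge[of z l] by (simp add: norm_divide frac_le)

lemma resolvent_kernel_measurable [measurable]:
  "(\<lambda>l. 1 / (complex_of_real l - z)) \<in> borel_measurable borel"
  by measurable

context real_distribution
begin

lemma prob_UNIV [simp]: "measure M UNIV = 1"
  using prob_space space_eq_univ by simp

lemma integrable_resolvent_kernel: "Im z > 0 \<Longrightarrow> integrable M (\<lambda>l. 1 / (complex_of_real l - z))"
  by (rule integrable_const_bound[of _ "1 / Im z"]) (auto simp: cmod_resolvent_kernel_le)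

lemma cmod_stieltjes_le: "Im z > 0 \<Longrightarrow> cmod (stieltjes M z) \<le> 1 / Im z"
proof -
  assume z: "Im z > 0"
  have "cmod (stieltjes M z) \<le> (\<integral>l. cmod (1 / (complex_of_real l - z)) \<partial>M)"
    unfolding stieltjes_def by (rule integral_norm_bound)
  also have "\<dots> \<le> (\<integral>l. 1 / Im z \<partial>M)"
    by (rule integral_mono) (use integrable_resolvent_kernel[OF z] cmod_resolvent_kernel_le[OF z] in auto)
  finally show ?thesis by (simp add: prob_space)
qed

lemma Im_resolvent_kernel:
  "Im z > 0 \<Longrightarrow> Im (1 / (complex_of_real l - z)) = Im z / (cmod (complex_of_real l - z))\<^sup>2"
  by (simp add: Im_divide cmod_power2)

lemma Im_stieltjes: "Im z > 0 \<Longrightarrow> Im (stieltjes M z) = (\<integral>l. Im z / (cmod (complex_of_real l - z))\<^sup>2 \<partial>M)"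
  unfolding stieltjes_def
  using integral_Im[OF integrable_resolvent_kernel, symmetric] by (simp add: Im_resolvent_kernel)

lemma integrable_Im_kernel: "Im z > 0 \<Longrightarrow> integrable M (\<lambda>l. Im z / (cmod (complex_of_real l - z))\<^sup>2)"
  using integrable_Im[OF integrable_resolvent_kernel] by (simp add: Im_resolvent_kernel)

lemma Im_stieltjes_pos:
  assumes z: "Im z > 0" shows "Im (stieltjes M z) > 0"
proof -
  have "(\<integral>l. 0 \<partial>M) < (\<integral>l. Im z / (cmod (complex_of_real l - z))\<^sup>2 \<partial>M)"
    by (rule integral_less_AE_space)
      (use z integrable_Im_kernel[OF z] cmod_real_minus_ge[OF z] emeasure_space_1 in \<open>auto simp: space_eq_univ\<close>)
  then show ?thesis using Im_stieltjes[OF z] by simp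
qed

lemma stieltjes_diff_le:
  assumes z: "Im z > 0" and w: "Im w > 0"
  shows "cmod (stieltjes M z - stieltjes M w) \<le> cmod (z - w) / (Im z * Im w)"
proof -
  have eq: "1 / (complex_of_real l - z) - 1 / (complex_of_real l - w) =
      (z - w) * ((1 / (complex_of_real l - z)) * (1 / (complex_of_real l - w)))" for l
    using cmod_real_minus_ge(2)[OF z, of l] cmod_real_minus_ge(2)[OF w, of l] by (simp add: field_simps)
  have le: "cmod (1 / (complex_of_real l - z) - 1 / (complex_of_real l - w)) \<le> cmod (z - w) / (Im z * Im w)" for l
  proof -
    have "cmod ((1 / (complex_of_real l - z)) * (1 / (complex_of_real l - w))) \<le> (1 / Im z) * (1 / Im w)"
      unfolding norm_mult using z w by (intro mult_mono cmod_resolvent_kernel_le) auto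
    then show ?thesis unfolding eq norm_mult[of "z - w"]
      using mult_left_mono[of _ _ "cmod (z - w)"] by fastforce
  qed
  have "cmod (stieltjes M z - stieltjes M w) =
      cmod (\<integral>l. 1 / (complex_of_real l - z) - 1 / (complex_of_real l - w) \<partial>M)"
    unfolding stieltjes_def using integrable_resolvent_kernel[OF z] integrable_resolvent_kernel[OF w] by simp
  also have "\<dots> \<le> (\<integral>l. cmod (1 / (complex_of_real l - z) - 1 / (complex_of_real l - w)) \<partial>M)"
    by (rule integral_norm_bound)
  also have "\<dots> \<le> (\<integral>l. cmod (z - w) / (Im z * Im w) \<partial>M)"
    by (rule integral_mono)
      (use integrable_resolvent_kernel[OF z] integrable_resolvent_kernel[OF w] le in auto)
  finally show ?thesis by (simp add: prob_space)
qed

lemma continuous_on_stieltjes: "continuous_on upper_half_plane (stieltjes M)"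
  unfolding continuous_on_iff
proof (intro ballI allI impI)
  fix z e assume z: "z \<in> upper_half_plane" and e: "0 < (e :: real)"
  then have z': "Im z > 0" by (simp add: upper_half_plane_def)
  have "((\<lambda>w. cmod (w - z) / (Im w * Im z)) \<longlongrightarrow> cmod (z - z) / (Im z * Im z)) (at z within upper_half_plane)"
    by (intro tendsto_intros) (use z' in auto)
  then have "\<forall>\<^sub>F w in at z within upper_half_plane. cmod (w - z) / (Im w * Im z) < e"
    using e by (intro order_tendstoD) auto
  then obtain d where d: "d > 0" "\<And>w. w \<in> upper_half_plane \<Longrightarrow> w \<noteq> z \<Longrightarrow> dist w z < d \<Longrightarrow>
      cmod (w - z) / (Im w * Im z) < e"
    unfolding eventually_at by auto
  show "\<exists>d>0. \<forall>w\<in>upper_half_plane. dist w z < d \<longrightarrow> dist (stieltjes M w) (stieltjes M z) < e"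
  proof (intro exI[of _ d] conjI ballI impI d(1))
    fix w assume w: "w \<in> upper_half_plane" "dist w z < d"
    show "dist (stieltjes M w) (stieltjes M z) < e"
    proof (cases "w = z")
      case False
      then have "cmod (w - z) / (Im w * Im z) < e" using d(2) w by blast
      moreover have "Im w > 0" using w by (simp add: upper_half_plane_def)
      ultimately show ?thesis using stieltjes_diff_le[of w z] z' by (simp add: dist_norm)
    qed (use e in simp)
  qed
qed

text \<open>Integrating the imaginary part along a horizontal line yields a
  difference of arctangents, which tends to \<open>pi\<close> times the indicator of the interval.\<close>

lemma integral_Im_stieltjes:
  assumes ab: "a \<le> b" and e: "e > 0"
  shows "(LBINT x:{a..b}. Im (stieltjes M (Complex x e))) =
    (\<integral>l. arctan ((b - l) / e) - arctan ((a - l) / e) \<partial>M)"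
proof -
  interpret P: pair_sigma_finite lborel M by unfold_locales
  define k where "k x l = indicator {a..b} x * (e / ((l - x)\<^sup>2 + e\<^sup>2))" for x l :: real
  have km [measurable]: "case_prod k \<in> borel_measurable (lborel \<Otimes>\<^sub>M M)"
    unfolding k_def[abs_def] by measurable
  have k0: "0 \<le> k x l" for x l using e by (simp add: k_def)
  have pos: "0 < (l - x)\<^sup>2 + e\<^sup>2" for l x using e by (simp add: add_nonneg_pos)
  have D: "((\<lambda>x. arctan ((x - l) / e)) has_real_derivative (e / ((l - x)\<^sup>2 + e\<^sup>2))) (at x)" for l x
  proof -
    have "((\<lambda>x. arctan ((x - l) / e)) has_real_derivative (1 / e) * inverse (1 + ((x - l) / e)\<^sup>2)) (at x)"
      using e by (auto intro!: derivative_eq_intros)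
    moreover have "(1 / e) * inverse (1 + ((x - l) / e)\<^sup>2) = e / ((l - x)\<^sup>2 + e\<^sup>2)"
      using e pos[of l x] by (simp add: field_simps power2_eq_square add_nonneg_eq_0_iff)
    ultimately show ?thesis by simp
  qed
  have FTC: "has_bochner_integral lborel (\<lambda>x. k x l) (arctan ((b - l) / e) - arctan ((a - l) / e))" for l
  proof -
    have "has_bochner_integral lborel (\<lambda>x. (e / ((l - x)\<^sup>2 + e\<^sup>2)) * indicator {a..b} x)
        (arctan ((b - l) / e) - arctan ((a - l) / e))"
      by (rule has_bochner_integral_FTC_Icc_real[OF ab D])
        (intro continuous_intros, use pos in \<open>auto simp: less_le\<close>)
    then show ?thesis by (simp add: k_def mult.commute)
  qed
  have int: "integrable (lborel \<Otimes>\<^sub>M M) (case_prod k)"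
  proof (rule integrableI_bounded)
    have "(\<integral>\<^sup>+x. ennreal (norm (case_prod k x)) \<partial>(lborel \<Otimes>\<^sub>M M)) =
        (\<integral>\<^sup>+x. ennreal (case_prod k x) \<partial>(lborel \<Otimes>\<^sub>M M))"
      using k0 by (intro nn_integral_cong) auto
    also have "\<dots> = (\<integral>\<^sup>+x. (\<integral>\<^sup>+l. ennreal (k x l) \<partial>M) \<partial>lborel)"
      by (subst nn_integral_fst[symmetric]) auto
    also have "\<dots> \<le> (\<integral>\<^sup>+x. ennreal (1 / e) * indicator {a..b} x \<partial>lborel)"
    proof (rule nn_integral_mono)
      fix x
      have "k x l \<le> 1 / e * indicator {a..b} x" for l
      proof -
        have "e / ((l - x)\<^sup>2 + e\<^sup>2) \<le> 1 / e"
          using e pos[of l x] by (simp add: pos_divide_le_eq pos_le_divide_eq power2_eq_square)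
        then show ?thesis by (auto simp: k_def split: split_indicator)
      qed
      then have "(\<integral>\<^sup>+l. ennreal (k x l) \<partial>M) \<le> (\<integral>\<^sup>+l. ennreal (1 / e * indicator {a..b} x) \<partial>M)"
        by (intro nn_integral_mono ennreal_leI)
      then show "(\<integral>\<^sup>+l. ennreal (k x l) \<partial>M) \<le> ennreal (1 / e) * indicator {a..b} x"
        using emeasure_space_1 e by (auto split: split_indicator)
    qed
    also have "\<dots> = ennreal (1 / e) * emeasure lborel {a..b}" by (rule nn_integral_cmult_indicator) simp
    also have "\<dots> < \<infinity>" using ab by (simp add: ennreal_mult_less_top)
    finally show "(\<integral>\<^sup>+x. ennreal (norm (case_prod k x)) \<partial>(lborel \<Otimes>\<^sub>M M)) < \<infinity>" .
  qed simp
  have "(LBINT x:{a..b}. Im (stieltjes M (Complex x e))) = (\<integral>x. (\<integral>l. k x l \<partial>M) \<partial>lborel)"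
    unfolding set_lebesgue_integral_def
  proof (rule Bochner_Integration.integral_cong[OF refl])
    fix x
    have "(cmod (complex_of_real l - Complex x e))\<^sup>2 = (l - x)\<^sup>2 + e\<^sup>2" for l
      by (simp add: cmod_power2)
    then show "indicat_real {a..b} x *\<^sub>R Im (stieltjes M (Complex x e)) = (\<integral>l. k x l \<partial>M)"
      using e by (cases "x \<in> {a..b}") (simp_all add: Im_stieltjes k_def)
  qed
  also have "\<dots> = (\<integral>l. (\<integral>x. k x l \<partial>lborel) \<partial>M)"
    using P.Fubini_integral[OF int] by simp
  also have "\<dots> = (\<integral>l. arctan ((b - l) / e) - arctan ((a - l) / e) \<partial>M)"
    by (simp add: has_bochner_integral_integral_eq[OF FTC])
  finally show ?thesis .
qed

lemma arctan_scaled_limit: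
  "(\<lambda>n. arctan (u / (1 / real (Suc n)))) \<longlonglongrightarrow> pi / 2 * sgn u"
proof -
  have inf: "filterlim (\<lambda>n. real (Suc n)) at_top sequentially"
    by (rule filterlim_compose[OF filterlim_real_sequentially filterlim_Suc])
  consider "u = 0" | "u > 0" | "u < 0" by linarith
  then show ?thesis
  proof cases
    case 2
    have "filterlim (\<lambda>n. u * real (Suc n)) at_top sequentially"
      by (rule filterlim_tendsto_pos_mult_at_top[OF tendsto_const 2 inf])
    from filterlim_compose[OF tendsto_arctan_at_top this] show ?thesis using 2 by (simp add: mult.commute)
  next
    case 3
    have "filterlim (\<lambda>n. u * real (Suc n)) at_bot sequentially"
      by (rule filterlim_tendsto_neg_mult_at_bot[OF tendsto_const 3 inf])
    from filterlim_compose[OF tendsto_arctan_at_bot this] show ?thesis using 3 by (simp add: mult.commute)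
  qed simp
qed

text \<open>Dominated convergence in the arctangent formula. An atom at an endpoint would be counted
  with weight one half, which is why the endpoints must carry no mass.\<close>

lemma stieltjes_inversion:
  assumes ab: "a < b" and null: "measure M {a} = 0" "measure M {b} = 0"
  shows "(\<lambda>n. (LBINT x:{a..b}. Im (stieltjes M (Complex x (1 / real (Suc n)))))) \<longlonglongrightarrow> pi * measure M {a<..b}"
proof -
  have "(\<lambda>n. (\<integral>l. arctan ((b - l) / (1 / real (Suc n))) - arctan ((a - l) / (1 / real (Suc n))) \<partial>M))
      \<longlonglongrightarrow> (\<integral>l. pi / 2 * sgn (b - l) - pi / 2 * sgn (a - l) \<partial>M)"
  proof (rule integral_dominated_convergence[where w = "\<lambda>_. pi"])
    show "AE l in M. (\<lambda>n. arctan ((b - l) / (1 / real (Suc n))) - arctan ((a - l) / (1 / real (Suc n))))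
        \<longlonglongrightarrow> pi / 2 * sgn (b - l) - pi / 2 * sgn (a - l)"
      by (intro AE_I2 tendsto_diff arctan_scaled_limit)
    show "AE l in M. norm (arctan ((b - l) / (1 / real (Suc n))) - arctan ((a - l) / (1 / real (Suc n)))) \<le> pi" for n
    proof (rule AE_I2)
      fix l
      have "\<bar>arctan x - arctan y\<bar> \<le> pi" for x y
        using arctan_bounded[of x] arctan_bounded[of y] by linarith
      then show "norm (arctan ((b - l) / (1 / real (Suc n))) - arctan ((a - l) / (1 / real (Suc n)))) \<le> pi"
        by simp
    qed
  qed auto
  moreover have "(\<integral>l. pi / 2 * sgn (b - l) - pi / 2 * sgn (a - l) \<partial>M) = (\<integral>l. pi * indicator {a<..b} l \<partial>M)"
  proof (rule integral_cong_AE)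
    have "AE l in M. l \<noteq> a" "AE l in M. l \<noteq> b"
      using null by (auto intro!: AE_I[where N = "{_}"] simp: emeasure_eq_measure space_eq_univ)
    then show "AE l in M. pi / 2 * sgn (b - l) - pi / 2 * sgn (a - l) = pi * indicator {a<..b} l"
      by eventually_elim (use ab in \<open>auto simp: sgn_if split: split_indicator\<close>)
  qed auto
  moreover have "(\<integral>l. pi * indicator {a<..b} l \<partial>M) = pi * measure M {a<..b}" by simp
  ultimately show ?thesis using ab by (simp add: integral_Im_stieltjes)
qed

end


lemma countable_atoms_sum:
  assumes "real_distribution \<mu>"
  shows "countable {x. measure \<mu> {x} \<noteq> 0}"
proof -
  interpret real_distribution \<mu> by fact
  show ?thesis using countable_support by simp
qed

text \<open>Inversion determines the mass of every interval whose endpoints avoid the countable set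
  of atoms. Letting the left endpoint run to minus infinity and then the right endpoint decrease to
  \<open>x\<close>, always outside the atoms, recovers the distribution function.\<close>

lemma stieltjes_eq_imp_eq:
  assumes \<mu>: "real_distribution \<mu>" and \<nu>: "real_distribution \<nu>"
    and eq: "\<And>z. Im z > 0 \<Longrightarrow> stieltjes \<mu> z = stieltjes \<nu> z"
  shows "\<mu> = \<nu>"
proof -
  interpret m: real_distribution \<mu> by fact
  interpret n: real_distribution \<nu> by fact
  define E where "E = {x. measure \<mu> {x} \<noteq> 0} \<union> {x. measure \<nu> {x} \<noteq> 0}"
  have E: "countable E" using countable_atoms_sum \<mu> \<nu> by (simp add: E_def)
  have Ioc: "measure \<mu> {a<..b} = measure \<nu> {a<..b}" if "a < b" "a \<notin> E" "b \<notin> E" for a b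
  proof -
    have "(LBINT x:{a..b}. Im (stieltjes \<mu> (Complex x (1 / real (Suc n))))) =
        (LBINT x:{a..b}. Im (stieltjes \<nu> (Complex x (1 / real (Suc n)))))" for n
      using eq by simp
    moreover have null: "measure \<mu> {a} = 0" "measure \<mu> {b} = 0" "measure \<nu> {a} = 0" "measure \<nu> {b} = 0"
      using that by (auto simp: E_def)
    ultimately have "pi * measure \<mu> {a<..b} = pi * measure \<nu> {a<..b}"
      using LIMSEQ_unique[OF m.stieltjes_inversion[OF that(1) null(1,2)]]
        n.stieltjes_inversion[OF that(1) null(3,4)] by presburger
    then show ?thesis by simp
  qed
  have ex: "\<exists>x. x \<notin> E \<and> a < x \<and> x < b" if "a < b" for a b :: real
  proof -
    have "\<not> {a<..<b} \<subseteq> E"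
      using countable_subset[OF _ E] uncountable_open_interval[of a b] that by blast
    then show ?thesis by auto
  qed
  have cdf_eq: "cdf \<mu> b = cdf \<nu> b" if b: "b \<notin> E" for b
  proof -
    have "\<forall>n. \<exists>x. x \<notin> E \<and> b - real n - 2 < x \<and> x < b - real n - 1"
      using ex[of "b - real _ - 2" "b - real _ - 1"] by (intro allI ex) simp
    then obtain a where a: "\<And>n. a n \<notin> E" "\<And>n. b - real n - 2 < a n" "\<And>n. a n < b - real n - 1"
      by metis
    have lim: "filterlim a at_bot sequentially"
      unfolding filterlim_uminus_at_bot
    proof (rule filterlim_at_top_mono)
      show "filterlim (\<lambda>n. (1 - b) + real n) at_top sequentially"
        by (rule filterlim_tendsto_add_at_top[OF tendsto_const filterlim_real_sequentially])
      have "1 - b + real n \<le> - a n" for n using a(3)[of n] by simp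
      then show "eventually (\<lambda>n. (1 - b) + real n \<le> - a n) sequentially" by simp
    qed
    have eqn: "cdf \<mu> b - cdf \<mu> (a n) = cdf \<nu> b - cdf \<nu> (a n)" for n
    proof -
      have lt: "a n < b" using a(3)[of n] by simp
      show ?thesis
        using m.cdf_diff_eq[OF lt] n.cdf_diff_eq[OF lt] Ioc[OF lt a(1) b] by simp
    qed
    have "(\<lambda>n. cdf \<mu> b - cdf \<mu> (a n)) \<longlonglongrightarrow> cdf \<mu> b - 0"
      by (intro tendsto_diff tendsto_const filterlim_compose[OF m.cdf_lim_at_bot lim])
    moreover have "(\<lambda>n. cdf \<nu> b - cdf \<nu> (a n)) \<longlonglongrightarrow> cdf \<nu> b - 0"
      by (intro tendsto_diff tendsto_const filterlim_compose[OF n.cdf_lim_at_bot lim])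
    ultimately show ?thesis unfolding eqn using LIMSEQ_unique by fastforce
  qed
  have "cdf \<mu> x = cdf \<nu> x" for x
  proof -
    have "\<forall>n. \<exists>b. b \<notin> E \<and> x < b \<and> b < x + 1 / real (Suc n)" by (intro allI ex) simp
    then obtain b where b: "\<And>n. b n \<notin> E" "\<And>n. x < b n" "\<And>n. b n < x + 1 / real (Suc n)" by metis
    have "b \<longlonglongrightarrow> x"
    proof (rule tendsto_sandwich[of "\<lambda>_. x" b _ "\<lambda>n. x + 1 / real (Suc n)"])
      show "(\<lambda>n. x + 1 / real (Suc n)) \<longlonglongrightarrow> x"
        using tendsto_add[OF tendsto_const[of x] LIMSEQ_Suc[OF lim_1_over_n]] by simp
      show "\<forall>\<^sub>F n in sequentially. x \<le> b n" "\<forall>\<^sub>F n in sequentially. b n \<le> x + 1 / real (Suc n)"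
        by (intro always_eventually allI less_imp_le b)+
    qed simp
    then have fl: "filterlim b (at_right x) sequentially"
      using b(2) by (auto simp: filterlim_at intro!: always_eventually)
    have "(\<lambda>n. cdf \<mu> (b n)) \<longlonglongrightarrow> cdf \<mu> x"
      using m.cdf_is_right_cont[of x] filterlim_compose[OF _ fl] by (auto simp: continuous_within)
    moreover have "(\<lambda>n. cdf \<nu> (b n)) \<longlonglongrightarrow> cdf \<nu> x"
      using n.cdf_is_right_cont[of x] filterlim_compose[OF _ fl] by (auto simp: continuous_within)
    ultimately show ?thesis unfolding cdf_eq[OF b(1)] by (rule LIMSEQ_unique)
  qed
  then show ?thesis by (intro cdf_unique \<mu> \<nu> ext)
qed

section \<open>Weak convergence and compact support read off from Stieltjes transforms\<close>

lemma weak_conv_imp_stieltjes: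
  assumes "\<And>n. real_distribution (\<mu> n)" "real_distribution F" "weak_conv_m \<mu> F" "Im z > 0"
  shows "(\<lambda>n. stieltjes (\<mu> n) z) \<longlonglongrightarrow> stieltjes F z"
  unfolding stieltjes_def
  by (rule weak_conv_imp_integral_bdd_continuous_conv[OF assms(1-3), of _ "1 / Im z"])
    (use assms(4) cmod_resolvent_kernel_le cmod_real_minus_ge in \<open>auto intro!: continuous_intros\<close>)

text \<open>On the imaginary axis 1 - k Im m(i k) is the integral of l^2 / (l^2 + k^2), which is at
  least 1/2 where |l| >= k. Twice this quantity therefore bounds the tail outside (-k, k], and the
  hypothesis on \<open>m\<close> says that no mass escapes in the limit.\<close>

lemma tight_of_stieltjes:
  assumes rd: "\<And>n. real_distribution (\<mu> n)"
    and conv: "\<And>k. (\<lambda>n. stieltjes (\<mu> n) (Complex 0 (real (Suc k)))) \<longlonglongrightarrow> m k"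
    and lim: "(\<lambda>k. real (Suc k) * Im (m k)) \<longlonglongrightarrow> 1"
  shows "tight \<mu>"
  unfolding tight_def
proof (intro conjI allI impI rd)
  fix \<epsilon> :: real assume \<epsilon>: "\<epsilon> > 0"
  have key: "measure (\<mu> n) (UNIV - {- real k<..real k}) \<le> 2 * (1 - real k * Im (stieltjes (\<mu> n) (Complex 0 (real k))))"
    if "k > 0" for n k
  proof -
    interpret real_distribution "\<mu> n" by (rule rd)
    let ?A = "UNIV - {- real k<..real k}"
    have k: "real k > 0" using that by simp
    have sq: "(cmod (complex_of_real l - Complex 0 (real k)))\<^sup>2 = l\<^sup>2 + (real k)\<^sup>2" for l
      by (simp add: cmod_power2)
    define g where "g l = real k / (l\<^sup>2 + (real k)\<^sup>2)" for l
    have I0: "integrable (\<mu> n) g"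
      using integrable_Im_kernel[of "Complex 0 (real k)"] k unfolding sq g_def[abs_def] by simp
    have I: "integrable (\<mu> n) (\<lambda>l. 1 - real k * g l)"
      using I0 by simp
    have "measure (\<mu> n) ?A = (\<integral>l. indicator ?A l \<partial>\<mu> n)" by simp
    also have "\<dots> \<le> (\<integral>l. 2 * (1 - real k * g l) \<partial>\<mu> n)"
    proof (rule integral_mono)
      fix l
      have pos: "0 < l\<^sup>2 + (real k)\<^sup>2" using k by (simp add: add_nonneg_pos)
      have e: "1 - real k * g l = l\<^sup>2 / (l\<^sup>2 + (real k)\<^sup>2)"
      proof -
        have "1 - real k * (real k / D) = (D - (real k)\<^sup>2) / D" if "D > 0" for D
          using that by (simp add: diff_divide_distrib power2_eq_square)
        from this[OF pos] show ?thesis by (simp add: g_def)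
      qed
      show "indicator ?A l \<le> 2 * (1 - real k * g l)"
      proof (cases "l \<in> ?A")
        case True
        then have "real k \<le> \<bar>l\<bar>" by auto
        then have "(real k)\<^sup>2 \<le> l\<^sup>2" using power_mono[of "real k" "\<bar>l\<bar>" 2] by simp
        then have "1 \<le> 2 * (l\<^sup>2 / (l\<^sup>2 + (real k)\<^sup>2))" using pos by (simp add: pos_le_divide_eq)
        then show ?thesis unfolding e using True by simp
      next
        case False
        then show ?thesis unfolding e using pos by simp
      qed
    next
      show "integrable (\<mu> n) (\<lambda>l. 2 * (1 - real k * g l))" by (rule integrable_mult_right[OF I])
    qed (simp add: integrable_real_indicator emeasure_eq_measure)
    also have "\<dots> = 2 * (1 - real k * (\<integral>l. g l \<partial>\<mu> n))"
      using I0 by simp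
    finally show ?thesis using Im_stieltjes[of "Complex 0 (real k)"] k by (simp add: sq g_def)
  qed
  have "\<forall>\<^sub>F k in sequentially. 1 - \<epsilon> / 4 < real (Suc k) * Im (m k)"
    using order_tendstoD(1)[OF lim] \<epsilon> by simp
  then obtain k where k: "1 - \<epsilon> / 4 < real (Suc k) * Im (m k)"
    by (auto simp: eventually_sequentially)
  have "(\<lambda>n. real (Suc k) * Im (stieltjes (\<mu> n) (Complex 0 (real (Suc k))))) \<longlonglongrightarrow> real (Suc k) * Im (m k)"
    by (intro tendsto_intros conv)
  from order_tendstoD(1)[OF this k]
  obtain N where N: "\<And>n. n \<ge> N \<Longrightarrow> 1 - \<epsilon> / 4 < real (Suc k) * Im (stieltjes (\<mu> n) (Complex 0 (real (Suc k))))"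
    unfolding eventually_sequentially by blast
  have one: "\<exists>K. \<forall>x\<ge>K. measure (\<mu> n) (UNIV - {-real x<..real x}) < \<epsilon>" for n
  proof -
    interpret real_distribution "\<mu> n" by (rule rd)
    have lim: "(\<lambda>x. measure (\<mu> n) (UNIV - {-real x<..real x})) \<longlonglongrightarrow> measure (\<mu> n) (\<Inter>x::nat. UNIV - {-real x<..real x})"
      by (rule finite_Lim_measure_decseq) (auto simp: decseq_def)
    have eq: "(\<Inter>x::nat. UNIV - {-real x<..real x}) = ({} :: real set)"
    proof -
      have "\<exists>x::nat. -real x < l \<and> l \<le> real x" for l
        using reals_Archimedean2[of "\<bar>l\<bar>"] by (metis abs_less_iff less_imp_le minus_less_iff)
      then show ?thesis by auto
    qed
    have "(\<lambda>x. measure (\<mu> n) (UNIV - {-real x<..real x})) \<longlonglongrightarrow> 0" using lim unfolding eq by simp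
    from order_tendstoD(2)[OF this \<epsilon>] show ?thesis unfolding eventually_sequentially .
  qed
  then obtain K where K: "\<And>n x. x \<ge> K n \<Longrightarrow> measure (\<mu> n) (UNIV - {-real x<..real x}) < \<epsilon>" by metis
  \<comment> \<open>From \<open>N\<close> on the tails are controlled uniformly; the finitely many
    earlier measures are tight one at a time.\<close>
  define L where "L = Suc k + Max (K ` {..N})"
  have L: "measure (\<mu> n) (UNIV - {-real L<..real L}) < \<epsilon>" for n
  proof (cases "n \<le> N")
    case True
    then have "K n \<le> L" unfolding L_def by (intro trans_le_add2 Max_ge) auto
    then show ?thesis by (rule K)
  next
    case False
    interpret real_distribution "\<mu> n" by (rule rd)
    have "measure (\<mu> n) (UNIV - {-real L<..real L}) \<le> measure (\<mu> n) (UNIV - {-real (Suc k)<..real (Suc k)})"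
      by (rule finite_measure_mono) (auto simp: L_def)
    also have "\<dots> \<le> 2 * (1 - real (Suc k) * Im (stieltjes (\<mu> n) (Complex 0 (real (Suc k)))))"
      by (rule key) simp
    also have "\<dots> < \<epsilon>" using N[of n] False \<epsilon> by simp
    finally show ?thesis .
  qed
  show "\<exists>a b. a < b \<and> (\<forall>n. 1 - \<epsilon> < measure (\<mu> n) {a<..b})"
  proof (intro exI conjI allI)
    show "- real L < real L" by (simp add: L_def)
    fix n
    interpret real_distribution "\<mu> n" by (rule rd)
    show "1 - \<epsilon> < measure (\<mu> n) {- real L<..real L}"
      using L[of n] prob_compl[of "{- real L<..real L}"] by (simp add: space_eq_univ)
  qed
qed

lemma dense_stieltjes_eq:
  assumes \<mu>: "real_distribution \<mu>" and \<nu>: "real_distribution \<nu>"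
    and Q: "upper_half_plane \<subseteq> closure (Q \<inter> upper_half_plane)"
    and eq: "\<And>z. z \<in> Q \<Longrightarrow> Im z > 0 \<Longrightarrow> stieltjes \<mu> z = stieltjes \<nu> z"
  shows "\<mu> = \<nu>"
proof (rule stieltjes_eq_imp_eq[OF \<mu> \<nu>])
  interpret m: real_distribution \<mu> by fact
  interpret n: real_distribution \<nu> by fact
  fix z :: complex assume z: "Im z > 0"
  then have "z \<in> closure (Q \<inter> upper_half_plane)" using Q by (auto simp: upper_half_plane_def)
  then obtain s where s: "\<And>n. s n \<in> Q \<inter> upper_half_plane" "s \<longlonglongrightarrow> z"
    unfolding closure_sequential by blast
  have zu: "z \<in> upper_half_plane" using z by (simp add: upper_half_plane_def)
  have "(\<lambda>n. stieltjes \<mu> (s n)) \<longlonglongrightarrow> stieltjes \<mu> z"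
    by (rule continuous_on_tendsto_compose[OF m.continuous_on_stieltjes s(2) zu]) (use s in auto)
  moreover have "(\<lambda>n. stieltjes \<nu> (s n)) \<longlonglongrightarrow> stieltjes \<nu> z"
    by (rule continuous_on_tendsto_compose[OF n.continuous_on_stieltjes s(2) zu]) (use s in auto)
  moreover have "stieltjes \<mu> (s n) = stieltjes \<nu> (s n)" for n
    using s(1)[of n] eq by (auto simp: upper_half_plane_def)
  ultimately show "stieltjes \<mu> z = stieltjes \<nu> z" using LIMSEQ_unique by simp
qed

text \<open>Tightness gives convergent subsequences, and their limits agree because their transforms
  agree on a dense set. Convergence is asked only on \<open>Q\<close>, so that a countable
  \<open>Q\<close> leaves a single exceptional null set when the measures are random.\<close>

lemma stieltjes_continuity:
  assumes rd: "\<And>n. real_distribution (\<mu> n)"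
    and Q: "upper_half_plane \<subseteq> closure (Q \<inter> upper_half_plane)"
    and conv: "\<And>z. z \<in> Q \<Longrightarrow> Im z > 0 \<Longrightarrow> (\<lambda>n. stieltjes (\<mu> n) z) \<longlonglongrightarrow> m z"
    and convI: "\<And>k. (\<lambda>n. stieltjes (\<mu> n) (Complex 0 (real (Suc k)))) \<longlonglongrightarrow> m (Complex 0 (real (Suc k)))"
    and lim: "(\<lambda>k. real (Suc k) * Im (m (Complex 0 (real (Suc k))))) \<longlonglongrightarrow> 1"
  obtains F where "real_distribution F" "weak_conv_m \<mu> F"
    "\<And>z. z \<in> Q \<Longrightarrow> Im z > 0 \<Longrightarrow> stieltjes F z = m z"
proof -
  have tight: "tight \<mu>" by (rule tight_of_stieltjes[OF rd convI lim])
  have st: "stieltjes \<nu> z = m z"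
    if "strict_mono s" "real_distribution \<nu>" "weak_conv_m (\<mu> \<circ> s) \<nu>" "z \<in> Q" "Im z > 0" for s \<nu> z
  proof -
    have "(\<lambda>n. stieltjes ((\<mu> \<circ> s) n) z) \<longlonglongrightarrow> stieltjes \<nu> z"
      by (rule weak_conv_imp_stieltjes[OF _ that(2,3,5)]) (simp add: rd)
    moreover have "(\<lambda>n. stieltjes ((\<mu> \<circ> s) n) z) \<longlonglongrightarrow> m z"
      using LIMSEQ_subseq_LIMSEQ[OF conv[OF that(4,5)] that(1)] by (simp add: comp_def)
    ultimately show ?thesis by (rule LIMSEQ_unique)
  qed
  obtain r F where F: "strict_mono (r :: nat \<Rightarrow> nat)" "real_distribution F" "weak_conv_m (\<mu> \<circ> id \<circ> r) F"
    using tight_imp_convergent_subsubsequence[OF tight strict_mono_id] by blast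
  have F': "weak_conv_m (\<mu> \<circ> r) F" using F(3) by simp
  have "weak_conv_m \<mu> F"
  proof (rule tight_subseq_weak_converge[OF rd F(2) tight])
    fix s \<nu> assume s: "strict_mono s" "real_distribution \<nu>" "weak_conv_m (\<mu> \<circ> s) \<nu>"
    have "\<nu> = F"
      by (rule dense_stieltjes_eq[OF s(2) F(2) Q]) (use st[OF s] st[OF F(1,2) F'] in auto)
    then show "weak_conv_m (\<mu> \<circ> s) F" using s(3) by simp
  qed
  then show ?thesis using that F(2) st[OF F(1,2) F'] by blast
qed

text \<open>The Poisson kernel at height e is at least 1 / (2 e) on the interval of radius e, so
  that interval has mass at most 2 C e^2. This is quadratic in e, while covering a fixed interval
  takes only O(1 / e) such pieces; hence intervals beyond \<open>K\<close> are null.\<close>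

lemma bounded_support_of_stieltjes:
  assumes F: "real_distribution F" and K: "K > 0" and C: "C \<ge> 0"
    and bd: "\<And>x e. \<bar>x\<bar> \<ge> K \<Longrightarrow> 0 < e \<Longrightarrow> Im (stieltjes F (Complex x e)) \<le> C * e"
  shows "bounded (measure_support F)"
proof -
  interpret real_distribution F by fact
  have loc: "measure F {x - e<..<x + e} \<le> 2 * C * e\<^sup>2" if x: "\<bar>x\<bar> \<ge> K" and e: "e > 0" for x e
  proof -
    have sq: "(cmod (complex_of_real l - Complex x e))\<^sup>2 = (l - x)\<^sup>2 + e\<^sup>2" for l
      by (simp add: cmod_power2)
    have I: "integrable F (\<lambda>l. e / ((l - x)\<^sup>2 + e\<^sup>2))"
      using integrable_Im_kernel[of "Complex x e"] e unfolding sq by simp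
    have "measure F {x - e<..<x + e} / (2 * e) = (\<integral>l. indicator {x - e<..<x + e} l / (2 * e) \<partial>F)" by simp
    also have "\<dots> \<le> (\<integral>l. e / ((l - x)\<^sup>2 + e\<^sup>2) \<partial>F)"
    proof (rule integral_mono)
      fix l
      have pos: "0 < (l - x)\<^sup>2 + e\<^sup>2" using e by (simp add: add_nonneg_pos)
      show "indicator {x - e<..<x + e} l / (2 * e) \<le> e / ((l - x)\<^sup>2 + e\<^sup>2)"
      proof (cases "l \<in> {x - e<..<x + e}")
        case True
        then have "\<bar>l - x\<bar> \<le> \<bar>e\<bar>" by auto
        then have "(l - x)\<^sup>2 \<le> e\<^sup>2" by (simp only: abs_le_square_iff)
        then show ?thesis using True e pos
          by (simp add: pos_divide_le_eq pos_le_divide_eq power2_eq_square divide_le_eq le_divide_eq)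
      qed (use e pos in simp)
    qed (use I in \<open>auto intro!: integrable_real_indicator simp: emeasure_eq_measure\<close>)
    also have "\<dots> \<le> C * e"
      using bd[OF x e] Im_stieltjes[of "Complex x e"] e by (simp add: sq)
    finally show ?thesis using e by (simp add: pos_divide_le_eq power2_eq_square mult_ac)
  qed
  have sub: "measure F {x - d<..<x + d} = 0" if x: "\<bar>x\<bar> \<ge> K + d" and d: "d > 0" for x d
  proof -
    have le: "measure F {x - d<..<x + d} \<le> 8 * C * d\<^sup>2 / real (Suc n)" for n
    proof -
      define e where "e = d / real (Suc n)"
      have e: "e > 0" using d by (simp add: e_def)
      \<comment> \<open>Centres at distance \<open>e = d / (n + 1)\<close> from each other across a
        length of \<open>2 * d\<close>, hence the indices up to \<open>2 * n + 2\<close>.\<close>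
      define y where "y i = x - d + e * real i" for i :: nat
      have cover: "{x - d<..<x + d} \<subseteq> (\<Union>i\<in>{..2 * n + 2}. {y i - e<..<y i + e})"
      proof
        fix l assume l: "l \<in> {x - d<..<x + d}"
        define i where "i = nat \<lfloor>(l - (x - d)) / e\<rfloor>"
        have nn: "0 \<le> (l - (x - d)) / e" using l e by simp
        have i1: "real i \<le> (l - (x - d)) / e" "(l - (x - d)) / e < real i + 1"
          using nn by (simp_all add: i_def)
        have "e * real i \<le> l - (x - d)" "l - (x - d) < e * (real i + 1)"
          using i1 e by (simp_all add: pos_le_divide_eq pos_divide_less_eq mult.commute)
        moreover have "i \<le> 2 * n + 2"
        proof -
          have "(l - (x - d)) / e \<le> 2 * d / e" using l e by (intro divide_right_mono) auto
          also have "2 * d / e = real (2 * n + 2)" using d by (simp add: e_def field_simps)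
          finally show ?thesis using i1(1) by linarith
        qed
        ultimately show "l \<in> (\<Union>i\<in>{..2 * n + 2}. {y i - e<..<y i + e})"
          using e by (intro UN_I[of i]) (auto simp: y_def algebra_simps)
      qed
      have yK: "\<bar>y i\<bar> \<ge> K" if "i \<le> 2 * n + 2" for i
      proof -
        have "e * real i \<le> e * real (2 * n + 2)" using that e by (intro mult_left_mono) auto
        also have "e * real (2 * n + 2) = 2 * d" using d by (simp add: e_def field_simps)
        finally have "\<bar>y i - x\<bar> \<le> d" using e by (auto simp: y_def abs_le_iff)
        then show ?thesis using x by linarith
      qed
      have "measure F {x - d<..<x + d} \<le> measure F (\<Union>i\<in>{..2 * n + 2}. {y i - e<..<y i + e})"
        by (rule finite_measure_mono[OF cover]) auto
      also have "\<dots> \<le> (\<Sum>i\<in>{..2 * n + 2}. measure F {y i - e<..<y i + e})"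
        by (rule finite_measure_subadditive_finite) auto
      also have "\<dots> \<le> (\<Sum>i\<in>{..2 * n + 2}. 2 * C * e\<^sup>2)"
        by (intro sum_mono loc yK e) auto
      also have "\<dots> = real (2 * n + 3) * (2 * C * e\<^sup>2)" by simp
      also have "\<dots> \<le> (4 * real (Suc n)) * (2 * C * e\<^sup>2)"
        using C by (intro mult_right_mono) auto
      finally have *: "measure F {x - d<..<x + d} \<le> (4 * real (Suc n)) * (2 * C * e\<^sup>2)" .
      have "(4 * k) * (2 * C * (d / k)\<^sup>2) = 8 * C * d\<^sup>2 / k" if "k > 0" for k
        using that by (simp add: power2_eq_square field_simps)
      from this[of "real (Suc n)"] * show ?thesis unfolding e_def by (simp del: of_nat_Suc)
    qed
    have "(\<lambda>n. 8 * C * d\<^sup>2 / real (Suc n)) \<longlonglongrightarrow> 0"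
      using LIMSEQ_Suc[OF lim_const_over_n[of "8 * C * d\<^sup>2"]] .
    then have "measure F {x - d<..<x + d} \<le> 0"
      by (rule LIMSEQ_le_const) (use le in auto)
    then show ?thesis by (simp add: measure_le_0_iff)
  qed
  have "measure_support F \<subseteq> {- (K + 1)..K + 1}"
  proof
    fix x assume x: "x \<in> measure_support F"
    show "x \<in> {- (K + 1)..K + 1}"
    proof (rule ccontr)
      assume "x \<notin> {- (K + 1)..K + 1}"
      then have "measure F {x - 1<..<x + 1} = 0" by (intro sub) auto
      moreover have "emeasure F {x - 1<..<x + 1} > 0"
        using x unfolding measure_support_def by auto
      ultimately show False by (simp add: emeasure_eq_measure)
    qed
  qed
  then show ?thesis using bounded_subset bounded_closed_interval by blast
qed

section \<open>Change of variables along level sets\<close>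

lemma borel_measurable_indicator_comp:
  fixes f h :: "real \<Rightarrow> real"
  assumes S: "S \<in> sets borel" "S \<subseteq> {a..b}" and cont: "continuous_on {a..b} f"
    and h: "h \<in> borel_measurable borel"
  shows "(\<lambda>x. indicator S x * h (f x)) \<in> borel_measurable borel"
proof -
  note [measurable] = S(1) h
  have fm [measurable]: "(\<lambda>x. indicator {a..b} x *\<^sub>R f x) \<in> borel_measurable borel"
    by (rule borel_measurable_continuous_on_indicator) (use cont in auto)
  have eq: "indicator S x * h (f x) = indicator S x * h (indicator {a..b} x *\<^sub>R f x)" for x
    using S(2) by (auto split: split_indicator)
  show ?thesis unfolding eq by measurable
qed

lemma integrable_indicator_comp:
  fixes f h :: "real \<Rightarrow> real"
  assumes S: "S \<in> sets borel" "S \<subseteq> {a..b}" and cont: "continuous_on {a..b} f"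
    and h: "h \<in> borel_measurable borel" and B: "\<And>l. \<bar>h l\<bar> \<le> B"
  shows "integrable lborel (\<lambda>x. indicator S x * h (f x))"
proof (rule Bochner_Integration.integrable_bound)
  have "B \<ge> 0" using B[of 0] by linarith
  then have "norm (indicator S x * h (f x)) \<le> norm (B * indicator {a..b} x)" for x
    using B[of "f x"] S(2) by (auto split: split_indicator)
  then show "AE x in lborel. norm (indicator S x * h (f x)) \<le> norm (B * indicator {a..b} x)" by simp
  show "integrable lborel (\<lambda>x. B * indicator {a..b} x)"
    by (intro integrable_mult_right integrable_real_indicator) (auto simp: emeasure_lborel_Icc_eq)
qed (use borel_measurable_indicator_comp[OF S cont h] in simp)

text \<open>On a piece where f is injective the integrand on the image is h divided by |f'| at the
  unique preimage, chosen so that multiplication by the Jacobian returns h o f.\<close>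

lemma change_of_variables_piece:
  fixes f f' h :: "real \<Rightarrow> real"
  assumes S: "S \<in> sets borel" "S \<subseteq> {a..b}" and cont: "continuous_on {a..b} f"
    and der: "\<And>x. x \<in> S \<Longrightarrow> (f has_real_derivative f' x) (at x within S)"
    and inj: "inj_on f S" and nz: "\<And>x. x \<in> S \<Longrightarrow> f' x \<noteq> 0"
    and h: "h \<in> borel_measurable borel" and B: "\<And>l. \<bar>h l\<bar> \<le> B"
  shows "integrable lebesgue (\<lambda>l. indicator (f ` S) l * (h l / \<bar>f' (inv_into S f l)\<bar>))"
    and "(\<integral>l. indicator (f ` S) l * (h l / \<bar>f' (inv_into S f l)\<bar>) \<partial>lebesgue) =
      (\<integral>x. indicator S x * h (f x) \<partial>lborel)"
    and "integrable lborel (\<lambda>x. indicator S x * h (f x))"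
proof -
  have meas: "(\<lambda>x. indicator S x * h (f x)) \<in> borel_measurable borel"
    by (rule borel_measurable_indicator_comp[OF S cont h])
  show int: "integrable lborel (\<lambda>x. indicator S x * h (f x))"
    by (rule integrable_indicator_comp[OF S cont h B])
  define F where "F l = h l / \<bar>f' (inv_into S f l)\<bar>" for l
  have Ff: "\<bar>f' x\<bar> * F (f x) = h (f x)" if "x \<in> S" for x
    using that nz inj by (simp add: F_def)
  have intS: "set_integrable lebesgue S (\<lambda>x. h (f x))"
    unfolding set_integrable_def using int meas by (simp add: integrable_completion)
  have I: "(\<lambda>x. \<bar>f' x\<bar> * F (f x)) absolutely_integrable_on S"
    using intS by (rule set_integrable_cong[THEN iffD1, rotated 3]) (use Ff in auto)
  have "F absolutely_integrable_on (f ` S) \<and>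
      integral (f ` S) F = integral S (\<lambda>x. \<bar>f' x\<bar> * F (f x))"
    using has_absolute_integral_change_of_variables_1'[of S f f' F] S(1) der inj I by auto
  then have F: "F absolutely_integrable_on (f ` S)"
    "integral (f ` S) F = integral S (\<lambda>x. \<bar>f' x\<bar> * F (f x))" by auto
  show "integrable lebesgue (\<lambda>l. indicator (f ` S) l * (h l / \<bar>f' (inv_into S f l)\<bar>))"
    using F(1) by (simp add: set_integrable_def F_def)
  have "(\<integral>l. indicator (f ` S) l * (h l / \<bar>f' (inv_into S f l)\<bar>) \<partial>lebesgue) = integral (f ` S) F"
    using set_lebesgue_integral_eq_integral(2)[OF F(1)] by (simp add: set_lebesgue_integral_def F_def)
  also have "\<dots> = integral S (\<lambda>x. h (f x))"
    unfolding F(2) by (rule integral_cong) (rule Ff)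
  also have "\<dots> = (LINT x:S|lebesgue. h (f x))"
    using set_lebesgue_integral_eq_integral(2)[OF intS] by simp
  also have "\<dots> = (\<integral>x. indicator S x * h (f x) \<partial>lborel)"
    unfolding set_lebesgue_integral_def using meas by (simp add: integral_completion)
  finally show "(\<integral>l. indicator (f ` S) l * (h l / \<bar>f' (inv_into S f l)\<bar>) \<partial>lebesgue) =
      (\<integral>x. indicator S x * h (f x) \<partial>lborel)" .
qed

lemma open_real_cover_rational_intervals:
  fixes U :: "real set"
  assumes "open U"
  obtains J :: "nat \<Rightarrow> real set" where "(\<Union>k. J k) = U" "\<And>k. \<exists>p q. J k = {p<..<q}"
proof -
  define C where "C = (\<lambda>(p, q). {p<..<q}) ` {(p, q) \<in> \<rat> \<times> \<rat>. {p<..<q} \<subseteq> U}"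
  have "countable (\<rat> \<times> \<rat> :: (real \<times> real) set)" by (simp add: countable_rat)
  then have "countable C" unfolding C_def by (intro countable_image) (rule countable_subset, auto)
  moreover have "{} \<in> C" unfolding C_def by (rule image_eqI[of _ _ "(0, 0)"]) auto
  ultimately have r: "range (from_nat_into C) = C" by (intro range_from_nat_into) auto
  have "\<Union>C = U"
  proof (intro equalityI subsetI)
    fix x assume "x \<in> U"
    then obtain e where e: "e > 0" "ball x e \<subseteq> U" using assms openE by blast
    obtain p where p: "p \<in> \<rat>" "x - e < p" "p < x" using Rats_dense_in_real[of "x - e" x] e by auto
    obtain q where q: "q \<in> \<rat>" "x < q" "q < x + e" using Rats_dense_in_real[of x "x + e"] e by auto
    have "{p<..<q} \<subseteq> ball x e" using p q by (auto simp: dist_real_def)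
    then have "{p<..<q} \<in> C" unfolding C_def using p q e by (intro image_eqI[of _ _ "(p, q)"]) auto
    then show "x \<in> \<Union>C" using p q by (intro UnionI[of "{p<..<q}"]) auto
  qed (auto simp: C_def)
  then show ?thesis using that[of "from_nat_into C"] r
    by (metis (mono_tags, lifting) C_def imageE rangeI case_prod_unfold)
qed

text \<open>The open set where f' does not vanish is cut into countably many disjoint Borel pieces
  on which f is injective, and the formulas for the pieces are added; the L1 norms are summable
  since |h| <= B and the pieces have finite total length. The remaining points form a null set with
  null image, so for almost every l all preimages lie in the pieces, and as there are finitely many
  of them the series at l is a finite sum.\<close>

lemma level_density_change_of_variables_real:
  fixes f f' h :: "real \<Rightarrow> real"
  assumes der: "\<And>\<omega>. \<omega> \<in> {0..2*pi} \<Longrightarrow> (f has_real_derivative f' \<omega>) (at \<omega> within {0..2*pi})"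
    and cont': "continuous_on {0..2*pi} f'"
    and lev: "AE l in lebesgue. finite {\<omega> \<in> {0..2*pi}. f \<omega> = l}"
    and nz: "AE \<omega> in lebesgue. \<omega> \<in> {0..2*pi} \<longrightarrow> f' \<omega> \<noteq> 0"
    and h: "h \<in> borel_measurable borel" and B: "\<And>l. \<bar>h l\<bar> \<le> B"
  shows "has_bochner_integral lebesgue (\<lambda>l. h l * level_density f f' l)
    (\<integral>x. indicator {0..2*pi} x * h (f x) \<partial>lborel)"
proof -
  let ?I = "{0..2*pi}"
  have cont: "continuous_on ?I f"
    using der by (meson DERIV_continuous continuous_on_eq_continuous_within)
  define U where "U = {\<omega> \<in> {0<..<2*pi}. f' \<omega> \<noteq> 0}"
  have derU: "(f has_real_derivative f' x) (at x)" if "x \<in> {0<..<2*pi}" for x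
    using der[of x] that by (simp add: at_within_Icc_at)
  have "continuous_on {0<..<2*pi} f'" by (rule continuous_on_subset[OF cont']) auto
  then have "open ({0<..<2*pi} \<inter> f' -` (- {0}))"
    by (intro continuous_open_preimage) auto
  then have oU: "open U" by (simp add: U_def vimage_def Int_def)
  obtain J :: "nat \<Rightarrow> real set" where J: "(\<Union>k. J k) = U" "\<And>k. \<exists>p q. J k = {p<..<q}"
    using open_real_cover_rational_intervals[OF oU] by blast
  define A where "A = disjointed J"
  have A: "(\<Union>k. A k) = U" "disjoint_family A" "\<And>k. A k \<subseteq> J k"
    using J(1) by (auto simp: A_def UN_disjointed_eq disjoint_family_disjointed disjointed_subset)
  have Jb: "range J \<subseteq> sets borel" using J(2) by (metis image_subsetI borel_open open_greaterThanLessThan)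
  have Ab: "A k \<in> sets borel" for k
    using sets.range_disjointed_sets[OF Jb] by (auto simp: A_def)
  have AU: "A k \<subseteq> U" for k using A(1) by auto
  have AI: "A k \<subseteq> ?I" for k using AU by (force simp: U_def)
  \<comment> \<open>Equal values at two points of one interval would, by the mean value theorem,
    produce a zero of f' between them.\<close>
  have inj: "inj_on f (A k)" for k
  proof -
    obtain p q where pq: "J k = {p<..<q}" using J(2) by blast
    have JU: "J k \<subseteq> U" using J(1) by auto
    have ne: "f x \<noteq> f y" if xy: "x \<in> J k" "y \<in> J k" "x < y" for x y
    proof
      assume e: "f x = f y"
      have sub: "z \<in> U" if "x \<le> z" "z \<le> y" for z
        using that xy pq JU by auto
      obtain z where z: "x < z" "z < y" "f y - f x = (y - x) * f' z"
        using MVT2[OF xy(3), of f f'] sub derU by (auto simp: U_def)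
      then show False using e xy(3) sub[of z] by (auto simp: U_def)
    qed
    have "inj_on f (J k)"
      by (rule linorder_inj_onI') (use ne in auto)
    then show ?thesis using A(3) by (rule inj_on_subset)
  qed
  have derA: "(f has_real_derivative f' x) (at x within A k)" if "x \<in> A k" for x k
    using derU[of x] that AU[of k] by (auto simp: U_def intro: has_field_derivative_at_within)
  have nzA: "f' x \<noteq> 0" if "x \<in> A k" for x k using that AU[of k] by (auto simp: U_def)
  define G where "G g k l = indicator (f ` A k) l * (g l / \<bar>f' (inv_into (A k) f l)\<bar>)" for g :: "real \<Rightarrow> real" and k l
  have piece: "integrable lebesgue (G g k)"
    "(\<integral>l. G g k l \<partial>lebesgue) = (\<integral>x. indicator (A k) x * g (f x) \<partial>lborel)"
    "integrable lborel (\<lambda>x. indicator (A k) x * g (f x))"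
    if "g \<in> borel_measurable borel" "\<And>l. \<bar>g l\<bar> \<le> B" for g k
    unfolding G_def[abs_def]
    by (rule change_of_variables_piece[OF Ab AI cont _ inj _ that, where f' = f']; use derA nzA in auto)+
  have habs: "(\<lambda>l. \<bar>h l\<bar>) \<in> borel_measurable borel" "\<And>l. \<bar>\<bar>h l\<bar>\<bar> \<le> B" using h B by auto
  have normG: "norm (G h k l) = G (\<lambda>l. \<bar>h l\<bar>) k l" for k l
    by (simp add: G_def abs_mult)
  have B0: "B \<ge> 0" using B[of 0] by linarith
  have measA: "emeasure lborel (A k) \<noteq> \<infinity>" for k
  proof -
    have "emeasure lborel (A k) \<le> emeasure lborel ?I" by (rule emeasure_mono[OF AI]) simp
    also have "\<dots> < \<infinity>" by (simp add: emeasure_lborel_Icc_eq)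
    finally show ?thesis by simp
  qed
  have measU: "emeasure lborel U \<noteq> \<infinity>"
  proof -
    have "emeasure lborel U \<le> emeasure lborel ?I" by (rule emeasure_mono) (auto simp: U_def)
    also have "\<dots> < \<infinity>" by (simp add: emeasure_lborel_Icc_eq)
    finally show ?thesis by simp
  qed
  have sumA: "summable (\<lambda>k. measure lborel (A k))"
    by (rule sums_summable[OF measure_UNION]) (use Ab A(1,2) measU in auto)
  have le: "(\<integral>l. norm (G h k l) \<partial>lebesgue) \<le> B * measure lborel (A k)" for k
  proof -
    have "(\<integral>l. norm (G h k l) \<partial>lebesgue) = (\<integral>x. indicator (A k) x * \<bar>h (f x)\<bar> \<partial>lborel)"
      unfolding normG by (rule piece(2)[OF habs])
    also have "\<dots> \<le> (\<integral>x. indicator (A k) x * B \<partial>lborel)"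
      by (rule integral_mono[OF piece(3)[OF habs]])
        (use B Ab measA in \<open>auto intro!: integrable_mult_left integrable_real_indicator mult_left_mono simp: less_top\<close>)
    also have "\<dots> = B * measure lborel (A k)" by simp
    finally show ?thesis .
  qed
  have summ: "summable (\<lambda>k. \<integral>l. norm (G h k l) \<partial>lebesgue)"
    by (rule summable_comparison_test'[OF summable_mult[OF sumA, of B], of 0]) (use le in simp)
  \<comment> \<open>The endpoints join the critical points because \<open>U\<close> lies in the open
    interval.\<close>
  define N0 where "N0 = {0, 2*pi} \<union> {\<omega> \<in> ?I. f' \<omega> = 0}"
  have negN: "negligible N0"
  proof -
    have "{\<omega> \<in> ?I. f' \<omega> = 0} \<in> null_sets lebesgue"
      using nz by (auto simp: eventually_ae_filter intro: completion.complete2) 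
    then show ?thesis by (simp add: N0_def negligible_iff_null_sets[symmetric])
  qed
  have "f differentiable_on N0"
    unfolding differentiable_on_def
  proof
    fix x assume "x \<in> N0"
    then have x: "x \<in> ?I" by (auto simp: N0_def)
    have "N0 \<subseteq> ?I" by (auto simp: N0_def)
    then have "(f has_real_derivative f' x) (at x within N0)"
      using der[OF x] has_field_derivative_subset by blast
    then show "f differentiable at x within N0"
      by (meson differentiable_def has_field_derivative_imp_has_derivative)
  qed
  then have "negligible (f ` N0)" using negN by (intro negligible_differentiable_image_negligible) auto
  then have AEN: "AE l in lebesgue. l \<notin> f ` N0"
    by (simp add: negligible_iff_null_sets AE_not_in)
  have main: "AE l in lebesgue. (\<lambda>k. G h k l) sums (h l * level_density f f' l) \<and> summable (\<lambda>k. norm (G h k l))"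
    using AEN lev
  proof eventually_elim
    case (elim l)
    define L where "L = {\<omega> \<in> ?I. f \<omega> = l}"
    have L: "finite L" "L \<subseteq> U" using elim by (force simp: L_def U_def N0_def)+
    have "\<forall>\<omega>\<in>L. \<exists>k. \<omega> \<in> A k" using L(2) A(1) by auto
    then obtain K where K: "\<And>\<omega>. \<omega> \<in> L \<Longrightarrow> \<omega> \<in> A (K \<omega>)" by metis
    have uniq: "\<omega> \<in> A k \<longleftrightarrow> k = K \<omega>" if "\<omega> \<in> L" for \<omega> k
      using K[OF that] A(2) unfolding disjoint_family_on_def by blast
    have Gs: "G g k l = (\<Sum>\<omega>\<in>L. if k = K \<omega> then g l / \<bar>f' \<omega>\<bar> else 0)" for g k
    proof (cases "l \<in> f ` A k")
      case True
      then obtain \<omega> where w: "\<omega> \<in> A k" "f \<omega> = l" by auto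
      then have wL: "\<omega> \<in> L" using AI[of k] by (auto simp: L_def)
      have others: "k \<noteq> K \<nu>" if "\<nu> \<in> L" "\<nu> \<noteq> \<omega>" for \<nu>
      proof
        assume "k = K \<nu>"
        then have "\<nu> \<in> A k" using uniq that by simp
        then have "\<nu> = \<omega>" using inj[of k] w that(1) by (auto simp: inj_on_def L_def)
        then show False using that by simp
      qed
      have "(\<Sum>\<omega>\<in>L. if k = K \<omega> then g l / \<bar>f' \<omega>\<bar> else 0) = (\<Sum>\<nu>\<in>{\<omega>}. if k = K \<nu> then g l / \<bar>f' \<nu>\<bar> else 0)"
        by (rule sum.mono_neutral_right) (use L wL others in auto)
      also have "\<dots> = g l / \<bar>f' \<omega>\<bar>" using uniq[OF wL] w by simp
      also have "\<dots> = G g k l" using w True inv_into_f_f[OF inj w(1)] by (simp add: G_def)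
      finally show ?thesis by simp
    next
      case False
      then have "k \<noteq> K \<omega>" if "\<omega> \<in> L" for \<omega>
        using K[OF that] that by (auto simp: L_def)
      then have "(\<Sum>\<omega>\<in>L. if k = K \<omega> then g l / \<bar>f' \<omega>\<bar> else 0) = 0" by (intro sum.neutral) auto
      then show ?thesis using False by (simp add: G_def)
    qed
    have sm: "(\<lambda>k. G g k l) sums (\<Sum>\<omega>\<in>L. g l / \<bar>f' \<omega>\<bar>)" for g
      unfolding Gs by (intro sums_sum sums_single)
    have "(\<Sum>\<omega>\<in>L. h l / \<bar>f' \<omega>\<bar>) = h l * level_density f f' l"
      by (simp add: level_density_def L_def sum_distrib_left)
    then show ?case unfolding normG using sm[of h] sums_summable[OF sm[of "\<lambda>l. \<bar>h l\<bar>"]] by simp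
  qed
  have AEsum: "AE l in lebesgue. summable (\<lambda>k. norm (G h k l))" using main by eventually_elim simp
  have AEeq: "AE l in lebesgue. (\<Sum>k. G h k l) = h l * level_density f f' l"
    using main by eventually_elim (simp add: sums_iff)
  have Gi: "\<And>k. integrable lebesgue (G h k)" using piece(1)[OF h B] by simp
  have i1: "integrable lebesgue (\<lambda>l. \<Sum>k. G h k l)" by (rule integrable_suminf[OF Gi AEsum summ])
  have s1: "(\<lambda>k. \<integral>l. G h k l \<partial>lebesgue) sums (\<integral>l. (\<Sum>k. G h k l) \<partial>lebesgue)"
    by (rule sums_integral[OF Gi AEsum summ])
  have lm: "(\<lambda>l. h l * level_density f f' l) \<in> borel_measurable lebesgue"
    by (rule borel_measurable_AE[OF borel_measurable_integrable[OF i1] AEeq])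
  have "has_bochner_integral lebesgue (\<lambda>l. \<Sum>k. G h k l) (\<integral>l. (\<Sum>k. G h k l) \<partial>lebesgue)"
    by (rule has_bochner_integral_integrable[OF i1])
  then have hb: "has_bochner_integral lebesgue (\<lambda>l. h l * level_density f f' l) (\<integral>l. (\<Sum>k. G h k l) \<partial>lebesgue)"
    by (subst (asm) has_bochner_integral_cong_AE[OF borel_measurable_integrable[OF i1] lm AEeq])
  have Ub: "U \<in> sets borel" "U \<subseteq> ?I" using oU by (auto simp: U_def)
  note iU = integrable_indicator_comp[OF Ub cont h B]
  have "(\<integral>l. (\<Sum>k. G h k l) \<partial>lebesgue) = (\<Sum>k. \<integral>x. indicator (A k) x * h (f x) \<partial>lborel)"
    using s1 unfolding piece(2)[OF h B] by (simp add: sums_iff)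
  also have "\<dots> = (\<integral>x. indicator U x * h (f x) \<partial>lborel)"
    using lebesgue_integral_countable_add[of A lborel "\<lambda>x. h (f x)"] Ab A(1,2) iU
    by (simp add: set_lebesgue_integral_def set_integrable_def disjoint_family_on_def)
  also have "\<dots> = (\<integral>x. indicator U x * h (f x) \<partial>lebesgue)"
    using borel_measurable_indicator_comp[OF Ub cont h] by (simp add: integral_completion)
  also have "\<dots> = (\<integral>x. indicator ?I x * h (f x) \<partial>lebesgue)"
  proof (rule integral_cong_AE)
    have "AE x in lebesgue. x \<notin> N0"
      using negN by (simp add: negligible_iff_null_sets AE_not_in)
    then show "AE x in lebesgue. indicator U x * h (f x) = indicator ?I x * h (f x)"
      by eventually_elim (auto simp: U_def N0_def split: split_indicator)
    show "(\<lambda>x. indicator U x * h (f x)) \<in> borel_measurable lebesgue"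
      "(\<lambda>x. indicator ?I x * h (f x)) \<in> borel_measurable lebesgue"
      using borel_measurable_indicator_comp[OF Ub cont h] borel_measurable_indicator_comp[of ?I, OF _ _ cont h]
      by (simp_all add: measurable_completion)
  qed
  also have "\<dots> = (\<integral>x. indicator ?I x * h (f x) \<partial>lborel)"
    using borel_measurable_indicator_comp[of ?I, OF _ _ cont h] by (simp add: integral_completion)
  finally show ?thesis using hb by simp
qed

text \<open>Applied to real and imaginary part of h cut off outside the range interval, as h is
  continuous only there. The cut is harmless because the level density vanishes off the range of f;
  the endpoints missing from the interval integral are a null set.\<close>

lemma level_density_change_of_variables:
  fixes f f' :: "real \<Rightarrow> real" and h :: "real \<Rightarrow> complex"
  assumes der: "\<And>\<omega>. \<omega> \<in> {0..2*pi} \<Longrightarrow> (f has_real_derivative f' \<omega>) (at \<omega> within {0..2*pi})"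
    and cont': "continuous_on {0..2*pi} f'"
    and lev: "AE l in lebesgue. finite {\<omega> \<in> {0..2*pi}. f \<omega> = l}"
    and nz: "AE \<omega> in lebesgue. \<omega> \<in> {0..2*pi} \<longrightarrow> f' \<omega> \<noteq> 0"
    and rng: "\<And>\<omega>. \<omega> \<in> {0..2*pi} \<Longrightarrow> f \<omega> \<in> {l\<^sub>1..l\<^sub>2}" and l: "l\<^sub>1 \<le> l\<^sub>2"
    and h: "continuous_on {l\<^sub>1..l\<^sub>2} h"
  shows "(LINT l=l\<^sub>1..l\<^sub>2|lebesgue. (h l * complex_of_real (level_density f f' l))) =
    (LBINT x:{0..2*pi}. h (f x))"
proof -
  let ?J = "{l\<^sub>1..l\<^sub>2}" and ?I = "{0..2*pi}"
  have cont: "continuous_on ?I f"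
    using der by (meson DERIV_continuous continuous_on_eq_continuous_within)
  have "compact (h ` ?J)" by (rule compact_continuous_image[OF h]) simp
  then obtain B where B: "\<And>l. l \<in> ?J \<Longrightarrow> cmod (h l) \<le> B" "B > 0"
    by (metis compact_imp_bounded bounded_pos imageI)
  define R I where "R l = indicator ?J l *\<^sub>R Re (h l)" and "I l = indicator ?J l *\<^sub>R Im (h l)" for l
  have Rm: "R \<in> borel_measurable borel" and Im: "I \<in> borel_measurable borel"
    unfolding R_def[abs_def] I_def[abs_def] using h
    by (auto intro!: borel_measurable_continuous_on_indicator continuous_intros simp del: real_scaleR_def)
  have RB: "\<bar>R l\<bar> \<le> B" "\<bar>I l\<bar> \<le> B" for l
    using B(1)[of l] B(2) abs_Re_le_cmod[of "h l"] abs_Im_le_cmod[of "h l"]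
    by (auto simp: R_def I_def split: split_indicator)
  have cv: "has_bochner_integral lebesgue (\<lambda>l. g l * level_density f f' l) (\<integral>x. indicator ?I x * g (f x) \<partial>lborel)"
    if "g \<in> borel_measurable borel" "\<And>l. \<bar>g l\<bar> \<le> B" for g
    by (rule level_density_change_of_variables_real[OF _ cont' lev nz that]) (rule der)
  have ld0: "level_density f f' l = 0" if "l \<notin> ?J" for l
    using rng that by (auto simp: level_density_def intro!: sum.neutral)
  have hI: "h (f x) = complex_of_real (R (f x)) + \<i> * complex_of_real (I (f x))" if "x \<in> ?I" for x
    using rng[OF that] by (simp add: R_def I_def complex_eq_iff)
  have hJ: "h l * complex_of_real (level_density f f' l) =
      complex_of_real (R l * level_density f f' l) + \<i> * complex_of_real (I l * level_density f f' l)" if "l \<in> ?J" for l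
    using that by (simp add: R_def I_def complex_eq_iff)
  have "(LINT l=l\<^sub>1..l\<^sub>2|lebesgue. (h l * complex_of_real (level_density f f' l))) =
      (LINT l:{l\<^sub>1<..<l\<^sub>2}|lebesgue. h l * complex_of_real (level_density f f' l))"
    using l by (simp add: interval_lebesgue_integral_def)
  also have "\<dots> = (\<integral>l. complex_of_real (R l * level_density f f' l) + \<i> * complex_of_real (I l * level_density f f' l) \<partial>lebesgue)"
    unfolding set_lebesgue_integral_def
  proof (rule integral_cong_AE)
    let ?g = "\<lambda>l. complex_of_real (R l * level_density f f' l) + \<i> * complex_of_real (I l * level_density f f' l)"
    show gm: "?g \<in> borel_measurable lebesgue"
    proof -
      have "integrable lebesgue (\<lambda>l. R l * level_density f f' l)" "integrable lebesgue (\<lambda>l. I l * level_density f f' l)"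
        using cv[OF Rm RB(1)] cv[OF Im RB(2)] by (simp_all add: has_bochner_integral_iff)
      then show ?thesis
        by (intro borel_measurable_integrable Bochner_Integration.integrable_add integrable_mult_right integrable_of_real)
    qed
    have AE: "AE l in lebesgue. l \<notin> {l\<^sub>1, l\<^sub>2}" by (rule AE_not_in) (simp add: negligible_iff_null_sets[symmetric])
    then show ae: "AE l in lebesgue. indicator {l\<^sub>1<..<l\<^sub>2} l *\<^sub>R (h l * complex_of_real (level_density f f' l)) = ?g l"
      by eventually_elim (use hJ ld0 in \<open>auto split: split_indicator\<close>)
    show "(\<lambda>l. indicator {l\<^sub>1<..<l\<^sub>2} l *\<^sub>R (h l * complex_of_real (level_density f f' l))) \<in> borel_measurable lebesgue"
      by (rule borel_measurable_AE[OF gm]) (use ae in \<open>auto elim: eventually_mono\<close>)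
  qed
  also have "\<dots> = complex_of_real (\<integral>x. indicator ?I x * R (f x) \<partial>lborel) + \<i> * complex_of_real (\<integral>x. indicator ?I x * I (f x) \<partial>lborel)"
    using cv[OF Rm RB(1)] cv[OF Im RB(2)]
    by (simp add: has_bochner_integral_iff del: of_real_mult)
  also have "\<dots> = (\<integral>x. complex_of_real (indicator ?I x * R (f x)) + \<i> * complex_of_real (indicator ?I x * I (f x)) \<partial>lborel)"
    using integrable_indicator_comp[of ?I, OF _ _ cont Rm RB(1)] integrable_indicator_comp[of ?I, OF _ _ cont Im RB(2)]
    by (simp del: of_real_mult)
  also have "\<dots> = (LBINT x:?I. h (f x))"
    unfolding set_lebesgue_integral_def
    by (rule Bochner_Integration.integral_cong) (use hI in \<open>auto split: split_indicator\<close>)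
  finally show ?thesis .
qed

section \<open>Resolvents of Gram matrices\<close>

definition psd :: "cmat \<Rightarrow> bool" where
  "psd S \<longleftrightarrow> cadj S = S \<and> (\<forall>U. 0 \<le> Re (ctr (cadj U * (S * U))))"

lemma psd_quad:
  assumes "psd S"
  obtains s where "ctr (cadj U * (S * U)) = of_real s" "0 \<le> s"
proof -
  have "cnj (ctr (cadj U * (S * U))) = ctr (cadj U * (S * U))"
    using assms unfolding psd_def by (subst ctr_cadj[symmetric]) (simp add: mult.assoc)
  then have "ctr (cadj U * (S * U)) = of_real (Re (ctr (cadj U * (S * U))))"
    by (metis Reals_cnj_iff of_real_Re)
  then show ?thesis using that assms unfolding psd_def by blast
qed

lemma psd_gram: "psd (cadj x * x)"
proof -
  have "ctr (cadj U * (cadj x * x * U)) = of_real ((norm (x * U))\<^sup>2)" for U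
    unfolding ctr_cadj_self[symmetric] by (simp add: mult.assoc)
  then show ?thesis by (simp add: psd_def)
qed

lemma psd_add: "psd A \<Longrightarrow> psd B \<Longrightarrow> psd (A + B)"
  by (simp add: psd_def distrib_left distrib_right)

lemma psd_sum: "(\<And>i. i \<in> I \<Longrightarrow> psd (F i)) \<Longrightarrow> psd (sum F I)"
proof (induction I rule: infinite_finite_induct)
  case (insert i I)
  then show ?case by (simp add: psd_add)
qed (simp_all add: psd_def)

lemma resolvent_quad:
  assumes S: "psd S" and U: "cunit n * U = U"
  obtains s where "0 \<le> s"
    "ctr (cadj U * ((csc b S - csc z (cunit n)) * U)) = b * of_real s - z * of_real ((norm U)\<^sup>2)"
    "ctr (cadj U * (cadj (csc b S - csc z (cunit n)) * U)) = cnj b * of_real s - cnj z * of_real ((norm U)\<^sup>2)"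
proof -
  obtain s where s: "ctr (cadj U * (S * U)) = of_real s" "0 \<le> s" using psd_quad[OF S] by blast
  have "cadj S = S" using S by (simp add: psd_def)
  then show ?thesis using that[of s] s
    by (simp add: left_diff_distrib right_diff_distrib U ctr_cadj_self)
qed

text \<open>The imaginary part of the form of b S - z is Im b s - Im z |U|^2 with s >= 0, two
  nonpositive terms, so the form is coercive with constant Im z. The case b = 1 is the sample
  resolvent, a general b the deterministic equivalent.\<close>

lemma resolvent_props:
  assumes S: "psd S" "corner n S" and z: "Im z > 0" and b: "Im b \<le> 0"
  defines "B \<equiv> csc b S - csc z (cunit n)"
  shows "cinv n B * B = cunit n" "B * cinv n B = cunit n" "op_bound (1 / Im z) (cinv n B)"
proof -
  have B: "corner n B" unfolding B_def by (intro corner_diff corner_csc S corner_cunit)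
  have co: "Im z * (norm U)\<^sup>2 \<le> cmod (ctr (cadj U * (B * U)))" if U: "cunit n * U = U" for U
  proof -
    obtain s where s: "0 \<le> s" "ctr (cadj U * (B * U)) = b * of_real s - z * of_real ((norm U)\<^sup>2)"
      using resolvent_quad[OF S(1) U, where b = b and z = z] unfolding B_def by blast
    have "Im (ctr (cadj U * (B * U))) = Im b * s - Im z * (norm U)\<^sup>2"
      unfolding s(2) by simp
    moreover have "Im b * s \<le> 0" using s b by (simp add: mult_nonpos_nonneg)
    ultimately show ?thesis using abs_Im_le_cmod[of "ctr (cadj U * (B * U))"] by linarith
  qed
  show "cinv n B * B = cunit n" "B * cinv n B = cunit n" "op_bound (1 / Im z) (cinv n B)"
    using coercive_cinv[OF B z co] by blast+
qed

section \<open>Resolvents and their rank one perturbations\<close>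

definition resolvent :: "nat \<Rightarrow> complex \<Rightarrow> cmat \<Rightarrow> cmat" where
  "resolvent n z S = cinv n (S - csc z (cunit n))"

lemma corner_resolvent [simp]: "corner n (resolvent n z S)"
  by (simp add: resolvent_def)

lemma
  assumes "psd S" "corner n S" "Im z > 0"
  shows resolvent_left: "resolvent n z S * (S - csc z (cunit n)) = cunit n"
    and resolvent_right: "(S - csc z (cunit n)) * resolvent n z S = cunit n"
    and op_bound_resolvent: "op_bound (1 / Im z) (resolvent n z S)"
  using resolvent_props[OF assms, of 1] by (simp_all add: resolvent_def)

text \<open>Let u be the resolvent applied to the adjoint of x. Then the adjoint of x is B u with B
  = S - z, so q is the form of the adjoint of B at u, that is q = s - cnj z |u|^2 with s >= 0. Both
  signs are visible from this expression; the second formula for Im q uses the row x R instead of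
  u.\<close>

lemma resolvent_form:
  assumes S: "psd S" "corner n S" and z: "Im z > 0" and x: "x * cunit n = x"
  defines "q \<equiv> ctr (x * resolvent n z S * cadj x)"
  shows "Im q = Im z * (norm (resolvent n z S * cadj x))\<^sup>2"
    and "Im q = Im z * (norm (x * resolvent n z S))\<^sup>2"
    and "0 \<le> Im (z * q)"
proof -
  define R where "R = resolvent n z S"
  define B where "B = S - csc z (cunit n)"
  have B: "R * B = cunit n" "B * R = cunit n"
    using resolvent_left[OF S z] resolvent_right[OF S z] by (simp_all add: R_def B_def)
  have R: "cunit n * R = R" "R * cunit n = R"
    using corner_resolvent[of n z S] by (simp_all add: R_def corner_def)
  have x': "cunit n * cadj x = cadj x" using x by (metis cadj_cunit cadj_mult)
  define u where "u = R * cadj x"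
  have u: "cunit n * u = u" using R by (simp add: u_def flip: mult.assoc)
  have Bu: "B * u = cadj x" using B x' by (simp add: u_def flip: mult.assoc)
  have "q = ctr (cadj u * (cadj B * u))"
    unfolding q_def R_def[symmetric] by (metis Bu cadj_cadj cadj_mult mult.assoc u_def)
  moreover obtain s where s: "0 \<le> s" "ctr (cadj u * (cadj B * u)) = of_real s - cnj z * of_real ((norm u)\<^sup>2)"
    using resolvent_quad[OF S(1) u, where b = 1 and z = z] by (auto simp: B_def)
  ultimately have q: "q = of_real s - cnj z * of_real ((norm u)\<^sup>2)" by simp
  show "Im q = Im z * (norm (resolvent n z S * cadj x))\<^sup>2"
    using q by (simp add: u_def R_def)
  have "z * q = z * of_real s - of_real ((cmod z)\<^sup>2) * of_real ((norm u)\<^sup>2)"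
    unfolding q complex_norm_square by (simp add: algebra_simps)
  also have "Im \<dots> = Im z * s" by (simp flip: of_real_mult)
  finally show "0 \<le> Im (z * q)" using z s by simp
  define v where "v = cadj (x * R)"
  have v: "cunit n * v = v" unfolding v_def using R by (metis cadj_cunit cadj_mult mult.assoc)
  have "cadj v * B = x" using B x by (simp add: v_def mult.assoc)
  then have "q = ctr (cadj v * (cadj B * v))"
    unfolding q_def R_def[symmetric] by (metis cadj_cadj cadj_mult v_def)
  moreover obtain s' where "0 \<le> s'" "ctr (cadj v * (cadj B * v)) = of_real s' - cnj z * of_real ((norm v)\<^sup>2)"
    using resolvent_quad[OF S(1) v, where b = 1 and z = z] by (auto simp: B_def)
  moreover have "norm v = norm (x * R)" unfolding v_def by (rule norm_cadj)
  ultimately show "Im q = Im z * (norm (x * resolvent n z S))\<^sup>2"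
    by (simp add: R_def)
qed

lemma one_by_one: "cunit 1 * A = A \<Longrightarrow> A * cunit 1 = A \<Longrightarrow> A = csc (ctr A) (cunit 1)"
proof (rule cmat_eqI)
  fix i j assume A: "cunit 1 * A = A" "A * cunit 1 = A"
  then have c: "corner 1 A" by (simp add: corner_def)
  then have "ctr A = (\<Sum>i<1. ent A i i)" by (intro ctr_eq) (auto simp: corner_iff)
  then show "ent A i j = ent (csc (ctr A) (cunit 1)) i j"
    using c by (cases i; cases j) (auto simp: corner_iff)
qed

text \<open>The Sherman-Morrison formula. Since Im (z q) >= 0, the imaginary part of z (1 + q) is at
  least Im z, which bounds 1 / (1 + q). In the trace difference the two vector norms multiply to Im
  q / Im z, and Im q <= |1 + q| cancels the denominator: the bound does not depend on the length of
  y.\<close>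

lemma rank_one:
  assumes S: "psd S" "corner n S" and z: "Im z > 0" and y: "y * cunit n = y" "cunit 1 * y = y"
  defines "R' \<equiv> resolvent n z S" and "R \<equiv> resolvent n z (S + cadj y * y)"
    and "q \<equiv> ctr (y * resolvent n z S * cadj y)"
  shows "1 + q \<noteq> 0" "cmod (1 / (1 + q)) \<le> cmod z / Im z"
    and "R * cadj y = csc (1 / (1 + q)) (R' * cadj y)"
    and "y * R = csc (1 / (1 + q)) (y * R')"
    and "op_bound L A \<Longrightarrow> 0 \<le> L \<Longrightarrow> cmod (ctr (A * R) - ctr (A * R')) \<le> L / Im z"
proof -
  have y': "cunit n * cadj y = cadj y" "cadj y * cunit 1 = cadj y"
    using y by (metis cadj_cunit cadj_mult)+
  have S2: "psd (S + cadj y * y)" "corner n (S + cadj y * y)"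
  proof -
    have "corner n (cadj y * y)"
      unfolding corner_def using y(1) y'(1) by (metis mult.assoc)
    then show "psd (S + cadj y * y)" "corner n (S + cadj y * y)"
      using S psd_gram by (auto intro: psd_add corner_add)
  qed
  define B' B where "B' = S - csc z (cunit n)" and "B = S + cadj y * y - csc z (cunit n)"
  have BB: "B = B' + cadj y * y" by (simp add: B_def B'_def)
  have I: "R * B = cunit n" "B * R = cunit n" "R' * B' = cunit n" "B' * R' = cunit n"
    using resolvent_left[OF S z] resolvent_right[OF S z] resolvent_left[OF S2 z] resolvent_right[OF S2 z]
    by (simp_all add: R_def R'_def B_def B'_def)
  have RR: "cunit n * R = R" "R * cunit n = R" "cunit n * R' = R'" "R' * cunit n = R'"
    using corner_resolvent[of n z] by (simp_all add: R_def R'_def corner_def)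
  note f = resolvent_form[OF S z y(1), folded R'_def]
  have qR: "q = ctr (y * R' * cadj y)" by (simp add: q_def R'_def)
  have "Im z \<le> Im (z * (1 + q))" using f(3) by (simp add: qR distrib_left)
  also have "\<dots> \<le> cmod (z * (1 + q))" using abs_Im_le_cmod by (metis abs_le_D1)
  finally have le: "Im z \<le> cmod z * cmod (1 + q)" by (simp add: norm_mult)
  then show q1: "1 + q \<noteq> 0" using z by auto
  then show "cmod (1 / (1 + q)) \<le> cmod z / Im z"
    using le z by (simp add: norm_divide divide_simps mult.commute)
  have m: "y * R' * cadj y = csc q (cunit 1)"
    unfolding qR by (rule one_by_one) (metis y(2) mult.assoc, metis y'(2) mult.assoc)
  have "B * (R' * cadj y) = cadj y + cadj y * (y * R' * cadj y)"
    using y' by (simp add: BB distrib_right I flip: mult.assoc)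
  also have "\<dots> = csc (1 + q) (cadj y)"
    unfolding m using y' by (simp add: csc_add_left)
  finally have "R * (B * (R' * cadj y)) = csc (1 + q) (R * cadj y)" by simp
  moreover have "R * (B * (R' * cadj y)) = R' * cadj y"
    using I RR by (simp flip: mult.assoc)
  ultimately have e1: "R' * cadj y = csc (1 + q) (R * cadj y)" by simp
  then show Ry: "R * cadj y = csc (1 / (1 + q)) (R' * cadj y)" using q1 by simp
  have "(y * R') * B = y + (y * R' * cadj y) * y"
    using y by (simp add: BB distrib_left I mult.assoc)
  also have "\<dots> = csc (1 + q) y"
    unfolding m using y by (simp add: csc_add_left)
  finally have "((y * R') * B) * R = csc (1 + q) (y * R)" by simp
  moreover have "((y * R') * B) * R = y * R'"
    using I RR by (simp add: mult.assoc)
  ultimately have "y * R' = csc (1 + q) (y * R)" by simp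
  then show yR: "y * R = csc (1 / (1 + q)) (y * R')" using q1 by simp
  assume A: "op_bound L A" "0 \<le> L"
  have "R - R' = R * (B' * R') - (R * B) * R'" using I RR by simp
  also have "\<dots> = - (R * cadj y * (y * R'))" by (simp add: BB algebra_simps)
  also have "\<dots> = - csc (1 / (1 + q)) (R' * cadj y * (y * R'))" unfolding Ry by simp
  finally have d: "R - R' = - csc (1 / (1 + q)) (R' * cadj y * (y * R'))" .
  have "ctr (A * R) - ctr (A * R') = ctr (A * (R - R'))" by (simp add: right_diff_distrib)
  also have "\<dots> = - (1 / (1 + q)) * ctr ((A * (R' * cadj y)) * (y * R'))"
    unfolding d by (simp add: mult.assoc)
  finally have "cmod (ctr (A * R) - ctr (A * R')) = cmod (ctr ((A * (R' * cadj y)) * (y * R'))) / cmod (1 + q)"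
    by (simp add: norm_mult norm_divide)
  also have "\<dots> \<le> L * (Im q / Im z) / cmod (1 + q)"
  proof (rule divide_right_mono)
    have n1: "norm (R' * cadj y) = sqrt (Im q / Im z)" "norm (y * R') = sqrt (Im q / Im z)"
      using f(1,2) z by (simp_all add: qR)
    have n0: "0 \<le> Im q / Im z" using f(1) z by (simp add: qR)
    have "cmod (ctr ((A * (R' * cadj y)) * (y * R'))) \<le> norm (A * (R' * cadj y)) * norm (y * R')"
      by (rule cmod_ctr_mult_le)
    also have "\<dots> \<le> (L * norm (R' * cadj y)) * norm (y * R')"
      using A by (intro mult_right_mono) (auto simp: op_bound_def)
    also have "\<dots> = L * (Im q / Im z)"
      by (simp only: n1 mult.assoc real_sqrt_mult_self abs_of_nonneg[OF n0])
    finally show "cmod (ctr ((A * (R' * cadj y)) * (y * R'))) \<le> L * (Im q / Im z)" .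
  qed simp
  also have "\<dots> \<le> L / Im z"
  proof -
    have "Im q \<le> cmod (1 + q)" using abs_Im_le_cmod[of "1 + q"] by simp
    then have "Im q / cmod (1 + q) \<le> 1" using q1 by (simp add: divide_le_eq)
    then have "(L / Im z) * (Im q / cmod (1 + q)) \<le> L / Im z"
      using A z by (intro mult_left_le) auto
    then show ?thesis by (simp add: mult_ac)
  qed
  finally show "cmod (ctr (A * R) - ctr (A * R')) \<le> L / Im z" .
qed

section \<open>Rows, sample covariance and removal of one row\<close>

definition row_vec :: "nat \<Rightarrow> nat \<Rightarrow> (nat \<Rightarrow> real) \<Rightarrow> cmat" where
  "row_vec p n x = cm 1 n (\<lambda>i t. complex_of_real (x t / sqrt p))"

definition sample_cov :: "nat \<Rightarrow> nat \<Rightarrow> (nat \<Rightarrow> nat \<Rightarrow> real) \<Rightarrow> cmat" where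
  "sample_cov p n X = (\<Sum>i<p. cadj (row_vec p n (X i)) * row_vec p n (X i))"

lemma row_vec_unit [simp]: "row_vec p n x * cunit n = row_vec p n x" "cunit (Suc 0) * row_vec p n x = row_vec p n x"
  by (rule cmat_eqI; simp add: row_vec_def)+

lemma row_vec_unit' [simp]: "cunit n * cadj (row_vec p n x) = cadj (row_vec p n x)"
  by (metis cadj_cunit cadj_mult row_vec_unit(1))

lemma corner_gram_row: "corner n (cadj (row_vec p n x) * row_vec p n x)"
  by (simp add: corner_def mult.assoc) (simp flip: mult.assoc)

lemma row_vec_zero [simp]: "row_vec p n (\<lambda>_. 0) = 0"
  by (rule cmat_eqI) (simp add: row_vec_def)

lemma psd_sample_cov [simp]: "psd (sample_cov p n X)"
  unfolding sample_cov_def by (intro psd_sum psd_gram)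

lemma corner_sample_cov [simp]: "corner n (sample_cov p n X)"
  unfolding sample_cov_def by (intro corner_sum corner_gram_row)

lemma sample_cov_upd:
  assumes "i < p"
  shows "sample_cov p n (X(i := x)) =
    sample_cov p n (X(i := (\<lambda>_. 0))) + cadj (row_vec p n x) * row_vec p n x"
proof -
  have *: "sample_cov p n (X(i := v)) = cadj (row_vec p n v) * row_vec p n v +
      (\<Sum>k\<in>{..<p} - {i}. cadj (row_vec p n (X k)) * row_vec p n (X k))" for v
    unfolding sample_cov_def using assms by (subst sum.remove[of _ i]) (auto intro!: sum.cong)
  show ?thesis unfolding *[of x] *[of "\<lambda>_. 0"] by simp
qed

text \<open>The transform of the spectrum of the p x p matrix, computed from the n x n companion:
  the spectra differ by p - n zero eigenvalues (a signed count), and each contributes -1 /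
  z.\<close>

definition companion_stieltjes :: "nat \<Rightarrow> nat \<Rightarrow> complex \<Rightarrow> (nat \<Rightarrow> nat \<Rightarrow> real) \<Rightarrow> complex" where
  "companion_stieltjes p n z X =
    ctr (resolvent n z (sample_cov p n X)) / of_nat p - (1 - of_nat n / of_nat p) / z"

text \<open>The row is set to zero instead of being deleted, so that \<open>p\<close>, the
  normalisation and the index set stay the same.\<close>

definition loo_resolvent :: "nat \<Rightarrow> nat \<Rightarrow> complex \<Rightarrow> (nat \<Rightarrow> nat \<Rightarrow> real) \<Rightarrow> nat \<Rightarrow> cmat" where
  "loo_resolvent p n z X i = resolvent n z (sample_cov p n (X(i := (\<lambda>_. 0))))"

definition loo_form :: "nat \<Rightarrow> nat \<Rightarrow> complex \<Rightarrow> (nat \<Rightarrow> nat \<Rightarrow> real) \<Rightarrow> nat \<Rightarrow> complex" where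
  "loo_form p n z X i = ctr (row_vec p n (X i) * loo_resolvent p n z X i * cadj (row_vec p n (X i)))"

lemma leave_one_out:
  fixes X :: "nat \<Rightarrow> nat \<Rightarrow> real" and n p :: nat
  assumes i: "i < p" and z: "Im z > 0"
  defines "y \<equiv> row_vec p n (X i)" and "R \<equiv> resolvent n z (sample_cov p n X)"
    and "R' \<equiv> loo_resolvent p n z X i" and "q \<equiv> loo_form p n z X i"
  shows "1 + q \<noteq> 0" "cmod (1 / (1 + q)) \<le> cmod z / Im z"
    and "y * R = csc (1 / (1 + q)) (y * R')"
    and "op_bound L A \<Longrightarrow> 0 \<le> L \<Longrightarrow> cmod (ctr (A * R) - ctr (A * R')) \<le> L / Im z"
proof -
  have S: "sample_cov p n X = sample_cov p n (X(i := (\<lambda>_. 0))) + cadj y * y"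
    using sample_cov_upd[OF i, of n X "X i"] by (simp add: y_def)
  note r = rank_one[where S = "sample_cov p n (X(i := (\<lambda>_. 0)))" and y = "row_vec p n (X i)" and n = n,
      OF psd_sample_cov corner_sample_cov z row_vec_unit[folded One_nat_def],
      folded y_def, folded S, folded R_def loo_resolvent_def, folded R'_def]
  have q: "q = ctr (y * R' * cadj y)" by (simp add: q_def loo_form_def y_def R'_def)
  show "1 + q \<noteq> 0" "cmod (1 / (1 + q)) \<le> cmod z / Im z"
    "y * R = csc (1 / (1 + q)) (y * R')"
    "op_bound L A \<Longrightarrow> 0 \<le> L \<Longrightarrow> cmod (ctr (A * R) - ctr (A * R')) \<le> L / Im z"
    unfolding q by (fact r)+
qed

text \<open>The trace of S R, with S the sample covariance, is evaluated twice: as n + z tr R from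
  the resolvent equation, and row by row as the sum of q_i / (1 + q_i) = 1 - 1 / (1 + q_i) from
  Sherman-Morrison.\<close>

lemma companion_stieltjes_eq:
  assumes z: "Im z > 0" and p: "p > 0"
  shows "companion_stieltjes p n z X = - (\<Sum>i<p. 1 / (1 + loo_form p n z X i)) / (z * of_nat p)"
proof -
  define R where "R = resolvent n z (sample_cov p n X)"
  have "(\<Sum>i<p. 1 - 1 / (1 + loo_form p n z X i)) =
      (\<Sum>i<p. ctr (row_vec p n (X i) * R * cadj (row_vec p n (X i))))"
  proof (rule sum.cong[OF refl])
    fix i assume "i \<in> {..<p}"
    then have i: "i < p" by simp
    note l = leave_one_out[OF i z, where X = X and n = n, folded R_def]
    have "ctr (row_vec p n (X i) * R * cadj (row_vec p n (X i))) = 1 / (1 + loo_form p n z X i) * loo_form p n z X i"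
      unfolding l(3) by (simp add: loo_form_def)
    then show "1 - 1 / (1 + loo_form p n z X i) = ctr (row_vec p n (X i) * R * cadj (row_vec p n (X i)))"
      using l(1) by (simp add: field_simps)
  qed
  also have "\<dots> = ctr (sample_cov p n X * R)"
    unfolding sample_cov_def by (simp add: sum_distrib_right mult.assoc ctr_comm[of "cadj _"])
  also have "\<dots> = ctr (cunit n) + z * ctr R"
  proof -
    have "(sample_cov p n X - csc z (cunit n)) * R = cunit n"
      unfolding R_def by (rule resolvent_right[OF psd_sample_cov corner_sample_cov z])
    moreover have "cunit n * R = R" using corner_resolvent[of n z] by (simp add: R_def corner_def)
    ultimately have "sample_cov p n X * R = cunit n + csc z R" by (simp add: left_diff_distrib diff_eq_eq)
    then show ?thesis by simp
  qed
  finally have "of_nat p - (\<Sum>i<p. 1 / (1 + loo_form p n z X i)) = of_nat n + z * ctr R"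
    by (simp add: sum_subtractf)
  then have "(\<Sum>i<p. 1 / (1 + loo_form p n z X i)) = of_nat p - (of_nat n + z * ctr R)"
    by (simp add: algebra_simps)
  moreover have "t / P - (1 - N / P) / z = - (P - (N + z * t)) / (z * P)" if "P \<noteq> 0" for t P N
  proof -
    have "z \<noteq> 0" using z by auto
    then show ?thesis using that by (simp add: field_simps)
  qed
  ultimately show ?thesis
    unfolding companion_stieltjes_def R_def[symmetric] using p by simp
qed

text \<open>The resolvent of the larger Gram matrix is guessed by the push-through identity as
  \<open>T\<close>, which is -1/z times the identity minus Y R and the adjoint of Y; multiplying out
  confirms it. Its trace is then cyclic.\<close>

lemma ctr_resolvent_gram:
  fixes Y :: cmat
  assumes z: "Im z > 0" and Y: "cunit p * Y = Y" "Y * cunit n = Y"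
  shows "ctr (resolvent p z (Y * cadj Y)) = ctr (resolvent n z (cadj Y * Y)) - (of_nat p - of_nat n) / z"
    and "resolvent p z (Y * cadj Y) * (Y * cadj Y - csc z (cunit p)) = cunit p"
proof -
  have Y': "cunit n * cadj Y = cadj Y" "cadj Y * cunit p = cadj Y"
    using Y by (metis cadj_cunit cadj_mult)+
  have z0: "z \<noteq> 0" using z by auto
  have S1: "psd (cadj Y * Y)" "corner n (cadj Y * Y)"
    using psd_gram Y Y' by (auto simp: corner_def mult.assoc) (simp flip: mult.assoc)
  have S2: "psd (Y * cadj Y)" "corner p (Y * cadj Y)"
    using psd_gram[of "cadj Y"] Y Y' by (auto simp: corner_def mult.assoc) (simp flip: mult.assoc)
  show "resolvent p z (Y * cadj Y) * (Y * cadj Y - csc z (cunit p)) = cunit p"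
    by (rule resolvent_left[OF S2 z])
  define R where "R = resolvent n z (cadj Y * Y)"
  have R: "R * (cadj Y * Y) = cunit n + csc z R"
    using resolvent_left[OF S1 z] corner_resolvent[of n z "cadj Y * Y"]
    by (simp add: R_def right_diff_distrib diff_eq_eq corner_def)
  define T where "T = csc (- 1 / z) (cunit p - Y * R * cadj Y)"
  have "Y * R * cadj Y * (Y * cadj Y) = Y * (R * (cadj Y * Y)) * cadj Y" by (simp add: mult.assoc)
  also have "\<dots> = Y * cadj Y + csc z (Y * R * cadj Y)"
    unfolding R using Y by (simp add: distrib_left distrib_right)
  finally have e1: "Y * R * cadj Y * (Y * cadj Y) = Y * cadj Y + csc z (Y * R * cadj Y)" .
  have e2: "cunit p * (Y * cadj Y) = Y * cadj Y" "Y * R * cadj Y * cunit p = Y * R * cadj Y"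
    using Y Y' by (metis mult.assoc)+
  have "(cunit p - W) * (G - csc z (cunit p)) = - csc z (cunit p)"
    if "W * G = G + csc z W" "cunit p * G = G" "W * cunit p = W" for W G
    using that by (simp add: algebra_simps csc_diff)
  from this[OF e1 e2] have "(cunit p - Y * R * cadj Y) * (Y * cadj Y - csc z (cunit p)) = - csc z (cunit p)" .
  then have "T * (Y * cadj Y - csc z (cunit p)) = cunit p"
    using z0 by (simp add: T_def) (simp flip: csc_csc add: cmat_eqI)
  moreover have "corner p T"
  proof -
    have "corner p (Y * R * cadj Y)" using Y Y' by (simp add: corner_def mult.assoc flip: mult.assoc[of "cunit p"])
    then show ?thesis unfolding T_def by (intro corner_csc corner_diff corner_cunit)
  qed
  moreover have "corner p (Y * cadj Y - csc z (cunit p))"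
    by (intro corner_diff S2 corner_csc corner_cunit)
  ultimately have "resolvent p z (Y * cadj Y) = T"
    unfolding resolvent_def by (intro cinv_unique(2))
  moreover have "ctr (Y * R * cadj Y) = of_nat n + z * ctr R"
    using arg_cong[OF R, of ctr] by (metis ctr_add ctr_comm ctr_csc ctr_cunit mult.assoc)
  ultimately show "ctr (resolvent p z (Y * cadj Y)) = ctr (resolvent n z (cadj Y * Y)) - (of_nat p - of_nat n) / z"
    using z0 by (simp add: T_def R_def field_simps)
qed

section \<open>Gram matrices with independent rows\<close>

text \<open>Measurability is entrywise inside a fixed corner, so no Borel structure on
  \<open>cmat\<close> itself has to be examined.\<close>

definition cmat_measurable :: "nat \<Rightarrow> 'b measure \<Rightarrow> ('b \<Rightarrow> cmat) \<Rightarrow> bool" where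
  "cmat_measurable n M A \<longleftrightarrow> (\<forall>w. corner n (A w)) \<and> (\<forall>i j. (\<lambda>w. ent (A w) i j) \<in> borel_measurable M)"

lemma cmat_measurableD:
  assumes "cmat_measurable n M A"
  shows "corner n (A w)" "(\<lambda>w. ent (A w) i j) \<in> borel_measurable M"
  using assms by (auto simp: cmat_measurable_def)

lemma cmat_measurable_const: "corner n A \<Longrightarrow> cmat_measurable n M (\<lambda>_. A)"
  by (simp add: cmat_measurable_def)

lemma cmat_measurable_mult:
  assumes "cmat_measurable n M A" "cmat_measurable n M B"
  shows "cmat_measurable n M (\<lambda>w. A w * B w)"
proof -
  have "ent (A w * B w) i j = (\<Sum>k<n. ent (A w) i k * ent (B w) k j)" for w i j
    by (rule ent_mult) (use assms in \<open>auto simp: cmat_measurable_def corner_iff\<close>)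
  then show ?thesis
    unfolding cmat_measurable_def
    by (auto intro!: corner_mult borel_measurable_sum borel_measurable_times
        cmat_measurableD[OF assms(1)] cmat_measurableD[OF assms(2)])
qed

lemma cmat_measurable_cadj:
  assumes "cmat_measurable n M A"
  shows "cmat_measurable n M (\<lambda>w. cadj (A w))"
proof -
  have c: "cnj \<in> borel_measurable borel"
    by (intro borel_measurable_continuous_onI continuous_intros)
  show ?thesis
    using measurable_compose[OF cmat_measurableD(2)[OF assms] c] cmat_measurableD(1)[OF assms]
    by (auto simp: cmat_measurable_def intro: corner_cadj)
qed

lemma cmat_measurable_sum:
  "(\<And>i. i \<in> I \<Longrightarrow> cmat_measurable n M (A i)) \<Longrightarrow> cmat_measurable n M (\<lambda>w. \<Sum>i\<in>I. A i w)"
  unfolding cmat_measurable_def by (auto intro!: corner_sum borel_measurable_sum)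

lemma cmat_measurable_resolvent:
  "cmat_measurable n M A \<Longrightarrow> cmat_measurable n M (\<lambda>w. resolvent n z (A w))"
  unfolding cmat_measurable_def resolvent_def
  by (auto intro!: measurable_ent_cinv borel_measurable_diff simp del: ent_diff simp add: ent_diff[abs_def])

lemma ctr_measurable: "cmat_measurable n M A \<Longrightarrow> (\<lambda>w. ctr (A w)) \<in> borel_measurable M"
proof -
  assume A: "cmat_measurable n M A"
  then have "ctr (A w) = (\<Sum>i<n. ent (A w) i i)" for w
    by (intro ctr_eq) (auto simp: cmat_measurable_def corner_iff)
  then show ?thesis by (auto intro!: borel_measurable_sum cmat_measurableD[OF A])
qed

text \<open>Real and imaginary parts separately; (a + b)^2 <= 2 a^2 + 2 b^2 turns 55 into 2 * (55 +
  55) = 220.\<close>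

lemma mcdiarmid_moments_complex:
  fixes N :: "'i \<Rightarrow> 'b measure" and g :: "('i \<Rightarrow> 'b) \<Rightarrow> complex"
  assumes N: "\<And>i. prob_space (N i)" and I: "finite I" "I \<noteq> {}" and c: "c > 0"
    and g: "g \<in> borel_measurable (PiM I N)" and B: "\<And>X. X \<in> space (PiM I N) \<Longrightarrow> cmod (g X) \<le> B"
    and osc: "\<And>X i a b. X \<in> space (PiM I N) \<Longrightarrow> i \<in> I \<Longrightarrow> a \<in> space (N i) \<Longrightarrow> b \<in> space (N i) \<Longrightarrow>
      cmod (g (X(i := a)) - g (X(i := b))) \<le> c"
  shows "(\<integral>X. (cmod (g X - (\<integral>X. g X \<partial>PiM I N)))\<^sup>2 \<partial>PiM I N) \<le> 10 * c\<^sup>2 * card I"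
    and "(\<integral>X. (cmod (g X - (\<integral>X. g X \<partial>PiM I N))) ^ 4 \<partial>PiM I N) \<le> 220 * c ^ 4 * (card I)\<^sup>2"
proof -
  interpret P: prob_space "PiM I N" by (rule prob_space_PiM) (rule N)
  note [measurable] = g
  have gi: "integrable (PiM I N) g"
    by (rule P.integrable_const_bound[of _ B]) (use B g in auto)
  define \<mu> where "\<mu> = (\<integral>X. g X \<partial>PiM I N)"
  define R J where "R X = Re (g X) - Re \<mu>" and "J X = Im (g X) - Im \<mu>" for X
  have \<mu>: "Re \<mu> = (\<integral>X. Re (g X) \<partial>PiM I N)" "Im \<mu> = (\<integral>X. Im (g X) \<partial>PiM I N)"
    unfolding \<mu>_def using gi by (simp_all add: integral_Re integral_Im)
  have bd: "\<bar>Re (g X)\<bar> \<le> B" "\<bar>Im (g X)\<bar> \<le> B" if "X \<in> space (PiM I N)" for X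
    using B[OF that] abs_Re_le_cmod[of "g X"] abs_Im_le_cmod[of "g X"] by linarith+
  have os: "\<bar>Re (g (X(i := a))) - Re (g (X(i := b)))\<bar> \<le> c" "\<bar>Im (g (X(i := a))) - Im (g (X(i := b)))\<bar> \<le> c"
    if "X \<in> space (PiM I N)" "i \<in> I" "a \<in> space (N i)" "b \<in> space (N i)" for X i a b
    using osc[OF that] abs_Re_le_cmod[of "g (X(i := a)) - g (X(i := b))"]
      abs_Im_le_cmod[of "g (X(i := a)) - g (X(i := b))"] by simp_all
  have mR: "(\<lambda>X. Re (g X)) \<in> borel_measurable (PiM I N)" "(\<lambda>X. Im (g X)) \<in> borel_measurable (PiM I N)"
    by measurable
  note mr = mcdiarmid_moments[OF N I c mR(1) bd(1) os(1), folded \<mu> R_def]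
  note mi = mcdiarmid_moments[OF N I c mR(2) bd(2) os(2), folded \<mu> J_def]
  have [measurable]: "R \<in> borel_measurable (PiM I N)" "J \<in> borel_measurable (PiM I N)"
    unfolding R_def J_def by measurable
  have RJ: "\<bar>R X\<bar> \<le> B + cmod \<mu>" "\<bar>J X\<bar> \<le> B + cmod \<mu>" if "X \<in> space (PiM I N)" for X
    using bd[OF that] abs_Re_le_cmod[of \<mu>] abs_Im_le_cmod[of \<mu>] unfolding R_def J_def by linarith+
  have int: "integrable (PiM I N) (\<lambda>X. R X ^ k)" "integrable (PiM I N) (\<lambda>X. J X ^ k)" for k
    by (rule P.integrable_const_bound[of _ "(B + cmod \<mu>) ^ k"];
        use RJ in \<open>auto simp: power_abs intro!: power_mono\<close>)+
  have sq: "(cmod (g X - \<mu>))\<^sup>2 = (R X)\<^sup>2 + (J X)\<^sup>2" for X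
    by (simp add: cmod_power2 R_def J_def)
  show "(\<integral>X. (cmod (g X - (\<integral>X. g X \<partial>PiM I N)))\<^sup>2 \<partial>PiM I N) \<le> 10 * c\<^sup>2 * card I"
    unfolding \<mu>_def[symmetric] sq using int mr(1) mi(1) by simp
  have q: "(cmod (g X - \<mu>)) ^ 4 \<le> 2 * (R X) ^ 4 + 2 * (J X) ^ 4" for X
  proof -
    have "(cmod (g X - \<mu>)) ^ 4 = ((R X)\<^sup>2 + (J X)\<^sup>2)\<^sup>2"
      unfolding sq[symmetric] by (simp flip: power_mult)
    also have "\<dots> \<le> 2 * ((R X)\<^sup>2)\<^sup>2 + 2 * ((J X)\<^sup>2)\<^sup>2"
      using zero_le_power2[of "(R X)\<^sup>2 - (J X)\<^sup>2"] by (simp add: power2_eq_square algebra_simps)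
    finally show ?thesis by (simp flip: power_mult)
  qed
  have "(\<integral>X. (cmod (g X - \<mu>)) ^ 4 \<partial>PiM I N) \<le> (\<integral>X. 2 * (R X) ^ 4 + 2 * (J X) ^ 4 \<partial>PiM I N)"
    by (rule integral_mono') (use int q in auto)
  also have "\<dots> \<le> 220 * c ^ 4 * (card I)\<^sup>2" using int mr(2) mi(2) by simp
  finally show "(\<integral>X. (cmod (g X - (\<integral>X. g X \<partial>PiM I N))) ^ 4 \<partial>PiM I N) \<le> 220 * c ^ 4 * (card I)\<^sup>2"
    unfolding \<mu>_def .
qed

text \<open>The bound is put on the nonnegative integral, because integrability is part of what has
  to be derived; the rest is nonnegativity of the variance.\<close>

lemma (in prob_space) L1_of_L2:
  fixes g :: "'a \<Rightarrow> complex"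
  assumes g: "g \<in> borel_measurable M" and c: "0 \<le> c"
    and le: "(\<integral>\<^sup>+w. ennreal ((cmod (g w))\<^sup>2) \<partial>M) \<le> ennreal c"
  shows "integrable M g" "expectation (\<lambda>w. cmod (g w)) \<le> sqrt c"
proof -
  note [measurable] = g
  have i2: "integrable M (\<lambda>w. (cmod (g w))\<^sup>2)"
    by (rule integrableI_bounded) (use le_less_trans[OF le ennreal_less_top] in auto)
  have e2: "expectation (\<lambda>w. (cmod (g w))\<^sup>2) \<le> c"
    using le c nn_integral_eq_integral[OF i2] by simp
  have i1: "integrable M (\<lambda>w. cmod (g w))"
  proof (rule Bochner_Integration.integrable_bound)
    show "integrable M (\<lambda>w. (cmod (g w))\<^sup>2 + 1)" using i2 by simp
    have "x \<le> x\<^sup>2 + 1" for x :: real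
    proof -
      have "(x - 1)\<^sup>2 = x\<^sup>2 - 2 * x + 1" by (simp add: power2_eq_square algebra_simps)
      then show ?thesis using zero_le_power2[of "x - 1"] zero_le_power2[of x] by linarith
    qed
    then show "AE w in M. norm (cmod (g w)) \<le> norm ((cmod (g w))\<^sup>2 + 1)" by simp
  qed simp
  then show "integrable M g" by (subst (asm) integrable_norm_iff) auto
  have "(expectation (\<lambda>w. cmod (g w)))\<^sup>2 \<le> expectation (\<lambda>w. (cmod (g w))\<^sup>2)"
    using variance_positive[of "\<lambda>w. cmod (g w)"] variance_eq[OF i1 i2] by simp
  then show "expectation (\<lambda>w. cmod (g w)) \<le> sqrt c" using e2 by (intro real_le_rsqrt) simp
qed

text \<open>Replaces a square root of \<Gamma>: statements about Gram factors pass to the entrywise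
  limit. For the Toeplitz covariance the factors come from truncating the linear process.\<close>

definition gram_limit :: "nat \<Rightarrow> cmat \<Rightarrow> bool" where
  "gram_limit n \<Gamma> \<longleftrightarrow> corner n \<Gamma> \<and>
    (\<exists>G. \<forall>i j. (\<lambda>k::nat. ent (cadj (G k * cunit n) * (G k * cunit n)) i j) \<longlonglongrightarrow> ent \<Gamma> i j)"

lemma gram_limitE:
  assumes "gram_limit n \<Gamma>"
  obtains G :: "nat \<Rightarrow> cmat" where "\<And>k. G k * cunit n = G k" "\<And>i j. (\<lambda>k. ent (cadj (G k) * G k) i j) \<longlonglongrightarrow> ent \<Gamma> i j"
    "\<And>A. (\<lambda>k. ctr (G k * A * cadj (G k))) \<longlonglongrightarrow> ctr (A * \<Gamma>)"
proof -
  obtain G0 :: "nat \<Rightarrow> cmat" where G0: "\<And>i j. (\<lambda>k. ent (cadj (G0 k * cunit n) * (G0 k * cunit n)) i j) \<longlonglongrightarrow> ent \<Gamma> i j"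
    using assms unfolding gram_limit_def by blast
  define G where "G k = G0 k * cunit n" for k
  have G: "G k * cunit n = G k" for k by (simp add: G_def mult.assoc)
  have cadjG: "cunit n * cadj (G k) = cadj (G k)" for k using G by (metis cadj_cunit cadj_mult)
  have lim: "(\<lambda>k. ent (cadj (G k) * G k) i j) \<longlonglongrightarrow> ent \<Gamma> i j" for i j
    using G0 by (simp add: G_def)
  have cor: "corner n (cadj (G k) * G k)" for k
    unfolding corner_def using G cadjG by (metis mult.assoc)
  have cor\<Gamma>: "corner n \<Gamma>" using assms by (simp add: gram_limit_def)
  have "(\<lambda>k. ctr (G k * A * cadj (G k))) \<longlonglongrightarrow> ctr (A * \<Gamma>)" for A
  proof -
    have eq: "ctr (A * B) = (\<Sum>i<n. \<Sum>k<n. ent A i k * ent B k i)" if "corner n B" for B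
      by (rule ctr_mult) (use that in \<open>auto simp: corner_iff\<close>)
    have "(\<lambda>k. ctr (A * (cadj (G k) * G k))) \<longlonglongrightarrow> ctr (A * \<Gamma>)"
      unfolding eq[OF cor] eq[OF cor\<Gamma>] by (intro tendsto_intros lim)
    moreover have "ctr (G k * A * cadj (G k)) = ctr (A * (cadj (G k) * G k))" for k
      by (metis ctr_comm mult.assoc)
    ultimately show ?thesis by simp
  qed
  then show ?thesis using that[of G] G lim by blast
qed

lemma gram_limit_psd:
  assumes "gram_limit n \<Gamma>" shows "psd \<Gamma>"
proof -
  obtain G :: "nat \<Rightarrow> cmat" where G: "\<And>k. G k * cunit n = G k" "\<And>i j. (\<lambda>k. ent (cadj (G k) * G k) i j) \<longlonglongrightarrow> ent \<Gamma> i j"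
    "\<And>A. (\<lambda>k. ctr (G k * A * cadj (G k))) \<longlonglongrightarrow> ctr (A * \<Gamma>)"
    by (rule gram_limitE[OF assms], rule that)
  have "cadj \<Gamma> = \<Gamma>"
  proof (rule cmat_eqI)
    fix i j
    have "(\<lambda>k. cnj (ent (cadj (G k) * G k) j i)) \<longlonglongrightarrow> cnj (ent \<Gamma> j i)" by (intro tendsto_cnj G)
    moreover have "cnj (ent (cadj (G k) * G k) j i) = ent (cadj (G k) * G k) i j" for k
      by (metis cadj_cadj cadj_mult ent_cadj)
    ultimately show "ent (cadj \<Gamma>) i j = ent \<Gamma> i j" using G(2)[of i j] LIMSEQ_unique by simp blast
  qed
  moreover have "0 \<le> Re (ctr (cadj U * (\<Gamma> * U)))" for U
  proof -
    have e: "ctr (cadj U * (\<Gamma> * U)) = ctr ((U * cadj U) * \<Gamma>)"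
      using ctr_comm[of "cadj U" "\<Gamma> * U"] ctr_comm[of \<Gamma> "U * cadj U"] by (simp add: mult.assoc)
    have "(\<lambda>k. Re (ctr (G k * (U * cadj U) * cadj (G k)))) \<longlonglongrightarrow> Re (ctr ((U * cadj U) * \<Gamma>))"
      by (intro tendsto_Re G)
    moreover have "0 \<le> Re (ctr (G k * (U * cadj U) * cadj (G k)))" for k
    proof -
      have "ctr (G k * (U * cadj U) * cadj (G k)) = ctr (cadj (cadj (G k * U)) * cadj (G k * U))"
        by (simp add: mult.assoc)
      then show ?thesis unfolding ctr_cadj_self by simp
    qed
    ultimately show ?thesis unfolding e by (intro LIMSEQ_le_const) auto
  qed
  ultimately show ?thesis unfolding psd_def by blast
qed

text \<open>The trace against \<Gamma> is a limit of forms of the kind treated in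
  \<open>resolvent_form\<close>, and weak inequalities survive the limit.\<close>

lemma gram_limit_resolvent_form:
  assumes \<Gamma>: "gram_limit n \<Gamma>" and S: "psd S" "corner n S" and z: "Im z > 0"
  shows "0 \<le> Im (ctr (\<Gamma> * resolvent n z S))" "0 \<le> Im (z * ctr (\<Gamma> * resolvent n z S))"
proof -
  obtain G :: "nat \<Rightarrow> cmat" where G: "\<And>k. G k * cunit n = G k"
    "\<And>i j. (\<lambda>k. ent (cadj (G k) * G k) i j) \<longlonglongrightarrow> ent \<Gamma> i j"
    "\<And>A. (\<lambda>k. ctr (G k * A * cadj (G k))) \<longlonglongrightarrow> ctr (A * \<Gamma>)"
    by (rule gram_limitE[OF \<Gamma>], rule that)
  have e: "ctr (\<Gamma> * resolvent n z S) = ctr (resolvent n z S * \<Gamma>)" by (rule ctr_comm)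
  have "0 \<le> Im (ctr (G k * resolvent n z S * cadj (G k)))" for k
    using resolvent_form(1)[OF S z G(1)] z by simp
  moreover have "(\<lambda>k. Im (ctr (G k * resolvent n z S * cadj (G k)))) \<longlonglongrightarrow> Im (ctr (resolvent n z S * \<Gamma>))"
    by (intro tendsto_Im G(3))
  ultimately show "0 \<le> Im (ctr (\<Gamma> * resolvent n z S))"
    unfolding e by (intro LIMSEQ_le_const) auto
  have "0 \<le> Im (z * ctr (G k * resolvent n z S * cadj (G k)))" for k
    by (rule resolvent_form(3)[OF S z G(1)])
  moreover have "(\<lambda>k. Im (z * ctr (G k * resolvent n z S * cadj (G k)))) \<longlonglongrightarrow> Im (z * ctr (resolvent n z S * \<Gamma>))"
    by (intro tendsto_Im tendsto_mult tendsto_const G(3))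
  ultimately show "0 \<le> Im (z * ctr (\<Gamma> * resolvent n z S))"
    unfolding e by (intro LIMSEQ_le_const) auto
qed

text \<open>All that the argument uses about the rows: independence through the product measure, a
  common \<Gamma>, and a mean square deviation of quadratic forms from their trace of order |A|^2.
  The row laws themselves may differ.\<close>

locale sample_model =
  fixes p n :: nat and N :: "nat \<Rightarrow> (nat \<Rightarrow> real) measure" and \<Gamma> :: cmat and L \<kappa> :: real and z :: complex
  assumes N: "\<And>i. prob_space (N i)" and setsN: "\<And>i. sets (N i) = sets (PiM {..<n} (\<lambda>_. borel))"
    and p: "p \<ge> 1" and n: "n \<ge> 1"
    and \<Gamma>: "gram_limit n \<Gamma>" and L: "op_bound L \<Gamma>" "0 < L" and \<kappa>: "0 \<le> \<kappa>"
    and z: "Im z > 0"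
    and form: "\<And>i A. i < p \<Longrightarrow> corner n A \<Longrightarrow>
      (\<integral>\<^sup>+x. ennreal ((cmod (of_nat p * ctr (row_vec p n x * A * cadj (row_vec p n x)) - ctr (A * \<Gamma>)))\<^sup>2) \<partial>N i)
        \<le> ennreal (\<kappa> * (norm A)\<^sup>2)"
begin

abbreviation "P \<equiv> PiM {..<p} N"
abbreviation "R X \<equiv> resolvent n z (sample_cov p n X)"
abbreviation "R' X i \<equiv> loo_resolvent p n z X i"
abbreviation "\<eta> \<equiv> Im z"

sublocale P: prob_space P by (rule prob_space_PiM) (rule N)

lemma corner\<Gamma> [simp]: "corner n \<Gamma>" using \<Gamma> by (simp add: gram_limit_def)

lemma coord_measurable: "t < n \<Longrightarrow> (\<lambda>x. x t) \<in> borel_measurable (N i)"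
  unfolding measurable_cong_sets[OF setsN refl] by measurable

lemma entry_measurable [measurable]: "i < p \<Longrightarrow> t < n \<Longrightarrow> (\<lambda>X. X i t) \<in> borel_measurable P"
proof -
  assume i: "i < p" "t < n"
  show ?thesis
    using i coord_measurable[of t i] by (intro measurable_compose[OF measurable_component_singleton[of i "{..<p}" N]]) auto
qed

lemma row_measurable:
  assumes "\<And>t. t < n \<Longrightarrow> (\<lambda>w. x w t) \<in> borel_measurable M"
  shows "cmat_measurable n M (\<lambda>w. row_vec p n (x w))"
  unfolding cmat_measurable_def
proof (intro conjI allI)
  show "corner n (row_vec p n (x w))" for w using n by (auto simp: corner_iff row_vec_def)
  show "(\<lambda>w. ent (row_vec p n (x w)) i j) \<in> borel_measurable M" for i j
    using assms[of j] by (cases "i < 1 \<and> j < n") (auto simp: row_vec_def)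
qed

lemma cov_measurable:
  assumes "\<And>i t. i < p \<Longrightarrow> t < n \<Longrightarrow> (\<lambda>w. Y w i t) \<in> borel_measurable M"
  shows "cmat_measurable n M (\<lambda>w. resolvent n z (sample_cov p n (Y w)))"
  unfolding sample_cov_def
  by (intro cmat_measurable_resolvent cmat_measurable_sum cmat_measurable_mult cmat_measurable_cadj
      row_measurable assms) auto

lemma R_measurable: "cmat_measurable n P (\<lambda>X. R X)"
  by (rule cov_measurable) measurable

lemma R'_measurable: "cmat_measurable n P (\<lambda>X. R' X i)"
  unfolding loo_resolvent_def
proof (rule cov_measurable)
  fix k t assume kt: "k < p" "t < n"
  show "(\<lambda>X. (X(i := \<lambda>_. 0)) k t) \<in> borel_measurable P"
    using entry_measurable[OF kt] by (cases "k = i") auto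
qed

lemma op_R: "op_bound (1 / \<eta>) (R X)" and op_R': "op_bound (1 / \<eta>) (R' X i)"
  unfolding loo_resolvent_def by (intro op_bound_resolvent psd_sample_cov corner_sample_cov z)+

lemma corner_R' [simp]: "corner n (R' X i)" by (simp add: loo_resolvent_def)

lemma ctr_bound:
  assumes "op_bound l A" "0 \<le> l" "corner n A"
  shows "cmod (ctr (A * R X)) \<le> l / \<eta> * n"
  using cmod_ctr_le_op_bound[OF corner_mult[OF assms(3) corner_resolvent]
      op_bound_mult[OF assms(1) op_R assms(2)]] z by simp

text \<open>Both configurations are compared with the one where row i is zero, which they share.
  Hence the factor 2, and no restriction on the rows \<open>a\<close> and \<open>b\<close>.\<close>

lemma osc:
  assumes A: "op_bound l A" "0 \<le> l" and i: "i < p"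
  shows "cmod (ctr (A * R (X(i := a))) - ctr (A * R (X(i := b)))) \<le> 2 * l / \<eta>"
proof -
  have e: "R' (X(i := v)) i = R' X i" for v by (simp add: loo_resolvent_def)
  have "cmod (ctr (A * R (X(i := v))) - ctr (A * R' X i)) \<le> l / \<eta>" for v
    using leave_one_out(4)[OF i z A, of n "X(i := v)"] unfolding e .
  from norm_triangle_le_diff[OF add_mono[OF this[of a] this[of b]]]
  show ?thesis by simp
qed

lemma concentration:
  assumes A: "op_bound l A" "0 < l" "corner n A"
  defines "T \<equiv> \<lambda>X. ctr (A * R X)"
  shows "T \<in> borel_measurable P" "integrable P T"
    and "P.expectation (\<lambda>X. (cmod (T X - P.expectation T))\<^sup>2) \<le> 10 * (2 * l / \<eta>)\<^sup>2 * p"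
    and "P.expectation (\<lambda>X. (cmod (T X - P.expectation T)) ^ 4) \<le> 220 * (2 * l / \<eta>) ^ 4 * p\<^sup>2"
proof -
  have c: "2 * l / \<eta> > 0" using A z by simp
  show Tm: "T \<in> borel_measurable P"
    unfolding T_def by (rule ctr_measurable[OF cmat_measurable_mult[OF cmat_measurable_const[OF A(3)] R_measurable]])
  have TB: "cmod (T X) \<le> l / \<eta> * n" for X
    unfolding T_def by (rule ctr_bound) (use A in auto)
  show "integrable P T"
    by (rule P.integrable_const_bound[of _ "l / \<eta> * n"]) (use TB Tm in auto)
  have os: "cmod (T (X(i := a)) - T (X(i := b))) \<le> 2 * l / \<eta>" if "i \<in> {..<p}" for X i a b
    unfolding T_def by (rule osc) (use A that in auto)
  have ne: "{..<p} \<noteq> {}" using p by (auto simp: lessThan_empty_iff)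
  show "P.expectation (\<lambda>X. (cmod (T X - P.expectation T))\<^sup>2) \<le> 10 * (2 * l / \<eta>)\<^sup>2 * p"
    "P.expectation (\<lambda>X. (cmod (T X - P.expectation T)) ^ 4) \<le> 220 * (2 * l / \<eta>) ^ 4 * p\<^sup>2"
    using mcdiarmid_moments_complex[where N = N and g = T and B = "l / \<eta> * n",
        OF N finite_lessThan[of p] ne c Tm] TB os by simp_all
qed

text \<open>The leave-one-out resolvent does not see row i. With the other rows fixed,
  \<open>form\<close> applies to row i and the constant matrix \<open>A = R' x i * D\<close>, whose
  Frobenius norm is at most \<open>d / \<eta> * sqrt n\<close>; the outer integral then costs
  nothing.\<close>

lemma loo_concentration:
  assumes i: "i < p" and D: "corner n D" "op_bound d D" "0 \<le> d"
  defines "g \<equiv> \<lambda>X. ctr (row_vec p n (X i) * (R' X i * D) * cadj (row_vec p n (X i))) - ctr (R' X i * D * \<Gamma>) / of_nat p"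
  shows "g \<in> borel_measurable P" "integrable P g"
    and "P.expectation (\<lambda>X. cmod (g X)) \<le> sqrt (\<kappa> * n) * d / (\<eta> * p)"
proof -
  have rm: "cmat_measurable n P (\<lambda>X. row_vec p n (X i))"
    by (rule row_measurable) (use i in measurable)
  have mD: "cmat_measurable n P (\<lambda>X. R' X i * D)"
    by (intro cmat_measurable_mult R'_measurable cmat_measurable_const D)
  show gm: "g \<in> borel_measurable P"
    unfolding g_def
    by (intro borel_measurable_diff borel_measurable_divide borel_measurable_const ctr_measurable[of n]
        cmat_measurable_mult cmat_measurable_cadj cmat_measurable_const rm R'_measurable D corner\<Gamma>)
  define c where "c = \<kappa> * n * d\<^sup>2 / (\<eta>\<^sup>2 * (real p)\<^sup>2)"
  have c0: "0 \<le> c" using \<kappa> by (simp add: c_def)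
  let ?I = "{..<p} - {i}"
  have ins: "insert i ?I = {..<p}" using i by auto
  interpret product_sigma_finite N
    by (simp add: product_sigma_finite_def N prob_space_imp_sigma_finite)
  interpret Q: prob_space "PiM ?I N" by (rule prob_space_PiM) (rule N)
  have "(\<integral>\<^sup>+X. ennreal ((cmod (g X))\<^sup>2) \<partial>P) = (\<integral>\<^sup>+X. ennreal ((cmod (g X))\<^sup>2) \<partial>PiM (insert i ?I) N)"
    unfolding ins ..
  also have "\<dots> = (\<integral>\<^sup>+x. (\<integral>\<^sup>+y. ennreal ((cmod (g (x(i := y))))\<^sup>2) \<partial>N i) \<partial>PiM ?I N)"
    by (rule product_nn_integral_insert) (use gm in \<open>simp_all only: ins finite_Diff finite_lessThan, auto\<close>)
  also have "\<dots> \<le> (\<integral>\<^sup>+x. ennreal c \<partial>PiM ?I N)"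
  proof (rule nn_integral_mono)
    fix x
    define A where "A = R' x i * D"
    have A: "corner n A" unfolding A_def by (intro corner_mult corner_R' D)
    have e: "R' (x(i := v)) i = R' x i" for v by (simp add: loo_resolvent_def)
    have gx: "ennreal ((cmod (g (x(i := y))))\<^sup>2) =
        ennreal ((cmod (of_nat p * ctr (row_vec p n y * A * cadj (row_vec p n y)) - ctr (A * \<Gamma>)))\<^sup>2) / ennreal ((real p)\<^sup>2)" for y
    proof -
      have "g (x(i := y)) = (of_nat p * ctr (row_vec p n y * A * cadj (row_vec p n y)) - ctr (A * \<Gamma>)) / of_nat p"
        using p unfolding g_def e A_def[symmetric] by (simp add: diff_divide_distrib)
      then have "(cmod (g (x(i := y))))\<^sup>2 =
          (cmod (of_nat p * ctr (row_vec p n y * A * cadj (row_vec p n y)) - ctr (A * \<Gamma>)))\<^sup>2 / (real p)\<^sup>2"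
        by (simp add: norm_divide power_divide)
      then show ?thesis using p by (simp add: divide_ennreal)
    qed
    have "norm A \<le> d / \<eta> * sqrt n"
    proof -
      have "norm A = norm (A * cunit n)" using A by (simp add: corner_def)
      also have "\<dots> \<le> (1 / \<eta> * d) * norm (cunit n)"
        using op_bound_mult[OF op_R'[of x i] D(2)] z D(3) unfolding A_def op_bound_def by simp
      finally show ?thesis by (simp add: norm_cunit)
    qed
    then have "(norm A)\<^sup>2 \<le> (d / \<eta> * sqrt n)\<^sup>2" by (rule power_mono) simp
    then have nA: "(norm A)\<^sup>2 \<le> d\<^sup>2 / \<eta>\<^sup>2 * n" by (simp add: power_mult_distrib power_divide)
    have "(\<integral>\<^sup>+y. ennreal ((cmod (g (x(i := y))))\<^sup>2) \<partial>N i) =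
      (\<integral>\<^sup>+y. ennreal ((cmod (of_nat p * ctr (row_vec p n y * A * cadj (row_vec p n y)) - ctr (A * \<Gamma>)))\<^sup>2) \<partial>N i) / ennreal ((real p)\<^sup>2)"
      unfolding gx
    proof (rule nn_integral_divide)
      have "cmat_measurable n (N i) (\<lambda>y. row_vec p n y)"
        by (rule row_measurable) (rule coord_measurable)
      then have "(\<lambda>y. ctr (row_vec p n y * A * cadj (row_vec p n y))) \<in> borel_measurable (N i)"
        by (intro ctr_measurable[of n] cmat_measurable_mult cmat_measurable_cadj cmat_measurable_const A)
      then show "(\<lambda>y. ennreal ((cmod (of_nat p * ctr (row_vec p n y * A * cadj (row_vec p n y)) - ctr (A * \<Gamma>)))\<^sup>2)) \<in> borel_measurable (N i)"
        by measurable
    qed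
    also have "\<dots> \<le> ennreal (\<kappa> * (norm A)\<^sup>2) / ennreal ((real p)\<^sup>2)"
      by (intro divide_right_mono_ennreal form i A)
    also have "\<dots> = ennreal (\<kappa> * (norm A)\<^sup>2 / (real p)\<^sup>2)"
      using p \<kappa> by (simp add: divide_ennreal)
    also have "\<dots> \<le> ennreal c"
    proof (rule ennreal_leI)
      have "\<kappa> * (norm A)\<^sup>2 / (real p)\<^sup>2 \<le> \<kappa> * (d\<^sup>2 / \<eta>\<^sup>2 * n) / (real p)\<^sup>2"
        using nA \<kappa> by (intro divide_right_mono mult_left_mono) auto
      then show "\<kappa> * (norm A)\<^sup>2 / (real p)\<^sup>2 \<le> c" by (simp add: c_def mult_ac)
    qed
    finally show "(\<integral>\<^sup>+y. ennreal ((cmod (g (x(i := y))))\<^sup>2) \<partial>N i) \<le> ennreal c" .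
  qed
  also have "\<dots> = ennreal c" by (simp add: Q.emeasure_space_1)
  finally have le: "(\<integral>\<^sup>+X. ennreal ((cmod (g X))\<^sup>2) \<partial>P) \<le> ennreal c" .
  show "integrable P g" by (rule P.L1_of_L2(1)[OF gm c0 le])
  have "c = (sqrt (\<kappa> * n) * d / (\<eta> * p))\<^sup>2"
    using \<kappa> by (simp add: c_def power_divide power_mult_distrib)
  moreover have "0 \<le> sqrt (\<kappa> * n) * d / (\<eta> * p)"
    using D z \<kappa> by (intro divide_nonneg_nonneg mult_nonneg_nonneg) auto
  ultimately have sq: "sqrt c = sqrt (\<kappa> * n) * d / (\<eta> * p)"
    by (simp only: real_sqrt_abs abs_of_nonneg)
  show "P.expectation (\<lambda>X. cmod (g X)) \<le> sqrt (\<kappa> * n) * d / (\<eta> * p)"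
    using P.L1_of_L2(2)[OF gm c0 le] unfolding sq .
qed

end

section \<open>The deterministic equivalent and its error bounds\<close>

context sample_model
begin

text \<open>\<open>gam\<close> is the limiting value of the leave-one-out forms and \<open>cinv n (csc bet \<Gamma> - csc z (cunit n))\<close>
  the deterministic equivalent of the resolvent.\<close>

definition "gam = P.expectation (\<lambda>X. ctr (\<Gamma> * R X)) / of_nat p"
definition "bet = 1 / (1 + gam)"
definition "K = cinv n (csc bet \<Gamma> - csc z (cunit n))"
text \<open>Mean error of a leave-one-out form against \<open>gam\<close>. Its terms stem from the
  randomness of one row (\<open>\<kappa>\<close>), the removal of that row (\<open>L\<close>), and
  the fluctuation of the trace around its mean (\<open>7 * L * sqrt p\<close>).\<close>

definition "\<rho> = (sqrt (\<kappa> * n) + L + 7 * L * sqrt p) / (\<eta> * p)"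

lemma conc_\<Gamma>: "(\<lambda>X. ctr (\<Gamma> * R X)) \<in> borel_measurable P" "integrable P (\<lambda>X. ctr (\<Gamma> * R X))"
  "P.expectation (\<lambda>X. (cmod (ctr (\<Gamma> * R X) - P.expectation (\<lambda>X. ctr (\<Gamma> * R X))))\<^sup>2) \<le> 10 * (2 * L / \<eta>)\<^sup>2 * p"
  using concentration[OF L corner\<Gamma>] by auto

lemma Im_gam: "0 \<le> Im gam" "0 \<le> Im (z * gam)"
proof -
  have i: "integrable P (\<lambda>X. z * ctr (\<Gamma> * R X))" using conc_\<Gamma>(2) by simp
  note g = gram_limit_resolvent_form[OF \<Gamma> psd_sample_cov corner_sample_cov z]
  have "0 \<le> P.expectation (\<lambda>X. Im (ctr (\<Gamma> * R X)))"
    by (rule Bochner_Integration.integral_nonneg) (rule g(1))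
  then show "0 \<le> Im gam"
    using integral_Im[OF conc_\<Gamma>(2)] p by (simp add: gam_def Im_divide_of_nat)
  have "0 \<le> P.expectation (\<lambda>X. Im (z * ctr (\<Gamma> * R X)))"
    by (rule Bochner_Integration.integral_nonneg) (rule g(2))
  also have "\<dots> = Im (z * P.expectation (\<lambda>X. ctr (\<Gamma> * R X)))"
    using integral_Im[OF i] by simp
  finally have "0 \<le> Im ((z * P.expectation (\<lambda>X. ctr (\<Gamma> * R X))) / of_nat p)"
    unfolding Im_divide_of_nat using p by simp
  then show "0 \<le> Im (z * gam)" by (simp add: gam_def)
qed

lemma gam_ne: "1 + gam \<noteq> 0" and cmod_bet: "cmod bet \<le> cmod z / \<eta>" and Im_bet: "Im bet \<le> 0"
proof -
  have "\<eta> \<le> Im (z * (1 + gam))" using Im_gam by (simp add: distrib_left)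
  also have "\<dots> \<le> cmod (z * (1 + gam))" using abs_Im_le_cmod by (metis abs_le_D1)
  finally have le: "\<eta> \<le> cmod z * cmod (1 + gam)" by (simp add: norm_mult)
  then show ne: "1 + gam \<noteq> 0" using z by auto
  then show "cmod bet \<le> cmod z / \<eta>"
    using le z by (simp add: bet_def norm_divide divide_simps mult.commute)
  show "Im bet \<le> 0"
    using Im_gam(1) by (simp add: bet_def Im_divide divide_nonpos_nonneg)
qed

lemma K_props: "K * (csc bet \<Gamma> - csc z (cunit n)) = cunit n" "op_bound (1 / \<eta>) K" "corner n K"
  using resolvent_props[OF gram_limit_psd[OF \<Gamma>] corner\<Gamma> z Im_bet] by (simp_all add: K_def)

lemma op_\<Gamma>K: "op_bound (L / \<eta>) (\<Gamma> * K)" "op_bound (L / \<eta> * L) (\<Gamma> * K * \<Gamma>)"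
  "corner n (\<Gamma> * K)" "corner n (\<Gamma> * K * \<Gamma>)"
proof -
  show 1: "op_bound (L / \<eta>) (\<Gamma> * K)"
    using op_bound_mult[OF L(1) K_props(2)] L(2) z by simp
  show "op_bound (L / \<eta> * L) (\<Gamma> * K * \<Gamma>)"
    by (rule op_bound_mult[OF 1 L(1)]) (use L(2) z in auto)
  show "corner n (\<Gamma> * K)" "corner n (\<Gamma> * K * \<Gamma>)" by (intro corner_mult corner\<Gamma> K_props(3))+
qed

definition "q X i = loo_form p n z X i"
text \<open>The form of row i that is left when the row is split off in the trace of \<Gamma> K S R,
  with S the sample covariance. Its predicted value is \<open>t\<close>, the normalised trace
  against \<Gamma>.\<close>

definition "d X i = ctr (row_vec p n (X i) * (R' X i * (\<Gamma> * K)) * cadj (row_vec p n (X i)))"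
definition "t X i = ctr (R' X i * (\<Gamma> * K) * \<Gamma>) / of_nat p"

lemma inv_q: "i < p \<Longrightarrow> 1 + q X i \<noteq> 0" "i < p \<Longrightarrow> cmod (1 / (1 + q X i)) \<le> cmod z / \<eta>"
  using leave_one_out(1,2)[OF _ z] by (simp_all add: q_def)

lemma q_form: "q X i = ctr (row_vec p n (X i) * (R' X i * cunit n) * cadj (row_vec p n (X i)))"
  using corner_R'[of X i] by (simp add: q_def loo_form_def corner_def)

lemma q_dev:
  assumes i: "i < p"
  shows "integrable P (\<lambda>X. cmod (q X i - gam))" "P.expectation (\<lambda>X. cmod (q X i - gam)) \<le> \<rho>"
    "(\<lambda>X. q X i) \<in> borel_measurable P"
proof -
  define g1 where "g1 X = q X i - ctr (R' X i * \<Gamma>) / of_nat p" for X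
  have R'u: "R' X i * cunit n * \<Gamma> = R' X i * \<Gamma>" for X
    using corner\<Gamma> by (simp add: mult.assoc corner_def)
  note lc = loo_concentration[OF i corner_cunit op_bound_cunit, simplified, folded q_form, unfolded R'u, folded g1_def]
  define g2 where "g2 X = ctr (\<Gamma> * R X) / of_nat p - gam" for X
  have g2m: "g2 \<in> borel_measurable P" unfolding g2_def using conc_\<Gamma>(1) by measurable
  have int4: "P.expectation (\<lambda>X. (cmod (g2 X))\<^sup>2) \<le> 10 * (2 * L / \<eta>)\<^sup>2 / p"
  proof -
    have "g2 X = (ctr (\<Gamma> * R X) - P.expectation (\<lambda>X. ctr (\<Gamma> * R X))) / of_nat p" for X
      by (simp add: g2_def gam_def diff_divide_distrib)
    then have e: "(cmod (g2 X))\<^sup>2 = (cmod (ctr (\<Gamma> * R X) - P.expectation (\<lambda>X. ctr (\<Gamma> * R X))))\<^sup>2 / (real p)\<^sup>2" for X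
      by (simp add: norm_divide power_divide)
    have "P.expectation (\<lambda>X. (cmod (g2 X))\<^sup>2) =
        P.expectation (\<lambda>X. (cmod (ctr (\<Gamma> * R X) - P.expectation (\<lambda>X. ctr (\<Gamma> * R X))))\<^sup>2) / (real p)\<^sup>2"
      unfolding e by simp
    also have "\<dots> \<le> 10 * (2 * L / \<eta>)\<^sup>2 * p / (real p)\<^sup>2"
      by (intro divide_right_mono conc_\<Gamma>(3)) simp
    finally show ?thesis using p by (simp add: power2_eq_square)
  qed
  have g2b: "cmod (g2 X) \<le> L / \<eta> * n + cmod gam" for X
  proof -
    have "cmod (ctr (\<Gamma> * R X) / of_nat p) \<le> cmod (ctr (\<Gamma> * R X)) / 1"
      unfolding norm_divide using p by (intro frac_le) auto
    also have "\<dots> \<le> L / \<eta> * n" using ctr_bound[OF L(1) _ corner\<Gamma>, of X] L(2) by simp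
    finally show ?thesis unfolding g2_def
      by (meson add_mono norm_triangle_ineq4 order_refl order_trans)
  qed
  have i2: "integrable P (\<lambda>X. (cmod (g2 X))\<^sup>2)"
    by (rule P.integrable_const_bound[of _ "(L / \<eta> * n + cmod gam)\<^sup>2"]) (use g2b g2m in \<open>auto intro!: power_mono\<close>)
  have "(\<integral>\<^sup>+X. ennreal ((cmod (g2 X))\<^sup>2) \<partial>P) = ennreal (P.expectation (\<lambda>X. (cmod (g2 X))\<^sup>2))"
    by (rule nn_integral_eq_integral[OF i2]) simp
  also have "\<dots> \<le> ennreal (10 * (2 * L / \<eta>)\<^sup>2 / p)" by (rule ennreal_leI[OF int4])
  finally have le2: "(\<integral>\<^sup>+X. ennreal ((cmod (g2 X))\<^sup>2) \<partial>P) \<le> ennreal (10 * (2 * L / \<eta>)\<^sup>2 / p)" .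
  note l2 = P.L1_of_L2[OF g2m _ le2]
  have s2: "P.expectation (\<lambda>X. cmod (g2 X)) \<le> 7 * L / (\<eta> * sqrt p)"
  proof -
    \<comment> \<open>The 7 is the first integer above the square root of 40.\<close>
    have "10 * (2 * L / \<eta>)\<^sup>2 / p \<le> (7 * L / (\<eta> * sqrt p))\<^sup>2"
    proof -
      have "(7 * L / (\<eta> * sqrt p))\<^sup>2 = 49 * (L / \<eta>)\<^sup>2 / p" by (simp add: power_divide power_mult_distrib)
      moreover have "10 * (2 * L / \<eta>)\<^sup>2 / p = 40 * (L / \<eta>)\<^sup>2 / p"
      proof -
        have "(2 * L / \<eta>)\<^sup>2 = 4 * (L / \<eta>)\<^sup>2" by (simp add: power_divide power_mult_distrib)
        show ?thesis unfolding \<open>(2 * L / \<eta>)\<^sup>2 = 4 * (L / \<eta>)\<^sup>2\<close> by simp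
      qed
      moreover have "40 * (L / \<eta>)\<^sup>2 / p \<le> 49 * (L / \<eta>)\<^sup>2 / p" by (intro divide_right_mono) auto
      ultimately show ?thesis by (simp only:)
    qed
    then have "sqrt (10 * (2 * L / \<eta>)\<^sup>2 / p) \<le> 7 * L / (\<eta> * sqrt p)"
      using L(2) z by (intro real_le_lsqrt) auto
    then show ?thesis using l2(2) by simp
  qed
  have d3: "cmod (ctr (R' X i * \<Gamma>) / of_nat p - ctr (\<Gamma> * R X) / of_nat p) \<le> L / (\<eta> * p)" for X
  proof -
    have "cmod (ctr (\<Gamma> * R X) - ctr (\<Gamma> * R' X i)) \<le> L / \<eta>"
      by (rule leave_one_out(4)[OF i z L(1)]) (use L(2) in simp)
    then have "cmod (ctr (R' X i * \<Gamma>) - ctr (\<Gamma> * R X)) / p \<le> L / \<eta> / p"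
      by (intro divide_right_mono) (simp_all add: norm_minus_commute ctr_comm[of _ \<Gamma>])
    then show ?thesis by (simp add: norm_divide flip: diff_divide_distrib)
  qed
  have bound: "cmod (q X i - gam) \<le> cmod (g1 X) + (L / (\<eta> * p) + cmod (g2 X))" for X
  proof -
    have eq: "q X i - gam = g1 X + ((ctr (R' X i * \<Gamma>) / of_nat p - ctr (\<Gamma> * R X) / of_nat p) + g2 X)"
      by (simp add: g1_def g2_def)
    have "cmod (q X i - gam) \<le> cmod (g1 X) + (cmod (ctr (R' X i * \<Gamma>) / of_nat p - ctr (\<Gamma> * R X) / of_nat p) + cmod (g2 X))"
      unfolding eq by (rule order_trans[OF norm_triangle_ineq add_left_mono[OF norm_triangle_ineq]])
    also have "\<dots> \<le> cmod (g1 X) + (L / (\<eta> * p) + cmod (g2 X))"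
      by (intro add_left_mono add_right_mono d3)
    finally show ?thesis .
  qed
  have int: "integrable P (\<lambda>X. cmod (g1 X) + (L / (\<eta> * p) + cmod (g2 X)))"
    using lc(2) l2(1) by simp
  show qm: "(\<lambda>X. q X i) \<in> borel_measurable P"
  proof -
    have "(\<lambda>X. ctr (R' X i * \<Gamma>)) \<in> borel_measurable P"
      by (intro ctr_measurable[of n] cmat_measurable_mult R'_measurable cmat_measurable_const corner\<Gamma>)
    then have "(\<lambda>X. g1 X + ctr (R' X i * \<Gamma>) / of_nat p) \<in> borel_measurable P"
      using lc(1) by measurable
    then show ?thesis by (simp add: g1_def)
  qed
  show "integrable P (\<lambda>X. cmod (q X i - gam))"
    by (rule Bochner_Integration.integrable_bound[OF int]) (use qm bound order_trans[OF bound abs_ge_self] in auto)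
  have "P.expectation (\<lambda>X. cmod (q X i - gam)) \<le> P.expectation (\<lambda>X. cmod (g1 X) + (L / (\<eta> * p) + cmod (g2 X)))"
    by (rule integral_mono'[OF int bound])
      (use L(2) z in \<open>auto intro!: add_nonneg_nonneg divide_nonneg_nonneg\<close>)
  also have "\<dots> = P.expectation (\<lambda>X. cmod (g1 X)) + (L / (\<eta> * p) + P.expectation (\<lambda>X. cmod (g2 X)))"
    using lc(2) l2(1) by (simp add: P.prob_space)
  also have "\<dots> \<le> sqrt (\<kappa> * n) / (\<eta> * p) + (L / (\<eta> * p) + 7 * L / (\<eta> * sqrt p))"
    using lc(3) s2 by (intro add_mono) auto
  also have "\<dots> = \<rho>"
  proof -
    have "7 * L / (\<eta> * sqrt p) = 7 * L * sqrt p / (\<eta> * p)"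
      using p z by (simp add: frac_eq_eq)
    then show ?thesis by (simp add: \<rho>_def add_divide_distrib)
  qed
  finally show "P.expectation (\<lambda>X. cmod (q X i - gam)) \<le> \<rho>" .
qed

lemma d_dev:
  assumes i: "i < p"
  shows "integrable P (\<lambda>X. cmod (d X i - t X i))"
    "P.expectation (\<lambda>X. cmod (d X i - t X i)) \<le> sqrt (\<kappa> * n) * (L / \<eta>) / (\<eta> * p)"
  using loo_concentration[OF i op_\<Gamma>K(3,1)] L(2) z by (simp_all add: d_def t_def)

lemma bet_diff: "i < p \<Longrightarrow> cmod (bet - 1 / (1 + q X i)) \<le> (cmod z / \<eta>)\<^sup>2 * cmod (q X i - gam)"
proof -
  assume i: "i < p"
  have "bet - 1 / (1 + q X i) = (q X i - gam) * (bet * (1 / (1 + q X i)))"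
    using gam_ne inv_q(1)[OF i, of X] by (simp add: bet_def field_simps)
  then have "cmod (bet - 1 / (1 + q X i)) = cmod (q X i - gam) * (cmod bet * cmod (1 / (1 + q X i)))"
    by (simp only: norm_mult)
  also have "\<dots> \<le> cmod (q X i - gam) * ((cmod z / \<eta>) * (cmod z / \<eta>))"
    using cmod_bet inv_q(2)[OF i, of X] z by (intro mult_left_mono mult_mono) auto
  finally show ?thesis by (simp add: power2_eq_square mult.commute)
qed

text \<open>By \<open>companion_stieltjes_eq\<close> the transform is - 1/z times the average of 1 /
  (1 + q_i); each summand is exchanged for \<open>bet\<close>, and the mean of that error is
  controlled by \<open>q_dev\<close>.\<close>

lemma companion_expectation:
  "cmod (P.expectation (companion_stieltjes p n z) + bet / z) \<le> (cmod z / \<eta>)\<^sup>2 * \<rho> / cmod z"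
  "integrable P (companion_stieltjes p n z)"
proof -
  have z0: "z \<noteq> 0" using z by auto
  have iR: "integrable P (\<lambda>X. ctr (R X))"
  proof -
    have "cunit n * R X = R X" for X using corner_resolvent[of n z] by (simp add: corner_def)
    then show ?thesis using concentration(2)[OF op_bound_cunit _ corner_cunit] by simp
  qed
  then show int: "integrable P (companion_stieltjes p n z)"
    unfolding companion_stieltjes_def by simp
  have e: "companion_stieltjes p n z X + bet / z = (\<Sum>i<p. bet - 1 / (1 + q X i)) / (z * of_nat p)" for X
    using z0 p by (simp add: companion_stieltjes_eq[OF z] sum_subtractf q_def diff_divide_distrib)
  have "cmod (P.expectation (companion_stieltjes p n z) + bet / z) =
      cmod (P.expectation (\<lambda>X. companion_stieltjes p n z X + bet / z))"
    using int by (simp add: P.prob_space)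
  also have "\<dots> \<le> P.expectation (\<lambda>X. cmod (companion_stieltjes p n z X + bet / z))"
    by (rule integral_norm_bound)
  also have "\<dots> \<le> P.expectation (\<lambda>X. (\<Sum>i<p. (cmod z / \<eta>)\<^sup>2 * cmod (q X i - gam)) / (cmod z * p))"
  proof (rule integral_mono')
    show "integrable P (\<lambda>X. (\<Sum>i<p. (cmod z / \<eta>)\<^sup>2 * cmod (q X i - gam)) / (cmod z * p))"
      using q_dev(1) by (intro integrable_divide integrable_sum integrable_mult_right) auto
    fix X
    have "cmod (\<Sum>i<p. bet - 1 / (1 + q X i)) \<le> (\<Sum>i<p. (cmod z / \<eta>)\<^sup>2 * cmod (q X i - gam))"
      by (rule sum_norm_le) (use bet_diff in auto)
    then show "cmod (companion_stieltjes p n z X + bet / z) \<le> (\<Sum>i<p. (cmod z / \<eta>)\<^sup>2 * cmod (q X i - gam)) / (cmod z * p)"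
      unfolding e norm_divide norm_mult by (simp add: divide_right_mono)
  qed (intro divide_nonneg_nonneg sum_nonneg mult_nonneg_nonneg, simp_all)
  also have "\<dots> = (\<Sum>i<p. (cmod z / \<eta>)\<^sup>2 * P.expectation (\<lambda>X. cmod (q X i - gam))) / (cmod z * p)"
    unfolding integral_divide_zero
    by (subst Bochner_Integration.integral_sum) (use q_dev(1) in \<open>auto intro!: integrable_mult_right\<close>)
  also have "\<dots> \<le> (\<Sum>i<p. (cmod z / \<eta>)\<^sup>2 * \<rho>) / (cmod z * p)"
    by (intro divide_right_mono sum_mono mult_left_mono) (use q_dev(2) in auto)
  also have "\<dots> = (cmod z / \<eta>)\<^sup>2 * \<rho> / cmod z" using p by simp
  finally show "cmod (P.expectation (companion_stieltjes p n z) + bet / z) \<le> (cmod z / \<eta>)\<^sup>2 * \<rho> / cmod z" .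
qed

text \<open>The resolvent identity gives R - K = K (bet \<Gamma> - S) R with S the sample
  covariance. In the trace against \<Gamma> the rows of S contribute d_i / (1 + q_i), to be compared
  with bet tr (D R) / p. Three exchanges produce the three errors: R for the leave-one-out
  resolvent, \<open>bet\<close> for 1 / (1 + q_i), and d_i for t_i.\<close>

lemma gam_equation:
  "cmod (gam - ctr (\<Gamma> * K) / of_nat p) \<le>
    (cmod z / \<eta>) * (L / \<eta> * L) / (\<eta> * p) +
    ((L / \<eta>)\<^sup>2 * n / p * (cmod z / \<eta>)\<^sup>2 * \<rho> + (cmod z / \<eta>) * (sqrt (\<kappa> * n) * (L / \<eta>) / (\<eta> * p)))"
proof -
  let ?\<beta> = "cmod z / \<eta>"
  define D where "D = \<Gamma> * K * \<Gamma>"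
  define \<tau> where "\<tau> = (L / \<eta>)\<^sup>2 * n / p"
  have LL: "0 \<le> L / \<eta> * L" "0 \<le> L / \<eta>" using L(2) z by auto
  have term1: "cmod (ctr (D * R X) - ctr (D * R' X i)) \<le> L / \<eta> * L / \<eta>" if "i < p" for X i
    unfolding D_def by (rule leave_one_out(4)[OF that z op_\<Gamma>K(2) LL(1)])
  have tb: "cmod (t X i) \<le> \<tau>" for X i
  proof -
    have "op_bound (1 / \<eta> * (L / \<eta> * L)) (R' X i * (\<Gamma> * K * \<Gamma>))"
      by (rule op_bound_mult[OF op_R' op_\<Gamma>K(2)]) (use z LL in auto)
    then have "cmod (ctr (R' X i * (\<Gamma> * K * \<Gamma>))) \<le> 1 / \<eta> * (L / \<eta> * L) * n"
      by (intro cmod_ctr_le_op_bound corner_mult corner_R' op_\<Gamma>K)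
    then have "cmod (ctr (R' X i * (\<Gamma> * K * \<Gamma>))) / p \<le> 1 / \<eta> * (L / \<eta> * L) * n / p"
      by (intro divide_right_mono) auto
    then show ?thesis by (simp add: t_def \<tau>_def norm_divide power2_eq_square mult.assoc)
  qed
  have td: "of_nat p * t X i = ctr (D * R' X i)" for X i
    using p ctr_comm[of D "R' X i"] by (simp add: t_def D_def mult.assoc)
  have ident: "ctr (\<Gamma> * R X) - ctr (\<Gamma> * K) = (\<Sum>i<p. bet / of_nat p * ctr (D * R X) - d X i / (1 + q X i))" for X
  proof -
    define BK BR where "BK = csc bet \<Gamma> - csc z (cunit n)" and "BR = sample_cov p n X - csc z (cunit n)"
    have K1: "K * BK = cunit n" using K_props(1) by (simp add: BK_def)
    have R1: "BR * R X = cunit n" unfolding BR_def by (rule resolvent_right[OF psd_sample_cov corner_sample_cov z])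
    have u: "cunit n * R X = R X" "K * cunit n = K" using corner_resolvent[of n z] K_props(3) by (simp_all add: corner_def)
    have "K * (BK - BR) * R X = (K * BK) * R X - K * (BR * R X)" by (simp add: algebra_simps)
    then have "R X - K = K * (csc bet \<Gamma> - sample_cov p n X) * R X"
      unfolding K1 R1 u by (simp add: BK_def BR_def)
    then have "\<Gamma> * (R X - K) = \<Gamma> * (K * (csc bet \<Gamma> - sample_cov p n X) * R X)" by simp
    then have "ctr (\<Gamma> * R X) - ctr (\<Gamma> * K) = ctr (\<Gamma> * (K * (csc bet \<Gamma> - sample_cov p n X) * R X))"
      unfolding right_diff_distrib[of \<Gamma>] ctr_diff[symmetric] by (rule arg_cong)
    also have "\<dots> = bet * ctr (D * R X) - ctr (\<Gamma> * K * sample_cov p n X * R X)"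
      by (simp add: D_def left_diff_distrib right_diff_distrib mult.assoc)
    also have "ctr (\<Gamma> * K * sample_cov p n X * R X) = (\<Sum>i<p. d X i / (1 + q X i))"
    proof -
      have "ctr (\<Gamma> * K * sample_cov p n X * R X) =
          (\<Sum>i<p. ctr (row_vec p n (X i) * R X * (\<Gamma> * K * cadj (row_vec p n (X i)))))"
      proof -
        have "\<Gamma> * K * sample_cov p n X * R X = (\<Sum>i<p. (\<Gamma> * K * cadj (row_vec p n (X i))) * (row_vec p n (X i) * R X))"
          by (simp add: sample_cov_def sum_distrib_left sum_distrib_right mult.assoc)
        then show ?thesis by (simp only: ctr_sum ctr_comm[of "\<Gamma> * K * cadj _"])
      qed
      also have "\<dots> = (\<Sum>i<p. d X i / (1 + q X i))"
      proof (rule sum.cong[OF refl])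
        fix i assume "i \<in> {..<p}"
        then have i: "i < p" by simp
        show "ctr (row_vec p n (X i) * R X * (\<Gamma> * K * cadj (row_vec p n (X i)))) = d X i / (1 + q X i)"
          unfolding leave_one_out(3)[OF i z] by (simp add: d_def q_def mult.assoc)
      qed
      finally show ?thesis .
    qed
    finally show ?thesis using p by (simp add: sum_subtractf)
  qed
  have each: "cmod (bet / of_nat p * ctr (D * R X) - d X i / (1 + q X i)) \<le>
      ?\<beta> * (L / \<eta> * L) / (\<eta> * p) + (\<tau> * ?\<beta>\<^sup>2 * cmod (q X i - gam) + ?\<beta> * cmod (d X i - t X i))" if i: "i < p" for X i
  proof -
    have eq: "bet / of_nat p * ctr (D * R X) - d X i / (1 + q X i) =
        bet / of_nat p * (ctr (D * R X) - ctr (D * R' X i)) +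
        (t X i * (bet - 1 / (1 + q X i)) + - (d X i - t X i) * (1 / (1 + q X i)))"
    proof -
      have "b / P' * A - x * u = b / P' * (A - P' * y) + (y * (b - u) + - (x - y) * u)"
        if "P' \<noteq> 0" for b P' A x u y :: complex
        using that by (simp add: field_simps)
      from this[of "of_nat p" bet "ctr (D * R X)" "d X i" "1 / (1 + q X i)" "t X i"]
      show ?thesis unfolding td[symmetric] using p by simp
    qed
    have "cmod (bet / of_nat p * ctr (D * R X) - d X i / (1 + q X i)) \<le>
        cmod (bet / of_nat p * (ctr (D * R X) - ctr (D * R' X i))) +
        (cmod (t X i * (bet - 1 / (1 + q X i))) + cmod (- (d X i - t X i) * (1 / (1 + q X i))))"
      unfolding eq by (rule order_trans[OF norm_triangle_ineq add_left_mono[OF norm_triangle_ineq]])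
    also have "\<dots> \<le> ?\<beta> * (L / \<eta> * L) / (\<eta> * p) + (\<tau> * ?\<beta>\<^sup>2 * cmod (q X i - gam) + ?\<beta> * cmod (d X i - t X i))"
    proof (intro add_mono)
      have "cmod bet / p * cmod (ctr (D * R X) - ctr (D * R' X i)) \<le> ?\<beta> / p * (L / \<eta> * L / \<eta>)"
        using cmod_bet term1[OF i] z by (intro mult_mono divide_right_mono) auto
      then show "cmod (bet / of_nat p * (ctr (D * R X) - ctr (D * R' X i))) \<le> ?\<beta> * (L / \<eta> * L) / (\<eta> * p)"
        by (simp add: norm_mult norm_divide mult_ac)
      have "cmod (t X i) * cmod (bet - 1 / (1 + q X i)) \<le> \<tau> * (?\<beta>\<^sup>2 * cmod (q X i - gam))"
        using tb bet_diff[OF i] order_trans[OF norm_ge_zero tb] by (intro mult_mono) auto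
      then show "cmod (t X i * (bet - 1 / (1 + q X i))) \<le> \<tau> * ?\<beta>\<^sup>2 * cmod (q X i - gam)"
        by (simp add: norm_mult mult.assoc)
      have "cmod (d X i - t X i) * cmod (1 / (1 + q X i)) \<le> cmod (d X i - t X i) * ?\<beta>"
        using inv_q(2)[OF i] by (intro mult_left_mono) auto
      then show "cmod (- (d X i - t X i) * (1 / (1 + q X i))) \<le> ?\<beta> * cmod (d X i - t X i)"
        by (simp only: norm_mult norm_minus_cancel mult.commute)
    qed
    finally show ?thesis .
  qed
  define c1 c2 where "c1 = ?\<beta> * (L / \<eta> * L) / (\<eta> * p)" and "c2 = \<tau> * ?\<beta>\<^sup>2"
  define W where "W X i = c1 + (c2 * cmod (q X i - gam) + ?\<beta> * cmod (d X i - t X i))" for X i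
  have c2: "0 \<le> c2" using LL by (simp add: c2_def \<tau>_def)
  have Wi: "integrable P (\<lambda>X. W X i)" if "i < p" for i
    unfolding W_def using q_dev(1)[OF that] d_dev(1)[OF that] by simp
  have We: "P.expectation (\<lambda>X. W X i) \<le> c1 + (c2 * \<rho> + ?\<beta> * (sqrt (\<kappa> * n) * (L / \<eta>) / (\<eta> * p)))" if i: "i < p" for i
  proof -
    have "P.expectation (\<lambda>X. W X i) = c1 + (c2 * P.expectation (\<lambda>X. cmod (q X i - gam)) + ?\<beta> * P.expectation (\<lambda>X. cmod (d X i - t X i)))"
      unfolding W_def using q_dev(1)[OF i] d_dev(1)[OF i] by (simp add: P.prob_space)
    also have "\<dots> \<le> c1 + (c2 * \<rho> + ?\<beta> * (sqrt (\<kappa> * n) * (L / \<eta>) / (\<eta> * p)))"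
      using q_dev(2)[OF i] d_dev(2)[OF i] c2 z by (intro add_mono order_refl mult_left_mono) auto
    finally show ?thesis .
  qed
  have "gam - ctr (\<Gamma> * K) / of_nat p = P.expectation (\<lambda>X. (ctr (\<Gamma> * R X) - ctr (\<Gamma> * K)) / of_nat p)"
    using conc_\<Gamma>(2) by (simp add: gam_def P.prob_space diff_divide_distrib)
  then have "cmod (gam - ctr (\<Gamma> * K) / of_nat p) \<le> P.expectation (\<lambda>X. cmod ((ctr (\<Gamma> * R X) - ctr (\<Gamma> * K)) / of_nat p))"
    by (simp only: integral_norm_bound)
  also have "\<dots> \<le> P.expectation (\<lambda>X. (\<Sum>i<p. W X i) / p)"
  proof (rule integral_mono')
    show "integrable P (\<lambda>X. (\<Sum>i<p. W X i) / p)" using Wi by (intro integrable_divide integrable_sum) auto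
    fix X
    have "cmod (ctr (\<Gamma> * R X) - ctr (\<Gamma> * K)) \<le> (\<Sum>i<p. W X i)"
      unfolding ident W_def c1_def c2_def by (rule sum_norm_le) (use each in auto)
    then show "cmod ((ctr (\<Gamma> * R X) - ctr (\<Gamma> * K)) / of_nat p) \<le> (\<Sum>i<p. W X i) / p"
      unfolding norm_divide by (simp add: divide_right_mono)
    then show "0 \<le> (\<Sum>i<p. W X i) / p" by (rule order_trans[OF norm_ge_zero])
  qed
  also have "\<dots> = (\<Sum>i<p. P.expectation (\<lambda>X. W X i)) / p"
    unfolding integral_divide_zero
    by (subst Bochner_Integration.integral_sum) (use Wi in auto)
  also have "\<dots> \<le> (\<Sum>i<p. c1 + (c2 * \<rho> + ?\<beta> * (sqrt (\<kappa> * n) * (L / \<eta>) / (\<eta> * p)))) / p"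
    by (intro divide_right_mono sum_mono We) auto
  also have "\<dots> = c1 + (c2 * \<rho> + ?\<beta> * (sqrt (\<kappa> * n) * (L / \<eta>) / (\<eta> * p)))" using p by simp
  finally show ?thesis unfolding c1_def c2_def \<tau>_def .
qed

text \<open>The fourth power is taken because the second would give only 1 / p, which is not
  summable. The constant is 220 * 2^4, the oscillation of the trace being 2 / \<eta>.\<close>

lemma companion_fourth_moment:
  "P.expectation (\<lambda>X. (cmod (companion_stieltjes p n z X - P.expectation (companion_stieltjes p n z))) ^ 4)
    \<le> 3520 / (\<eta> ^ 4 * (real p)\<^sup>2)"
proof -
  have u: "cunit n * R X = R X" for X using corner_resolvent[of n z] by (simp add: corner_def)
  note c = concentration[OF op_bound_cunit _ corner_cunit, simplified, unfolded u]
  have "P.expectation (companion_stieltjes p n z) = P.expectation (\<lambda>X. ctr (R X)) / of_nat p - (1 - of_nat n / of_nat p) / z"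
    unfolding companion_stieltjes_def using c(2) by (simp add: P.prob_space)
  then have "companion_stieltjes p n z X - P.expectation (companion_stieltjes p n z) =
      (ctr (R X) - P.expectation (\<lambda>X. ctr (R X))) / of_nat p" for X
    by (simp add: companion_stieltjes_def diff_divide_distrib)
  then have "P.expectation (\<lambda>X. (cmod (companion_stieltjes p n z X - P.expectation (companion_stieltjes p n z))) ^ 4) =
      P.expectation (\<lambda>X. (cmod (ctr (R X) - P.expectation (\<lambda>X. ctr (R X)))) ^ 4) / (real p) ^ 4"
    by (simp add: norm_divide power_divide)
  also have "\<dots> \<le> 220 * (2 / \<eta>) ^ 4 * p\<^sup>2 / (real p) ^ 4"
    using c(4) by (intro divide_right_mono) (simp_all add: power_divide)
  also have "\<dots> = 3520 / (\<eta> ^ 4 * (real p)\<^sup>2)"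
  proof -
    have "220 * (2 / e) ^ 4 * P\<^sup>2 / P ^ 4 = 3520 / (e ^ 4 * P\<^sup>2)" if "P > 0" "e > 0" for e P :: real
      using that by (simp add: field_simps eval_nat_numeral)
    from this[of "real p" \<eta>] show ?thesis using p z by simp
  qed
  finally show ?thesis .
qed

end

section \<open>Toeplitz matrices\<close>

text \<open>\<open>e_vec n \<omega>\<close> is the column of Fourier exponentials, an approximate eigenvector of every
  Toeplitz matrix for the value of its symbol at \<open>\<omega>\<close>.\<close>

definition e_vec :: "nat \<Rightarrow> real \<Rightarrow> cmat" where
  "e_vec n \<omega> = cm n 1 (\<lambda>j _. cis (real j * \<omega>))"

definition toeplitz :: "nat \<Rightarrow> (int \<Rightarrow> real) \<Rightarrow> cmat" where
  "toeplitz n \<gamma> = cm n n (\<lambda>j k. complex_of_real (\<gamma> (int j - int k)))"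

lemma corner_toeplitz [simp]: "corner n (toeplitz n \<gamma>)"
  by (simp add: toeplitz_def corner_cm)

lemma e_vec_unit [simp]: "cunit n * e_vec n \<omega> = e_vec n \<omega>"
  by (rule cmat_eqI) (simp add: e_vec_def)

lemma norm_column_square:
  assumes "n \<ge> 1"
  shows "(norm (cm n 1 v))\<^sup>2 = (\<Sum>j<n. (cmod (v j 0))\<^sup>2)"
proof -
  have "corner n (cm n 1 v)" using assms by (auto simp: corner_iff)
  then have "(norm (cm n 1 v))\<^sup>2 = (\<Sum>j<n. \<Sum>k<n. (cmod (ent (cm n 1 v) j k))\<^sup>2)"
    by (intro norm_cmat_square corner_csize)
  also have "\<dots> = (\<Sum>j<n. \<Sum>k\<in>{0}. (cmod (ent (cm n 1 v) j k))\<^sup>2)"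
    using assms by (intro sum.cong[OF refl] sum.mono_neutral_right) auto
  also have "\<dots> = (\<Sum>j<n. (cmod (v j 0))\<^sup>2)" by simp
  finally show ?thesis .
qed

lemma norm_e_vec: "n \<ge> 1 \<Longrightarrow> norm (e_vec n \<omega>) = sqrt n"
  using norm_column_square[of n "\<lambda>j _. cis (real j * \<omega>)"]
  by (simp add: e_vec_def real_sqrt_unique)

lemma ctr_e_vec_form:
  assumes "corner n A"
  shows "ctr (cadj (e_vec n \<omega>) * (A * e_vec n \<omega>)) =
    (\<Sum>j<n. \<Sum>k<n. ent A j k * cis ((real k - real j) * \<omega>))"
proof -
  have "ctr (cadj (e_vec n \<omega>) * (A * e_vec n \<omega>)) = (\<Sum>i<1. \<Sum>j<n. cnj (ent (e_vec n \<omega>) j i) * ent (A * e_vec n \<omega>) j i)"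
    by (subst ctr_mult[of 1 _ _ n]) (auto simp: e_vec_def)
  also have "\<dots> = (\<Sum>j<n. cnj (ent (e_vec n \<omega>) j 0) * (\<Sum>k<n. ent A j k * ent (e_vec n \<omega>) k 0))"
    using assms by (simp add: ent_mult[of n A _ "e_vec n \<omega>"] corner_iff)
  also have "\<dots> = (\<Sum>j<n. \<Sum>k<n. ent A j k * cis ((real k - real j) * \<omega>))"
  proof (simp only: sum_distrib_left, intro sum.cong refl)
    fix j k assume "j \<in> {..<n}" "k \<in> {..<n}"
    have "cnj (cis (real j * \<omega>)) * cis (real k * \<omega>) = cis ((real k - real j) * \<omega>)"
      by (simp add: cis_cnj cis_mult algebra_simps)
    then show "cnj (ent (e_vec n \<omega>) j 0) * (ent A j k * ent (e_vec n \<omega>) k 0) = ent A j k * cis ((real k - real j) * \<omega>)"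
      using \<open>j \<in> _\<close> \<open>k \<in> _\<close> by (simp add: e_vec_def mult_ac)
  qed
  finally show ?thesis .
qed

lemma has_integral_cis:
  fixes h :: int
  shows "((\<lambda>x. cis (of_int h * x)) has_integral (if h = 0 then 2 * pi else 0)) {0..2*pi}"
proof (cases "h = 0")
  case True
  then show ?thesis using has_integral_const_real[of "1 :: complex" 0 "2*pi"] by (simp add: scaleR_conv_of_real)
next
  case False
  have "((\<lambda>x. cis (of_int h * x)) has_integral
      cis (of_int h * (2 * pi)) / (\<i> * of_int h) - cis (of_int h * 0) / (\<i> * of_int h)) {0..2*pi}"
  proof (rule fundamental_theorem_of_calculus)
    fix x :: real
    have "((\<lambda>x. exp (\<i> * of_int h * complex_of_real x) / (\<i> * of_int h)) has_vector_derivative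
        exp (\<i> * of_int h * complex_of_real x)) (at x within {0..2*pi})"
      using False by (auto intro!: derivative_eq_intros has_vector_derivative_real_field)
    then show "((\<lambda>x. cis (of_int h * x) / (\<i> * of_int h)) has_vector_derivative cis (of_int h * x)) (at x within {0..2*pi})"
      by (simp add: cis_conv_exp mult.assoc)
  qed simp
  moreover have "cis (of_int h * (2 * pi)) = 1"
    using cis_multiple_2pi[of "of_int h"] by (simp add: mult_ac)
  ultimately show ?thesis using False by simp
qed

text \<open>The exponentials at all frequencies resolve the identity: off-diagonal entries carry a
  nonzero integer frequency and integrate to 0. A trace is thus an average of forms over
  \<omega>.\<close>

lemma has_integral_e_vec_form:
  assumes A: "corner n A"
  shows "((\<lambda>\<omega>. ctr (cadj (e_vec n \<omega>) * (A * e_vec n \<omega>))) has_integral 2 * pi * ctr A) {0..2*pi}"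
proof -
  have "((\<lambda>\<omega>. \<Sum>j<n. \<Sum>k<n. ent A j k * cis (of_int (int k - int j) * \<omega>)) has_integral
      (\<Sum>j<n. \<Sum>k<n. ent A j k * (if int k - int j = 0 then 2 * pi else 0))) {0..2*pi}"
    by (intro has_integral_sum finite_lessThan has_integral_mult_right has_integral_cis)
  moreover have "(\<Sum>j<n. \<Sum>k<n. ent A j k * (if int k - int j = 0 then 2 * pi else 0)) = 2 * pi * ctr A"
  proof -
    have "(\<Sum>j<n. \<Sum>k<n. ent A j k * (if int k - int j = 0 then 2 * pi else 0)) =
        (\<Sum>j<n. \<Sum>k<n. if k = j then ent A j k * (2 * pi) else 0)"
      by (intro sum.cong refl) auto
    also have "\<dots> = (\<Sum>j<n. ent A j j * (2 * pi))" by simp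
    also have "\<dots> = 2 * pi * ctr A"
      using A by (simp add: ctr_eq[of n] corner_iff sum_distrib_left mult.commute)
    finally show ?thesis .
  qed
  ultimately show ?thesis using ctr_e_vec_form[OF A] by simp
qed



text \<open>The mass of \<gamma> at the lags that a row of the finite matrix cuts off, averaged over
  the rows.\<close>

definition toeplitz_tail :: "(int \<Rightarrow> real) \<Rightarrow> nat \<Rightarrow> real" where
  "toeplitz_tail \<gamma> n = (\<Sum>j<n. \<Sum>\<^sub>\<infinity>l\<in>-{0..<int n}. \<bar>\<gamma> (int j - l)\<bar>) / real n"

lemma summable_on_shift_int:
  fixes \<gamma> :: "int \<Rightarrow> real"
  assumes "\<gamma> summable_on UNIV"
  shows "(\<lambda>l. \<gamma> (j - l)) summable_on A"
proof -
  have "bij_betw (\<lambda>l. j - l) UNIV (UNIV :: int set)"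
    by (rule bij_betwI[of _ _ _ "\<lambda>l. j - l"]) auto
  then have "(\<lambda>l. \<gamma> (j - l)) summable_on UNIV"
    using assms summable_on_reindex_bij_betw[of "\<lambda>l. j - l" UNIV UNIV \<gamma>] by simp
  then show ?thesis by (rule summable_on_subset_banach) auto
qed

lemma infsum_shift_int:
  fixes \<gamma> :: "int \<Rightarrow> real"
  shows "(\<Sum>\<^sub>\<infinity>l. \<gamma> (j - l)) = (\<Sum>\<^sub>\<infinity>l. \<gamma> l)"
proof -
  have "bij_betw (\<lambda>l. j - l) UNIV (UNIV :: int set)"
    by (rule bij_betwI[of _ _ _ "\<lambda>l. j - l"]) auto
  then show ?thesis by (rule infsum_reindex_bij_betw)
qed

text \<open>Rows at distance at least \<open>H\<close> from both ends keep almost all of the mass.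
  At most \<open>2 * H\<close> boundary rows remain, each losing at most the total mass
  \<open>S\<close>, and the average makes them negligible.\<close>

lemma toeplitz_tail_tendsto_0:
  fixes \<gamma> :: "int \<Rightarrow> real"
  assumes \<gamma>: "(\<lambda>h. \<bar>\<gamma> h\<bar>) summable_on UNIV"
  shows "toeplitz_tail \<gamma> \<longlonglongrightarrow> 0"
proof (rule LIMSEQ_I)
  fix \<epsilon> :: real assume \<epsilon>: "\<epsilon> > 0"
  define S where "S = (\<Sum>\<^sub>\<infinity>h. \<bar>\<gamma> h\<bar>)"
  have S0: "S \<ge> 0" unfolding S_def by (rule infsum_nonneg) auto
  have "((\<lambda>h. \<bar>\<gamma> h\<bar>) has_sum S) UNIV" using \<gamma> by (simp add: S_def)
  then have "\<forall>\<^sub>F F in finite_subsets_at_top UNIV. S - \<epsilon> / 4 < (\<Sum>h\<in>F. \<bar>\<gamma> h\<bar>)"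
    unfolding has_sum_def using \<epsilon> by (intro order_tendstoD(1)) auto
  then obtain F :: "int set" where F: "finite F" "S - \<epsilon> / 4 < (\<Sum>h\<in>F. \<bar>\<gamma> h\<bar>)"
    unfolding eventually_finite_subsets_at_top by auto
  obtain H :: nat where H: "\<And>h. h \<in> F \<Longrightarrow> \<bar>h\<bar> \<le> int H"
  proof -
    have "\<forall>h\<in>F. \<bar>h\<bar> \<le> int (nat (\<Sum>h\<in>F. \<bar>h\<bar>))" using F(1) by (simp add: member_le_sum sum_nonneg)
    then show ?thesis using that by blast
  qed
  \<comment> \<open>With this \<open>N\<close> the boundary rows contribute less than a quarter of
    \<open>\<epsilon> * n\<close>; the interior rows account for another quarter.\<close>
  obtain N :: nat where N: "real N > 8 * real H * S / \<epsilon>" using reals_Archimedean2 by blast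
  show "\<exists>no. \<forall>n\<ge>no. norm (toeplitz_tail \<gamma> n - 0) < \<epsilon>"
  proof (intro exI[of _ "max N 1"] allI impI)
    fix n assume n: "n \<ge> max N 1"
    let ?T = "\<lambda>j::nat. \<Sum>\<^sub>\<infinity>l\<in>-{0..<int n}. \<bar>\<gamma> (int j - l)\<bar>"
    have T0: "0 \<le> ?T j" for j by (rule infsum_nonneg) auto
    have TS: "?T j \<le> S" for j
    proof -
      have "?T j \<le> (\<Sum>\<^sub>\<infinity>l. \<bar>\<gamma> (int j - l)\<bar>)"
        by (rule infsum_mono_neutral) (use summable_on_shift_int[OF \<gamma>] in auto)
      then show ?thesis unfolding S_def infsum_shift_int[of "\<lambda>h. \<bar>\<gamma> h\<bar>"] .
    qed
    have mid: "?T j \<le> \<epsilon> / 4" if j: "H \<le> j" "j + H < n" for j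
    proof -
      have dis: "(\<lambda>h. int j - h) ` F \<inter> -{0..<int n} = {}" using H j by fastforce
      have inj: "inj_on (\<lambda>h. int j - h) F" by (auto simp: inj_on_def)
      have "?T j + (\<Sum>h\<in>F. \<bar>\<gamma> h\<bar>) = ?T j + (\<Sum>\<^sub>\<infinity>l\<in>(\<lambda>h. int j - h) ` F. \<bar>\<gamma> (int j - l)\<bar>)"
        using F(1) inj by (simp add: sum.reindex)
      also have "\<dots> = (\<Sum>\<^sub>\<infinity>l\<in>-{0..<int n} \<union> (\<lambda>h. int j - h) ` F. \<bar>\<gamma> (int j - l)\<bar>)"
        by (rule infsum_Un_disjoint[symmetric]) (use summable_on_shift_int[OF \<gamma>] dis in auto)
      also have "\<dots> \<le> (\<Sum>\<^sub>\<infinity>l. \<bar>\<gamma> (int j - l)\<bar>)"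
        by (rule infsum_mono_neutral) (use summable_on_shift_int[OF \<gamma>] in auto)
      also have "\<dots> = S" unfolding S_def infsum_shift_int[of "\<lambda>h. \<bar>\<gamma> h\<bar>"] ..
      finally show ?thesis using F(2) by linarith
    qed
    have "(\<Sum>j<n. ?T j) \<le> (\<Sum>j<n. \<epsilon> / 4 + (if j < H \<or> n \<le> j + H then S else 0))"
      by (intro sum_mono) (use mid TS \<epsilon> S0 in \<open>force simp: not_less intro: order_trans\<close>)
    also have "\<dots> = real n * (\<epsilon> / 4) + S * real (card {j. j < n \<and> (j < H \<or> n \<le> j + H)})"
      by (simp add: sum.distrib sum.If_cases Int_def conj_commute)
    also have "\<dots> \<le> real n * (\<epsilon> / 4) + S * (2 * real H)"
    proof -
      have "card {j. j < n \<and> (j < H \<or> n \<le> j + H)} \<le> card ({..<H} \<union> {n - H..<n})"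
        by (intro card_mono) auto
      also have "\<dots> \<le> H + H" using card_Un_le[of "{..<H}" "{n - H..<n}"] by simp
      finally show ?thesis using S0 by (intro add_left_mono mult_left_mono) auto
    qed
    finally have le: "(\<Sum>j<n. ?T j) \<le> real n * (\<epsilon> / 4) + S * (2 * real H)" .
    have "8 * real H * S < \<epsilon> * real N" using N \<epsilon> by (simp add: divide_less_eq mult.commute)
    also have "\<dots> \<le> \<epsilon> * real n" using n \<epsilon> by (intro mult_left_mono) auto
    finally have "S * (2 * real H) < real n * (\<epsilon> / 4)" by (simp add: mult_ac)
    moreover have "real n * (\<epsilon> / 4) = (\<epsilon> * real n) / 4" by simp
    moreover have "0 < \<epsilon> * real n" using n \<epsilon> by simp
    ultimately have "(\<Sum>j<n. ?T j) < \<epsilon> * real n" using le by linarith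
    then have "toeplitz_tail \<gamma> n < \<epsilon>" using n by (simp add: toeplitz_tail_def divide_less_eq)
    moreover have "0 \<le> toeplitz_tail \<gamma> n" unfolding toeplitz_tail_def by (intro divide_nonneg_nonneg sum_nonneg T0) auto
    ultimately show "norm (toeplitz_tail \<gamma> n - 0) < \<epsilon>" by simp
  qed
qed

section \<open>The symbol, approximate eigenvectors and Szego's limit for resolvents\<close>

locale toeplitz_symbol =
  fixes \<gamma> :: "int \<Rightarrow> real" and f :: "real \<Rightarrow> real" and S :: real
  assumes symbol: "\<And>\<omega>. \<omega> \<in> {0..2*pi} \<Longrightarrow>
      ((\<lambda>h. complex_of_real (\<gamma> h) * cis (- (of_int h * \<omega>))) has_sum complex_of_real (f \<omega>)) UNIV"
    and abs_sum: "((\<lambda>h. \<bar>\<gamma> h\<bar>) has_sum S) UNIV"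
    and psd_toeplitz: "\<And>n. psd (toeplitz n \<gamma>)"
    and f_cont: "continuous_on {0..2*pi} f"
begin

lemma S_nonneg: "0 \<le> S"
  by (rule has_sum_nonneg[OF abs_sum]) simp

definition residual :: "nat \<Rightarrow> real \<Rightarrow> cmat" where
  "residual n \<omega> = toeplitz n \<gamma> * e_vec n \<omega> - csc (of_real (f \<omega>)) (e_vec n \<omega>)"

text \<open>Entry j of the residual is, up to a phase, the part of the symbol series that row j cuts
  off. Since that part is at most S, its square is at most S times itself, so the sum of squares is
  bounded by the averaged tail.\<close>

lemma norm_residual:
  assumes n: "n \<ge> 1" and \<omega>: "\<omega> \<in> {0..2*pi}"
  shows "norm (residual n \<omega>) \<le> sqrt (S * toeplitz_tail \<gamma> n) * sqrt n"
proof -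
  let ?T = "\<lambda>j::nat. \<Sum>\<^sub>\<infinity>l\<in>-{0..<int n}. \<bar>\<gamma> (int j - l)\<bar>"
  have asum: "(\<lambda>h. \<bar>\<gamma> h\<bar>) summable_on UNIV" using abs_sum by (auto simp: summable_on_def)
  have T0: "0 \<le> ?T j" for j by (rule infsum_nonneg) auto
  have TS: "?T j \<le> S" for j
  proof -
    have "?T j \<le> (\<Sum>\<^sub>\<infinity>l. \<bar>\<gamma> (int j - l)\<bar>)"
      by (rule infsum_mono_neutral) (use summable_on_shift_int[OF asum] in auto)
    then show ?thesis using infsumI[OF abs_sum] unfolding infsum_shift_int[of "\<lambda>h. \<bar>\<gamma> h\<bar>"] by simp
  qed
  have ent: "cmod (ent (residual n \<omega>) j 0) \<le> ?T j" if j: "j < n" for j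
  proof -
    define g where "g l = complex_of_real (\<gamma> (int j - l)) * cis (- (of_int (int j - l) * \<omega>))" for l
    have bij: "bij_betw (\<lambda>l. int j - l) UNIV (UNIV :: int set)"
      by (rule bij_betwI[of _ _ _ "\<lambda>l. int j - l"]) auto
    have gs: "(g has_sum complex_of_real (f \<omega>)) UNIV"
      using has_sum_reindex_bij_betw[OF bij, of "\<lambda>h. complex_of_real (\<gamma> h) * cis (- (of_int h * \<omega>))"] symbol[OF \<omega>]
      unfolding g_def by simp
    have "(g has_sum (\<Sum>l\<in>{0..<int n}. g l)) {0..<int n}" by (rule has_sum_finite) simp
    then have "(g has_sum (complex_of_real (f \<omega>) - (\<Sum>l\<in>{0..<int n}. g l))) (UNIV - {0..<int n})"
      by (intro has_sum_Diff gs) auto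
    then have gt: "(\<Sum>\<^sub>\<infinity>l\<in>-{0..<int n}. g l) = complex_of_real (f \<omega>) - (\<Sum>l\<in>{0..<int n}. g l)"
      by (simp add: infsumI Compl_eq_Diff_UNIV)
    have ng: "norm (g l) = \<bar>\<gamma> (int j - l)\<bar>" for l by (simp add: g_def norm_mult)
    have "(\<Sum>l\<in>{0..<int n}. g l) = (\<Sum>k<n. g (int k))"
      by (rule sum.reindex_bij_witness[of _ int nat]) auto
    moreover have "ent (toeplitz n \<gamma> * e_vec n \<omega>) j 0 = cis (real j * \<omega>) * (\<Sum>k<n. g (int k))"
    proof -
      have "ent (toeplitz n \<gamma> * e_vec n \<omega>) j 0 = (\<Sum>k<n. ent (toeplitz n \<gamma>) j k * ent (e_vec n \<omega>) k 0)"
        by (rule ent_mult) (simp add: toeplitz_def)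
      also have "\<dots> = (\<Sum>k<n. cis (real j * \<omega>) * g (int k))"
      proof (rule sum.cong[OF refl])
        fix k assume "k \<in> {..<n}"
        moreover have "cis (real j * \<omega>) * cis (- (of_int (int j - int k) * \<omega>)) = cis (real k * \<omega>)"
          by (simp add: cis_mult algebra_simps)
        ultimately show "ent (toeplitz n \<gamma>) j k * ent (e_vec n \<omega>) k 0 = cis (real j * \<omega>) * g (int k)"
          using j by (simp add: toeplitz_def e_vec_def g_def mult.left_commute)
      qed
      finally show ?thesis by (simp add: sum_distrib_left)
    qed
    ultimately have "ent (residual n \<omega>) j 0 = - (cis (real j * \<omega>) * (\<Sum>\<^sub>\<infinity>l\<in>-{0..<int n}. g l))"
      unfolding gt using j by (simp add: residual_def e_vec_def algebra_simps)
    then have "cmod (ent (residual n \<omega>) j 0) = cmod (\<Sum>\<^sub>\<infinity>l\<in>-{0..<int n}. g l)"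
      by (simp add: norm_mult)
    also have "\<dots> \<le> (\<Sum>\<^sub>\<infinity>l\<in>-{0..<int n}. norm (g l))"
      by (rule norm_infsum_bound) (use summable_on_shift_int[OF asum] in \<open>simp add: ng\<close>)
    finally show ?thesis by (simp add: ng)
  qed
  have re: "residual n \<omega> = cm n 1 (\<lambda>j k. ent (residual n \<omega>) j 0)"
    by (rule cmat_eqI) (auto simp: residual_def e_vec_def toeplitz_def ent_mult[of n])
  have "(norm (residual n \<omega>))\<^sup>2 = (\<Sum>j<n. (cmod (ent (residual n \<omega>) j 0))\<^sup>2)"
    using norm_column_square[OF n, of "\<lambda>j k. ent (residual n \<omega>) j 0"] re by simp
  also have "\<dots> \<le> (\<Sum>j<n. S * ?T j)"
  proof (rule sum_mono)
    fix j assume "j \<in> {..<n}"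
    then have "(cmod (ent (residual n \<omega>) j 0))\<^sup>2 \<le> ?T j * ?T j"
      unfolding power2_eq_square using ent T0 by (intro mult_mono) auto
    also have "\<dots> \<le> S * ?T j" using TS T0 by (intro mult_right_mono) auto
    finally show "(cmod (ent (residual n \<omega>) j 0))\<^sup>2 \<le> S * ?T j" .
  qed
  also have "\<dots> = S * toeplitz_tail \<gamma> n * n"
    using n by (simp add: toeplitz_tail_def sum_distrib_left)
  finally have "norm (residual n \<omega>) \<le> sqrt (S * toeplitz_tail \<gamma> n * n)" by (rule real_le_rsqrt)
  then show ?thesis by (simp add: real_sqrt_mult)
qed

lemma tail_lim: "(\<lambda>n. sqrt (S * toeplitz_tail \<gamma> n)) \<longlonglongrightarrow> 0"
proof -
  have "(\<lambda>h. \<bar>\<gamma> h\<bar>) summable_on UNIV" using abs_sum by (auto simp: summable_on_def)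
  from tendsto_real_sqrt[OF tendsto_mult[OF tendsto_const toeplitz_tail_tendsto_0[OF this]]]
  show ?thesis by simp
qed

lemma e_vec_toeplitz_form:
  assumes n: "n \<ge> 1"
  shows "ctr (cadj (e_vec n \<omega>) * (toeplitz n \<gamma> * e_vec n \<omega>)) =
    of_real (f \<omega>) * of_nat n + ctr (cadj (e_vec n \<omega>) * residual n \<omega>)"
proof -
  have "ctr (cadj (e_vec n \<omega>) * e_vec n \<omega>) = of_nat n"
    unfolding ctr_cadj_self norm_e_vec[OF n] by simp
  then show ?thesis by (simp add: residual_def right_diff_distrib)
qed

text \<open>Positive semidefiniteness tested on the exponentials gives f \<omega> up to the
  residual, which tends to 0.\<close>

lemma symbol_nonneg:
  assumes \<omega>: "\<omega> \<in> {0..2*pi}" shows "0 \<le> f \<omega>"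
proof -
  have "- sqrt (S * toeplitz_tail \<gamma> n) \<le> f \<omega>" if n: "n \<ge> 1" for n
  proof -
    have "0 \<le> Re (ctr (cadj (e_vec n \<omega>) * (toeplitz n \<gamma> * e_vec n \<omega>)))"
      using psd_toeplitz[of n] by (simp add: psd_def)
    also have "\<dots> = f \<omega> * n + Re (ctr (cadj (e_vec n \<omega>) * residual n \<omega>))"
      unfolding e_vec_toeplitz_form[OF n] by simp
    also have "Re (ctr (cadj (e_vec n \<omega>) * residual n \<omega>)) \<le> norm (e_vec n \<omega>) * norm (residual n \<omega>)"
      using cmod_ctr_mult_le[of "cadj (e_vec n \<omega>)" "residual n \<omega>"]
        complex_Re_le_cmod[of "ctr (cadj (e_vec n \<omega>) * residual n \<omega>)"] by simp
    also have "\<dots> \<le> sqrt n * (sqrt (S * toeplitz_tail \<gamma> n) * sqrt n)"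
      using norm_residual[OF n \<omega>] by (simp add: norm_e_vec[OF n] mult_left_mono)
    also have "\<dots> = sqrt (S * toeplitz_tail \<gamma> n) * n" by (simp add: mult_ac)
    finally have "0 \<le> (f \<omega> + sqrt (S * toeplitz_tail \<gamma> n)) * n" by (simp add: distrib_right)
    then have "0 \<le> f \<omega> + sqrt (S * toeplitz_tail \<gamma> n)" using n by (simp add: zero_le_mult_iff)
    then show ?thesis by linarith
  qed
  then have ev: "\<exists>N. \<forall>n\<ge>N. - sqrt (S * toeplitz_tail \<gamma> n) \<le> f \<omega>" by blast
  have "(\<lambda>n. - sqrt (S * toeplitz_tail \<gamma> n)) \<longlonglongrightarrow> - 0" by (intro tendsto_minus tail_lim)
  from LIMSEQ_le_const2[OF this ev] show ?thesis by simp
qed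

lemma symbol_denominator:
  assumes \<omega>: "\<omega> \<in> {0..2*pi}" and z: "Im z > 0" and b: "Im b \<le> 0"
  shows "Im z \<le> cmod (b * of_real (f \<omega>) - z)" "b * of_real (f \<omega>) - z \<noteq> 0"
proof -
  have "Im b * f \<omega> \<le> 0" using b symbol_nonneg[OF \<omega>] by (simp add: mult_nonpos_nonneg)
  then show *: "Im z \<le> cmod (b * of_real (f \<omega>) - z)"
    using abs_Im_le_cmod[of "b * of_real (f \<omega>) - z"] by simp
  show "b * of_real (f \<omega>) - z \<noteq> 0" using * z by auto
qed

text \<open>On an approximate eigenvector K acts as division by b f \<omega> - z, with an error
  bounded by the residual times the norm of \<Gamma> K, uniformly in \<omega>. Integration over
  \<omega> turns the forms into the trace.\<close>

lemma szego_resolvent: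
  assumes n: "n \<ge> 1" and z: "Im z > 0" and b: "Im b \<le> 0"
    and L: "op_bound L (toeplitz n \<gamma>)" "0 \<le> L"
  defines "K \<equiv> cinv n (csc b (toeplitz n \<gamma>) - csc z (cunit n))"
  shows "cmod (ctr (toeplitz n \<gamma> * K) / of_nat n -
      integral {0..2*pi} (\<lambda>\<omega>. of_real (f \<omega>) / (b * of_real (f \<omega>) - z)) / (2 * pi))
    \<le> (1 + cmod b * L / Im z) / Im z * sqrt (S * toeplitz_tail \<gamma> n)"
proof -
  define G where "G = toeplitz n \<gamma>"
  note K = resolvent_props[OF psd_toeplitz corner_toeplitz z b, of n, folded K_def G_def]
  have cK: "corner n K" by (simp add: K_def)
  have GK: "corner n (G * K)" unfolding G_def by (intro corner_mult corner_toeplitz cK)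
  define t where "t = sqrt (S * toeplitz_tail \<gamma> n)"
  define c where "c = (1 + cmod b * L / Im z) / Im z * t"
  have opGK: "op_bound (L * (1 / Im z)) (G * K)"
    using op_bound_mult[OF L(1)[folded G_def] K(3) L(2)] z by simp
  have key: "cmod (ctr (cadj (e_vec n \<omega>) * (G * K * e_vec n \<omega>)) / of_nat n -
      of_real (f \<omega>) / (b * of_real (f \<omega>) - z)) \<le> c" if \<omega>: "\<omega> \<in> {0..2*pi}" for \<omega>
  proof -
    define e r F where "e = e_vec n \<omega>" and "r = residual n \<omega>" and "F = complex_of_real (f \<omega>)"
    define d where "d = b * F - z"
    have d: "Im z \<le> cmod d" "d \<noteq> 0" using symbol_denominator[OF \<omega> z b] by (simp_all add: d_def F_def)
    have Pe: "cunit n * e = e" by (simp add: e_def)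
    have Ge: "G * e = csc F e + r" by (simp add: G_def e_def r_def F_def residual_def)
    have "(csc b G - csc z (cunit n)) * e = csc d e + csc b r"
      by (simp add: left_diff_distrib Pe Ge csc_add d_def csc_diff_left)
    then have "K * ((csc b G - csc z (cunit n)) * e) = csc d (K * e) + csc b (K * r)"
      by (simp add: distrib_left)
    \<comment> \<open>Solved for K e this is (e - b K r) / d: the eigenvector relation carried over
      to the inverse. Only the part with \<open>r\<close> is an error.\<close>
    then have "e = csc d (K * e) + csc b (K * r)"
      using K(1) Pe by (simp flip: mult.assoc)
    then have "cadj e * (G * e) = csc d (cadj e * (G * (K * e))) + csc b (cadj e * (G * (K * r)))"
      by (metis (no_types) csc_mult_right distrib_left)
    then have "ctr (cadj e * (G * e)) = d * ctr (cadj e * (G * K * e)) + b * ctr (cadj e * (G * K * r))"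
      by (simp add: mult.assoc)
    moreover have "ctr (cadj e * (G * e)) = F * of_nat n + ctr (cadj e * r)"
      using e_vec_toeplitz_form[OF n] by (simp add: e_def G_def F_def r_def)
    ultimately have "ctr (cadj e * (G * K * e)) = (F * of_nat n + ctr (cadj e * r) - b * ctr (cadj e * (G * K * r))) / d"
      using d(2) by (simp add: field_simps)
    then have "ctr (cadj e * (G * K * e)) / of_nat n - F / d = (ctr (cadj e * r) - b * ctr (cadj e * (G * K * r))) / (d * of_nat n)"
      using d(2) n by (simp add: field_simps)
    then have "cmod (ctr (cadj e * (G * K * e)) / of_nat n - F / d) =
        cmod (ctr (cadj e * r) - b * ctr (cadj e * (G * K * r))) / (cmod d * n)"
      by (simp add: norm_divide norm_mult)
    also have "\<dots> \<le> (sqrt n * (t * sqrt n) + cmod b * (sqrt n * (L * (1 / Im z) * (t * sqrt n)))) / (Im z * n)"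
    proof (rule frac_le)
      have nr: "norm r \<le> t * sqrt n" using norm_residual[OF n \<omega>] by (simp add: r_def t_def)
      have ne: "norm (cadj e) = sqrt n" using norm_e_vec[OF n] by (simp add: e_def)
      have "cmod (ctr (cadj e * r)) \<le> sqrt n * (t * sqrt n)"
        using cmod_ctr_mult_le[of "cadj e" r] nr unfolding ne
        by (meson mult_left_mono order_trans real_sqrt_ge_zero of_nat_0_le_iff)
      moreover have "cmod (ctr (cadj e * (G * K * r))) \<le> sqrt n * (L * (1 / Im z) * (t * sqrt n))"
      proof -
        have "norm (G * K * r) \<le> L * (1 / Im z) * norm r" using opGK by (simp only: op_bound_def)
        also have "\<dots> \<le> L * (1 / Im z) * (t * sqrt n)" using nr L z by (intro mult_left_mono) auto
        finally have "norm (G * K * r) \<le> L * (1 / Im z) * (t * sqrt n)" .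
        then show ?thesis using cmod_ctr_mult_le[of "cadj e" "G * K * r"] unfolding ne
          by (meson mult_left_mono order_trans real_sqrt_ge_zero of_nat_0_le_iff)
      qed
      ultimately show "cmod (ctr (cadj e * r) - b * ctr (cadj e * (G * K * r))) \<le>
          sqrt n * (t * sqrt n) + cmod b * (sqrt n * (L * (1 / Im z) * (t * sqrt n)))"
        by (intro order_trans[OF norm_triangle_ineq4] add_mono) (simp_all only: norm_mult mult_left_mono norm_ge_zero)
      have "0 \<le> t"
        unfolding t_def toeplitz_tail_def
        by (intro real_sqrt_ge_zero mult_nonneg_nonneg S_nonneg divide_nonneg_nonneg sum_nonneg infsum_nonneg) auto
      then show "0 \<le> sqrt n * (t * sqrt n) + cmod b * (sqrt n * (L * (1 / Im z) * (t * sqrt n)))"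
        using L z by (intro add_nonneg_nonneg mult_nonneg_nonneg) auto
      show "0 < Im z * n" using z n by simp
      show "Im z * n \<le> cmod d * n" using d by (intro mult_right_mono) auto
    qed
    also have "\<dots> = c"
    proof -
      have "(s * (t * s) + B * (s * (L * (1 / y) * (t * s)))) / (y * (s * s)) = (1 + B * L / y) / y * t"
        if "s > 0" "y > 0" for s B y :: real
        using that by (simp add: field_simps)
      from this[of "sqrt n" "Im z" "cmod b"] show ?thesis using n z by (simp add: c_def)
    qed
    finally show ?thesis by (simp add: e_def F_def d_def)
  qed
  have i1: "((\<lambda>\<omega>. ctr (cadj (e_vec n \<omega>) * (G * K * e_vec n \<omega>)) / of_nat n) has_integral 2 * pi * ctr (G * K) / of_nat n) {0..2*pi}"
    by (intro has_integral_divide has_integral_e_vec_form GK)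
  have "continuous_on {0..2*pi} (\<lambda>\<omega>. complex_of_real (f \<omega>) / (b * of_real (f \<omega>) - z))"
    using symbol_denominator[OF _ z b] f_cont by (intro continuous_intros) auto
  then have i2: "((\<lambda>\<omega>. complex_of_real (f \<omega>) / (b * of_real (f \<omega>) - z)) has_integral
      integral {0..2*pi} (\<lambda>\<omega>. of_real (f \<omega>) / (b * of_real (f \<omega>) - z))) {0..2*pi}"
    by (intro integrable_integral integrable_continuous_real)
  have "0 \<le> c" using key[of 0] by (meson norm_ge_zero order_trans pi_ge_zero atLeastAtMost_iff order_refl mult_nonneg_nonneg zero_le_numeral)
  define c2 J where "c2 = 2 * complex_of_real pi"
    and "J = integral {0..2*pi} (\<lambda>\<omega>. complex_of_real (f \<omega>) / (b * of_real (f \<omega>) - z))"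
  have c2: "cmod c2 = 2 * pi" "c2 \<noteq> 0" by (simp_all add: c2_def norm_mult)
  have "cmod (c2 * ctr (G * K) / of_nat n - J) \<le> c * measure lborel (cbox 0 (2 * pi))"
    using has_integral_bound[OF \<open>0 \<le> c\<close> has_integral_diff[OF i1 i2, folded cbox_interval]] key
    unfolding c2_def J_def by auto
  then have le: "cmod (c2 * ctr (G * K) / of_nat n - J) \<le> c * (2 * pi)" by simp
  have "(2 * pi) * cmod (ctr (G * K) / of_nat n - J / c2) = cmod (c2 * (ctr (G * K) / of_nat n - J / c2))"
    by (simp only: norm_mult c2)
  also have "c2 * (ctr (G * K) / of_nat n - J / c2) = c2 * ctr (G * K) / of_nat n - J"
    using c2(2) by (simp add: right_diff_distrib)
  finally have "(2 * pi) * cmod (ctr (G * K) / of_nat n - J / c2) \<le> (2 * pi) * c"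
    using le by (simp only: mult.commute)
  then have "cmod (ctr (G * K) / of_nat n - J / c2) \<le> c"
    by (simp only: mult_le_cancel_left_pos pi_gt_zero mult_pos_pos zero_less_numeral)
  then show ?thesis by (simp only: c_def t_def G_def J_def c2_def of_real_mult of_real_numeral)
qed

end

section \<open>Spectra of real symmetric matrices\<close>

text \<open>Columns are treated from left to right. In entry (i, j) of C T with j <= i, the terms
  with k < j vanish by induction and those with k > j by triangularity, which leaves only k =
  j.\<close>

lemma upper_triangular_inverse_diag:
  assumes T: "corner n T" and C: "corner n C" and ut: "\<And>i j. j < i \<Longrightarrow> i < n \<Longrightarrow> ent T i j = 0"
    and nz: "\<And>i. i < n \<Longrightarrow> ent T i i \<noteq> 0" and inv: "C * T = cunit n"
  shows "j < n \<Longrightarrow> j \<le> i \<Longrightarrow> i < n \<Longrightarrow> ent C i j = (if i = j then 1 / ent T i i else 0)"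
proof (induction j arbitrary: i rule: less_induct)
  case (less j)
  have "(\<Sum>k<n. ent C i k * ent T k j) = ent (C * T) i j"
    by (rule ent_mult[symmetric]) (use T in \<open>auto simp: corner_iff\<close>)
  also have "(\<Sum>k<n. ent C i k * ent T k j) = (\<Sum>k\<in>{j}. ent C i k * ent T k j)"
  proof (rule sum.mono_neutral_right)
    show "\<forall>k\<in>{..<n} - {j}. ent C i k * ent T k j = 0"
    proof
      fix k assume k: "k \<in> {..<n} - {j}"
      show "ent C i k * ent T k j = 0"
        using less.IH[of k i] ut[of j k] less.prems k by (cases "k < j") auto
    qed
  qed (use less.prems in auto)
  finally have "ent C i j * ent T j j = (if i = j then 1 else 0)"
    using inv less.prems by simp
  then show ?case using nz[of j] less.prems by (auto simp: field_simps split: if_splits)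
qed

text \<open>Schur decomposition makes A triangular with the prescribed diagonal. The conjugate of R
  inverts the shifted triangular matrix, so its diagonal consists of the reciprocals, and
  conjugation preserves the trace.\<close>

lemma ctr_resolvent_linear_factors:
  fixes A :: "complex mat"
  assumes A: "A \<in> carrier_mat n n" and es: "char_poly A = (\<Prod>e\<leftarrow>es. [:- e, 1:])"
    and z: "\<And>e. e \<in> set es \<Longrightarrow> e \<noteq> z"
    and R: "corner n R" and inv: "R * (of_cmat n A - csc z (cunit n)) = cunit n"
  shows "ctr R = (\<Sum>e\<leftarrow>es. 1 / (e - z))"
proof -
  obtain B P Q where BPQ: "schur_decomposition A es = (B, P, Q)"
    by (cases "schur_decomposition A es") auto
  note s = schur_decomposition[OF A es BPQ]
  then have car: "B \<in> carrier_mat n n" "P \<in> carrier_mat n n" "Q \<in> carrier_mat n n"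
    and w: "P * Q = 1\<^sub>m n" "Q * P = 1\<^sub>m n" "A = P * B * Q"
    and ut: "upper_triangular B" and dg: "diag_mat B = es"
    using A by (auto simp: similar_mat_wit_def Let_def)
  have dim: "dim_row B = n" using car by auto
  have len: "length es = n" and bii: "\<And>i. i < n \<Longrightarrow> B $$ (i, i) = es ! i"
    unfolding dg[symmetric] by (simp_all add: diag_mat_def dim)
  define b p q where "b = of_cmat n B" and "p = of_cmat n P" and "q = of_cmat n Q"
  have cor: "corner n b" "corner n p" "corner n q" by (simp_all add: b_def p_def q_def)
  have pq: "p * q = cunit n" "q * p = cunit n"
    using w car by (simp_all add: p_def q_def of_cmat_one flip: of_cmat_mult)
  have a: "of_cmat n A = p * b * q"
    unfolding w(3) b_def p_def q_def using car by (simp add: of_cmat_mult del: assoc_mult_mat)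
  define T where "T = b - csc z (cunit n)"
  define C where "C = q * R * p"
  have T: "corner n T" and C: "corner n C"
    using corner_diff[OF cor(1) corner_csc[OF corner_cunit[of n], of z]]
      corner_mult[OF corner_mult[OF cor(3) R] cor(2)] by (simp_all add: T_def C_def)
  have "q * (of_cmat n A - csc z (cunit n)) * p = (q * p) * b * (q * p) - csc z (q * (cunit n * p))"
    by (simp add: a algebra_simps)
  then have eT: "q * (of_cmat n A - csc z (cunit n)) * p = T"
    using cor by (simp add: T_def pq corner_def)
  have "C * T = q * (R * ((p * q) * (of_cmat n A - csc z (cunit n)))) * p"
    unfolding C_def eT[symmetric] by (simp only: mult.assoc)
  also have "(p * q) * (of_cmat n A - csc z (cunit n)) = of_cmat n A - csc z (cunit n)"
    unfolding pq using corner_diff[OF corner_of_cmat[of n A] corner_csc[OF corner_cunit[of n], of z]]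
    by (simp add: corner_def)
  also have "q * (R * (of_cmat n A - csc z (cunit n))) * p = cunit n"
    unfolding inv using cor by (simp add: corner_def pq)
  finally have CT: "C * T = cunit n" .
  have utT: "ent T i j = 0" if "j < i" "i < n" for i j
    using ut that dim by (simp add: T_def b_def of_cmat_def upper_triangular_def)
  have diag: "ent T i i = es ! i - z" if "i < n" for i
    using that bii by (simp add: T_def b_def of_cmat_def)
  have nz: "ent T i i \<noteq> 0" if "i < n" for i
    using that diag z[of "es ! i"] len by simp
  have "ctr R = ctr (R * (p * q))"
    using R by (simp add: pq corner_def)
  also have "\<dots> = ctr C"
    unfolding C_def by (metis ctr_comm mult.assoc)
  also have "\<dots> = (\<Sum>i<n. ent C i i)"
    by (rule ctr_eq) (use C in \<open>auto simp: corner_iff\<close>)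
  also have "\<dots> = (\<Sum>i<n. 1 / (es ! i - z))"
    using upper_triangular_inverse_diag[OF T C utT nz CT] diag by simp
  also have "\<dots> = (\<Sum>e\<leftarrow>es. 1 / (e - z))"
    using len by (simp add: sum_list_sum_nth atLeast0LessThan)
  finally show ?thesis .
qed

text \<open>Over the complex numbers the polynomial splits; a root is a Rayleigh quotient of a real
  symmetric matrix, hence real. The factorisation descends because the embedding of real polynomials
  is injective.\<close>

lemma symmetric_char_poly_real:
  fixes A :: "real mat"
  assumes A: "A \<in> carrier_mat n n" and sym: "transpose_mat A = A"
  obtains rs where "char_poly A = (\<Prod>r\<leftarrow>rs. [:- r, 1:])" "length rs = n"
    "char_poly (map_mat complex_of_real A) = (\<Prod>e\<leftarrow>map complex_of_real rs. [:- e, 1:])"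
proof -
  define B where "B = map_mat complex_of_real A"
  have B: "B \<in> carrier_mat n n" using A by (simp add: B_def)
  obtain es where es: "char_poly B = (\<Prod>e\<leftarrow>es. [:- e, 1:])" "length es = n"
    using char_poly_factorized[OF B] by blast
  have real: "e \<in> \<real>" if e: "e \<in> set es" for e
  proof -
    have "poly (char_poly B) e = 0"
      using e unfolding es(1) by (auto simp: poly_prod_list prod_list_zero_iff)
    then have "eigenvalue B e" using eigenvalue_root_char_poly[OF B] by simp
    then obtain v where v: "v \<in> carrier_vec n" "v \<noteq> 0\<^sub>v n" "B *\<^sub>v v = e \<cdot>\<^sub>v v"
      using B by (auto simp: eigenvalue_def eigenvector_def)
    define S where "S = (\<Sum>i<n. \<Sum>k<n. cnj (v $ i) * (B $$ (i, k) * v $ k))"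
    define N where "N = (\<Sum>i<n. cnj (v $ i) * v $ i)"
    have "S = (\<Sum>i<n. cnj (v $ i) * (B *\<^sub>v v) $ i)"
      using B v(1) by (simp add: S_def scalar_prod_def atLeast0LessThan sum_distrib_left)
    also have "\<dots> = e * N"
      using v(1) unfolding v(3) by (simp add: N_def sum_distrib_left mult_ac)
    finally have SN: "S = e * N" .
    have symB: "B $$ (i, k) = B $$ (k, i)" if "i < n" "k < n" for i k
      using that A arg_cong[OF sym, of "\<lambda>M. M $$ (i, k)"] by (simp add: B_def)
    have "cnj S = (\<Sum>i<n. \<Sum>k<n. v $ i * (B $$ (i, k) * cnj (v $ k)))"
      using A by (simp add: S_def B_def)
    also have "\<dots> = (\<Sum>k<n. \<Sum>i<n. v $ i * (B $$ (i, k) * cnj (v $ k)))" by (rule sum.swap)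
    also have "\<dots> = S"
      unfolding S_def using symB by (auto intro!: sum.cong simp: mult_ac)
    finally have SR: "S \<in> \<real>" by (simp add: Reals_cnj_iff)
    have N: "N = of_real (\<Sum>i<n. (cmod (v $ i))\<^sup>2)"
      unfolding N_def of_real_sum complex_norm_square by (simp add: mult.commute)
    have "(\<Sum>i<n. (cmod (v $ i))\<^sup>2) \<noteq> 0"
    proof
      assume "(\<Sum>i<n. (cmod (v $ i))\<^sup>2) = 0"
      then have "\<forall>i<n. v $ i = 0" by (simp add: sum_nonneg_eq_0_iff)
      then have "v = 0\<^sub>v n" using v(1) by (auto intro!: eq_vecI)
      then show False using v(2) by simp
    qed
    then have "N \<noteq> 0" unfolding N using of_real_eq_0_iff by blast
    then have "e = S / N" using SN by simp
    moreover have "N \<in> \<real>" unfolding N by (rule Reals_of_real)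
    ultimately show ?thesis using SR Reals_divide by blast
  qed
  define rs where "rs = map Re es"
  have esr: "es = map complex_of_real rs"
    unfolding rs_def map_map using real by (auto simp: comp_def intro!: map_idI[symmetric])
  interpret mp: map_poly_inj_comm_ring_hom complex_of_real ..
  have "map_poly complex_of_real (char_poly A) = char_poly B"
    unfolding B_def by (rule of_real_hom.char_poly_hom[OF A, symmetric])
  also have "\<dots> = map_poly complex_of_real (\<Prod>r\<leftarrow>rs. [:- r, 1:])"
    unfolding es(1) esr by (simp add: mp.hom_prod_list comp_def)
  finally have "char_poly A = (\<Prod>r\<leftarrow>rs. [:- r, 1:])" by (simp only: mp.eq_iff)
  moreover have "length rs = n" using es by (simp add: rs_def)
  ultimately show ?thesis using es(1) esr that unfolding B_def by metis
qed

lemma proots_linear_factors: "proots (\<Prod>r\<leftarrow>rs. [:- r, 1:]) = mset (rs :: real list)"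
proof (induction rs)
  case (Cons r rs)
  have "(\<Prod>r\<leftarrow>rs. [:- r, 1:]) \<noteq> 0" by (auto simp: prod_list_zero_iff)
  then show ?case using Cons by (simp add: proots_mult del: mult_pCons_left)
qed simp

lemma sum_list_eq_sum_count:
  fixes g :: "'b \<Rightarrow> complex"
  assumes "finite S" "set rs \<subseteq> S"
  shows "(\<Sum>e\<leftarrow>rs. g e) = (\<Sum>e\<in>S. of_nat (count (mset rs) e) * g e)"
  using assms(2)
proof (induction rs)
  case (Cons a rs)
  have "(\<Sum>e\<in>S. of_nat (count (mset (a # rs)) e) * g e) =
      (\<Sum>e\<in>S. (if e = a then g e else 0) + of_nat (count (mset rs) e) * g e)"
    by (intro sum.cong) (auto simp: distrib_right)
  also have "\<dots> = g a + (\<Sum>e\<leftarrow>rs. g e)"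
    using Cons assms(1) by (simp add: sum.distrib)
  finally show ?case by simp
qed simp

text \<open>Written as a finitely supported probability mass function, the measure has total mass
  one and its integrals are finite sums; the sum over the eigenvalues is the trace of any left
  inverse of A - z in the corner.\<close>

lemma symmetric_spectral_distribution:
  fixes A :: "real mat"
  assumes A: "A \<in> carrier_mat n n" and sym: "transpose_mat A = A" and n: "n > 0"
  shows "real_distribution (spectral_distribution A)"
    and "Im z > 0 \<Longrightarrow> corner n R \<Longrightarrow>
      R * (of_cmat n (map_mat complex_of_real A) - csc z (cunit n)) = cunit n \<Longrightarrow>
      stieltjes (spectral_distribution A) z = ctr R / of_nat n"
proof -
  obtain rs where rs: "char_poly A = (\<Prod>r\<leftarrow>rs. [:- r, 1:])" "length rs = n"
    "char_poly (map_mat complex_of_real A) = (\<Prod>e\<leftarrow>map complex_of_real rs. [:- e, 1:])"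
    using symmetric_char_poly_real[OF A sym] by blast
  have dim: "dim_row A = n" using A by auto
  have ne: "rs \<noteq> []" using rs n by auto
  define q where "q = pmf_of_list (map (\<lambda>r. (r, 1 / real n)) rs)"
  have wf: "pmf_of_list_wf (map (\<lambda>r. (r, 1 / real n)) rs)"
    using n rs(2) by (auto simp: pmf_of_list_wf_def comp_def sum_list_triv)
  have sd: "spectral_distribution A = distr (measure_pmf q) borel (\<lambda>x. x)"
  proof (rule measure_eqI)
    fix B assume "B \<in> sets (spectral_distribution A)"
    then have B: "B \<in> sets borel" by simp
    have "emeasure (spectral_distribution A) B = (\<Sum>l\<in>#mset rs. emeasure (return borel l) B) / of_nat n"
      using emeasure_spectral_distribution[OF B, of A] by (simp add: rs(1) proots_linear_factors dim)
    also have "(\<Sum>l\<in>#mset rs. emeasure (return borel l) B) = (\<Sum>l\<leftarrow>rs. indicator B l)"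
      using B by (simp flip: mset_map sum_mset_sum_list)
    also have "\<dots> = ennreal (\<Sum>l\<leftarrow>rs. indicator B l)"
    proof (induction rs)
      case (Cons r rs)
      have "0 \<le> sum_list (map (indicat_real B) rs)" by (rule sum_list_nonneg) auto
      then show ?case using Cons by (simp add: ennreal_plus flip: ennreal_indicator)
    qed simp
    also have "\<dots> / of_nat n = ennreal ((\<Sum>l\<leftarrow>rs. indicator B l) / real n)"
      using n divide_ennreal[OF sum_list_nonneg, of "map (indicat_real B) rs" "real n"]
      by (auto simp: ennreal_of_nat_eq_real_of_nat)
    also have "(\<Sum>l\<leftarrow>rs. indicator B l) / real n = measure (measure_pmf q) B"
      unfolding q_def measure_pmf_of_list[OF wf]
      by (induction rs) (auto simp: add_divide_distrib)
    finally show "emeasure (spectral_distribution A) B = emeasure (distr (measure_pmf q) borel (\<lambda>x. x)) B"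
      using B by (simp add: emeasure_distr measure_pmf.emeasure_eq_measure)
  qed simp
  have "prob_space (spectral_distribution A)"
    unfolding sd by (rule measure_pmf.prob_space_distr) simp
  then show "real_distribution (spectral_distribution A)"
    by (simp add: real_distribution_def real_distribution_axioms_def)
  assume z: "Im z > 0" and R: "corner n R"
    "R * (of_cmat n (map_mat complex_of_real A) - csc z (cunit n)) = cunit n"
  have "stieltjes (spectral_distribution A) z = (\<integral>l. 1 / (complex_of_real l - z) \<partial>measure_pmf q)"
    unfolding stieltjes_def sd by (rule integral_distr) auto
  also have "\<dots> = (\<Sum>l\<in>set rs. pmf q l *\<^sub>R (1 / (complex_of_real l - z)))"
    by (rule integral_measure_pmf) (use set_pmf_of_list[OF wf] in \<open>auto simp: q_def set_pmf_iff\<close>)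
  also have "\<dots> = (\<Sum>e\<leftarrow>rs. 1 / (complex_of_real e - z)) / of_nat n"
  proof -
    have pm: "pmf q l = real (count (mset rs) l) / real n" for l
      unfolding q_def pmf_pmf_of_list[OF wf]
      by (induction rs) (auto simp: add_divide_distrib)
    have "(\<Sum>e\<leftarrow>rs. 1 / (complex_of_real e - z)) =
        (\<Sum>e\<in>set rs. of_nat (count (mset rs) e) * (1 / (complex_of_real e - z)))"
      by (rule sum_list_eq_sum_count) auto
    then show ?thesis by (simp add: pm scaleR_conv_of_real sum_divide_distrib mult.commute)
  qed
  also have "(\<Sum>e\<leftarrow>rs. 1 / (complex_of_real e - z)) = ctr R"
  proof -
    have "ctr R = (\<Sum>e\<leftarrow>map complex_of_real rs. 1 / (e - z))"
      by (rule ctr_resolvent_linear_factors[OF _ rs(3) _ R]) (use A z in auto)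
    then show ?thesis by (simp add: comp_def)
  qed
  finally show "stieltjes (spectral_distribution A) z = ctr R / of_nat n" .
qed

section \<open>Linear processes\<close>

lemma weighted_Cauchy_Schwarz_sum:
  fixes a u :: "'i \<Rightarrow> real"
  assumes "\<And>j. j \<in> J \<Longrightarrow> 0 \<le> a j"
  shows "(\<Sum>j\<in>J. a j * u j)\<^sup>2 \<le> (\<Sum>j\<in>J. a j) * (\<Sum>j\<in>J. a j * (u j)\<^sup>2)"
proof -
  have "(\<Sum>j\<in>J. a j * u j) = (\<Sum>j\<in>J. sqrt (a j) * (sqrt (a j) * u j))"
    using assms by (intro sum.cong refl) (simp flip: mult.assoc)
  also have "(\<dots>)\<^sup>2 \<le> (\<Sum>j\<in>J. (sqrt (a j))\<^sup>2) * (\<Sum>j\<in>J. (sqrt (a j) * u j)\<^sup>2)"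
    by (rule Cauchy_Schwarz_ineq_sum)
  also have "\<dots> = (\<Sum>j\<in>J. a j) * (\<Sum>j\<in>J. a j * (u j)\<^sup>2)"
    using assms by (simp add: power_mult_distrib)
  finally show ?thesis .
qed

text \<open>Cauchy-Schwarz with the moduli of the entries as weights: one factor is a row sum, and
  after exchanging the sums the other becomes a column sum.\<close>

lemma schur_test_left:
  assumes A: "csize A \<le> m" and s: "0 \<le> s"
    and row: "\<And>i. i < m \<Longrightarrow> (\<Sum>j<m. cmod (ent A i j)) \<le> s" and col: "\<And>j. j < m \<Longrightarrow> (\<Sum>i<m. cmod (ent A i j)) \<le> s"
  shows "norm (A * U) \<le> s * norm U"
proof -
  define M where "M = max m (csize U)"
  have cA: "csize (A * U) \<le> M" "csize U \<le> M"
  proof -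
    show "csize (A * U) \<le> M"
      unfolding csize_def[of "A * U"]
      by (rule Least_le) (use A in \<open>auto simp: M_def ent_mult0 ent_beyond intro!: sum.neutral\<close>)
  qed (simp add: M_def)
  have e: "(cmod (ent (A * U) i k))\<^sup>2 \<le> s * (\<Sum>j<m. cmod (ent A i j) * (cmod (ent U j k))\<^sup>2)" for i k
  proof (cases "i < m")
    case True
    have "ent (A * U) i k = (\<Sum>j<m. ent A i j * ent U j k)"
      by (rule ent_mult) (use A in \<open>simp add: ent_beyond\<close>)
    then have "cmod (ent (A * U) i k) \<le> (\<Sum>j<m. cmod (ent A i j) * cmod (ent U j k))"
      using norm_sum[of "\<lambda>j. ent A i j * ent U j k" "{..<m}"] by (simp add: norm_mult)
    then have "(cmod (ent (A * U) i k))\<^sup>2 \<le> (\<Sum>j<m. cmod (ent A i j) * cmod (ent U j k))\<^sup>2"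
      by (intro power_mono) auto
    also have "\<dots> \<le> (\<Sum>j<m. cmod (ent A i j)) * (\<Sum>j<m. cmod (ent A i j) * (cmod (ent U j k))\<^sup>2)"
      by (rule weighted_Cauchy_Schwarz_sum) simp
    also have "\<dots> \<le> s * (\<Sum>j<m. cmod (ent A i j) * (cmod (ent U j k))\<^sup>2)"
      using row[OF True] by (intro mult_right_mono sum_nonneg) auto
    finally show ?thesis .
  next
    case False
    then have "ent A i j = 0" for j using A by (intro ent_beyond) auto
    then show ?thesis by (simp add: ent_mult0)
  qed
  have "(norm (A * U))\<^sup>2 = (\<Sum>i<M. \<Sum>k<M. (cmod (ent (A * U) i k))\<^sup>2)" by (rule norm_cmat_square[OF cA(1)])
  also have "\<dots> = (\<Sum>i<m. \<Sum>k<M. (cmod (ent (A * U) i k))\<^sup>2)"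
  proof (rule sum.mono_neutral_right)
    show "\<forall>i\<in>{..<M} - {..<m}. (\<Sum>k<M. (cmod (ent (A * U) i k))\<^sup>2) = 0"
    proof
      fix i assume "i \<in> {..<M} - {..<m}"
      then have "ent A i j = 0" for j using A by (intro ent_beyond) auto
      then show "(\<Sum>k<M. (cmod (ent (A * U) i k))\<^sup>2) = 0" by (simp add: ent_mult0)
    qed
  qed (auto simp: M_def)
  also have "\<dots> \<le> (\<Sum>i<m. \<Sum>k<M. s * (\<Sum>j<m. cmod (ent A i j) * (cmod (ent U j k))\<^sup>2))"
    by (intro sum_mono e)
  also have "\<dots> = s * (\<Sum>k<M. \<Sum>i<m. \<Sum>j<m. cmod (ent A i j) * (cmod (ent U j k))\<^sup>2)"
    by (subst sum.swap) (simp add: sum_distrib_left)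
  also have "\<dots> = s * (\<Sum>k<M. \<Sum>j<m. (\<Sum>i<m. cmod (ent A i j)) * (cmod (ent U j k))\<^sup>2)"
  proof -
    have "(\<Sum>i<m. \<Sum>j<m. cmod (ent A i j) * (cmod (ent U j k))\<^sup>2) =
        (\<Sum>j<m. (\<Sum>i<m. cmod (ent A i j)) * (cmod (ent U j k))\<^sup>2)" for k
      by (subst sum.swap) (simp add: sum_distrib_right)
    then show ?thesis by simp
  qed
  also have "\<dots> \<le> s * (\<Sum>k<M. \<Sum>j<m. s * (cmod (ent U j k))\<^sup>2)"
    by (intro mult_left_mono sum_mono mult_right_mono col s) auto
  also have "\<dots> \<le> s * (\<Sum>k<M. \<Sum>j<M. s * (cmod (ent U j k))\<^sup>2)"
    by (intro mult_left_mono sum_mono sum_mono2 s mult_nonneg_nonneg) (auto simp: M_def)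
  also have "\<dots> = (s * norm U)\<^sup>2"
    unfolding power_mult_distrib norm_cmat_square[OF cA(2)] by (subst sum.swap) (simp add: sum_distrib_left power2_eq_square mult.assoc)
  finally show ?thesis by (rule power2_le_imp_le) (simp add: s)
qed

lemma schur_test:
  assumes A: "corner m A" and s: "0 \<le> s"
    and row: "\<And>i. i < m \<Longrightarrow> (\<Sum>j<m. cmod (ent A i j)) \<le> s" and col: "\<And>j. j < m \<Longrightarrow> (\<Sum>i<m. cmod (ent A i j)) \<le> s"
  shows "op_bound s A"
proof (rule op_boundI)
  show "norm (A * U) \<le> s * norm U" for U
    by (rule schur_test_left[OF corner_csize[OF A] s row col])
  show "norm (cadj A * U) \<le> s * norm U" for U
    by (rule schur_test_left[OF corner_csize[OF corner_cadj[OF A]] s]) (use row col in auto)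
qed

lemma op_bound_toeplitz:
  assumes \<gamma>: "((\<lambda>h. \<bar>\<gamma> h\<bar>) has_sum S) UNIV"
  shows "op_bound S (toeplitz n \<gamma>)"
proof (rule schur_test[OF corner_toeplitz])
  show "0 \<le> S" by (rule has_sum_nonneg[OF \<gamma>]) simp
  have le: "sum (\<lambda>h. \<bar>\<gamma> h\<bar>) F \<le> S" if "finite F" for F
    by (rule has_sum_mono_neutral[OF has_sum_finite[OF that] \<gamma>]) auto
  show "(\<Sum>j<n. cmod (ent (toeplitz n \<gamma>) i j)) \<le> S" if "i < n" for i
  proof -
    have "(\<Sum>j<n. cmod (ent (toeplitz n \<gamma>) i j)) = sum (\<lambda>h. \<bar>\<gamma> h\<bar>) ((\<lambda>j. int i - int j) ` {..<n})"
      using that by (subst sum.reindex) (auto simp: inj_on_def toeplitz_def)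
    then show ?thesis using le by simp
  qed
  show "(\<Sum>i<n. cmod (ent (toeplitz n \<gamma>) i j)) \<le> S" if "j < n" for j
  proof -
    have "(\<Sum>i<n. cmod (ent (toeplitz n \<gamma>) i j)) = sum (\<lambda>h. \<bar>\<gamma> h\<bar>) ((\<lambda>i. int i - int j) ` {..<n})"
      using that by (subst sum.reindex) (auto simp: inj_on_def toeplitz_def)
    then show ?thesis using le by simp
  qed
qed

text \<open>The first \<open>n\<close> values of the process truncated at lag \<open>k\<close> depend on \<open>n + k\<close> innovations;
  index \<open>u\<close> stands for the innovation at time \<open>u - k + 1\<close>.\<close>

definition trunc_coeff :: "(nat \<Rightarrow> real) \<Rightarrow> nat \<Rightarrow> nat \<Rightarrow> nat \<Rightarrow> real" where
  "trunc_coeff c k t u = (if t \<le> u \<and> u \<le> t + k then c (t + k - u) else 0)"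

definition trunc_mat :: "(nat \<Rightarrow> real) \<Rightarrow> nat \<Rightarrow> nat \<Rightarrow> cmat" where
  "trunc_mat c n k = cm n (n + k) (\<lambda>t u. complex_of_real (trunc_coeff c k t u))"

lemma sum_trunc_coeff:
  assumes "t < n"
  shows "(\<Sum>u<n + k. trunc_coeff c k t u * g u) = (\<Sum>j\<le>k. c j * g (t + k - j))"
proof -
  have "(\<Sum>u<n + k. trunc_coeff c k t u * g u) = (\<Sum>u\<in>{t..t + k}. trunc_coeff c k t u * g u)"
    by (rule sum.mono_neutral_right) (use assms in \<open>auto simp: trunc_coeff_def\<close>)
  also have "\<dots> = (\<Sum>j\<le>k. c j * g (t + k - j))"
    by (rule sum.reindex_bij_witness[of _ "\<lambda>j. t + k - j" "\<lambda>u. t + k - u"]) (auto simp: trunc_coeff_def)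
  finally show ?thesis .
qed

lemma sum_abs_le_suminf:
  fixes c :: "nat \<Rightarrow> real"
  assumes c: "summable (\<lambda>j. \<bar>c j\<bar>)" and "finite J" "inj_on f J"
  shows "(\<Sum>j\<in>J. \<bar>c (f j)\<bar>) \<le> (\<Sum>j. \<bar>c j\<bar>)"
proof -
  have "(\<Sum>j\<in>J. \<bar>c (f j)\<bar>) = (\<Sum>j\<in>f ` J. \<bar>c j\<bar>)"
    using assms(3) by (simp add: sum.reindex)
  also have "\<dots> \<le> (\<Sum>j. \<bar>c j\<bar>)" by (rule sum_le_suminf[OF c]) (use assms(2) in auto)
  finally show ?thesis .
qed

lemma op_bound_trunc_mat:
  assumes c: "summable (\<lambda>j. \<bar>c j\<bar>)"
  shows "op_bound (\<Sum>j. \<bar>c j\<bar>) (trunc_mat c n k)"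
proof (rule schur_test[of "n + k"])
  show "corner (n + k) (trunc_mat c n k)" by (simp add: corner_iff trunc_mat_def)
  show "0 \<le> (\<Sum>j. \<bar>c j\<bar>)" using c by (intro suminf_nonneg) auto
  show "(\<Sum>u<n + k. cmod (ent (trunc_mat c n k) t u)) \<le> (\<Sum>j. \<bar>c j\<bar>)" for t
  proof -
    have "(\<Sum>u<n + k. cmod (ent (trunc_mat c n k) t u)) \<le> (\<Sum>u\<in>{t..t + k}. \<bar>c (t + k - u)\<bar>)"
    proof -
      have "(\<Sum>u<n + k. cmod (ent (trunc_mat c n k) t u)) \<le> (\<Sum>u<n + k. if u \<in> {t..t + k} then \<bar>c (t + k - u)\<bar> else 0)"
        by (intro sum_mono) (auto simp: trunc_mat_def trunc_coeff_def)
      also have "\<dots> = (\<Sum>u\<in>{..<n + k} \<inter> {t..t + k}. \<bar>c (t + k - u)\<bar>)" by (simp add: sum.inter_restrict)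
      also have "\<dots> \<le> (\<Sum>u\<in>{t..t + k}. \<bar>c (t + k - u)\<bar>)" by (rule sum_mono2) auto
      finally show ?thesis .
    qed
    also have "\<dots> \<le> (\<Sum>j. \<bar>c j\<bar>)" by (rule sum_abs_le_suminf[OF c]) (auto simp: inj_on_def)
    finally show ?thesis .
  qed
  show "(\<Sum>t<n + k. cmod (ent (trunc_mat c n k) t u)) \<le> (\<Sum>j. \<bar>c j\<bar>)" for u
  proof -
    have "(\<Sum>t<n + k. cmod (ent (trunc_mat c n k) t u)) \<le> (\<Sum>t\<in>{u - k..u}. \<bar>c (t + k - u)\<bar>)"
    proof -
      have "(\<Sum>t<n + k. cmod (ent (trunc_mat c n k) t u)) \<le> (\<Sum>t<n + k. if t \<in> {u - k..u} then \<bar>c (t + k - u)\<bar> else 0)"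
        by (intro sum_mono) (auto simp: trunc_mat_def trunc_coeff_def)
      also have "\<dots> = (\<Sum>t\<in>{..<n + k} \<inter> {u - k..u}. \<bar>c (t + k - u)\<bar>)" by (simp add: sum.inter_restrict)
      also have "\<dots> \<le> (\<Sum>t\<in>{u - k..u}. \<bar>c (t + k - u)\<bar>)" by (rule sum_mono2) auto
      finally show ?thesis .
    qed
    also have "\<dots> \<le> (\<Sum>j. \<bar>c j\<bar>)" by (rule sum_abs_le_suminf[OF c]) (auto simp: inj_on_def)
    finally show ?thesis .
  qed
qed

lemma trunc_autocov_limit:
  assumes c: "summable (\<lambda>j. \<bar>c j\<bar>)"
  shows "(\<lambda>k. \<Sum>j\<le>k. c j * (if j + d \<le> k then c (j + d) else 0)) \<longlonglongrightarrow> (\<Sum>j. c j * c (j + d :: nat) :: real)"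
proof -
  have s: "summable (\<lambda>j. c j * c (j + d))"
  proof (rule summable_comparison_test'[OF summable_mult2[OF c, of "\<Sum>j. \<bar>c j\<bar>"], of 0])
    fix j :: nat
    have "\<bar>c (j + d)\<bar> \<le> (\<Sum>j. \<bar>c j\<bar>)" using sum_abs_le_suminf[OF c, of "{j + d}" id] by simp
    then show "norm (c j * c (j + d)) \<le> \<bar>c j\<bar> * (\<Sum>j. \<bar>c j\<bar>)" by (simp add: abs_mult mult_left_mono)
  qed
  have e: "(\<Sum>j\<le>k + d. c j * (if j + d \<le> k + d then c (j + d) else 0)) = (\<Sum>j\<le>k. c j * c (j + d))" for k
    by (rule sum.mono_neutral_cong_right) auto
  have "(\<lambda>k. \<Sum>j\<le>k + d. c j * (if j + d \<le> k + d then c (j + d) else 0)) \<longlonglongrightarrow> (\<Sum>j. c j * c (j + d))"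
    unfolding e by (rule summable_LIMSEQ'[OF s])
  then show ?thesis by (rule LIMSEQ_offset)
qed

text \<open>The product of two rows of the truncation matrix is the autocovariance sum at their lag,
  cut off at k. It is computed for \<open>s \<le> t\<close> and carried to the other half by
  conjugation.\<close>

lemma trunc_gram_entry:
  assumes c: "summable (\<lambda>j. \<bar>c j\<bar>)"
  shows "(\<lambda>k. ent (trunc_mat c n k * cadj (trunc_mat c n k)) s t) \<longlonglongrightarrow> ent (toeplitz n (autocov c)) s t"
proof (cases "s < n \<and> t < n")
  case True
  have one: "(\<lambda>k. ent (trunc_mat c n k * cadj (trunc_mat c n k)) s t) \<longlonglongrightarrow> ent (toeplitz n (autocov c)) s t"
    if st: "s \<le> t" "s < n" "t < n" for s t
  proof -
    have "ent (trunc_mat c n k * cadj (trunc_mat c n k)) s t =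
        complex_of_real (\<Sum>j\<le>k. c j * (if j + (t - s) \<le> k then c (j + (t - s)) else 0))" for k
    proof -
      have "ent (trunc_mat c n k * cadj (trunc_mat c n k)) s t =
          (\<Sum>u<n + k. ent (trunc_mat c n k) s u * ent (cadj (trunc_mat c n k)) u t)"
        by (rule ent_mult) (simp add: trunc_mat_def)
      also have "\<dots> = complex_of_real (\<Sum>u<n + k. trunc_coeff c k s u * trunc_coeff c k t u)"
        using st by (simp add: trunc_mat_def)
      also have "(\<Sum>u<n + k. trunc_coeff c k s u * trunc_coeff c k t u) = (\<Sum>j\<le>k. c j * trunc_coeff c k t (s + k - j))"
        by (rule sum_trunc_coeff[OF st(2)])
      also have "\<dots> = (\<Sum>j\<le>k. c j * (if j + (t - s) \<le> k then c (j + (t - s)) else 0))"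
      proof (intro sum.cong refl arg_cong[where f = "(*) _"])
        fix j assume "j \<in> {..k}"
        then have "t + k - (s + k - j) = j + (t - s)" "t \<le> s + k - j \<longleftrightarrow> j + (t - s) \<le> k" "s + k - j \<le> t + k"
          using st by auto
        then show "trunc_coeff c k t (s + k - j) = (if j + (t - s) \<le> k then c (j + (t - s)) else 0)"
          by (simp add: trunc_coeff_def)
      qed
      finally show ?thesis .
    qed
    moreover have "ent (toeplitz n (autocov c)) s t = complex_of_real (\<Sum>j. c j * c (j + (t - s)))"
    proof -
      have "nat \<bar>int s - int t\<bar> = t - s" using st by simp
      then show ?thesis using st by (simp add: toeplitz_def autocov_def)
    qed
    ultimately show ?thesis using tendsto_of_real[OF trunc_autocov_limit[OF c]] by simp
  qed
  show ?thesis
  proof (cases "s \<le> t")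
    case False
    have sw: "ent (trunc_mat c n k * cadj (trunc_mat c n k)) s t = cnj (ent (trunc_mat c n k * cadj (trunc_mat c n k)) t s)" for k
      by (subst ent_cadj[symmetric]) simp
    have "(\<lambda>k. cnj (ent (trunc_mat c n k * cadj (trunc_mat c n k)) t s)) \<longlonglongrightarrow> cnj (ent (toeplitz n (autocov c)) t s)"
      by (intro tendsto_cnj one) (use True False in auto)
    moreover have "cnj (ent (toeplitz n (autocov c)) t s) = ent (toeplitz n (autocov c)) s t"
      using True by (simp add: toeplitz_def autocov_def abs_minus_commute)
    ultimately show ?thesis by (simp only: sw)
  qed (use one True in auto)
next
  case False
  then have "ent (trunc_mat c n k * cadj (trunc_mat c n k)) s t = 0" for k
    by (auto simp: ent_mult0 trunc_mat_def intro!: sum.neutral)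
  moreover have "ent (toeplitz n (autocov c)) s t = 0" using False by (auto simp: toeplitz_def)
  ultimately show ?thesis by simp
qed

lemma gram_limit_toeplitz:
  assumes c: "summable (\<lambda>j. \<bar>c j\<bar>)"
  shows "gram_limit n (toeplitz n (autocov c))"
  unfolding gram_limit_def
\<comment> \<open>The Gram factors are the adjoints of the truncation matrices.\<close>
proof (intro conjI exI allI)
  fix i j
  have "cadj (trunc_mat c n k) * cunit n = cadj (trunc_mat c n k)" for k
    by (rule cmat_eqI) (simp add: trunc_mat_def)
  then show "(\<lambda>k. ent (cadj (cadj (trunc_mat c n k) * cunit n) * (cadj (trunc_mat c n k) * cunit n)) i j)
      \<longlonglongrightarrow> ent (toeplitz n (autocov c)) i j"
    using trunc_gram_entry[OF c] by simp
qed simp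

section \<open>One row of the process: quadratic forms by truncation\<close>

locale linear_row = prob_space M for M :: "'a measure" +
  fixes z :: "int \<Rightarrow> 'a \<Rightarrow> real" and c :: "nat \<Rightarrow> real" and \<sigma> :: real
  assumes indep: "indep_vars (\<lambda>_. borel) z UNIV"
    and i4: "\<And>u. integrable M (\<lambda>w. (z u w) ^ 4)"
    and m1: "\<And>u. expectation (z u) = 0"
    and m2: "\<And>u. expectation (\<lambda>w. (z u w)\<^sup>2) = 1"
    and m4: "\<And>u. expectation (\<lambda>w. (z u w) ^ 4) \<le> \<sigma>"
    and c: "summable (\<lambda>j. \<bar>c j\<bar>)"
begin

lemma z_meas [measurable]: "z u \<in> borel_measurable M"
  using indep by (auto simp: indep_vars_def)

lemma expectation_abs_le: "integrable M (\<lambda>w. \<bar>z u w\<bar>)" "expectation (\<lambda>w. \<bar>z u w\<bar>) \<le> 1"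
proof -
  \<comment> \<open>A function that is not integrable has expectation 0 by convention, so the value
    1 already yields integrability.\<close>
  have i2: "integrable M (\<lambda>w. (z u w)\<^sup>2)"
  proof (rule ccontr)
    assume "\<not> integrable M (\<lambda>w. (z u w)\<^sup>2)"
    then have "expectation (\<lambda>w. (z u w)\<^sup>2) = 0" by (rule not_integrable_integral_eq)
    then show False using m2[of u] by simp
  qed
  then have "integrable M (z u)" by (rule square_integrable_imp_integrable_real[rotated]) measurable
  then show i1: "integrable M (\<lambda>w. \<bar>z u w\<bar>)" by simp
  have "(expectation (\<lambda>w. \<bar>z u w\<bar>))\<^sup>2 \<le> expectation (\<lambda>w. (\<bar>z u w\<bar>)\<^sup>2)"
    using variance_positive[of "\<lambda>w. \<bar>z u w\<bar>"] variance_eq[OF i1] i2 by simp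
  then have "(expectation (\<lambda>w. \<bar>z u w\<bar>))\<^sup>2 \<le> 1\<^sup>2" using m2 by simp
  then show "expectation (\<lambda>w. \<bar>z u w\<bar>) \<le> 1" by (rule power2_le_imp_le) simp
qed

text \<open>The expected sum of absolute values is at most the sum of the |c j|. Outside the null
  set found here, \<open>suminf\<close> is a true limit of partial sums.\<close>

lemma AE_summable: "AE w in M. summable (\<lambda>j. c j * z (t - int j) w)"
proof -
  have "(\<integral>\<^sup>+w. (\<Sum>j. ennreal \<bar>c j * z (t - int j) w\<bar>) \<partial>M) = (\<Sum>j. \<integral>\<^sup>+w. ennreal \<bar>c j * z (t - int j) w\<bar> \<partial>M)"
    by (rule nn_integral_suminf) measurable
  also have "\<dots> \<le> (\<Sum>j. ennreal \<bar>c j\<bar>)"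
  proof (rule suminf_le)
    fix j
    have "(\<integral>\<^sup>+w. ennreal \<bar>c j * z (t - int j) w\<bar> \<partial>M) = ennreal (expectation (\<lambda>w. \<bar>c j\<bar> * \<bar>z (t - int j) w\<bar>))"
      using expectation_abs_le(1) by (subst nn_integral_eq_integral) (auto simp: abs_mult)
    also have "\<dots> \<le> ennreal \<bar>c j\<bar>"
      using expectation_abs_le(2) by (intro ennreal_leI) (simp add: mult_left_le)
    finally show "(\<integral>\<^sup>+w. ennreal \<bar>c j * z (t - int j) w\<bar> \<partial>M) \<le> ennreal \<bar>c j\<bar>" .
  qed auto
  also have "\<dots> = ennreal (\<Sum>j. \<bar>c j\<bar>)" by (rule suminf_ennreal2) (use c in auto)
  also have "\<dots> < \<infinity>" by simp
  finally have "AE w in M. (\<Sum>j. ennreal \<bar>c j * z (t - int j) w\<bar>) \<noteq> \<infinity>"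
    by (intro nn_integral_PInf_AE) auto
  then show ?thesis
  proof eventually_elim
    case (elim w)
    then have "summable (\<lambda>j. \<bar>c j * z (t - int j) w\<bar>)" by (intro summable_suminf_not_top) auto
    then show ?case by (rule summable_rabs_cancel)
  qed
qed

lemma quad_complex:
  fixes B :: "nat \<Rightarrow> nat \<Rightarrow> complex"
  assumes inj: "inj_on f {..<m}"
  shows "(\<integral>\<^sup>+w. ennreal ((cmod (\<Sum>u<m. \<Sum>v<m. B u v * of_real (z (f u) w * z (f v) w - (if u = v then 1 else 0))))\<^sup>2) \<partial>M)
    \<le> ennreal ((\<sigma> + 2) * (\<Sum>u<m. \<Sum>v<m. (cmod (B u v))\<^sup>2))"
proof -
  have ind: "indep_vars (\<lambda>_. borel) (\<lambda>u. z (f u)) {..<m}"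
  proof -
    have "indep_vars (\<lambda>u. PiM {f u} (\<lambda>_. borel)) (\<lambda>u w. \<lambda>i\<in>{f u}. z i w) {..<m}"
      by (rule indep_vars_restrict[OF indep]) (use inj in \<open>auto simp: disjoint_family_on_def inj_on_def\<close>)
    from indep_vars_compose2[OF this, of "\<lambda>u g. g (f u)" "\<lambda>_. borel"]
    show ?thesis by simp
  qed
  interpret S: indep_standardized M "\<lambda>u. z (f u)" "{..<m}" \<sigma>
    by unfold_locales (use ind i4 m1 m2 m4 in auto)
  define R I where "R = S.quad (\<lambda>u v. Re (B u v)) {..<m}" and "I = S.quad (\<lambda>u v. Im (B u v)) {..<m}"
  note r = S.quad_moments[OF finite_lessThan subset_refl, of "\<lambda>u v. Re (B u v)", folded R_def]
  note i = S.quad_moments[OF finite_lessThan subset_refl, of "\<lambda>u v. Im (B u v)", folded I_def]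
  have e: "(cmod (\<Sum>u<m. \<Sum>v<m. B u v * of_real (z (f u) w * z (f v) w - (if u = v then 1 else 0))))\<^sup>2 = (R w)\<^sup>2 + (I w)\<^sup>2" for w
    unfolding cmod_power2 R_def I_def S.quad_def by (simp del: of_real_mult of_real_diff)
  have "(\<integral>\<^sup>+w. ennreal ((R w)\<^sup>2 + (I w)\<^sup>2) \<partial>M) = ennreal (expectation (\<lambda>w. (R w)\<^sup>2 + (I w)\<^sup>2))"
    using r i by (intro nn_integral_eq_integral) auto
  also have "\<dots> \<le> ennreal ((\<sigma> + 2) * (\<Sum>u<m. \<Sum>v<m. (cmod (B u v))\<^sup>2))"
  proof (rule ennreal_leI)
    have "expectation (\<lambda>w. (R w)\<^sup>2 + (I w)\<^sup>2) = expectation (\<lambda>w. (R w)\<^sup>2) + expectation (\<lambda>w. (I w)\<^sup>2)"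
      using r i by simp
    also have "\<dots> \<le> (\<sigma> + 2) * (\<Sum>u<m. \<Sum>v<m. (Re (B u v))\<^sup>2) + (\<sigma> + 2) * (\<Sum>u<m. \<Sum>v<m. (Im (B u v))\<^sup>2)"
      using r i by simp
    also have "\<dots> = (\<sigma> + 2) * (\<Sum>u<m. \<Sum>v<m. (cmod (B u v))\<^sup>2)"
      by (simp add: cmod_power2 sum.distrib distrib_left)
    finally show "expectation (\<lambda>w. (R w)\<^sup>2 + (I w)\<^sup>2) \<le> (\<sigma> + 2) * (\<Sum>u<m. \<Sum>v<m. (cmod (B u v))\<^sup>2)" .
  qed
  finally show ?thesis unfolding e .
qed

definition trunc_row :: "nat \<Rightarrow> nat \<Rightarrow> 'a \<Rightarrow> real" where
  "trunc_row k t w = (\<Sum>j\<le>k. c j * z (int t + 1 - int j) w)"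

definition row :: "nat \<Rightarrow> 'a \<Rightarrow> real" where
  "row t w = (\<Sum>j. c j * z (int t + 1 - int j) w)"

lemma row_meas [measurable]: "row t \<in> borel_measurable M" "trunc_row k t \<in> borel_measurable M"
  unfolding row_def[abs_def] trunc_row_def[abs_def] by measurable

text \<open>A truncated row is the truncation matrix C applied to finitely many independent
  innovations. The form of A is therefore the form of B, which is C applied to A on both sides and
  has the trace to be subtracted. Two factors of the operator norm of C enter |B|, hence the fourth
  power after squaring.\<close>

lemma trunc_form:
  assumes A: "corner n A"
  shows "(\<integral>\<^sup>+w. ennreal ((cmod ((\<Sum>s<n. \<Sum>t<n. ent A s t * of_real (trunc_row k s w * trunc_row k t w)) -
      ctr (A * (trunc_mat c n k * cadj (trunc_mat c n k)))))\<^sup>2) \<partial>M)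
    \<le> ennreal ((\<bar>\<sigma>\<bar> + 2) * (\<Sum>j. \<bar>c j\<bar>) ^ 4 * (norm A)\<^sup>2)"
proof -
  define C where "C = trunc_mat c n k"
  define m where "m = n + k"
  define B where "B = cadj C * A * C"
  define f where "f u = int u - int k + 1" for u :: nat
  define \<zeta> where "\<zeta> w = cm m 1 (\<lambda>u _. of_real (z (f u) w))" for w
  have inj: "inj_on f {..<m}" by (auto simp: inj_on_def f_def)
  have cB: "corner m B" unfolding corner_def
  proof
    have "cunit m * cadj C = cadj C" "C * cunit m = C"
      by (rule cmat_eqI; simp add: C_def trunc_mat_def m_def)+
    then show "cunit m * B = B" "B * cunit m = B" unfolding B_def by (simp_all add: mult.assoc) (simp_all flip: mult.assoc)
  qed
  have Ct: "complex_of_real (trunc_row k t w) = ent (C * \<zeta> w) t 0" if "t < n" for t w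
  proof -
    have "ent (C * \<zeta> w) t 0 = (\<Sum>u<m. ent C t u * ent (\<zeta> w) u 0)"
      by (rule ent_mult) (simp add: \<zeta>_def)
    also have "\<dots> = complex_of_real (\<Sum>u<n + k. trunc_coeff c k t u * z (f u) w)"
      using that by (simp add: C_def trunc_mat_def \<zeta>_def m_def)
    also have "(\<Sum>u<n + k. trunc_coeff c k t u * z (f u) w) = trunc_row k t w"
      unfolding sum_trunc_coeff[OF that] trunc_row_def
      by (intro sum.cong refl) (simp add: f_def of_nat_diff algebra_simps)
    finally show ?thesis by simp
  qed
  have quad: "(\<Sum>s<n. \<Sum>t<n. ent A s t * of_real (trunc_row k s w * trunc_row k t w)) =
      (\<Sum>u<m. \<Sum>v<m. ent B u v * of_real (z (f u) w * z (f v) w))" for w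
  proof -
    define y where "y = C * \<zeta> w"
    have "(\<Sum>s<n. \<Sum>t<n. ent A s t * of_real (trunc_row k s w * trunc_row k t w)) =
        (\<Sum>s<n. \<Sum>t<n. cnj (ent y s 0) * (ent A s t * ent y t 0))"
    proof (intro sum.cong refl)
      fix s t assume "s \<in> {..<n}" "t \<in> {..<n}"
      then have e: "ent y s 0 = complex_of_real (trunc_row k s w)" "ent y t 0 = complex_of_real (trunc_row k t w)"
        using Ct by (simp_all add: y_def)
      show "ent A s t * of_real (trunc_row k s w * trunc_row k t w) = cnj (ent y s 0) * (ent A s t * ent y t 0)"
        unfolding e by simp
    qed
    also have "\<dots> = ent (cadj y * (A * y)) 0 0"
    proof -
      have "ent (cadj y * (A * y)) 0 0 = (\<Sum>s<n. ent (cadj y) 0 s * ent (A * y) s 0)"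
      proof (rule ent_mult)
        fix s assume "n \<le> s"
        then have "ent (A * y) s 0 = 0" using A by (auto simp: ent_mult0 corner_iff)
        then show "ent (cadj y) 0 s * ent (A * y) s 0 = 0" by simp
      qed
      moreover have "ent (A * y) s 0 = (\<Sum>t<n. ent A s t * ent y t 0)" for s
        by (rule ent_mult) (use A in \<open>simp add: corner_iff\<close>)
      ultimately show ?thesis by (simp add: sum_distrib_left)
    qed
    also have "cadj y * (A * y) = cadj (\<zeta> w) * (B * \<zeta> w)" by (simp add: y_def B_def mult.assoc)
    also have "ent \<dots> 0 0 = (\<Sum>u<m. ent (cadj (\<zeta> w)) 0 u * (\<Sum>v<m. ent B u v * ent (\<zeta> w) v 0))"
    proof -
      have "ent (cadj (\<zeta> w) * (B * \<zeta> w)) 0 0 = (\<Sum>u<m. ent (cadj (\<zeta> w)) 0 u * ent (B * \<zeta> w) u 0)"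
        by (rule ent_mult) (simp add: \<zeta>_def)
      moreover have "ent (B * \<zeta> w) u 0 = (\<Sum>v<m. ent B u v * ent (\<zeta> w) v 0)" for u
        by (rule ent_mult) (simp add: \<zeta>_def)
      ultimately show ?thesis by simp
    qed
    also have "\<dots> = (\<Sum>u<m. \<Sum>v<m. ent B u v * of_real (z (f u) w * z (f v) w))"
      by (simp add: \<zeta>_def sum_distrib_left mult_ac)
    finally show ?thesis .
  qed
  have tr: "ctr (A * (C * cadj C)) = (\<Sum>u<m. \<Sum>v<m. ent B u v * (if u = v then 1 else 0))"
  proof -
    have "ctr ((A * C) * cadj C) = ctr (cadj C * (A * C))" by (rule ctr_comm)
    then have "ctr (A * (C * cadj C)) = ctr B" by (simp add: B_def mult.assoc)
    also have "\<dots> = (\<Sum>u<m. ent B u u)" by (rule ctr_eq) (use cB in \<open>simp add: corner_iff\<close>)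
    finally show ?thesis by (simp add: if_distrib cong: if_cong)
  qed
  have "(\<integral>\<^sup>+w. ennreal ((cmod ((\<Sum>s<n. \<Sum>t<n. ent A s t * of_real (trunc_row k s w * trunc_row k t w)) -
      ctr (A * (C * cadj C))))\<^sup>2) \<partial>M) =
    (\<integral>\<^sup>+w. ennreal ((cmod (\<Sum>u<m. \<Sum>v<m. ent B u v * of_real (z (f u) w * z (f v) w - (if u = v then 1 else 0))))\<^sup>2) \<partial>M)"
  proof -
    have "(\<Sum>u<m. \<Sum>v<m. ent B u v * of_real (z (f u) w * z (f v) w)) - (\<Sum>u<m. \<Sum>v<m. ent B u v * (if u = v then 1 else 0)) =
        (\<Sum>u<m. \<Sum>v<m. ent B u v * of_real (z (f u) w * z (f v) w - (if u = v then 1 else 0)))" for w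
      unfolding sum_subtractf[symmetric] by (intro sum.cong refl) (simp add: right_diff_distrib)
    then show ?thesis unfolding quad tr by simp
  qed
  also have "\<dots> \<le> ennreal ((\<sigma> + 2) * (\<Sum>u<m. \<Sum>v<m. (cmod (ent B u v))\<^sup>2))"
    by (rule quad_complex[OF inj])
  also have "\<dots> \<le> ennreal ((\<bar>\<sigma>\<bar> + 2) * (\<Sum>j. \<bar>c j\<bar>) ^ 4 * (norm A)\<^sup>2)"
  proof (rule ennreal_leI)
    let ?s = "\<Sum>j. \<bar>c j\<bar>"
    have s: "0 \<le> ?s" using c by (intro suminf_nonneg) auto
    have C: "op_bound ?s C" unfolding C_def by (rule op_bound_trunc_mat[OF c])
    have "norm B \<le> ?s * norm (cadj C * A)" using C by (simp add: B_def op_bound_def)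
    also have "\<dots> \<le> ?s * (?s * norm A)" using op_bound_cadj[OF C] s by (intro mult_left_mono) (auto simp: op_bound_def)
    finally have "(norm B)\<^sup>2 \<le> (?s * (?s * norm A))\<^sup>2" by (rule power_mono) simp
    also have "\<dots> = ?s ^ 4 * (norm A)\<^sup>2" by (simp add: power2_eq_square power4_eq_xxxx mult_ac)
    finally have nB: "(norm B)\<^sup>2 \<le> ?s ^ 4 * (norm A)\<^sup>2" .
    have "(\<sigma> + 2) * (norm B)\<^sup>2 \<le> (\<bar>\<sigma>\<bar> + 2) * (norm B)\<^sup>2" by (intro mult_right_mono) auto
    also have "\<dots> \<le> (\<bar>\<sigma>\<bar> + 2) * (?s ^ 4 * (norm A)\<^sup>2)" using nB by (intro mult_left_mono) auto
    finally show "(\<sigma> + 2) * (\<Sum>u<m. \<Sum>v<m. (cmod (ent B u v))\<^sup>2) \<le> (\<bar>\<sigma>\<bar> + 2) * ?s ^ 4 * (norm A)\<^sup>2"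
      unfolding norm_cmat_square[OF corner_csize[OF cB]] by (simp add: mult.assoc)
  qed
  finally show ?thesis unfolding C_def .
qed

text \<open>Fatou's lemma in the truncation lag: forms and traces converge almost surely, and the
  bound for the truncated row does not depend on the lag.\<close>

lemma row_form:
  assumes A: "corner n A"
  shows "(\<integral>\<^sup>+w. ennreal ((cmod ((\<Sum>s<n. \<Sum>t<n. ent A s t * of_real (row s w * row t w)) -
      ctr (A * toeplitz n (autocov c))))\<^sup>2) \<partial>M)
    \<le> ennreal ((\<bar>\<sigma>\<bar> + 2) * (\<Sum>j. \<bar>c j\<bar>) ^ 4 * (norm A)\<^sup>2)"
proof -
  define Q where "Q k w = (cmod ((\<Sum>s<n. \<Sum>t<n. ent A s t * of_real (trunc_row k s w * trunc_row k t w)) -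
      ctr (A * (trunc_mat c n k * cadj (trunc_mat c n k)))))\<^sup>2" for k w
  define Q' where "Q' w = (cmod ((\<Sum>s<n. \<Sum>t<n. ent A s t * of_real (row s w * row t w)) -
      ctr (A * toeplitz n (autocov c))))\<^sup>2" for w
  have ctl: "(\<lambda>k. ctr (A * (trunc_mat c n k * cadj (trunc_mat c n k)))) \<longlonglongrightarrow> ctr (A * toeplitz n (autocov c))"
  proof -
    have e: "ctr (A * X) = (\<Sum>i<n. \<Sum>j<n. ent A i j * ent X j i)" for X
      by (rule ctr_mult) (use A in \<open>auto simp: corner_iff\<close>)
    show ?thesis unfolding e by (intro tendsto_intros trunc_gram_entry c)
  qed
  have "AE w in M. \<forall>t. summable (\<lambda>j. c j * z (int t + 1 - int j) w)"
    using AE_summable by (subst AE_all_countable) auto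
  then have lim: "AE w in M. (\<lambda>k. Q k w) \<longlonglongrightarrow> Q' w"
  proof eventually_elim
    case (elim w)
    have "(\<lambda>k. trunc_row k t w) \<longlonglongrightarrow> row t w" for t
      unfolding trunc_row_def row_def by (rule summable_LIMSEQ') (use elim in auto)
    then have "(\<lambda>k. complex_of_real (trunc_row k s w * trunc_row k t w)) \<longlonglongrightarrow> of_real (row s w * row t w)" for s t
      by (intro tendsto_of_real tendsto_mult)
    then show ?case unfolding Q_def Q'_def
      by (intro tendsto_power tendsto_norm tendsto_diff ctl tendsto_sum tendsto_mult tendsto_const)
  qed
  have "(\<integral>\<^sup>+w. ennreal (Q' w) \<partial>M) = (\<integral>\<^sup>+w. liminf (\<lambda>k. ennreal (Q k w)) \<partial>M)"
  proof (rule nn_integral_cong_AE)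
    show "AE w in M. ennreal (Q' w) = liminf (\<lambda>k. ennreal (Q k w))"
      using lim
    proof eventually_elim
      case (elim w)
      have "(\<lambda>k. ennreal (Q k w)) \<longlonglongrightarrow> ennreal (Q' w)" by (intro tendsto_ennrealI elim)
      then show ?case by (rule lim_imp_Liminf[symmetric, rotated]) simp
    qed
  qed
  also have "\<dots> \<le> liminf (\<lambda>k. \<integral>\<^sup>+w. ennreal (Q k w) \<partial>M)"
    by (rule nn_integral_liminf) (simp add: Q_def)
  also have "\<dots> \<le> liminf (\<lambda>k. ennreal ((\<bar>\<sigma>\<bar> + 2) * (\<Sum>j. \<bar>c j\<bar>) ^ 4 * (norm A)\<^sup>2))"
    by (intro Liminf_mono always_eventually allI) (unfold Q_def, rule trunc_form[OF A])
  also have "\<dots> = ennreal ((\<bar>\<sigma>\<bar> + 2) * (\<Sum>j. \<bar>c j\<bar>) ^ 4 * (norm A)\<^sup>2)"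
    by (simp add: Liminf_const)
  finally show ?thesis unfolding Q'_def .
qed

end

section \<open>The fixed point equation\<close>

lemma LIMSEQ_unique_limit_point:
  fixes s :: "nat \<Rightarrow> complex"
  assumes bd: "bounded (range s)"
    and un: "\<And>r l. strict_mono r \<Longrightarrow> (s \<circ> r) \<longlonglongrightarrow> l \<Longrightarrow> l = m"
  shows "s \<longlonglongrightarrow> m"
proof (rule ccontr)
  assume "\<not> s \<longlonglongrightarrow> m"
  then obtain e where e: "e > 0" "\<not> (\<forall>\<^sub>F n in sequentially. dist (s n) m < e)"
    unfolding tendsto_iff by blast
  then have "infinite {n. e \<le> dist (s n) m}"
    unfolding cofinite_eq_sequentially[symmetric] eventually_cofinite by (simp add: not_less)
  then obtain r :: "nat \<Rightarrow> nat" where r: "strict_mono r" "\<And>n. r n \<in> {n. e \<le> dist (s n) m}"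
    using infinite_enumerate by blast
  have "bounded (range (s \<circ> r))" by (rule bounded_subset[OF bd]) auto
  then obtain l r' where l: "strict_mono (r' :: nat \<Rightarrow> nat)" "((s \<circ> r) \<circ> r') \<longlonglongrightarrow> l"
    using bounded_imp_convergent_subsequence by blast
  have "l = m" by (rule un[of "r \<circ> r'"]) (use l r strict_mono_o in \<open>auto simp: o_assoc\<close>)
  with l(2) have "\<forall>\<^sub>F n in sequentially. dist (((s \<circ> r) \<circ> r') n) m < e" using e(1) tendstoD by blast
  then obtain n where "dist (s (r (r' n))) m < e" by (auto simp: eventually_sequentially)
  then show False using r(2)[of "r' n"] by simp
qed

text \<open>In the application U is the law of a uniform frequency and f the symbol; the analysis of
  the equation uses only that f is bounded and nonnegative.\<close>

locale stieltjes_fixed_point = prob_space U for U :: "'b measure" +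
  fixes f :: "'b \<Rightarrow> real" and L y :: real
  assumes f_meas [measurable]: "f \<in> borel_measurable U"
    and f_nonneg: "\<And>x. 0 \<le> f x" and f_le: "\<And>x. f x \<le> L" and L_pos: "0 < L" and y_pos: "0 < y"
begin

definition \<Phi> :: "complex \<Rightarrow> complex" where
  "\<Phi> m = (\<integral>x. of_real (f x) / (1 + of_real (f x) * m) \<partial>U)"

text \<open>The limit of the normalised traces of \<Gamma> K for a scalar b. At b = - z m it equals
  - \<Phi> m / z, which is how the system for b and m collapses to one equation.\<close>

definition \<Psi> :: "complex \<Rightarrow> complex \<Rightarrow> complex" where
  "\<Psi> z b = (\<integral>x. of_real (f x) / (b * of_real (f x) - z) \<partial>U)"

definition fixed_point :: "complex \<Rightarrow> complex \<Rightarrow> bool" where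
  "fixed_point z m \<longleftrightarrow> Im m > 0 \<and> 1 / m = - z + of_real y * \<Phi> m"

lemma one_plus_nz: "Im m > 0 \<Longrightarrow> 1 + of_real (f x) * m \<noteq> 0"
proof
  assume m: "Im m > 0" and e: "1 + of_real (f x) * m = 0"
  from e have "Im (1 + of_real (f x) * m) = 0" by simp
  then have "f x = 0" using m by simp
  then show False using e by simp
qed

lemma kernel_le: "Im m > 0 \<Longrightarrow> cmod (of_real (f x) / (1 + of_real (f x) * m)) \<le> 1 / Im m"
proof -
  assume m: "Im m > 0"
  have "f x * Im m \<le> cmod (1 + of_real (f x) * m)"
    using abs_Im_le_cmod[of "1 + of_real (f x) * m"] f_nonneg[of x] by simp
  then have "f x / cmod (1 + of_real (f x) * m) \<le> 1 / Im m"
    using m one_plus_nz[OF m, of x] by (simp add: divide_simps)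
  then show ?thesis using f_nonneg[of x] by (simp add: norm_divide)
qed

lemma kernel_int: "Im m > 0 \<Longrightarrow> integrable U (\<lambda>x. of_real (f x) / (1 + of_real (f x) * m))"
  by (rule integrable_const_bound[where B="1 / Im m"]) (auto intro: kernel_le)

lemma kernel_prod_int:
  assumes "Im m > 0" "Im m' > 0"
  shows "integrable U (\<lambda>x. (of_real (f x) / (1 + of_real (f x) * m)) * (of_real (f x) / (1 + of_real (f x) * m')))"
proof (rule integrable_const_bound[where B="1 / Im m * (1 / Im m')"])
  show "AE x in U. cmod ((of_real (f x) / (1 + of_real (f x) * m)) * (of_real (f x) / (1 + of_real (f x) * m'))) \<le> 1 / Im m * (1 / Im m')"
    unfolding norm_mult by (intro AE_I2 mult_mono kernel_le assms) (use assms in auto)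
qed measurable

lemma kernel_sq_int:
  assumes "Im m > 0"
  shows "integrable U (\<lambda>x. (cmod (of_real (f x) / (1 + of_real (f x) * m)))\<^sup>2)"
  by (rule integrable_const_bound[where B="(1 / Im m)\<^sup>2"])
    (use assms kernel_le in \<open>auto intro!: power_mono\<close>)

text \<open>The imaginary part of the equation. Every term contains the factor Im m except Im z;
  this identity drives both the uniqueness and the bound on the support.\<close>

lemma fixed_point_Im:
  assumes fp: "fixed_point z m"
  shows "Im m * (1 / (cmod m)\<^sup>2 - y * (\<integral>x. (cmod (of_real (f x) / (1 + of_real (f x) * m)))\<^sup>2 \<partial>U)) = Im z"
proof -
  have m: "Im m > 0" and eq: "1 / m = - z + of_real y * \<Phi> m" using fp by (auto simp: fixed_point_def)
  have k: "Im (of_real (f x) / (1 + of_real (f x) * m)) = - (Im m * (cmod (of_real (f x) / (1 + of_real (f x) * m)))\<^sup>2)" for x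
  proof -
    have "Im (of_real (f x) / (1 + of_real (f x) * m)) = - (f x * (f x * Im m)) / (cmod (1 + of_real (f x) * m))\<^sup>2"
      by (simp add: Im_divide cmod_power2)
    then show ?thesis by (simp add: norm_divide power_divide power2_eq_square mult_ac)
  qed
  have "Im (\<Phi> m) = (\<integral>x. - (Im m * (cmod (of_real (f x) / (1 + of_real (f x) * m)))\<^sup>2) \<partial>U)"
    unfolding \<Phi>_def by (subst integral_Im[symmetric, OF kernel_int[OF m]]) (simp only: k)
  also have "\<dots> = - (Im m * (\<integral>x. (cmod (of_real (f x) / (1 + of_real (f x) * m)))\<^sup>2 \<partial>U))" by simp
  finally have i: "Im (\<Phi> m) = - (Im m * (\<integral>x. (cmod (of_real (f x) / (1 + of_real (f x) * m)))\<^sup>2 \<partial>U))" .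
  have "Im (1 / m) = - (Im m / (cmod m)\<^sup>2)" by (simp add: Im_divide cmod_power2)
  then have "- (Im m / (cmod m)\<^sup>2) = - Im z - y * (Im m * (\<integral>x. (cmod (of_real (f x) / (1 + of_real (f x) * m)))\<^sup>2 \<partial>U))"
    using arg_cong[OF eq, of Im] i by simp
  then show ?thesis by (simp add: algebra_simps)
qed

lemma fixed_point_energy:
  assumes fp: "fixed_point z m" and z: "Im z > 0"
  shows "(cmod m)\<^sup>2 * (y * (\<integral>x. (cmod (of_real (f x) / (1 + of_real (f x) * m)))\<^sup>2 \<partial>U)) < 1"
proof -
  have m: "Im m > 0" using fp by (auto simp: fixed_point_def)
  then have m0: "(cmod m)\<^sup>2 > 0" by auto
  let ?I = "y * (\<integral>x. (cmod (of_real (f x) / (1 + of_real (f x) * m)))\<^sup>2 \<partial>U)"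
  have "0 < Im m * (1 / (cmod m)\<^sup>2 - ?I)" using fixed_point_Im[OF fp] z by simp
  then have "?I < 1 / (cmod m)\<^sup>2" using m by (simp add: zero_less_mult_iff)
  then show ?thesis using m0 by (simp add: field_simps)
qed

text \<open>Subtracting the equations and cancelling m' - m leaves 1 = m m' y E[a b]. By 2 s t <=
  s^2 + t^2 the right side is at most the mean of the two quantities in
  \<open>fixed_point_energy\<close>, both below 1.\<close>

lemma fixed_point_unique:
  assumes 1: "fixed_point z m" and 2: "fixed_point z m'" and z: "Im z > 0"
  shows "m = m'"
proof (rule ccontr)
  assume ne: "m \<noteq> m'"
  have m: "Im m > 0" "Im m' > 0" using 1 2 by (auto simp: fixed_point_def)
  then have nz: "m \<noteq> 0" "m' \<noteq> 0" by auto
  define a b where "a x = of_real (f x) / (1 + of_real (f x) * m)" and "b x = of_real (f x) / (1 + of_real (f x) * m')" for x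
  have ab: "a x - b x = (m' - m) * (a x * b x)" for x
    using one_plus_nz[OF m(1), of x] one_plus_nz[OF m(2), of x]
    by (simp add: a_def b_def divide_simps) (simp add: algebra_simps)
  have i: "integrable U a" "integrable U b" "integrable U (\<lambda>x. a x * b x)"
    "integrable U (\<lambda>x. (cmod (a x))\<^sup>2)" "integrable U (\<lambda>x. (cmod (b x))\<^sup>2)"
    using kernel_int m kernel_prod_int kernel_sq_int by (auto simp: a_def[abs_def] b_def[abs_def])
  have e1: "1 / m = - z + of_real y * \<Phi> m" "1 / m' = - z + of_real y * \<Phi> m'" using 1 2 by (simp_all add: fixed_point_def)
  have "1 / m - 1 / m' = of_real y * (\<Phi> m - \<Phi> m')" unfolding e1 by (simp add: right_diff_distrib)
  also have "\<Phi> m - \<Phi> m' = (\<integral>x. a x - b x \<partial>U)"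
    unfolding Bochner_Integration.integral_diff[OF i(1,2)] by (simp add: \<Phi>_def a_def[abs_def] b_def[abs_def])
  also have "\<dots> = (m' - m) * (\<integral>x. a x * b x \<partial>U)" unfolding ab by simp
  finally have e: "(m' - m) / (m * m') = (m' - m) * (of_real y * (\<integral>x. a x * b x \<partial>U))"
    using nz by (simp add: field_simps)
  have "1 = m * m' * (of_real y * (\<integral>x. a x * b x \<partial>U))" 
  proof -
    have "(m' - m) * (1 / (m * m')) = (m' - m) * (of_real y * (\<integral>x. a x * b x \<partial>U))" using e by simp
    then have "1 / (m * m') = of_real y * (\<integral>x. a x * b x \<partial>U)" unfolding mult_cancel_left using ne by simp
    then show ?thesis using nz by (simp add: field_simps)
  qed
  then have "1 = cmod (m * m' * (of_real y * (\<integral>x. a x * b x \<partial>U)))" by simp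
  also have "\<dots> = y * (cmod m * cmod m' * cmod (\<integral>x. a x * b x \<partial>U))"
    using y_pos by (simp add: norm_mult)
  also have "\<dots> \<le> y * ((cmod m)\<^sup>2 * (\<integral>x. (cmod (a x))\<^sup>2 \<partial>U) + (cmod m')\<^sup>2 * (\<integral>x. (cmod (b x))\<^sup>2 \<partial>U)) / 2"
  proof -
    have "cmod m * cmod m' * cmod (\<integral>x. a x * b x \<partial>U) \<le> cmod m * cmod m' * (\<integral>x. cmod (a x * b x) \<partial>U)"
      by (intro mult_left_mono integral_norm_bound) auto
    also have "\<dots> = (\<integral>x. cmod m * cmod m' * cmod (a x * b x) \<partial>U)" by simp
    also have "\<dots> \<le> (\<integral>x. ((cmod m)\<^sup>2 * (cmod (a x))\<^sup>2 + (cmod m')\<^sup>2 * (cmod (b x))\<^sup>2) / 2 \<partial>U)"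
    proof (rule integral_mono)
      show "cmod m * cmod m' * cmod (a x * b x) \<le> ((cmod m)\<^sup>2 * (cmod (a x))\<^sup>2 + (cmod m')\<^sup>2 * (cmod (b x))\<^sup>2) / 2" for x
        using sum_squares_bound[of "cmod m * cmod (a x)" "cmod m' * cmod (b x)"]
        by (simp add: norm_mult power_mult_distrib mult_ac)
    qed (use i in auto)
    also have "\<dots> = ((cmod m)\<^sup>2 * (\<integral>x. (cmod (a x))\<^sup>2 \<partial>U) + (cmod m')\<^sup>2 * (\<integral>x. (cmod (b x))\<^sup>2 \<partial>U)) / 2"
      using i by simp
    finally show ?thesis using y_pos by (simp add: mult_left_mono flip: times_divide_eq_right)
  qed
  also have "\<dots> < 1"
  proof -
    have "(cmod m)\<^sup>2 * (y * (\<integral>x. (cmod (a x))\<^sup>2 \<partial>U)) < 1" "(cmod m')\<^sup>2 * (y * (\<integral>x. (cmod (b x))\<^sup>2 \<partial>U)) < 1"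
      using fixed_point_energy[OF 1 z] fixed_point_energy[OF 2 z] by (simp_all add: a_def b_def)
    then show ?thesis by (simp add: algebra_simps)
  qed
  finally show False by simp
qed

lemma lower_denominator: "Im z \<le> cmod (b * of_real (f x) - z)" if "Im b \<le> 0"
  using abs_Im_le_cmod[of "b * of_real (f x) - z"] mult_nonpos_nonneg[OF that f_nonneg[of x]] by simp

lemma lower_kernel_le:
  assumes "Im z > 0" "Im b \<le> 0"
  shows "cmod (of_real (f x) / (b * of_real (f x) - z)) \<le> L / Im z"
  using lower_denominator[OF assms(2), of z x] assms(1) f_nonneg[of x] f_le[of x] L_pos
  by (auto simp: norm_divide intro!: frac_le)

lemma lower_kernel_int:
  assumes "Im z > 0" "Im b \<le> 0"
  shows "integrable U (\<lambda>x. of_real (f x) / (b * of_real (f x) - z))"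
  by (rule integrable_const_bound[where B="L / Im z"]) (use lower_kernel_le[OF assms] in auto)

lemma \<Psi>_diff_le:
  assumes z: "Im z > 0" and b: "Im b \<le> 0" and b': "Im b' \<le> 0"
  shows "cmod (\<Psi> z b - \<Psi> z b') \<le> cmod (b - b') * (L / Im z)\<^sup>2"
proof -
  let ?k = "\<lambda>b x. of_real (f x) / (b * of_real (f x) - z)"
  have nz: "b * of_real (f x) - z \<noteq> 0" "b' * of_real (f x) - z \<noteq> 0" for x
    using lower_denominator[OF b, of z x] lower_denominator[OF b', of z x] z by auto
  have e: "?k b x - ?k b' x = (b' - b) * (?k b x * ?k b' x)" for x
    using nz[of x] by (simp add: divide_simps) (simp add: algebra_simps)
  have "\<Psi> z b - \<Psi> z b' = (\<integral>x. ?k b x - ?k b' x \<partial>U)"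
    using lower_kernel_int[OF z b] lower_kernel_int[OF z b'] by (simp add: \<Psi>_def)
  also have "cmod \<dots> \<le> (\<integral>x. cmod (?k b x - ?k b' x) \<partial>U)" by (rule integral_norm_bound)
  also have "\<dots> \<le> (\<integral>x. cmod (b - b') * (L / Im z)\<^sup>2 \<partial>U)"
  proof (rule integral_mono)
    show "integrable U (\<lambda>x. cmod (?k b x - ?k b' x))"
      using lower_kernel_int[OF z b] lower_kernel_int[OF z b'] by auto
    fix x
    have "cmod (?k b x * ?k b' x) \<le> (L / Im z) * (L / Im z)"
      unfolding norm_mult using lower_kernel_le[OF z b, of x] lower_kernel_le[OF z b', of x] z L_pos
      by (intro mult_mono) auto
    then show "cmod (?k b x - ?k b' x) \<le> cmod (b - b') * (L / Im z)\<^sup>2"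
      unfolding e norm_mult[of "b' - b"] norm_minus_commute[of b'] by (intro mult_left_mono) (auto simp: power2_eq_square)
  qed simp
  finally show ?thesis by (simp add: prob_space)
qed

text \<open>The relation s = - b / z forces b to converge to - z m, in the closed lower half-plane
  where \<Psi> is Lipschitz. The limit of g is then y \<Psi>, and b (1 + g) = 1 becomes the equation
  for m.\<close>

lemma fixed_point_of_limit:
  fixes s g b :: "nat \<Rightarrow> complex" and r :: "nat \<Rightarrow> real"
  assumes z: "Im z > 0" and s: "s \<longlonglongrightarrow> m" and Ims: "\<And>n. Im (s n) \<ge> 0"
    and sb: "(\<lambda>n. s n + b n / z) \<longlonglongrightarrow> 0" and Imb: "\<And>n. Im (b n) \<le> 0"
    and bg: "\<And>n. b n * (1 + g n) = 1"
    and g: "(\<lambda>n. g n - of_real (r n) * \<Psi> z (b n)) \<longlonglongrightarrow> 0" and r: "r \<longlonglongrightarrow> y"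
  shows "fixed_point z m"
proof -
  have z0: "z \<noteq> 0" using z by auto
  define \<beta> where "\<beta> = - z * m"
  have "(\<lambda>n. z * ((s n + b n / z) - s n)) \<longlonglongrightarrow> z * (0 - m)" by (intro tendsto_intros sb s)
  then have b: "b \<longlonglongrightarrow> \<beta>" using z0 by (simp add: \<beta>_def)
  have Im\<beta>: "Im \<beta> \<le> 0" by (rule LIMSEQ_le_const2[OF tendsto_Im[OF b]]) (use Imb in auto)
  have "(\<lambda>n. \<Psi> z (b n)) \<longlonglongrightarrow> \<Psi> z \<beta>"
  proof (rule Lim_transform2[OF tendsto_const])
    have "(\<lambda>n. cmod (\<beta> - b n) * (L / Im z)\<^sup>2) \<longlonglongrightarrow> cmod (\<beta> - \<beta>) * (L / Im z)\<^sup>2" by (intro tendsto_intros b)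
    then have "(\<lambda>n. cmod (\<beta> - b n) * (L / Im z)\<^sup>2) \<longlonglongrightarrow> 0" by simp
    then show "(\<lambda>n. \<Psi> z \<beta> - \<Psi> z (b n)) \<longlonglongrightarrow> 0"
      by (rule Lim_null_comparison[rotated]) (use \<Psi>_diff_le[OF z Im\<beta> Imb] in auto)
  qed
  then have "(\<lambda>n. (g n - of_real (r n) * \<Psi> z (b n)) + of_real (r n) * \<Psi> z (b n)) \<longlonglongrightarrow> 0 + of_real y * \<Psi> z \<beta>"
    by (intro tendsto_intros g r)
  then have "g \<longlonglongrightarrow> of_real y * \<Psi> z \<beta>" by simp
  then have "(\<lambda>n. b n * (1 + g n)) \<longlonglongrightarrow> \<beta> * (1 + of_real y * \<Psi> z \<beta>)" by (intro tendsto_intros b)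
  then have \<beta>: "\<beta> * (1 + of_real y * \<Psi> z \<beta>) = 1" unfolding bg using LIMSEQ_unique tendsto_const by blast
  then have m0: "m \<noteq> 0" by (auto simp: \<beta>_def)
  have k: "of_real (f x) / (\<beta> * of_real (f x) - z) = - (1 / z) * (of_real (f x) / (1 + of_real (f x) * m))" for x
  proof -
    have "\<beta> * of_real (f x) - z = - z * (1 + of_real (f x) * m)" by (simp add: \<beta>_def algebra_simps)
    then show ?thesis by simp
  qed
  have \<Psi>: "\<Psi> z \<beta> = - (1 / z) * \<Phi> m" unfolding \<Psi>_def \<Phi>_def k by (rule integral_mult_right_zero)
  have eq: "1 / m = - z + of_real y * \<Phi> m"
  proof -
    have "- z * m * (1 + of_real y * (- (1 / z) * \<Phi> m)) = 1" using \<beta> unfolding \<Psi> by (simp add: \<beta>_def)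
    then have "m * (- z + of_real y * \<Phi> m) = 1" using z0 by (simp add: algebra_simps)
    then show ?thesis using m0 by (simp add: field_simps)
  qed
  have "Im m \<ge> 0" by (rule LIMSEQ_le_const[OF tendsto_Im[OF s]]) (use Ims in auto)
  \<comment> \<open>For real m every value of the kernel is real, also where the denominator is 0
    and the quotient is 0 by convention. Then \<Phi> m is real, and the equation would give the real
    number 1 / m the imaginary part - Im z.\<close>
  moreover have "Im m \<noteq> 0"
  proof
    assume "Im m = 0"
    then have m: "m = of_real (Re m)" by (simp add: complex_eq_iff)
    have k: "of_real (f x) / (1 + of_real (f x) * m) = complex_of_real (f x / (1 + f x * Re m))" for x
      by (subst m) simp
    have "\<Phi> m = of_real (\<integral>x. f x / (1 + f x * Re m) \<partial>U)" unfolding \<Phi>_def k by (rule integral_complex_of_real)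
    then have "Im (1 / m) = - Im z" unfolding eq by simp
    moreover have "Im (1 / m) = 0" by (subst m) (simp flip: of_real_divide)
    ultimately show False using z by simp
  qed
  ultimately show ?thesis using eq by (simp add: fixed_point_def)
qed

lemma fixed_point_limit:
  fixes s g b :: "nat \<Rightarrow> complex" and r :: "nat \<Rightarrow> real"
  assumes z: "Im z > 0" and s: "\<And>n. cmod (s n) \<le> B" and Ims: "\<And>n. Im (s n) \<ge> 0"
    and sb: "(\<lambda>n. s n + b n / z) \<longlonglongrightarrow> 0" and Imb: "\<And>n. Im (b n) \<le> 0"
    and bg: "\<And>n. b n * (1 + g n) = 1"
    and g: "(\<lambda>n. g n - of_real (r n) * \<Psi> z (b n)) \<longlonglongrightarrow> 0" and r: "r \<longlonglongrightarrow> y"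
  obtains m where "fixed_point z m" "s \<longlonglongrightarrow> m"
proof -
  have sub: "fixed_point z l" if q: "strict_mono q" "(s \<circ> q) \<longlonglongrightarrow> l" for q l
    by (rule fixed_point_of_limit[OF z q(2), of "b \<circ> q" "g \<circ> q" "r \<circ> q"])
      (use Ims Imb bg LIMSEQ_subseq_LIMSEQ[OF sb q(1)] LIMSEQ_subseq_LIMSEQ[OF g q(1)] LIMSEQ_subseq_LIMSEQ[OF r q(1)]
        in \<open>simp_all add: comp_def\<close>)
  have bd: "bounded (range s)" using s by (auto intro!: boundedI)
  then obtain m q where m: "strict_mono (q :: nat \<Rightarrow> nat)" "(s \<circ> q) \<longlonglongrightarrow> m"
    using bounded_imp_convergent_subsequence by blast
  have fp: "fixed_point z m" by (rule sub[OF m])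
  have "s \<longlonglongrightarrow> m"
    by (rule LIMSEQ_unique_limit_point[OF bd]) (use sub fixed_point_unique[OF _ fp z] in blast)
  then show ?thesis using that fp by blast
qed

lemma \<Phi>_le:
  assumes "cmod m * L \<le> 1 / 2"
  shows "cmod (of_real (f x) / (1 + of_real (f x) * m)) \<le> 2 * L" "cmod (\<Phi> m) \<le> 2 * L"
proof -
  show k: "cmod (of_real (f x) / (1 + of_real (f x) * m)) \<le> 2 * L" for x
  proof -
    have "cmod (of_real (f x) * m) \<le> L * cmod m"
      using f_nonneg[of x] f_le[of x] by (simp add: norm_mult mult_right_mono)
    then have "1 / 2 \<le> cmod (1 + of_real (f x) * m)"
      using norm_triangle_ineq2[of 1 "- (of_real (f x) * m)"] assms by (simp add: mult.commute)
    then have "f x / cmod (1 + of_real (f x) * m) \<le> L / (1 / 2)"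
      using f_nonneg[of x] f_le[of x] L_pos by (intro frac_le) auto
    then show ?thesis using f_nonneg[of x] by (simp add: norm_divide)
  qed
  have "cmod (\<Phi> m) \<le> (\<integral>x. 2 * L \<partial>U)" unfolding \<Phi>_def
    by (rule order_trans[OF integral_norm_bound integral_mono'])
      (use k L_pos in auto)
  then show "cmod (\<Phi> m) \<le> 2 * L" by (simp add: prob_space)
qed

text \<open>At z = i e the equation reads 1 + i e m = m y \<Phi> m, and the right side is O(1 / e)
  because \<Phi> is bounded near 0. This is the condition that the limit has total mass one.\<close>

lemma fixed_point_imaginary_axis:
  assumes fp: "\<And>k. fixed_point (Complex 0 (real (Suc k))) (m k)" and bd: "\<And>k. cmod (m k) \<le> 1 / real (Suc k)"
  shows "(\<lambda>k. real (Suc k) * Im (m k)) \<longlonglongrightarrow> 1"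
proof -
  have ev: "\<forall>\<^sub>F k in sequentially. norm (1 - real (Suc k) * Im (m k)) \<le> (2 * L * y) * inverse (real (Suc k))"
  proof -
    obtain N where N: "real N \<ge> 2 * L" using real_arch_simple by blast
    show ?thesis
    proof (rule eventually_sequentiallyI[of N])
      fix k assume "N \<le> k"
      then have k: "2 * L \<le> real (Suc k)" using N by simp
      define e where "e = real (Suc k)"
      have e: "e > 0" "2 * L \<le> e" using k by (auto simp: e_def)
      have m0: "m k \<noteq> 0" using fp[of k] by (auto simp: fixed_point_def)
      have bd': "cmod (m k) \<le> 1 / e" using bd by (simp add: e_def)
      have "cmod (m k) * L \<le> 1 / e * L" using bd' L_pos by (intro mult_right_mono) auto
      also have "\<dots> \<le> 1 / 2" using e by (simp add: field_simps)
      finally have \<Phi>: "cmod (\<Phi> (m k)) \<le> 2 * L" by (rule \<Phi>_le)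
      have z: "Complex 0 e = \<i> * of_real e" by (simp add: complex_eq_iff)
      have "1 / m k = - Complex 0 e + of_real y * \<Phi> (m k)" using fp[of k] by (simp add: fixed_point_def e_def)
      then have eq: "1 + \<i> * of_real e * m k = m k * (of_real y * \<Phi> (m k))"
        using m0 unfolding z by (simp add: field_simps)
      have "1 - e * Im (m k) = Re (1 + \<i> * of_real e * m k)" by simp
      then have "norm (1 - e * Im (m k)) \<le> cmod (1 + \<i> * of_real e * m k)"
        using abs_Re_le_cmod[of "1 + \<i> * of_real e * m k"] by simp
      also have "\<dots> = cmod (m k) * (y * cmod (\<Phi> (m k)))" unfolding eq using y_pos by (simp add: norm_mult)
      also have "\<dots> \<le> 1 / e * (y * (2 * L))" using bd' \<Phi> y_pos e by (intro mult_mono) auto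
      finally show "norm (1 - real (Suc k) * Im (m k)) \<le> (2 * L * y) * inverse (real (Suc k))"
        unfolding e_def[symmetric] by (simp add: divide_inverse mult_ac)
    qed
  qed
  have "(\<lambda>k. (2 * L * y) * inverse (real (Suc k))) \<longlonglongrightarrow> (2 * L * y) * 0"
    by (intro tendsto_intros LIMSEQ_inverse_real_of_nat)
  then have "(\<lambda>k. (2 * L * y) * inverse (real (Suc k))) \<longlonglongrightarrow> 0" by simp
  then have "(\<lambda>k. 1 - real (Suc k) * Im (m k)) \<longlonglongrightarrow> 0" by (rule Lim_null_comparison[OF ev])
  then have "(\<lambda>k. 1 - (1 - real (Suc k) * Im (m k))) \<longlonglongrightarrow> 1 - 0" by (intro tendsto_intros)
  then show ?thesis by simp
qed

text \<open>Far out on the real line z = y \<Phi> m - 1 / m can be large only if m is small. For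
  small m the bracket in \<open>fixed_point_Im\<close> is bounded below, so Im m is at most
  proportional to the height e, which is the criterion for null intervals.\<close>

lemma bounded_support_of_fixed_point:
  assumes F: "real_distribution F" and fp: "\<And>z. Im z > 0 \<Longrightarrow> fixed_point z (stieltjes F z)"
  shows "bounded (measure_support F)"
proof -
  interpret F: real_distribution F by fact
  \<comment> \<open>\<open>R\<close> exceeds the bound 2 L y for y \<Phi> m by exactly
    \<open>d\<close>, so |1 / m| >= d. As d >= 4 L, this gives |m| L <= 1/4, well inside the region
    |m| L <= 1/2 in which \<Phi> was bounded.\<close>
  define R where "R = 2 * L * y + 4 * L * (1 + y)"
  define d where "d = 4 * L * (1 + y)"
  have "d = 4 * L + 4 * (L * y)" by (simp add: d_def algebra_simps)
  then have d: "d > 0" "d \<ge> 4 * L" using L_pos y_pos by (simp_all add: add_pos_pos)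
  have inv: "d \<le> cmod (1 / stieltjes F (Complex x e))"
    if x: "\<bar>x\<bar> \<ge> R" and e: "e > 0" and s: "cmod (stieltjes F (Complex x e)) * L \<le> 1 / 2" for x e
  proof -
    have "R \<le> cmod (Complex x e)" using x abs_Re_le_cmod[of "Complex x e"] by simp
    also have "Complex x e = of_real y * \<Phi> (stieltjes F (Complex x e)) - 1 / stieltjes F (Complex x e)"
      using fp[of "Complex x e"] e by (simp add: fixed_point_def)
    also have "cmod (of_real y * \<Phi> (stieltjes F (Complex x e)) - 1 / stieltjes F (Complex x e))
        \<le> y * cmod (\<Phi> (stieltjes F (Complex x e))) + cmod (1 / stieltjes F (Complex x e))"
      using norm_triangle_ineq4[of "of_real y * \<Phi> (stieltjes F (Complex x e))"] y_pos by (simp add: norm_mult)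
    also have "y * cmod (\<Phi> (stieltjes F (Complex x e))) \<le> y * (2 * L)"
      using \<Phi>_le(2)[OF s] y_pos by simp
    finally show ?thesis by (simp add: R_def d_def)
  qed
  \<comment> \<open>A continuity argument down the vertical line: high up |m| L is at most 1/4, and
    it can never equal 1/2, because there the bound improves itself to 1/4.\<close>
  have small: "cmod (stieltjes F (Complex x e)) * L \<le> 1 / 2" if x: "\<bar>x\<bar> \<ge> R" and e: "e > 0" for x e
  proof (rule ccontr)
    assume n: "\<not> cmod (stieltjes F (Complex x e)) * L \<le> 1 / 2"
    define h where "h t = cmod (stieltjes F (Complex x t)) * L" for t
    define e' where "e' = max e (4 * L)"
    have e': "e \<le> e'" "e' > 0" "e' \<ge> 4 * L" using e by (auto simp: e'_def)
    have "h e' \<le> 1 / e' * L" unfolding h_def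
      using F.cmod_stieltjes_le[of "Complex x e'"] e' L_pos by (intro mult_right_mono) auto
    also have "\<dots> \<le> 1 / 2" using e' L_pos by (simp add: field_simps)
    finally have 1: "h e' \<le> 1 / 2" .
    have "continuous_on {e..e'} (\<lambda>t. stieltjes F (Complex x t))"
      by (rule continuous_on_compose2[OF F.continuous_on_stieltjes, of _ "\<lambda>t. Complex x t"])
        (use e in \<open>auto simp: upper_half_plane_def Complex_eq intro!: continuous_intros\<close>)
    then have "continuous_on {e..e'} h" unfolding h_def by (intro continuous_intros)
    then obtain t where t: "e \<le> t" "h t = 1 / 2" using IVT2'[of h e' "1/2" e] 1 n e' by (auto simp: h_def)
    then have "d \<le> cmod (1 / stieltjes F (Complex x t))" using inv[OF x, of t] e by (simp add: h_def)
    moreover have s0: "cmod (stieltjes F (Complex x t)) > 0" using t(2) by (auto simp: h_def)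
    ultimately have "d * cmod (stieltjes F (Complex x t)) \<le> 1" by (simp add: norm_divide field_simps)
    moreover have "4 * L * cmod (stieltjes F (Complex x t)) \<le> d * cmod (stieltjes F (Complex x t))"
      using d s0 by (intro mult_right_mono) auto
    ultimately show False using t(2) by (simp add: h_def mult_ac)
  qed
  show ?thesis
  \<comment> \<open>The 12 comes from 1 / |m|^2 >= d^2 >= 16 L^2 + 32 L^2 y, less the at most 4 L^2
    y of the integral.\<close>
  proof (rule bounded_support_of_stieltjes[OF F, of R "1 / (12 * L\<^sup>2)"])
    have "R = d + 2 * (L * y)" by (simp add: R_def d_def)
    then show "R > 0" using d L_pos y_pos by (simp add: add_pos_pos)
    show "1 / (12 * L\<^sup>2) \<ge> 0" by simp
    fix x e :: real assume x: "\<bar>x\<bar> \<ge> R" and e: "0 < e"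
    define m where "m = stieltjes F (Complex x e)"
    have fpm: "fixed_point (Complex x e) m" using fp e by (simp add: m_def)
    then have Im: "Im m > 0" by (simp add: fixed_point_def)
    let ?I = "\<integral>x. (cmod (of_real (f x) / (1 + of_real (f x) * m)))\<^sup>2 \<partial>U"
    have "?I \<le> (\<integral>x. (2 * L)\<^sup>2 \<partial>U)"
      by (intro integral_mono' power_mono) (use \<Phi>_le(1)[OF small[OF x e]] in \<open>auto simp: m_def\<close>)
    then have I: "y * ?I \<le> y * (4 * L\<^sup>2)" using y_pos by (simp add: prob_space power_mult_distrib)
    have "d\<^sup>2 \<le> (cmod (1 / m))\<^sup>2" using inv[OF x e small[OF x e]] d by (auto simp: m_def intro!: power_mono)
    then have "d\<^sup>2 \<le> 1 / (cmod m)\<^sup>2" by (simp add: norm_divide power_divide)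
    moreover have "d\<^sup>2 = 16 * L\<^sup>2 + 32 * (L\<^sup>2 * y) + 16 * (L\<^sup>2 * y\<^sup>2)"
      by (simp add: d_def power2_eq_square algebra_simps)
    moreover have "0 \<le> L\<^sup>2 * y" "0 \<le> L\<^sup>2 * y\<^sup>2" "0 \<le> L\<^sup>2" using y_pos by auto
    moreover have "y * ?I \<le> 4 * (L\<^sup>2 * y)" using I by (simp only: mult_ac)
    ultimately have "12 * L\<^sup>2 \<le> 1 / (cmod m)\<^sup>2 - y * ?I" by linarith
    then have "Im m * (12 * L\<^sup>2) \<le> Im m * (1 / (cmod m)\<^sup>2 - y * ?I)" using Im by (intro mult_left_mono) auto
    also have "\<dots> = e" using fixed_point_Im[OF fpm] by simp
    finally show "Im (stieltjes F (Complex x e)) \<le> 1 / (12 * L\<^sup>2) * e"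
      using L_pos by (simp add: m_def field_simps)
  qed
qed

end

section \<open>Convergence of the spectral distributions\<close>

locale linear_array = prob_space M for M :: "'a measure" +
  fixes Z :: "nat \<Rightarrow> int \<Rightarrow> 'a \<Rightarrow> real" and c :: "nat \<Rightarrow> real" and \<sigma> :: real
  assumes indep_array: "indep_vars (\<lambda>_. borel) (\<lambda>(i, t). Z i t) ({1..} \<times> UNIV)"
    and fourth_integrable: "\<And>i t. 1 \<le> i \<Longrightarrow> integrable M (\<lambda>w. (Z i t w) ^ 4)"
    and mean_zero: "\<And>i t. 1 \<le> i \<Longrightarrow> expectation (Z i t) = 0"
    and unit_variance: "\<And>i t. 1 \<le> i \<Longrightarrow> expectation (\<lambda>w. (Z i t w)\<^sup>2) = 1"
    and fourth_moment: "\<And>i t. 1 \<le> i \<Longrightarrow> expectation (\<lambda>w. (Z i t w) ^ 4) \<le> \<sigma>"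
    and summable_coeff: "summable (\<lambda>j. \<bar>c j\<bar>)"
begin

definition data :: "'a \<Rightarrow> nat \<Rightarrow> nat \<Rightarrow> real" where
  "data w i t = linear_process c Z (i + 1) (int (t + 1)) w"

lemma row_model: "linear_row M (Z (Suc i)) c \<sigma>"
proof unfold_locales

  have "indep_vars (\<lambda>t. PiM {(Suc i, t)} (\<lambda>_. borel)) (\<lambda>t w. restrict (\<lambda>k. (case k of (i, t) \<Rightarrow> Z i t) w) {(Suc i, t)}) (UNIV :: int set)"
    by (rule indep_vars_restrict[OF indep_array]) (auto simp: disjoint_family_on_def)
  from indep_vars_compose2[OF this, of "\<lambda>t g. g (Suc i, t)" "\<lambda>_. borel"]
  show "indep_vars (\<lambda>_. borel) (Z (Suc i)) UNIV" by simp
qed (use fourth_integrable mean_zero unit_variance fourth_moment summable_coeff in auto)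

lemma data_row: "data w i t = linear_row.row (Z (Suc i)) c t w"
proof -
  interpret linear_row M "Z (Suc i)" c \<sigma> by (rule row_model)
  show ?thesis by (simp add: data_def linear_process_def row_def add.commute)
qed

lemma data_measurable [measurable]: "(\<lambda>w. data w i t) \<in> borel_measurable M"
proof -
  interpret linear_row M "Z (Suc i)" c \<sigma> by (rule row_model)
  show ?thesis unfolding data_row by (rule row_meas)
qed

definition row_law :: "nat \<Rightarrow> nat \<Rightarrow> (nat \<Rightarrow> real) measure" where
  "row_law n i = distr M (PiM {..<n} (\<lambda>_. borel)) (\<lambda>w. \<lambda>t\<in>{..<n}. data w i t)"

lemma row_tuple_measurable [measurable]: "(\<lambda>w. \<lambda>t\<in>{..<n}. data w i t) \<in> measurable M (PiM {..<n} (\<lambda>_. borel))"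
  by measurable

lemma row_law_form:
  assumes A: "corner n A" and p: "p \<ge> 1"
  shows "(\<integral>\<^sup>+x. ennreal ((cmod (of_nat p * ctr (row_vec p n x * A * cadj (row_vec p n x)) -
      ctr (A * toeplitz n (autocov c))))\<^sup>2) \<partial>row_law n i) \<le> ennreal (((\<bar>\<sigma>\<bar> + 2) * (\<Sum>j. \<bar>c j\<bar>) ^ 4) * (norm A)\<^sup>2)"
proof -
  have form: "of_nat p * ctr (row_vec p n x * A * cadj (row_vec p n x)) =
      (\<Sum>s<n. \<Sum>t<n. ent A s t * of_real (x s * x t))" for x
  proof -
    have "ctr (row_vec p n x * A * cadj (row_vec p n x)) = ctr (A * (cadj (row_vec p n x) * row_vec p n x))"
      using ctr_comm[of "row_vec p n x" "A * cadj (row_vec p n x)"] by (simp add: mult.assoc)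
    also have "\<dots> = (\<Sum>s<n. \<Sum>t<n. ent A s t * ent (cadj (row_vec p n x) * row_vec p n x) t s)"
      by (rule ctr_mult) (use A in \<open>auto simp: corner_iff\<close>)
    also have "\<dots> = (\<Sum>s<n. \<Sum>t<n. ent A s t * of_real (x s * x t) / of_nat p)"
    proof (intro sum.cong refl)
      fix s t assume st: "s \<in> {..<n}" "t \<in> {..<n}"
      have "ent (cadj (row_vec p n x) * row_vec p n x) t s = (\<Sum>k<1. ent (cadj (row_vec p n x)) t k * ent (row_vec p n x) k s)"
        by (rule ent_mult) (simp add: row_vec_def)
      also have "\<dots> = of_real (x t / sqrt p) * of_real (x s / sqrt p)"
        using st by (simp add: row_vec_def del: of_real_divide)
      also have "\<dots> = of_real (x t / sqrt p * (x s / sqrt p))" by (simp only: of_real_mult)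
      also have "x t / sqrt p * (x s / sqrt p) = x s * x t / p" by simp
      finally show "ent A s t * ent (cadj (row_vec p n x) * row_vec p n x) t s = ent A s t * of_real (x s * x t) / of_nat p"
        by simp
    qed
    finally show ?thesis using p by (simp add: sum_divide_distrib[symmetric])
  qed
  interpret linear_row M "Z (Suc i)" c \<sigma> by (rule row_model)
  have "(\<integral>\<^sup>+x. ennreal ((cmod ((\<Sum>s<n. \<Sum>t<n. ent A s t * of_real (x s * x t)) - ctr (A * toeplitz n (autocov c))))\<^sup>2) \<partial>row_law n i) =
      (\<integral>\<^sup>+w. ennreal ((cmod ((\<Sum>s<n. \<Sum>t<n. ent A s t * of_real (row s w * row t w)) - ctr (A * toeplitz n (autocov c))))\<^sup>2) \<partial>M)"
    unfolding row_law_def by (subst nn_integral_distr) (simp_all add: data_row)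
  also have "\<dots> \<le> ennreal (((\<bar>\<sigma>\<bar> + 2) * (\<Sum>j. \<bar>c j\<bar>) ^ 4) * (norm A)\<^sup>2)" by (rule row_form[OF A])
  finally show ?thesis unfolding form .
qed

text \<open>Row i is a measurable function of the innovations with first index i + 1. These blocks
  are disjoint, so the rows are independent and their joint law is a product.\<close>

lemma joint_law:
  assumes "p \<ge> 1"
  shows "distr M (PiM {..<p} (\<lambda>_. PiM {..<n} (\<lambda>_. borel))) (\<lambda>w. \<lambda>i\<in>{..<p}. \<lambda>t\<in>{..<n}. data w i t) = PiM {..<p} (row_law n)"
proof -
  let ?K = "\<lambda>i. {Suc i} \<times> (UNIV :: int set)"
  have "indep_vars (\<lambda>i. PiM (?K i) (\<lambda>_. borel)) (\<lambda>i w. restrict (\<lambda>k. (case k of (i, t) \<Rightarrow> Z i t) w) (?K i)) {..<p}"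
    by (rule indep_vars_restrict[OF indep_array]) (auto simp: disjoint_family_on_def)
  from indep_vars_compose2[OF this, of "\<lambda>i g. \<lambda>t\<in>{..<n}. \<Sum>j. c j * g (Suc i, int t + 1 - int j)" "\<lambda>_. PiM {..<n} (\<lambda>_. borel)"]
  have "indep_vars (\<lambda>_. PiM {..<n} (\<lambda>_. borel)) (\<lambda>i w. \<lambda>t\<in>{..<n}. data w i t) {..<p}"
    by (simp add: data_def linear_process_def add.commute[of 1])
  then show ?thesis
    unfolding row_law_def using assms by (subst (asm) indep_vars_iff_distr_eq_PiM') (auto simp: lessThan_empty_iff)
qed

lemma companion_stieltjes_restrict:
  "companion_stieltjes p n z (\<lambda>i\<in>{..<p}. \<lambda>t\<in>{..<n}. X i t) = companion_stieltjes p n z X"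
proof -
  have "row_vec p n ((\<lambda>i\<in>{..<p}. \<lambda>t\<in>{..<n}. X i t) i) = row_vec p n (X i)" if "i < p" for i
    by (rule cmat_eqI) (use that in \<open>simp add: row_vec_def\<close>)
  then have "sample_cov p n (\<lambda>i\<in>{..<p}. \<lambda>t\<in>{..<n}. X i t) = sample_cov p n X"
    unfolding sample_cov_def by (intro sum.cong refl) auto
  then show ?thesis by (simp add: companion_stieltjes_def)
qed

definition S\<^sub>c :: real where "S\<^sub>c = (\<Sum>j. \<bar>c j\<bar>)"

text \<open>Transfers the estimates from the product of row laws to the underlying probability
  space. The scalars \<open>gam\<close> and \<open>bet\<close> depend on p, n and z; the existential
  lets sequences of them be chosen later.\<close>

lemma companion_moments:
  fixes z :: complex and p n :: nat
  assumes p: "p \<ge> 1" and n: "n \<ge> 1" and z: "Im z > 0" and L: "op_bound L (toeplitz n (autocov c))" "0 < L"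
  defines "s \<equiv> \<lambda>w. companion_stieltjes p n z (data w)"
    and "\<rho> \<equiv> (sqrt ((\<bar>\<sigma>\<bar> + 2) * S\<^sub>c ^ 4 * n) + L + 7 * L * sqrt p) / (Im z * p)"
    and "\<kappa> \<equiv> (\<bar>\<sigma>\<bar> + 2) * S\<^sub>c ^ 4"
  shows "s \<in> borel_measurable M" "integrable M s"
    and "integrable M (\<lambda>w. (cmod (s w - expectation s)) ^ 4)"
    and "expectation (\<lambda>w. (cmod (s w - expectation s)) ^ 4) \<le> 3520 / (Im z ^ 4 * (real p)\<^sup>2)"
    and "\<exists>g b. b * (1 + g) = 1 \<and> Im b \<le> 0 \<and> cmod b \<le> cmod z / Im z \<and>
      cmod (expectation s + b / z) \<le> (cmod z / Im z)\<^sup>2 * \<rho> / cmod z \<and>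
      cmod (g - ctr (toeplitz n (autocov c) * cinv n (csc b (toeplitz n (autocov c)) - csc z (cunit n))) / of_nat p) \<le>
        (cmod z / Im z) * (L / Im z * L) / (Im z * p) +
        ((L / Im z)\<^sup>2 * n / p * (cmod z / Im z)\<^sup>2 * \<rho> + (cmod z / Im z) * (sqrt (\<kappa> * n) * (L / Im z) / (Im z * p)))"
proof -
  have \<kappa>0: "0 \<le> \<kappa>" unfolding \<kappa>_def S\<^sub>c_def using summable_coeff by (intro mult_nonneg_nonneg zero_le_power suminf_nonneg) auto
  interpret S: sample_model p n "row_law n" "toeplitz n (autocov c)" L \<kappa> z
  proof (rule sample_model.intro)
    show "prob_space (row_law n i)" for i unfolding row_law_def by (rule prob_space_distr) measurable
    show "gram_limit n (toeplitz n (autocov c))" by (rule gram_limit_toeplitz[OF summable_coeff])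
    show "(\<integral>\<^sup>+x. ennreal ((cmod (of_nat p * ctr (row_vec p n x * A * cadj (row_vec p n x)) -
        ctr (A * toeplitz n (autocov c))))\<^sup>2) \<partial>row_law n i) \<le> ennreal (\<kappa> * (norm A)\<^sup>2)" if "corner n A" for i A
      unfolding \<kappa>_def S\<^sub>c_def by (rule row_law_form[OF that p])
  qed (use p n z L \<kappa>0 in \<open>auto simp: row_law_def\<close>)
  let ?X = "\<lambda>w. \<lambda>i\<in>{..<p}. \<lambda>t\<in>{..<n}. data w i t"
  have law: "distr M (PiM {..<p} (\<lambda>_. PiM {..<n} (\<lambda>_. borel))) ?X = S.P" by (rule joint_law[OF p])
  have X: "?X \<in> measurable M (PiM {..<p} (\<lambda>_. PiM {..<n} (\<lambda>_. borel)))" by measurable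
  have sets: "sets S.P = sets (PiM {..<p} (\<lambda>_. PiM {..<n} (\<lambda>_. borel)))" unfolding law[symmetric] by simp
  have X': "?X \<in> measurable M S.P" using X measurable_cong_sets[OF refl sets] by blast
  have s: "companion_stieltjes p n z (?X w) = s w" for w by (simp add: s_def companion_stieltjes_restrict)
  have cm: "companion_stieltjes p n z \<in> borel_measurable S.P" using S.companion_expectation(2) by auto
  show sm: "s \<in> borel_measurable M" using measurable_compose[OF X' cm] unfolding s .
  have E: "S.P.expectation F = expectation (\<lambda>w. F (?X w))"
    if "F \<in> borel_measurable S.P" for F :: "_ \<Rightarrow> 'c :: {banach, second_countable_topology}"
    unfolding law[symmetric] by (rule integral_distr[OF X]) (use that measurable_cong_sets[OF sets refl] in blast)
  have Es: "S.P.expectation (companion_stieltjes p n z) = expectation s" unfolding E[OF cm] s ..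
  show "integrable M s"
    using S.companion_expectation(2) unfolding law[symmetric]
    by (subst (asm) integrable_distr_eq[OF X]) (use cm measurable_cong_sets[OF sets refl] s in auto)
  obtain B where B: "\<And>w. cmod (s w) \<le> B"
  proof -
    have "cunit n * S.R X = S.R X" for X using corner_resolvent[of n z] by (simp add: corner_def)
    then have c: "cmod (ctr (S.R X)) \<le> 1 / Im z * n" for X
      using S.ctr_bound[OF op_bound_cunit _ corner_cunit, of X] by simp
    have "cmod (s w) \<le> 1 / Im z * n / p + cmod ((1 - of_nat n / of_nat p) / z)" for w
    proof -
      have "cmod (s w) \<le> cmod (ctr (S.R (data w)) / of_nat p) + cmod ((1 - of_nat n / of_nat p) / z)"
        unfolding s_def companion_stieltjes_def by (rule norm_triangle_ineq4)
      also have "cmod (ctr (S.R (data w)) / of_nat p) \<le> 1 / Im z * n / p"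
        unfolding norm_divide norm_of_nat by (intro divide_right_mono c) simp
      finally show ?thesis by simp
    qed
    then show ?thesis by (rule that)
  qed
  have B': "cmod (s w - expectation s) \<le> B + cmod (expectation s)" for w
    using norm_triangle_ineq4[of "s w" "expectation s"] B[of w] by linarith
  show "integrable M (\<lambda>w. (cmod (s w - expectation s)) ^ 4)"
  proof (rule integrable_const_bound)
    show "AE w in M. norm ((cmod (s w - expectation s)) ^ 4) \<le> (B + cmod (expectation s)) ^ 4"
      by (simp add: norm_power) (intro always_eventually allI power_mono B' norm_ge_zero)
    show "(\<lambda>w. (cmod (s w - expectation s)) ^ 4) \<in> borel_measurable M" using sm by measurable
  qed
  have cm4: "(\<lambda>X. (cmod (companion_stieltjes p n z X - S.P.expectation (companion_stieltjes p n z))) ^ 4) \<in> borel_measurable S.P"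
    using cm by measurable
  show "expectation (\<lambda>w. (cmod (s w - expectation s)) ^ 4) \<le> 3520 / (Im z ^ 4 * (real p)\<^sup>2)"
    using S.companion_fourth_moment E[OF cm4] unfolding Es s by simp
  have "S.bet * (1 + S.gam) = 1" using S.gam_ne by (simp add: S.bet_def)
  then have "S.bet * (1 + S.gam) = 1 \<and> Im S.bet \<le> 0 \<and> cmod S.bet \<le> cmod z / Im z \<and>
      cmod (expectation s + S.bet / z) \<le> (cmod z / Im z)\<^sup>2 * S.\<rho> / cmod z \<and>
      cmod (S.gam - ctr (toeplitz n (autocov c) * S.K) / of_nat p) \<le>
        (cmod z / Im z) * (L / Im z * L) / (Im z * p) +
        ((L / Im z)\<^sup>2 * n / p * (cmod z / Im z)\<^sup>2 * S.\<rho> + (cmod z / Im z) * (sqrt (\<kappa> * n) * (L / Im z) / (Im z * p)))"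
    using S.Im_bet S.cmod_bet S.companion_expectation(1)[unfolded Es] S.gam_equation by (intro conjI)
  then show "\<exists>g b. b * (1 + g) = 1 \<and> Im b \<le> 0 \<and> cmod b \<le> cmod z / Im z \<and>
      cmod (expectation s + b / z) \<le> (cmod z / Im z)\<^sup>2 * \<rho> / cmod z \<and>
      cmod (g - ctr (toeplitz n (autocov c) * cinv n (csc b (toeplitz n (autocov c)) - csc z (cunit n))) / of_nat p) \<le>
        (cmod z / Im z) * (L / Im z * L) / (Im z * p) +
        ((L / Im z)\<^sup>2 * n / p * (cmod z / Im z)\<^sup>2 * \<rho> + (cmod z / Im z) * (sqrt (\<kappa> * n) * (L / Im z) / (Im z * p)))"
    unfolding S.\<rho>_def S.K_def \<rho>_def \<kappa>_def[symmetric] by (intro exI)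
qed

end

lemma sample_spectral_distribution:
  fixes X :: "nat \<Rightarrow> int \<Rightarrow> 'a \<Rightarrow> real" and p n :: nat and w :: 'a
  defines "A \<equiv> (1 / real p) \<cdot>\<^sub>m (data_matrix p n X w * transpose_mat (data_matrix p n X w))"
  assumes p: "p > 0"
  shows "real_distribution (spectral_distribution A)"
    and "Im z > 0 \<Longrightarrow> stieltjes (spectral_distribution A) z =
      companion_stieltjes p n z (\<lambda>i t. X (i + 1) (int (t + 1)) w)"
proof -
  define x where "x i t = X (i + 1) (int (t + 1)) w" for i t
  have D: "data_matrix p n X w = Matrix.mat p n (\<lambda>(i, t). x i t)" by (simp add: data_matrix_def x_def)
  have Aij: "A $$ (i, j) = (\<Sum>t<n. x i t * x j t) / p" if "i < p" "j < p" for i j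
    using that by (simp add: A_def D scalar_prod_def atLeast0LessThan)
  have A: "A \<in> carrier_mat p p" by (rule carrier_matI) (simp_all add: A_def D)
  have sym: "transpose_mat A = A"
    by (rule eq_matI) (use A Aij in \<open>auto simp: mult.commute\<close>)
  show "real_distribution (spectral_distribution A)" by (rule symmetric_spectral_distribution(1)[OF A sym p])
  assume z: "Im z > 0"
  define Y where "Y = cm p n (\<lambda>i t. complex_of_real (x i t / sqrt p))"
  have Y: "cunit p * Y = Y" "Y * cunit n = Y" by (rule cmat_eqI; simp add: Y_def)+
  have sq: "complex_of_real (a / sqrt p) * complex_of_real (b / sqrt p) = complex_of_real (a * b / p)" for a b
  proof -
    have "a / sqrt p * (b / sqrt p) = a * b / p" by simp
    then show ?thesis by (metis of_real_mult)
  qed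
  have YY: "of_cmat p (map_mat complex_of_real A) = Y * cadj Y"
  proof (rule cmat_eqI)
    fix i j
    have "ent (Y * cadj Y) i j = (\<Sum>t<n. ent Y i t * ent (cadj Y) t j)"
      by (rule ent_mult) (simp add: Y_def)
    also have "\<dots> = (if i < p \<and> j < p then (\<Sum>t<n. complex_of_real (x i t * x j t / p)) else 0)"
      by (auto simp: Y_def sq simp del: of_real_divide intro!: sum.cong)
    also have "\<dots> = ent (of_cmat p (map_mat complex_of_real A)) i j"
      using A by (auto simp: of_cmat_def Aij sum_divide_distrib)
    finally show "ent (of_cmat p (map_mat complex_of_real A)) i j = ent (Y * cadj Y) i j" ..
  qed
  have cov: "cadj Y * Y = sample_cov p n x"
  proof (rule cmat_eqI)
    fix s t
    have "ent (cadj Y * Y) s t = (\<Sum>i<p. ent (cadj Y) s i * ent Y i t)"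
      by (rule ent_mult) (simp add: Y_def)
    also have "\<dots> = (\<Sum>i<p. ent (cadj (row_vec p n (x i)) * row_vec p n (x i)) s t)"
    proof (rule sum.cong[OF refl])
      fix i assume i: "i \<in> {..<p}"
      have "ent (cadj (row_vec p n (x i)) * row_vec p n (x i)) s t =
          (\<Sum>k<1. ent (cadj (row_vec p n (x i))) s k * ent (row_vec p n (x i)) k t)"
        by (rule ent_mult) (simp add: row_vec_def)
      then show "ent (cadj Y) s i * ent Y i t = ent (cadj (row_vec p n (x i)) * row_vec p n (x i)) s t"
        using i by (simp add: row_vec_def Y_def)
    qed
    finally show "ent (cadj Y * Y) s t = ent (sample_cov p n x) s t" by (simp add: sample_cov_def)
  qed
  note g = ctr_resolvent_gram[OF z Y, unfolded cov]
  have "stieltjes (spectral_distribution A) z = ctr (resolvent p z (Y * cadj Y)) / of_nat p"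
    by (rule symmetric_spectral_distribution(2)[OF A sym p z corner_resolvent]) (simp add: YY g(2))
  also have "\<dots> = companion_stieltjes p n z x"
  proof -
    have "(1 - of_nat n / of_nat p) / z = (of_nat p - of_nat n) / z / (of_nat p :: complex)"
      using p by (simp add: field_simps)
    then show ?thesis unfolding g(1) companion_stieltjes_def by (simp only: diff_divide_distrib[of "ctr _"])
  qed
  finally show "stieltjes (spectral_distribution A) z =
      companion_stieltjes p n z (\<lambda>i t. X (i + 1) (int (t + 1)) w)" by (simp add: x_def[abs_def])
qed

text \<open>The Borel-Cantelli argument in integrated form: a series of nonnegative variables with
  finite total expectation converges almost surely, so its terms tend to 0.\<close>

lemma (in prob_space) AE_LIMSEQ_0_of_summable_expectation:
  fixes D :: "nat \<Rightarrow> 'a \<Rightarrow> real"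
  assumes int: "\<And>k. integrable M (D k)" and nn: "\<And>k w. 0 \<le> D k w"
    and le: "\<And>k. expectation (D k) \<le> a k" and a: "summable a"
  shows "AE w in M. (\<lambda>k. D k w) \<longlonglongrightarrow> 0"
proof -
  have a0: "0 \<le> a k" for k
    by (rule order_trans[OF _ le]) (simp add: nn Bochner_Integration.integral_nonneg)
  have [measurable]: "D k \<in> borel_measurable M" for k using int by auto
  have "(\<integral>\<^sup>+w. (\<Sum>k. ennreal (D k w)) \<partial>M) = (\<Sum>k. \<integral>\<^sup>+w. ennreal (D k w) \<partial>M)"
    by (rule nn_integral_suminf) measurable
  also have "\<dots> \<le> (\<Sum>k. ennreal (a k))"
  proof (rule suminf_le)
    show "(\<integral>\<^sup>+w. ennreal (D k w) \<partial>M) \<le> ennreal (a k)" for k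
      using int nn by (subst nn_integral_eq_integral) (auto intro: ennreal_leI le)
  qed auto
  also have "\<dots> = ennreal (\<Sum>k. a k)" by (rule suminf_ennreal2) (use a a0 in auto)
  also have "\<dots> < \<infinity>" by simp
  finally have "AE w in M. (\<Sum>k. ennreal (D k w)) \<noteq> \<infinity>"
    by (intro nn_integral_PInf_AE) auto
  then show ?thesis
  proof eventually_elim
    case (elim w)
    then have "summable (\<lambda>k. D k w)" by (intro summable_suminf_not_top) (auto simp: nn)
    then show ?case by (rule summable_LIMSEQ_zero)
  qed
qed

section \<open>The proportional regime and almost sure limits\<close>

locale proportional_array = linear_array M Z c \<sigma> + toeplitz_symbol "autocov c" f S
  for M :: "'a measure" and Z c \<sigma> f S +
  fixes p :: "nat \<Rightarrow> nat" and y :: real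
  assumes p_pos: "\<And>n. n \<ge> 1 \<Longrightarrow> p n > 0"
    and p_lim: "filterlim p at_top sequentially"
    and y_pos: "y > 0"
    and ratio: "(\<lambda>n. real n / real (p n)) \<longlonglongrightarrow> y"
begin

text \<open>The law of a uniform frequency. The symbol is paired with it as
  \<open>f\<^sub>0\<close>, extended by 0, because f is known to be continuous only on the interval
  and measurability is required on the whole line.\<close>

definition U :: "real measure" where
  "U = density lborel (\<lambda>x. ennreal (indicator {0..2*pi} x / (2 * pi)))"

definition f\<^sub>0 :: "real \<Rightarrow> real" where "f\<^sub>0 x = indicator {0..2*pi} x * f x"

lemma f\<^sub>0_measurable [measurable]: "f\<^sub>0 \<in> borel_measurable borel"
  using borel_measurable_continuous_on_indicator[OF _ f_cont] unfolding f\<^sub>0_def[abs_def] by simp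

lemma symbol_le: "\<omega> \<in> {0..2*pi} \<Longrightarrow> f \<omega> \<le> S"
proof -
  assume w: "\<omega> \<in> {0..2*pi}"
  have "cmod (of_real (f \<omega>)) \<le> S"
    by (rule norm_has_sum_bound[OF _ symbol[OF w]]) (use abs_sum in \<open>simp add: norm_mult\<close>)
  then show ?thesis by simp
qed

text \<open>Adding 1 to \<open>S\<close> makes the bound strictly positive without knowing that the
  symbol is not identically zero.\<close>

sublocale fp: stieltjes_fixed_point U f\<^sub>0 "S + 1" y
proof (intro stieltjes_fixed_point.intro stieltjes_fixed_point_axioms.intro)
  show "prob_space U"
  proof
    have "emeasure U (space U) = (\<integral>\<^sup>+x. ennreal (1 / (2 * pi)) * indicator {0..2*pi} x \<partial>lborel)"
      unfolding U_def by (subst emeasure_density) (auto intro!: nn_integral_cong split: split_indicator)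
    also have "\<dots> = ennreal (1 / (2 * pi)) * ennreal (2 * pi)"
      by (subst nn_integral_cmult_indicator) auto
    also have "\<dots> = 1" by (simp flip: ennreal_mult)
    finally show "emeasure U (space U) = 1" .
  qed
  show "f\<^sub>0 \<in> borel_measurable U" by (simp add: U_def)
  show "0 \<le> f\<^sub>0 x" "f\<^sub>0 x \<le> S + 1" for x
    using symbol_nonneg[of x] symbol_le[of x] S_nonneg by (auto simp: f\<^sub>0_def indicator_def)
  show "0 < S + 1" using S_nonneg by simp
qed (rule y_pos)

lemma integral_U:
  fixes H :: "real \<Rightarrow> complex"
  assumes H: "(\<lambda>x. H (f\<^sub>0 x)) \<in> borel_measurable borel"
  shows "(\<integral>x. H (f\<^sub>0 x) \<partial>U) = (LBINT x:{0..2*pi}. H (f x)) / (2 * pi)"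
proof -
  have "(\<integral>x. H (f\<^sub>0 x) \<partial>U) = (\<integral>x. (indicator {0..2*pi} x / (2 * pi)) *\<^sub>R H (f\<^sub>0 x) \<partial>lborel)"
    unfolding U_def by (rule integral_density) (use H in auto)
  also have "\<dots> = (\<integral>x. (indicator {0..2*pi} x *\<^sub>R H (f x)) / (2 * pi) \<partial>lborel)"
    by (intro Bochner_Integration.integral_cong) (auto simp: f\<^sub>0_def scaleR_conv_of_real split: split_indicator)
  also have "\<dots> = (LBINT x:{0..2*pi}. H (f x)) / (2 * pi)"
    unfolding set_lebesgue_integral_def by simp
  finally show ?thesis .
qed

lemma \<Psi>_eq_integral:
  assumes z: "Im z > 0" and b: "Im b \<le> 0"
  shows "fp.\<Psi> z b = integral {0..2*pi} (\<lambda>\<omega>. of_real (f \<omega>) / (b * of_real (f \<omega>) - z)) / (2 * pi)"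
proof -
  have "continuous_on {0..2*pi} (\<lambda>\<omega>. complex_of_real (f \<omega>) / (b * of_real (f \<omega>) - z))"
    using symbol_denominator(2)[OF _ z b] by (intro continuous_intros f_cont) auto
  then have "(LBINT \<omega>:{0..2*pi}. complex_of_real (f \<omega>) / (b * of_real (f \<omega>) - z)) =
      integral {0..2*pi} (\<lambda>\<omega>. of_real (f \<omega>) / (b * of_real (f \<omega>) - z))"
    by (intro set_borel_integral_eq_integral(2) borel_integrable_atLeastAtMost')
  then show ?thesis unfolding fp.\<Psi>_def
    by (subst integral_U[of "\<lambda>l. of_real l / (b * of_real l - z)"]) auto
qed

text \<open>Indexed from n = 1, the first size for which p n is known to be positive.\<close>

definition s :: "complex \<Rightarrow> nat \<Rightarrow> 'a \<Rightarrow> complex" where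
  "s z k w = companion_stieltjes (p (Suc k)) (Suc k) z (data w)"

definition esd :: "nat \<Rightarrow> 'a \<Rightarrow> real measure" where
  "esd n w = (let X = data_matrix (p n) n (linear_process c Z) w in
    spectral_distribution ((1 / real (p n)) \<cdot>\<^sub>m (X * transpose_mat X)))"

lemma real_distribution_esd: "real_distribution (esd (Suc k) w)"
  unfolding esd_def Let_def by (rule sample_spectral_distribution(1)) (simp add: p_pos)

lemma stieltjes_esd: "Im z > 0 \<Longrightarrow> stieltjes (esd (Suc k) w) z = s z k w"
  unfolding esd_def Let_def s_def by (subst sample_spectral_distribution(2)) (simp_all add: p_pos data_def[abs_def])

definition "\<L> = S + 1"
definition "\<kappa> = (\<bar>\<sigma>\<bar> + 2) * S\<^sub>c ^ 4"
definition "\<rho> z k = (sqrt (\<kappa> * real (Suc k)) + \<L> + 7 * \<L> * sqrt (p (Suc k))) / (Im z * p (Suc k))"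

lemma op_bound_autocov: "op_bound \<L> (toeplitz n (autocov c))" "0 < \<L>"
proof -
  have "op_bound S (toeplitz n (autocov c))" by (rule op_bound_toeplitz[OF abs_sum])
  then show "op_bound \<L> (toeplitz n (autocov c))"
    unfolding op_bound_def \<L>_def by (meson add_increasing2 mult_right_mono norm_ge_zero order_refl order_trans zero_le_one)
  show "0 < \<L>" using S_nonneg by (simp add: \<L>_def)
qed

lemma s_moments:
  assumes z: "Im z > 0"
  shows "integrable M (s z k)"
    and "integrable M (\<lambda>w. (cmod (s z k w - expectation (s z k))) ^ 4)"
    and "expectation (\<lambda>w. (cmod (s z k w - expectation (s z k))) ^ 4) \<le> 3520 / (Im z ^ 4 * (real (p (Suc k)))\<^sup>2)"
    and "\<exists>g b. b * (1 + g) = 1 \<and> Im b \<le> 0 \<and> cmod b \<le> cmod z / Im z \<and>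
      cmod (expectation (s z k) + b / z) \<le> (cmod z / Im z)\<^sup>2 * \<rho> z k / cmod z \<and>
      cmod (g - ctr (toeplitz (Suc k) (autocov c) * cinv (Suc k) (csc b (toeplitz (Suc k) (autocov c)) -
          csc z (cunit (Suc k)))) / of_nat (p (Suc k))) \<le>
        (cmod z / Im z) * (\<L> / Im z * \<L>) / (Im z * p (Suc k)) +
        ((\<L> / Im z)\<^sup>2 * real (Suc k) / p (Suc k) * (cmod z / Im z)\<^sup>2 * \<rho> z k +
          (cmod z / Im z) * (sqrt (\<kappa> * real (Suc k)) * (\<L> / Im z) / (Im z * p (Suc k))))"
proof -
  have p: "1 \<le> p (Suc k)" using p_pos[of "Suc k"] by simp
  have n1: "1 \<le> Suc k" by simp
  have s: "s z k = (\<lambda>w. companion_stieltjes (p (Suc k)) (Suc k) z (data w))" by (simp add: s_def[abs_def])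
  note m = companion_moments[OF p n1 z op_bound_autocov, folded \<kappa>_def, folded \<rho>_def s]
  show "integrable M (s z k)" using m(2) by simp
  show "integrable M (\<lambda>w. (cmod (s z k w - expectation (s z k))) ^ 4)" using m(3) by (simp add: s_def)
  show "expectation (\<lambda>w. (cmod (s z k w - expectation (s z k))) ^ 4) \<le> 3520 / (Im z ^ 4 * (real (p (Suc k)))\<^sup>2)"
    using m(4) by (simp add: s_def)
  show "\<exists>g b. b * (1 + g) = 1 \<and> Im b \<le> 0 \<and> cmod b \<le> cmod z / Im z \<and>
      cmod (expectation (s z k) + b / z) \<le> (cmod z / Im z)\<^sup>2 * \<rho> z k / cmod z \<and>
      cmod (g - ctr (toeplitz (Suc k) (autocov c) * cinv (Suc k) (csc b (toeplitz (Suc k) (autocov c)) -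
          csc z (cunit (Suc k)))) / of_nat (p (Suc k))) \<le>
        (cmod z / Im z) * (\<L> / Im z * \<L>) / (Im z * p (Suc k)) +
        ((\<L> / Im z)\<^sup>2 * real (Suc k) / p (Suc k) * (cmod z / Im z)\<^sup>2 * \<rho> z k +
          (cmod z / Im z) * (sqrt (\<kappa> * real (Suc k)) * (\<L> / Im z) / (Im z * p (Suc k))))"
    using m(5) by blast
qed

text \<open>Eventually n / p < y + 1, so p^-2 is dominated by a multiple of n^-2 and the fourth
  moments are summable.\<close>

lemma AE_s_concentration:
  assumes z: "Im z > 0"
  shows "AE w in M. (\<lambda>k. s z k w - expectation (s z k)) \<longlonglongrightarrow> 0"
proof -
  have sum: "summable (\<lambda>k. 3520 / (Im z ^ 4 * (real (p (Suc k)))\<^sup>2))"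
  proof (rule summable_comparison_test_ev)
    have "\<forall>\<^sub>F k in sequentially. real (Suc k) / real (p (Suc k)) < y + 1"
      by (rule order_tendstoD(2)[OF LIMSEQ_Suc[OF ratio]]) simp
    then show "\<forall>\<^sub>F k in sequentially. norm (3520 / (Im z ^ 4 * (real (p (Suc k)))\<^sup>2)) \<le>
        3520 / Im z ^ 4 * (y + 1)\<^sup>2 * inverse ((real (Suc k))\<^sup>2)"
    proof eventually_elim
      case (elim k)
      have p: "0 < real (p (Suc k))" using p_pos[of "Suc k"] by simp
      have "(real (Suc k) / real (p (Suc k)))\<^sup>2 \<le> (y + 1)\<^sup>2" using elim by (intro power_mono) auto
      then have "inverse ((real (p (Suc k)))\<^sup>2) \<le> (y + 1)\<^sup>2 * inverse ((real (Suc k))\<^sup>2)"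
        using p by (simp add: power_divide divide_simps del: of_nat_Suc)
      then have "3520 / Im z ^ 4 * inverse ((real (p (Suc k)))\<^sup>2) \<le> 3520 / Im z ^ 4 * ((y + 1)\<^sup>2 * inverse ((real (Suc k))\<^sup>2))"
        using z by (intro mult_left_mono) auto
      then show ?case using z by (simp add: divide_inverse mult.assoc)
    qed
    have "summable (\<lambda>n. inverse ((real n)\<^sup>2))" using inverse_power_summable[of 2, where 'a=real] by simp
    then have "summable (\<lambda>k. inverse ((real (Suc k))\<^sup>2))" by (subst summable_Suc_iff)
    then show "summable (\<lambda>k. 3520 / Im z ^ 4 * (y + 1)\<^sup>2 * inverse ((real (Suc k))\<^sup>2))" by (rule summable_mult)
  qed
  have "AE w in M. (\<lambda>k. (cmod (s z k w - expectation (s z k))) ^ 4) \<longlonglongrightarrow> 0"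
    by (rule AE_LIMSEQ_0_of_summable_expectation[OF s_moments(2)[OF z] _ s_moments(3)[OF z] sum]) simp
  then show ?thesis
  proof eventually_elim
    case (elim w)
    then have "(\<lambda>k. cmod (s z k w - expectation (s z k))) \<longlonglongrightarrow> 0" by (simp add: power_tendsto_0_iff)
    then show ?case by (rule tendsto_norm_zero_cancel)
  qed
qed

lemma ratio_Suc: "(\<lambda>k. real (Suc k) / real (p (Suc k))) \<longlonglongrightarrow> y"
  by (rule LIMSEQ_Suc[OF ratio])

lemma expectation_limit:
  assumes z: "Im z > 0"
  obtains m where "fp.fixed_point z m" "(\<lambda>k. expectation (s z k)) \<longlonglongrightarrow> m"
proof -
  \<comment> \<open>Rewritten with \<open>q = p^(-1/2)\<close>, \<open>r = n / p\<close> and the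
    later \<open>t\<close>, each term of the error bounds is a convergent factor times a null
    sequence.\<close>
  define q where "q k = inverse (sqrt (real (p (Suc k))))" for k
  define r where "r k = real (Suc k) / real (p (Suc k))" for k
  have pp: "0 < real (p (Suc k))" for k using p_pos[of "Suc k"] by simp
  have "filterlim (\<lambda>n. sqrt (real (p n))) at_top sequentially"
    by (intro filterlim_compose[OF sqrt_at_top] filterlim_compose[OF filterlim_real_sequentially p_lim])
  then have "(\<lambda>n. inverse (sqrt (real (p n)))) \<longlonglongrightarrow> 0" by (rule tendsto_inverse_0_at_top)
  then have q: "q \<longlonglongrightarrow> 0" unfolding q_def[abs_def] by (rule LIMSEQ_Suc)
  have r: "r \<longlonglongrightarrow> y" unfolding r_def[abs_def] by (rule ratio_Suc)
  have q2: "1 / real (p (Suc k)) = (q k)\<^sup>2" for k using pp[of k] by (simp add: q_def power_inverse divide_inverse)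
  have qq: "sqrt (real (p (Suc k))) * (q k)\<^sup>2 = q k" for k
    using pp[of k] by (simp add: q_def power2_eq_square)
  have qr: "sqrt (\<kappa> * real (Suc k)) * (q k)\<^sup>2 = sqrt (\<kappa> * r k) * q k" for k
  proof -
    have "sqrt (\<kappa> * r k) = sqrt (\<kappa> * real (Suc k)) * q k"
      by (simp add: r_def q_def real_sqrt_mult real_sqrt_divide divide_inverse real_sqrt_inverse del: of_nat_Suc)
    then show ?thesis by (simp add: power2_eq_square)
  qed
  have \<rho>_eq: "\<rho> z k = (sqrt (\<kappa> * r k) * q k + \<L> * (q k)\<^sup>2 + 7 * \<L> * q k) / Im z" for k
  proof -
    have "\<rho> z k = (sqrt (\<kappa> * real (Suc k)) + \<L> + 7 * \<L> * sqrt (p (Suc k))) * (1 / real (p (Suc k))) / Im z"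
      by (simp add: \<rho>_def)
    also have "\<dots> = (sqrt (\<kappa> * real (Suc k)) * (q k)\<^sup>2 + \<L> * (q k)\<^sup>2 + 7 * \<L> * (sqrt (p (Suc k)) * (q k)\<^sup>2)) / Im z"
      unfolding q2 by (simp add: distrib_right mult.assoc del: of_nat_Suc)
    finally show ?thesis unfolding qr qq .
  qed
  have "(\<lambda>k. (sqrt (\<kappa> * r k) * q k + \<L> * (q k)\<^sup>2 + 7 * \<L> * q k) / Im z) \<longlonglongrightarrow>
      (sqrt (\<kappa> * y) * 0 + \<L> * 0\<^sup>2 + 7 * \<L> * 0) / Im z"
    using z by (intro tendsto_intros q r) auto
  then have \<rho>: "\<rho> z \<longlonglongrightarrow> 0" unfolding \<rho>_eq[symmetric] by simp
  define G where "G k g b \<longleftrightarrow> b * (1 + g) = 1 \<and> Im b \<le> 0 \<and> cmod b \<le> cmod z / Im z \<and>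
      cmod (expectation (s z k) + b / z) \<le> (cmod z / Im z)\<^sup>2 * \<rho> z k / cmod z \<and>
      cmod (g - ctr (toeplitz (Suc k) (autocov c) * cinv (Suc k) (csc b (toeplitz (Suc k) (autocov c)) -
          csc z (cunit (Suc k)))) / of_nat (p (Suc k))) \<le>
        (cmod z / Im z) * (\<L> / Im z * \<L>) / (Im z * p (Suc k)) +
        ((\<L> / Im z)\<^sup>2 * real (Suc k) / p (Suc k) * (cmod z / Im z)\<^sup>2 * \<rho> z k +
          (cmod z / Im z) * (sqrt (\<kappa> * real (Suc k)) * (\<L> / Im z) / (Im z * p (Suc k))))" for k g b
  have "\<forall>k. \<exists>g b. G k g b" unfolding G_def using s_moments(4)[OF z] by blast
  then obtain g b where G: "\<And>k. G k (g k) (b k)" by metis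
  have gb: "\<And>k. b k * (1 + g k) = 1" "\<And>k. Im (b k) \<le> 0" "\<And>k. cmod (b k) \<le> cmod z / Im z"
    "\<And>k. cmod (expectation (s z k) + b k / z) \<le> (cmod z / Im z)\<^sup>2 * \<rho> z k / cmod z"
    "\<And>k. cmod (g k - ctr (toeplitz (Suc k) (autocov c) * cinv (Suc k) (csc (b k) (toeplitz (Suc k) (autocov c)) -
          csc z (cunit (Suc k)))) / of_nat (p (Suc k))) \<le>
        (cmod z / Im z) * (\<L> / Im z * \<L>) / (Im z * p (Suc k)) +
        ((\<L> / Im z)\<^sup>2 * real (Suc k) / p (Suc k) * (cmod z / Im z)\<^sup>2 * \<rho> z k +
          (cmod z / Im z) * (sqrt (\<kappa> * real (Suc k)) * (\<L> / Im z) / (Im z * p (Suc k))))"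
    using G unfolding G_def by blast+
  have sb: "(\<lambda>k. expectation (s z k) + b k / z) \<longlonglongrightarrow> 0"
  proof (rule Lim_null_comparison[OF always_eventually[OF allI[OF gb(4)]]])
    have "(\<lambda>k. (cmod z / Im z)\<^sup>2 * \<rho> z k / cmod z) \<longlonglongrightarrow> (cmod z / Im z)\<^sup>2 * 0 / cmod z"
      using z by (intro tendsto_intros \<rho>) auto
    then show "(\<lambda>k. (cmod z / Im z)\<^sup>2 * \<rho> z k / cmod z) \<longlonglongrightarrow> 0" by simp
  qed
  define t where "t k = sqrt (S * toeplitz_tail (autocov c) (Suc k))" for k
  have t: "t \<longlonglongrightarrow> 0" unfolding t_def[abs_def] by (rule LIMSEQ_Suc[OF tail_lim])
  have t0: "0 \<le> t k" for k
    unfolding t_def toeplitz_tail_def using S_nonneg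
    by (intro real_sqrt_ge_zero mult_nonneg_nonneg divide_nonneg_nonneg sum_nonneg infsum_nonneg) auto
  have gl: "(\<lambda>k. g k - of_real (r k) * fp.\<Psi> z (b k)) \<longlonglongrightarrow> 0"
  proof (rule Lim_null_comparison[OF always_eventually[OF allI]])
    fix k
    define T where "T = ctr (toeplitz (Suc k) (autocov c) * cinv (Suc k) (csc (b k) (toeplitz (Suc k) (autocov c)) -
          csc z (cunit (Suc k))))"
    have "cmod (T / of_nat (Suc k) - fp.\<Psi> z (b k)) \<le> (1 + cmod (b k) * \<L> / Im z) / Im z * t k"
      unfolding T_def t_def \<Psi>_eq_integral[OF z gb(2)]
      by (rule szego_resolvent[OF _ z gb(2) op_bound_autocov(1)]) (use op_bound_autocov(2) in auto)
    also have "\<dots> \<le> (1 + (cmod z / Im z) * \<L> / Im z) / Im z * t k"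
      using gb(3) z op_bound_autocov(2) t0 by (intro mult_right_mono divide_right_mono add_left_mono) auto
    finally have 1: "cmod (T / of_nat (Suc k) - fp.\<Psi> z (b k)) \<le> (1 + (cmod z / Im z) * \<L> / Im z) / Im z * t k" .
    \<comment> \<open>As T / p = r (T / n), the first bracket is the error of the self-consistent
      equation and the second the error in Szego's limit.\<close>
    have e: "g k - of_real (r k) * fp.\<Psi> z (b k) =
        (g k - T / of_nat (p (Suc k))) + of_real (r k) * (T / of_nat (Suc k) - fp.\<Psi> z (b k))"
      by (simp add: r_def right_diff_distrib del: of_nat_Suc)
    have "cmod (g k - of_real (r k) * fp.\<Psi> z (b k)) \<le>
        cmod (g k - T / of_nat (p (Suc k))) + r k * cmod (T / of_nat (Suc k) - fp.\<Psi> z (b k))"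
    proof -
      have "0 \<le> r k" by (simp add: r_def)
      then have nv: "cmod (of_real (r k) * V) = r k * cmod V" for V by (simp add: norm_mult)
      show ?thesis unfolding e by (rule order_trans[OF norm_triangle_ineq]) (simp only: nv order_refl)
    qed
    also have "r k * cmod (T / of_nat (Suc k) - fp.\<Psi> z (b k)) \<le> r k * ((1 + (cmod z / Im z) * \<L> / Im z) / Im z * t k)"
      by (rule mult_left_mono[OF 1]) (simp add: r_def)
    also have "cmod (g k - T / of_nat (p (Suc k))) \<le> (cmod z / Im z) * (\<L> / Im z * \<L>) / Im z * (q k)\<^sup>2 +
        ((\<L> / Im z)\<^sup>2 * r k * (cmod z / Im z)\<^sup>2 * \<rho> z k + (cmod z / Im z) * (\<L> / Im z) / Im z * (sqrt (\<kappa> * r k) * q k))"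
      using gb(5)[of k, folded T_def] unfolding q2[symmetric] qr[symmetric] by (simp add: r_def mult_ac del: of_nat_Suc)
    finally show "cmod (g k - of_real (r k) * fp.\<Psi> z (b k)) \<le> (cmod z / Im z) * (\<L> / Im z * \<L>) / Im z * (q k)\<^sup>2 +
        ((\<L> / Im z)\<^sup>2 * r k * (cmod z / Im z)\<^sup>2 * \<rho> z k + (cmod z / Im z) * (\<L> / Im z) / Im z * (sqrt (\<kappa> * r k) * q k)) +
        r k * ((1 + (cmod z / Im z) * \<L> / Im z) / Im z * t k)" by simp
  next
    have "(\<lambda>k. (cmod z / Im z) * (\<L> / Im z * \<L>) / Im z * (q k)\<^sup>2 +
        ((\<L> / Im z)\<^sup>2 * r k * (cmod z / Im z)\<^sup>2 * \<rho> z k + (cmod z / Im z) * (\<L> / Im z) / Im z * (sqrt (\<kappa> * r k) * q k)) +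
        r k * ((1 + (cmod z / Im z) * \<L> / Im z) / Im z * t k)) \<longlonglongrightarrow>
      (cmod z / Im z) * (\<L> / Im z * \<L>) / Im z * 0\<^sup>2 +
        ((\<L> / Im z)\<^sup>2 * y * (cmod z / Im z)\<^sup>2 * 0 + (cmod z / Im z) * (\<L> / Im z) / Im z * (sqrt (\<kappa> * y) * 0)) +
        y * ((1 + (cmod z / Im z) * \<L> / Im z) / Im z * 0)"
      by (intro tendsto_intros q r t \<rho>)
    then show "(\<lambda>k. (cmod z / Im z) * (\<L> / Im z * \<L>) / Im z * (q k)\<^sup>2 +
        ((\<L> / Im z)\<^sup>2 * r k * (cmod z / Im z)\<^sup>2 * \<rho> z k + (cmod z / Im z) * (\<L> / Im z) / Im z * (sqrt (\<kappa> * r k) * q k)) +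
        r k * ((1 + (cmod z / Im z) * \<L> / Im z) / Im z * t k)) \<longlonglongrightarrow> 0" by simp
  qed
  have sB: "cmod (s z k w) \<le> 1 / Im z" "0 \<le> Im (s z k w)" for k w
    using real_distribution.cmod_stieltjes_le[OF real_distribution_esd z, of k w]
      real_distribution.Im_stieltjes_pos[OF real_distribution_esd z, of k w]
    by (simp_all add: stieltjes_esd[OF z])
  show ?thesis
  proof (rule fp.fixed_point_limit[OF z _ _ sb gb(2) gb(1) gl r])
    show "cmod (expectation (s z k)) \<le> 1 / Im z" for k
    proof -
      have "cmod (expectation (s z k)) \<le> expectation (\<lambda>w. 1 / Im z)"
        by (rule order_trans[OF integral_norm_bound integral_mono]) (use s_moments(1)[OF z] sB in auto)
      then show ?thesis by (simp add: prob_space)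
    qed
    show "0 \<le> Im (expectation (s z k))" for k
      using sB by (subst integral_Im[symmetric, OF s_moments(1)[OF z]]) (auto intro!: integral_nonneg)
  qed (rule that)
qed

lemma AE_s_limit:
  assumes z: "Im z > 0"
  obtains m where "fp.fixed_point z m" "AE w in M. (\<lambda>k. s z k w) \<longlonglongrightarrow> m"
proof -
  obtain m where m: "fp.fixed_point z m" "(\<lambda>k. expectation (s z k)) \<longlonglongrightarrow> m" by (rule expectation_limit[OF z])
  have "AE w in M. (\<lambda>k. s z k w) \<longlonglongrightarrow> m"
    using AE_s_concentration[OF z]
  proof eventually_elim
    case (elim w)
    from tendsto_add[OF elim m(2)] show ?case by simp
  qed
  then show ?thesis using m that by blast
qed

end

lemma countable_rational_points: "countable {z. Re z \<in> \<rat> \<and> Im z \<in> \<rat>}"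
proof (rule countable_subset)
  show "{z. Re z \<in> \<rat> \<and> Im z \<in> \<rat>} \<subseteq> (\<lambda>(a, b). Complex a b) ` (\<rat> \<times> \<rat>)"
  proof
    fix z assume "z \<in> {z. Re z \<in> \<rat> \<and> Im z \<in> \<rat>}"
    then show "z \<in> (\<lambda>(a, b). Complex a b) ` (\<rat> \<times> \<rat>)" by (intro image_eqI[where x="(Re z, Im z)"]) auto
  qed
  show "countable ((\<lambda>(a, b). Complex a b) ` (\<rat> \<times> \<rat>))" by (intro countable_image countable_SIGMA countable_rat)
qed

lemma upper_half_plane_subset_closure_rational_points:
  "upper_half_plane \<subseteq> closure ({z. Re z \<in> \<rat> \<and> Im z \<in> \<rat>} \<inter> upper_half_plane)"
proof
  fix z assume z: "z \<in> upper_half_plane"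
  show "z \<in> closure ({z. Re z \<in> \<rat> \<and> Im z \<in> \<rat>} \<inter> upper_half_plane)"
    unfolding closure_approachable
  proof (intro allI impI)
    fix e :: real assume e: "0 < e"
    obtain a where a: "a \<in> \<rat>" "Re z < a" "a < Re z + e / 2" using Rats_dense_in_real[of "Re z" "Re z + e / 2"] e by auto
    obtain b where b: "b \<in> \<rat>" "Im z < b" "b < Im z + e / 2" using Rats_dense_in_real[of "Im z" "Im z + e / 2"] e by auto
    have "cmod (Complex a b - z) \<le> \<bar>a - Re z\<bar> + \<bar>b - Im z\<bar>" using cmod_le[of "Complex a b - z"] by simp
    then have "dist (Complex a b) z < e" using a b by (simp add: dist_norm)
    moreover have "Complex a b \<in> {z. Re z \<in> \<rat> \<and> Im z \<in> \<rat>} \<inter> upper_half_plane"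
      using a b z by (auto simp: upper_half_plane_def)
    ultimately show "\<exists>w\<in>{z. Re z \<in> \<rat> \<and> Im z \<in> \<rat>} \<inter> upper_half_plane. dist w z < e" by blast
  qed
qed

lemma weak_conv_m_Suc_imp: "weak_conv_m (\<lambda>n. \<mu> (Suc n)) F \<Longrightarrow> weak_conv_m \<mu> F"
  unfolding weak_conv_m_def weak_conv_def using LIMSEQ_imp_Suc by fast

context proportional_array
begin

text \<open>Almost sure convergence holds for each z with its own null set. Restricting to rational
  points leaves one null set, outside of which the continuity theorem yields a limit law; it is the
  same law for all outcomes because the limits \<open>m z\<close> are not random.\<close>

lemma limit_distribution:
  obtains F where "real_distribution F" "AE w in M. weak_conv_m (\<lambda>n. esd n w) F"
    "\<And>z. Im z > 0 \<Longrightarrow> fp.fixed_point z (stieltjes F z)"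
proof -
  define Q :: "complex set" where "Q = {z. Re z \<in> \<rat> \<and> Im z \<in> \<rat>}"
  have Qd: "upper_half_plane \<subseteq> closure (Q \<inter> upper_half_plane)"
    unfolding Q_def by (rule upper_half_plane_subset_closure_rational_points)
  have "\<forall>z. \<exists>m. Im z > 0 \<longrightarrow> fp.fixed_point z m \<and> (AE w in M. (\<lambda>k. s z k w) \<longlonglongrightarrow> m)"
    using AE_s_limit by metis
  then obtain m where "\<forall>z. Im z > 0 \<longrightarrow> fp.fixed_point z (m z) \<and> (AE w in M. (\<lambda>k. s z k w) \<longlonglongrightarrow> m z)"
    by metis
  then have m: "\<And>z. Im z > 0 \<Longrightarrow> fp.fixed_point z (m z)"
    "\<And>z. Im z > 0 \<Longrightarrow> AE w in M. (\<lambda>k. s z k w) \<longlonglongrightarrow> m z" by blast+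
  define good where "good w \<longleftrightarrow> (\<forall>z\<in>Q \<inter> upper_half_plane. (\<lambda>k. s z k w) \<longlonglongrightarrow> m z)" for w
  have AE_good: "AE w in M. good w"
    unfolding good_def
  proof (rule AE_ball_countable[THEN iffD2])
    show "countable (Q \<inter> upper_half_plane)"
      unfolding Q_def by (rule countable_subset[OF Int_lower1 countable_rational_points])
  qed (use m(2) in \<open>auto simp: upper_half_plane_def\<close>)
  \<comment> \<open>A single good outcome suffices to define the limit law and to read off
    deterministic facts about \<open>m\<close>.\<close>
  obtain w\<^sub>0 where w\<^sub>0: "good w\<^sub>0" using eventually_happens'[OF ae_filter_bot AE_good] by blast
  have Qi: "Complex 0 (real (Suc k)) \<in> Q \<inter> upper_half_plane" for k
    by (simp add: Q_def upper_half_plane_def)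
  have bd: "cmod (m (Complex 0 (real (Suc k)))) \<le> 1 / real (Suc k)" for k
  proof (rule LIMSEQ_le_const2[OF tendsto_norm])
    show "(\<lambda>j. s (Complex 0 (real (Suc k))) j w\<^sub>0) \<longlonglongrightarrow> m (Complex 0 (real (Suc k)))"
      using w\<^sub>0 Qi unfolding good_def by blast
    have "cmod (s (Complex 0 (real (Suc k))) j w\<^sub>0) \<le> 1 / real (Suc k)" for j
      using real_distribution.cmod_stieltjes_le[OF real_distribution_esd, of "Complex 0 (real (Suc k))" j w\<^sub>0]
        stieltjes_esd[of "Complex 0 (real (Suc k))" j w\<^sub>0] by simp
    then show "\<exists>N. \<forall>j\<ge>N. cmod (s (Complex 0 (real (Suc k))) j w\<^sub>0) \<le> 1 / real (Suc k)" by blast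
  qed
  have mass: "(\<lambda>k. real (Suc k) * Im (m (Complex 0 (real (Suc k))))) \<longlonglongrightarrow> 1"
    by (rule fp.fixed_point_imaginary_axis) (use m(1) bd in auto)
  have lim: "\<exists>F. real_distribution F \<and> weak_conv_m (\<lambda>n. esd (Suc n) w) F \<and> (\<forall>z. z \<in> Q \<longrightarrow> Im z > 0 \<longrightarrow> stieltjes F z = m z)"
    if w: "good w" for w
  proof -
    have conv: "(\<lambda>n. stieltjes (esd (Suc n) w) z) \<longlonglongrightarrow> m z" if "z \<in> Q" "Im z > 0" for z
      using w that unfolding good_def by (simp add: stieltjes_esd upper_half_plane_def)
    have convI: "(\<lambda>n. stieltjes (esd (Suc n) w) (Complex 0 (real (Suc k)))) \<longlonglongrightarrow> m (Complex 0 (real (Suc k)))" for k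
      by (rule conv) (use Qi[of k] in \<open>auto simp: upper_half_plane_def\<close>)
    show ?thesis
    proof (rule stieltjes_continuity[OF real_distribution_esd Qd conv convI mass])
      fix F assume "real_distribution F" "weak_conv_m (\<lambda>n. esd (Suc n) w) F"
        "\<And>z. z \<in> Q \<Longrightarrow> Im z > 0 \<Longrightarrow> stieltjes F z = m z"
      then show ?thesis by blast
    qed
  qed
  obtain F where F: "real_distribution F" "\<And>z. z \<in> Q \<Longrightarrow> Im z > 0 \<Longrightarrow> stieltjes F z = m z"
    using lim[OF w\<^sub>0] by blast
  have conv: "weak_conv_m (\<lambda>n. esd (Suc n) w) F" if w: "good w" for w
  proof -
    obtain G where G: "real_distribution G" "weak_conv_m (\<lambda>n. esd (Suc n) w) G"
      "\<And>z. z \<in> Q \<Longrightarrow> Im z > 0 \<Longrightarrow> stieltjes G z = m z" using lim[OF w] by blast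
    have "G = F" by (rule dense_stieltjes_eq[OF G(1) F(1) Qd]) (simp add: G(3) F(2))
    then show ?thesis using G(2) by simp
  qed
  have AE: "AE w in M. weak_conv_m (\<lambda>n. esd n w) F"
    using AE_good by eventually_elim (rule weak_conv_m_Suc_imp[OF conv])
  have "fp.fixed_point z (stieltjes F z)" if z: "Im z > 0" for z
  proof -
    \<comment> \<open>For irrational z the null set may depend on z, but the equation itself does
      not involve the outcome; holding almost surely, it holds.\<close>
    have "AE w in M. stieltjes F z = m z"
      using m(2)[OF z] AE_good
    proof eventually_elim
      case (elim w)
      have "(\<lambda>k. stieltjes (esd (Suc k) w) z) \<longlonglongrightarrow> stieltjes F z"
        by (rule weak_conv_imp_stieltjes[OF real_distribution_esd F(1) conv[OF elim(2)] z])
      then show ?case using elim(1) LIMSEQ_unique by (simp add: stieltjes_esd[OF z])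
    qed
    then have "stieltjes F z = m z" by simp
    then show ?thesis using m(1)[OF z] by simp
  qed
  then show ?thesis using that F(1) AE by blast
qed

end

lemma solves_iff_fixed_point:
  fixes f f' :: "real \<Rightarrow> real"
  assumes "proportional_array M Z c \<sigma> f S p y"
    and der: "\<And>\<omega>. \<omega> \<in> {0..2*pi} \<Longrightarrow> (f has_real_derivative f' \<omega>) (at \<omega> within {0..2*pi})"
    and cont': "continuous_on {0..2*pi} f'"
    and lev: "AE l in lebesgue. finite {\<omega> \<in> {0..2*pi}. f \<omega> = l}"
    and nz: "AE \<omega> in lebesgue. \<omega> \<in> {0..2*pi} \<longrightarrow> f' \<omega> \<noteq> 0"
    and rng: "\<And>\<omega>. \<omega> \<in> {0..2*pi} \<Longrightarrow> f \<omega> \<in> {l\<^sub>1..l\<^sub>2}" and l: "l\<^sub>1 \<le> l\<^sub>2"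
  shows "solves_stieltjes_equation y f f' l\<^sub>1 l\<^sub>2 m \<longleftrightarrow>
    (\<forall>z. Im z > 0 \<longrightarrow> stieltjes_fixed_point.fixed_point proportional_array.U (proportional_array.f\<^sub>0 f) y z (m z))"
proof -
  interpret proportional_array M Z c \<sigma> f S p y by fact
  have eq: "of_real (y / (2*pi)) * (LINT l=l\<^sub>1..l\<^sub>2|lebesgue.
      (complex_of_real l / (1 + complex_of_real l * m) * complex_of_real (level_density f f' l))) = of_real y * fp.\<Phi> m"
    if m: "Im m > 0" for m
  proof -
    have ne: "1 + complex_of_real l * m \<noteq> 0" for l
    proof
      assume e: "1 + complex_of_real l * m = 0"
      then have "Im (1 + complex_of_real l * m) = 0" by simp
      then have "l = 0" using m by simp
      then show False using e by simp
    qed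
    have "(LINT l=l\<^sub>1..l\<^sub>2|lebesgue.
      (complex_of_real l / (1 + complex_of_real l * m) * complex_of_real (level_density f f' l))) =
      (LBINT x:{0..2*pi}. complex_of_real (f x) / (1 + complex_of_real (f x) * m))"
      by (rule level_density_change_of_variables[OF der cont' lev nz rng l])
        (use ne in \<open>auto intro!: continuous_intros\<close>)
    moreover have "fp.\<Phi> m = (LBINT x:{0..2*pi}. complex_of_real (f x) / (1 + complex_of_real (f x) * m)) / (2 * pi)"
      unfolding fp.\<Phi>_def by (subst integral_U[of "\<lambda>l. of_real l / (1 + of_real l * m)"]) auto
    ultimately show ?thesis by simp
  qed
  show ?thesis
    unfolding solves_stieltjes_equation_def fp.fixed_point_def
    using eq by (auto simp: upper_half_plane_def Pi_iff)
qed

theorem theorem1p1: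
  fixes M :: "'a measure"
    and p :: "nat \<Rightarrow> nat" and y :: real and c :: "nat \<Rightarrow> real"
    and Z :: "nat \<Rightarrow> int \<Rightarrow> 'a \<Rightarrow> real"
    and f f' :: "real \<Rightarrow> real"
  assumes M: "prob_space M"
    and p_pos: "\<And>n. n \<ge> 1 \<Longrightarrow> p n > 0"
    and p_lim: "filterlim p at_top sequentially"
    and y_pos: "y > 0"
    and ratio: "(\<lambda>n. real n / real (p n)) \<longlonglongrightarrow> y"
    and spectral_density: "\<And>\<omega>. \<omega> \<in> {0..2*pi} \<Longrightarrow>
      ((\<lambda>h::int. complex_of_real (autocov c h) * exp (- \<i> * of_int h * complex_of_real \<omega>))
        has_sum complex_of_real (f \<omega>)) UNIV"
    and f_deriv: "\<And>\<omega>. \<omega> \<in> {0..2*pi} \<Longrightarrow>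
      (f has_real_derivative f' \<omega>) (at \<omega> within {0..2*pi})"
    and f'_cont: "continuous_on {0..2*pi} f'"
    and Z_indep: "prob_space.indep_vars M (\<lambda>_. borel) (\<lambda>(i, t). Z i t) ({1..} \<times> UNIV)"
    and Z_mean: "\<And>i t. i \<ge> 1 \<Longrightarrow> (\<integral>w. Z i t w \<partial>M) = 0"
    and Z_var: "\<And>i t. i \<ge> 1 \<Longrightarrow> (\<integral>w. (Z i t w)^2 \<partial>M) = 1"
    and Z_fourth: "(SUP (i, t) \<in> {1..} \<times> UNIV. \<integral>\<^sup>+w. ennreal ((Z i t w)^4) \<partial>M) < \<infinity>"
    and Z_lindeberg: "\<And>\<epsilon>. \<epsilon> > 0 \<Longrightarrow>
      (\<lambda>n. 1 / (real (p n) * real n) *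
        (\<Sum>i=1..p n. \<Sum>t=1..n.
          \<integral>w. (Z i (int t) w)^2 * indicator {w. (Z i (int t) w)^2 \<ge> \<epsilon> * real n} w \<partial>M))
      \<longlonglongrightarrow> 0"
    and c_decay: "\<exists>C>0. \<exists>\<delta>>0. \<forall>j. \<bar>c j\<bar> \<le> C * (real j + 1) powr (- 1 - \<delta>)"
    and f_levels: "AE l in lebesgue. finite {\<omega> \<in> {0..2*pi}. f \<omega> = l}"
    and f'_nonzero: "AE \<omega> in lebesgue. \<omega> \<in> {0..2*pi} \<longrightarrow> f' \<omega> \<noteq> 0"
  shows "\<exists>F. real_distribution F \<and> bounded (measure_support F) \<and>
    (AE w in M. weak_conv_m
      (\<lambda>n. let X = data_matrix (p n) n (linear_process c Z) w in
        spectral_distribution ((1 / real (p n)) \<cdot>\<^sub>m (X * transpose_mat X))) F) \<and>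
    (\<exists>l\<^sub>1 l\<^sub>2. 0 \<le> l\<^sub>1 \<and> ((\<forall>\<omega>\<in>{0..2*pi}. f \<omega> > 0) \<longrightarrow> 0 < l\<^sub>1) \<and> 0 < l\<^sub>2 \<and>
      solves_stieltjes_equation y f f' l\<^sub>1 l\<^sub>2 (stieltjes F) \<and>
      (\<forall>m. solves_stieltjes_equation y f f' l\<^sub>1 l\<^sub>2 m \<longrightarrow>
        (\<forall>z\<in>upper_half_plane. m z = stieltjes F z)))"
proof -
  interpret prob_space M by (rule M)
  have summable: "summable (\<lambda>j. \<bar>c j\<bar>)"
  proof -
    obtain C \<delta> where C: "C > 0" "\<delta> > 0" "\<And>j. \<bar>c j\<bar> \<le> C * (real j + 1) powr (- 1 - \<delta>)" using c_decay by blast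
    have "summable (\<lambda>j. real (Suc j) powr (- 1 - \<delta>))"
      using C(2) by (subst summable_Suc_iff) (simp add: summable_real_powr_iff)
    then have "summable (\<lambda>j. C * real (Suc j) powr (- 1 - \<delta>))" by (rule summable_mult)
    then show ?thesis by (rule summable_comparison_test'[where N=0]) (use C(3) in \<open>simp add: add.commute\<close>)
  qed
  define \<Sigma> where "\<Sigma> = (SUP (i, t) \<in> {1..} \<times> UNIV. \<integral>\<^sup>+w. ennreal ((Z i t w)^4) \<partial>M)"
  have Zm: "Z i t \<in> borel_measurable M" if "1 \<le> i" for i t
    using Z_indep that unfolding indep_vars_def by auto
  have le\<Sigma>: "(\<integral>\<^sup>+w. ennreal ((Z i t w)^4) \<partial>M) \<le> \<Sigma>" if "1 \<le> i" for i t
  proof -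
    have "(case (i, t) of (i, t) \<Rightarrow> \<integral>\<^sup>+w. ennreal ((Z i t w)^4) \<partial>M) \<le> \<Sigma>"
      unfolding \<Sigma>_def by (rule SUP_upper) (use that in auto)
    then show ?thesis by simp
  qed
  have \<Sigma>: "\<Sigma> < \<infinity>" using Z_fourth by (simp add: \<Sigma>_def)
  \<comment> \<open>Finiteness of the nonnegative integral is what gives integrability; the Bochner
    integral alone would be 0 for a function that is not integrable.\<close>
  have i4: "integrable M (\<lambda>w. (Z i t w) ^ 4)" if "1 \<le> i" for i t
  proof (rule integrableI_nonneg)
    show "(\<integral>\<^sup>+w. ennreal ((Z i t w)^4) \<partial>M) < \<infinity>" using le\<Sigma>[OF that] \<Sigma> by (rule le_less_trans)
  qed (use Zm[OF that] in auto)
  have m4: "expectation (\<lambda>w. (Z i t w) ^ 4) \<le> enn2real \<Sigma>" if "1 \<le> i" for i t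
  proof -
    have "ennreal (expectation (\<lambda>w. (Z i t w) ^ 4)) \<le> \<Sigma>"
      using le\<Sigma>[OF that, of t] by (subst (asm) nn_integral_eq_integral) (use i4[OF that] in auto)
    then have "enn2real (ennreal (expectation (\<lambda>w. (Z i t w) ^ 4))) \<le> enn2real \<Sigma>"
      using \<Sigma> by (intro enn2real_mono) auto
    then show ?thesis by simp
  qed
  have e: "exp (- \<i> * of_int h * complex_of_real \<omega>) = cis (- (of_int h * \<omega>))" for h :: int and \<omega>
    by (simp add: cis_conv_exp mult.assoc)
  \<comment> \<open>Convergence over the finite subsets of the integers is unconditional, and for
    complex terms unconditional means absolute; one frequency is enough.\<close>
  have abs: "(\<lambda>h. \<bar>autocov c h\<bar>) summable_on UNIV"
  proof -
    have "(\<lambda>h. complex_of_real (autocov c h) * cis (- (of_int h * 0))) summable_on UNIV"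
      using spectral_density[of 0] unfolding e by (auto simp: summable_on_def)
    then have "(\<lambda>h. norm (complex_of_real (autocov c h) * cis (- (of_int h * 0)))) summable_on UNIV"
      by (rule summable_on_iff_abs_summable_on_complex[THEN iffD1])
    then show ?thesis by (simp add: norm_mult)
  qed
  define S where "S = infsum (\<lambda>h. \<bar>autocov c h\<bar>) UNIV"
  have f_cont: "continuous_on {0..2*pi} f"
    using f_deriv by (meson DERIV_continuous continuous_on_eq_continuous_within)
  have array: "proportional_array M Z c (enn2real \<Sigma>) f S p y"
  proof (intro proportional_array.intro linear_array.intro linear_array_axioms.intro toeplitz_symbol.intro
      proportional_array_axioms.intro)
    show "((\<lambda>h. complex_of_real (autocov c h) * cis (- (of_int h * \<omega>))) has_sum complex_of_real (f \<omega>)) UNIV"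
      if "\<omega> \<in> {0..2*pi}" for \<omega> using spectral_density[OF that] unfolding e .
    show "((\<lambda>h. \<bar>autocov c h\<bar>) has_sum S) UNIV" unfolding S_def using abs by (rule has_sum_infsum)
    show "psd (toeplitz n (autocov c))" for n by (rule gram_limit_psd[OF gram_limit_toeplitz[OF summable]])
  qed (use M Z_indep i4 Z_mean Z_var m4 summable f_cont p_pos p_lim y_pos ratio in auto)
  interpret A: proportional_array M Z c "enn2real \<Sigma>" f S p y by (rule array)
  obtain F where F: "real_distribution F" "AE w in M. weak_conv_m (\<lambda>n. A.esd n w) F"
    "\<And>z. Im z > 0 \<Longrightarrow> A.fp.fixed_point z (stieltjes F z)" using A.limit_distribution by blast
  obtain \<omega>\<^sub>1 where \<omega>\<^sub>1: "\<omega>\<^sub>1 \<in> {0..2*pi}" "\<And>\<omega>. \<omega> \<in> {0..2*pi} \<Longrightarrow> f \<omega>\<^sub>1 \<le> f \<omega>"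
    using continuous_attains_inf[OF compact_Icc _ f_cont] by auto
  obtain \<omega>\<^sub>2 where \<omega>\<^sub>2: "\<omega>\<^sub>2 \<in> {0..2*pi}" "\<And>\<omega>. \<omega> \<in> {0..2*pi} \<Longrightarrow> f \<omega> \<le> f \<omega>\<^sub>2"
    using continuous_attains_sup[OF compact_Icc _ f_cont] by auto
  \<comment> \<open>The limits of integration are the minimum and the maximum of the symbol on the
    circle, so the range of f is covered exactly.\<close>
  have rng: "f \<omega> \<in> {f \<omega>\<^sub>1..f \<omega>\<^sub>2}" if "\<omega> \<in> {0..2*pi}" for \<omega> using \<omega>\<^sub>1 \<omega>\<^sub>2 that by auto
  have le: "f \<omega>\<^sub>1 \<le> f \<omega>\<^sub>2" by (rule \<omega>\<^sub>1(2)[OF \<omega>\<^sub>2(1)])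
  have solves: "solves_stieltjes_equation y f f' (f \<omega>\<^sub>1) (f \<omega>\<^sub>2) m \<longleftrightarrow> (\<forall>z. Im z > 0 \<longrightarrow> A.fp.fixed_point z (m z))" for m
    by (rule solves_iff_fixed_point[OF array f_deriv f'_cont f_levels f'_nonzero rng le])
  \<comment> \<open>If they coincided, the change of variables with h = 1 would equate an integral
    over a degenerate interval, which is 0, with the length 2 pi. Together with the nonnegativity of
    the symbol this makes the maximum positive.\<close>
  have pos: "f \<omega>\<^sub>1 \<noteq> f \<omega>\<^sub>2"
  proof
    assume "f \<omega>\<^sub>1 = f \<omega>\<^sub>2"
    moreover have "(LINT l=f \<omega>\<^sub>1..f \<omega>\<^sub>2|lebesgue. (1 * complex_of_real (level_density f f' l))) = (LBINT x:{0..2*pi}. 1)"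
      by (rule level_density_change_of_variables[OF f_deriv f'_cont f_levels f'_nonzero rng le]) auto
    ultimately have "(LBINT x:{0..2*pi}. 1) = (0 :: complex)"
      by (simp add: interval_lebesgue_integral_def einterval_def set_lebesgue_integral_def)
    then show False by (simp add: set_lebesgue_integral_def)
  qed
  have "solves_stieltjes_equation y f f' (f \<omega>\<^sub>1) (f \<omega>\<^sub>2) (stieltjes F)" unfolding solves using F(3) by blast
  moreover have "m z = stieltjes F z"
    if "solves_stieltjes_equation y f f' (f \<omega>\<^sub>1) (f \<omega>\<^sub>2) m" "z \<in> upper_half_plane" for m z
    using that F(3) A.fp.fixed_point_unique unfolding solves upper_half_plane_def by blast
  moreover have "0 \<le> f \<omega>\<^sub>1" "0 < f \<omega>\<^sub>2" using A.symbol_nonneg[OF \<omega>\<^sub>1(1)] le pos by auto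
  moreover have "(\<forall>\<omega>\<in>{0..2*pi}. f \<omega> > 0) \<longrightarrow> 0 < f \<omega>\<^sub>1" using \<omega>\<^sub>1(1) by blast
  moreover have "bounded (measure_support F)" by (rule A.fp.bounded_support_of_fixed_point[OF F(1,3)])
  ultimately show ?thesis using F(1) F(2)[unfolded A.esd_def] by blast
qed

end
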